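(* Assume $(V_0)$ and $(f_1)$–$(f_4)$. Then problem $(\mathcal{P})$ has a ground state solution $\widehat{u}\in H^1_V(\mathbb{R}^3)$, i.e. $\widehat{u}\in\mathcal{N}$, $J'(\widehat{u})=0$ and $J(\widehat{u})=\inf_{v\in\mathcal{N}}J(v)$.
   Context: Fix $a>0$ and $q\neq 0$. $(V_0)$: $V\in C(\mathbb{R}^3,[0,\infty))$ is coercive, i.e. $V(x)\to+\infty$ as $|x|\to\infty$. Let $H^1_V(\mathbb{R}^3)=\{u\in H^1(\mathbb{R}^3):\int_{\mathbb{R}^3}V(x)u^2dx<\infty\}$ with norm $\|u\|^2=\int_{\mathbb{R}^3}|\nabla u|^2dx+\int_{\mathbb{R}^3}V(x)u^2dx$. For $u\in H^1(\mathbb{R}^3)$ let $\phi_u(x)=\int_{\mathbb{R}^3}\frac{1-e^{-|x-y|/a}}{|x-y|}u(y)^2dy$ (the unique solution in the space $\mathcal D$ of $-\Delta\phi+a^2\Delta^2\phi=4\pi u^2$). $f:\mathbb{R}^3\times\mathbb{R}\to\mathbb{R}$ is measurable in $x$, locally Lipschitz in $t$, and $F(x,t)=\int_0^tf(x,s)ds$. Hypotheses: $(f_1)$ $\lim_{t\to0}f(x,t)/t=0$ uniformly in $x$; $(f_2)$ $\lim_{|t|\to\infty}f(x,t)/t^5=0$ uniformly in $x$; $(f_3)$ $\lim_{t\to\pm\infty}F(x,t)/t^4=+\infty$ uniformly in $x$; $(f_4)$ $0<3f(x,t)t\le f^*(x,t)t^2$ for a.a. $x\in\mathbb{R}^3$,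 all $t\neq0$ and all $f^*(x,t)\in\partial f(x,t)$, where $\partial f(x,t)$ denotes Clarke's generalized subdifferential (generalized gradient) of the locally Lipschitz function $f(x,\cdot)$ at $t$. The energy functional $J:H^1_V(\mathbb{R}^3)\to\mathbb{R}$ is $J(u)=\frac12\|u\|^2+\frac{q^2}{4}\int_{\mathbb{R}^3}\phi_uu^2dx-\int_{\mathbb{R}^3}F(x,u)dx$; it is $C^1$ with $J'(u)v=\int\nabla u\cdot\nabla v+\int V uv+q^2\int\phi_u uv-\int f(x,u)v$. Problem $(\mathcal P)$ is $-\Delta u+V(x)u+q^2\phi_uu=f(x,u)$ in $\mathbb{R}^3$; its weak solutions are the critical points of $J$. Nehari manifold: $\mathcal{N}=\{u\in H^1_V(\mathbb{R}^3):u\not\equiv0,\ \langle J'(u),u\rangle=0\}$. Nodal set: with $u^+=\max\{0,u\}$, $u^-=\min\{0,u\}$, $\mathcal{M}=\{u\in\mathcal{N}:u^\pm\not\equiv0,\ \langle J'(u),u^+\rangle=0=\langle J'(u),u^-\rangle\}$. *)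

theory Defs
  imports "HOL-Analysis.Analysis"
begin

type_synonym R3 = "real ^ 3"

definition partial :: "3 \<Rightarrow> (R3 \<Rightarrow> real) \<Rightarrow> R3 \<Rightarrow> real" where
  "partial i \<phi> x = frechet_derivative \<phi> (at x) (axis i 1)"

coinductive smooth3 :: "(R3 \<Rightarrow> real) \<Rightarrow> bool" where
  "(\<forall>x. \<phi> differentiable (at x)) \<Longrightarrow> (\<forall>i. smooth3 (partial i \<phi>)) \<Longrightarrow> smooth3 \<phi>"

definition test_fun :: "(R3 \<Rightarrow> real) \<Rightarrow> bool" where
  "test_fun \<phi> \<longleftrightarrow> smooth3 \<phi> \<and> compact (closure {x. \<phi> x \<noteq> 0})"

definition has_weak_grad :: "(R3 \<Rightarrow> real) \<Rightarrow> (R3 \<Rightarrow> R3) \<Rightarrow> bool" where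
  "has_weak_grad u g \<longleftrightarrow>
     (\<forall>i. (\<lambda>x. g x $ i) \<in> borel_measurable lebesgue) \<and>
     (\<forall>\<phi> i. test_fun \<phi> \<longrightarrow>
        integrable lebesgue (\<lambda>x. u x * partial i \<phi> x) \<and>
        integrable lebesgue (\<lambda>x. g x $ i * \<phi> x) \<and>
        (\<integral>x. u x * partial i \<phi> x \<partial>lebesgue) = - (\<integral>x. g x $ i * \<phi> x \<partial>lebesgue))"

definition H1 :: "(R3 \<Rightarrow> real) set" where
  "H1 = {u. u \<in> borel_measurable lebesgue \<and> integrable lebesgue (\<lambda>x. (u x)\<^sup>2) \<and>
            (\<exists>g. has_weak_grad u g \<and> integrable lebesgue (\<lambda>x. (norm (g x))\<^sup>2))}"

definition weak_grad :: "(R3 \<Rightarrow> real) \<Rightarrow> R3 \<Rightarrow> R3" where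
  "weak_grad u = (SOME g. has_weak_grad u g \<and> integrable lebesgue (\<lambda>x. (norm (g x))\<^sup>2))"

definition H1V :: "(R3 \<Rightarrow> real) \<Rightarrow> (R3 \<Rightarrow> real) set" where
  "H1V V = {u \<in> H1. integrable lebesgue (\<lambda>x. V x * (u x)\<^sup>2)}"

definition normsq :: "(R3 \<Rightarrow> real) \<Rightarrow> (R3 \<Rightarrow> real) \<Rightarrow> real" where
  "normsq V u = (\<integral>x. (norm (weak_grad u x))\<^sup>2 \<partial>lebesgue) + (\<integral>x. V x * (u x)\<^sup>2 \<partial>lebesgue)"

text \<open>The potential phi_u (Bopp-Podolsky kernel).\<close>
definition phi :: "real \<Rightarrow> (R3 \<Rightarrow> real) \<Rightarrow> R3 \<Rightarrow> real" where
  "phi a u x = (\<integral>y. (1 - exp (- dist x y / a)) / dist x y * (u y)\<^sup>2 \<partial>lebesgue)"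

definition Fprim :: "(R3 \<Rightarrow> real \<Rightarrow> real) \<Rightarrow> R3 \<Rightarrow> real \<Rightarrow> real" where
  "Fprim f x t = (LBINT s=0..t. f x s)"

definition J :: "real \<Rightarrow> real \<Rightarrow> (R3 \<Rightarrow> real) \<Rightarrow> (R3 \<Rightarrow> real \<Rightarrow> real) \<Rightarrow> (R3 \<Rightarrow> real) \<Rightarrow> real" where
  "J a q V f u = normsq V u / 2 + q\<^sup>2 / 4 * (\<integral>x. phi a u x * (u x)\<^sup>2 \<partial>lebesgue)
                 - (\<integral>x. Fprim f x (u x) \<partial>lebesgue)"

definition dJ :: "real \<Rightarrow> real \<Rightarrow> (R3 \<Rightarrow> real) \<Rightarrow> (R3 \<Rightarrow> real \<Rightarrow> real) \<Rightarrow> (R3 \<Rightarrow> real) \<Rightarrow> (R3 \<Rightarrow> real) \<Rightarrow> real" where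
  "dJ a q V f u v = (\<integral>x. weak_grad u x \<bullet> weak_grad v x \<partial>lebesgue) + (\<integral>x. V x * u x * v x \<partial>lebesgue)
       + q\<^sup>2 * (\<integral>x. phi a u x * u x * v x \<partial>lebesgue) - (\<integral>x. f x (u x) * v x \<partial>lebesgue)"

definition Nehari :: "real \<Rightarrow> real \<Rightarrow> (R3 \<Rightarrow> real) \<Rightarrow> (R3 \<Rightarrow> real \<Rightarrow> real) \<Rightarrow> (R3 \<Rightarrow> real) set" where
  "Nehari a q V f = {u \<in> H1V V. \<not> (AE x in lebesgue. u x = 0) \<and> dJ a q V f u u = 0}"

definition clarke_dd :: "(real \<Rightarrow> real) \<Rightarrow> real \<Rightarrow> real \<Rightarrow> ereal" where
  "clarke_dd g t v = Limsup (nhds t \<times>\<^sub>F at_right 0) (\<lambda>(s, l). ereal ((g (s + l * v) - g s) / l))"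

definition clarke_subdiff :: "(real \<Rightarrow> real) \<Rightarrow> real \<Rightarrow> real set" where
  "clarke_subdiff g t = {\<xi>. \<forall>v. ereal (\<xi> * v) \<le> clarke_dd g t v}"

end

theory Submission
  imports Defs "HOL-Complex_Analysis.Great_Picard"
begin

text \<open>
  The energy is minimised on the Nehari manifold \<open>N\<close>. By \<open>(f\<^sub>4)\<close> every quotient \<open>f(x,t)/t\<^sup>3\<close> is monotone,
  hence \<open>f t / 4 - F\<close> is nonnegative and increasing in \<open>|t|\<close>, and on \<open>N\<close> we have
  \<open>J u = \<parallel>u\<parallel>\<^sup>2 / 4 + \<integral> (f(x,u) u / 4 - F(x,u))\<close>. Minimising sequences are therefore bounded, coercivity of
  \<open>V\<close> makes them precompact in \<open>L\<^sup>2\<close>, and all terms are semicontinuous in the right direction: the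
  limit \<open>u\<close> is nonzero with \<open>J'(u) u \<le> 0\<close>, so some \<open>t u\<close> with \<open>0 < t \<le> 1\<close> lies on \<open>N\<close> and has no larger
  energy. A minimiser \<open>u\<close> is critical because \<open>J (t u) \<le> J u\<close> for all \<open>t \<ge> 0\<close>: were \<open>J'(u) v < 0\<close>, then
  points \<open>t (u + s v)\<close> of \<open>N\<close> with small \<open>s > 0\<close> and \<open>t\<close> close to \<open>1\<close> would have smaller energy.

  For weakly differentiable \<open>u\<close> the identity \<open>u(x + h e\<^sub>i) - u(x) = \<integral>\<^sub>0\<^sup>h \<partial>\<^sub>i u(x + s e\<^sub>i) ds\<close> holds almost
  everywhere. It controls averages over cubes of side \<open>h\<close>, which yields both the Sobolev inequality
  (from its discrete analogue on the lattice, letting \<open>h \<rightarrow> 0\<close>) and compactness (finitely many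
  averages determine \<open>u\<close> up to a small error).
\<close>

section \<open>Smooth bumps and test functions\<close>

text \<open>The constraint is not smooth. As \<open>f x\<close> is only locally Lipschitz,
  \<open>\<Psi> u = J'(u) u\<close> is continuous but need not be differentiable, so no Lagrange
  multiplier can be invoked on the Nehari set. Instead \<open>J (t (u + s v)) - J (t u)\<close> is
  divided by \<open>t s\<close>; both values are compared with the minimum \<open>J u\<close>, one
  from each side. Of \<open>\<Psi>\<close> only its signs along rays and the intermediate value
  theorem enter. Nor are the Lipschitz constants uniform in \<open>x\<close>, so nothing bounds
  \<open>f\<close> uniformly for \<open>t\<close> between the regimes of \<open>f1\<close> and
  \<open>f2\<close>; there a bound is carried inwards from the outer regime by the monotone
  quotient. The 3 in \<open>f4\<close> is the exponent of that quotient: for \<open>t > 0\<close>,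
  \<open>(f / t^3)' \<ge> 0\<close> is formally \<open>t f' \<ge> 3 f\<close>. The resulting degree
  4 is also that of the nonlocal term, so subtracting a quarter of \<open>J'(u) u\<close> removes
  that term. \<open>f3\<close> enters once, to follow a ray far enough to meet the Nehari set.
  \<open>weak_grad\<close> is a choice by \<open>SOME\<close>, so identities for it hold only almost
  everywhere; Borel representatives are used where translations have to be jointly
  measurable.\<close>

definition flat_exp :: "nat \<Rightarrow> real \<Rightarrow> real" where
  "flat_exp k s = (if s > 0 then exp (- (1 / s)) / s ^ k else 0)"

lemma flat_exp_tendsto_0: "(flat_exp k \<longlongrightarrow> 0) (at_right 0)"
proof -
  have "((\<lambda>x. x ^ k / exp x) \<longlongrightarrow> (0::real)) at_top"
    by (rule tendsto_power_div_exp_0)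
  then have "((\<lambda>s. (1 / s) ^ k / exp (1 / s)) \<longlongrightarrow> (0::real)) (at_right 0)"
    using filterlim_compose[OF _ filterlim_inverse_at_top_right] by (simp add: inverse_eq_divide)
  moreover have "\<forall>\<^sub>F s in at_right 0. flat_exp k s = (1 / s) ^ k / exp (1 / s)"
    by (auto simp: eventually_at_right_field flat_exp_def exp_minus divide_simps intro!: exI[of _ 1])
  ultimately show ?thesis
    by (subst tendsto_cong)
qed

text \<open>The power \<open>k\<close> makes the family closed under differentiation: the factor
  \<open>1 / s^2\<close> from the exponential and \<open>1 / s\<close> from the power only raise the
  exponent. At 0 the right difference quotient of \<open>flat_exp k\<close> is
  \<open>flat_exp (k + 1)\<close>, which tends to 0.\<close>

lemma flat_exp_deriv:
  "(flat_exp k has_real_derivative flat_exp (k + 2) s - k * flat_exp (k + 1) s) (at s)"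
proof -
  consider "s > 0" | "s < 0" | "s = 0" by linarith
  then show ?thesis
  proof cases
    case 1
    have "((\<lambda>s. exp (- (1 / s)) / s ^ k) has_real_derivative flat_exp (k + 2) s - k * flat_exp (k + 1) s) (at s)"
    proof -
      let ?y = "inverse s"
      have "((\<lambda>s. exp (- inverse s) * inverse s ^ k) has_real_derivative
          exp (- ?y) * (?y * ?y) * ?y ^ k - exp (- ?y) * (k * ?y ^ (k - 1) * (?y * ?y))) (at s)"
        using 1 by (auto intro!: derivative_eq_intros simp: algebra_simps)
      moreover have "exp (- ?y) * (?y * ?y) * ?y ^ k - exp (- ?y) * (k * ?y ^ (k - 1) * (?y * ?y))
          = flat_exp (k + 2) s - k * flat_exp (k + 1) s"
        using 1 by (cases k) (simp_all add: flat_exp_def field_simps power2_eq_square)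
      ultimately show ?thesis by (simp add: power_inverse divide_inverse)
    qed
    then show ?thesis
      by (rule DERIV_cong_ev[THEN iffD1, rotated -1])
        (use 1 eventually_nhds_in_open[of "{0<..}" s] in \<open>auto simp: flat_exp_def elim!: eventually_mono\<close>)
  next
    case 2
    have "((\<lambda>s. 0) has_real_derivative flat_exp (k + 2) s - k * flat_exp (k + 1) s) (at s)"
      using 2 by (auto simp: flat_exp_def)
    then show ?thesis
      by (rule DERIV_cong_ev[THEN iffD1, rotated -1])
        (use 2 eventually_nhds_in_open[of "{..<0}" s] in \<open>auto simp: flat_exp_def elim!: eventually_mono\<close>)
  next
    case 3
    have "((\<lambda>h. (flat_exp k (0 + h) - flat_exp k 0) / h) \<longlongrightarrow> 0) (at_right 0)"
      using flat_exp_tendsto_0[of "Suc k"]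
      by (rule tendsto_cong[THEN iffD1, rotated])
        (auto simp: eventually_at_right_field flat_exp_def intro!: exI[of _ 1])
    moreover have "((\<lambda>h. (flat_exp k (0 + h) - flat_exp k 0) / h) \<longlongrightarrow> 0) (at_left 0)"
      by (rule tendsto_cong[THEN iffD1, OF _ tendsto_const])
        (auto simp: eventually_at_left_field flat_exp_def intro!: exI[of _ "-1"])
    ultimately show ?thesis
      using 3 filterlim_split_at_real[of "\<lambda>h. (flat_exp k (0 + h) - flat_exp k 0) / h" "nhds 0" 0]
      by (simp add: DERIV_def flat_exp_def)
  qed
qed

text \<open>Closed under partial derivatives, hence contained in \<^const>\<open>smooth3\<close> by coinduction.\<close>

inductive smooth_alg :: "(R3 \<Rightarrow> real) \<Rightarrow> bool" where
  const: "smooth_alg (\<lambda>x. c)"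
| flat: "smooth_alg (\<lambda>x. flat_exp k (c * x $ i + d))"
| add: "smooth_alg \<phi> \<Longrightarrow> smooth_alg \<psi> \<Longrightarrow> smooth_alg (\<lambda>x. \<phi> x + \<psi> x)"
| mult: "smooth_alg \<phi> \<Longrightarrow> smooth_alg \<psi> \<Longrightarrow> smooth_alg (\<lambda>x. \<phi> x * \<psi> x)"

lemma partial_eqI:
  assumes "\<And>x. (\<phi> has_derivative D x) (at x)"
  shows "partial i \<phi> = (\<lambda>x. D x (axis i 1))"
  using frechet_derivative_at[OF assms] by (auto simp: partial_def fun_eq_iff)

lemma has_derivative_flat_coord:
  "((\<lambda>x::R3. flat_exp k (c * x $ i + d)) has_derivative
    (\<lambda>v. (flat_exp (k + 2) (c * x $ i + d) - k * flat_exp (k + 1) (c * x $ i + d)) * (c * v $ i))) (at x)"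
proof -
  have "((\<lambda>x::R3. c * x $ i + d) has_derivative (\<lambda>v. c * v $ i)) (at x)"
    by (auto intro!: derivative_eq_intros bounded_linear.has_derivative[OF bounded_linear_vec_nth])
  from has_derivative_compose[OF this flat_exp_deriv[unfolded has_field_derivative_def]]
  show ?thesis by simp
qed

lemma smooth_alg_step:
  assumes "smooth_alg \<phi>"
  shows "(\<forall>x. \<phi> differentiable (at x)) \<and> (\<forall>i. smooth_alg (partial i \<phi>))"
  using assms
proof induction
  case (const c)
  have "partial i (\<lambda>x. c) = (\<lambda>x. 0)" for i
    by (subst partial_eqI[of _ "\<lambda>x v. 0"]) auto
  then show ?case by (auto intro: smooth_alg.const)
next
  case (flat k c i d)
  have "smooth_alg (partial j (\<lambda>x. flat_exp k (c * x $ i + d)))" for j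
  proof -
    have "partial j (\<lambda>x. flat_exp k (c * x $ i + d)) =
       (\<lambda>x. (flat_exp (k + 2) (c * x $ i + d) + (- real k) * flat_exp (k + 1) (c * x $ i + d)) * (c * axis j 1 $ i))"
      by (subst partial_eqI[OF has_derivative_flat_coord]) simp
    then show ?thesis
      by (simp only:) (intro smooth_alg.intros)
  qed
  then show ?case
    using has_derivative_flat_coord differentiable_def by blast
next
  case (add \<phi> \<psi>)
  have "partial i (\<lambda>x. \<phi> x + \<psi> x) = (\<lambda>x. partial i \<phi> x + partial i \<psi> x)" for i
    using add.IH by (subst partial_eqI) (auto simp: partial_def frechet_derivative_works intro!: derivative_intros)
  then show ?case using add.IH by (auto intro: smooth_alg.add)
next
  case (mult \<phi> \<psi>)
  have "partial i (\<lambda>x. \<phi> x * \<psi> x) = (\<lambda>x. \<phi> x * partial i \<psi> x + partial i \<phi> x * \<psi> x)" for i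
    using mult.IH by (subst partial_eqI) (auto simp: partial_def frechet_derivative_works intro!: derivative_intros)
  then show ?case using mult by (simp add: smooth_alg.add smooth_alg.mult)
qed

lemma smooth_alg_imp_smooth3: "smooth_alg \<phi> \<Longrightarrow> smooth3 \<phi>"
  by (coinduction arbitrary: \<phi>) (use smooth_alg_step in blast)

lemma smooth_alg_prod:
  "finite A \<Longrightarrow> (\<And>i. i \<in> A \<Longrightarrow> smooth_alg (\<phi> i)) \<Longrightarrow> smooth_alg (\<lambda>x. \<Prod>i\<in>A. \<phi> i x)"
  by (induction A rule: finite_induct) (auto intro: smooth_alg.intros)

text \<open>The factor \<open>n\<close> steepens the sides: \<open>exp (- 1 / (n s))\<close> tends
  to 1 for \<open>s > 0\<close>, so the bumps approximate the indicator of the open box from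
  below.\<close>

definition bump :: "nat \<Rightarrow> R3 \<Rightarrow> R3 \<Rightarrow> R3 \<Rightarrow> real" where
  "bump n a b x = (\<Prod>i\<in>UNIV. flat_exp 0 (real n * (x $ i - a $ i)) * flat_exp 0 (real n * (b $ i - x $ i)))"

lemma flat_exp_0_bounds: "0 \<le> flat_exp 0 s" "flat_exp 0 s \<le> 1"
  by (auto simp: flat_exp_def)

lemma bump_bounds: "0 \<le> bump n a b x" "bump n a b x \<le> 1"
  unfolding bump_def
  by (auto intro!: prod_nonneg prod_le_1 mult_nonneg_nonneg flat_exp_0_bounds mult_le_one)

lemma mem_box_vec: "x \<in> box a b \<longleftrightarrow> (\<forall>i. a $ i < x $ i \<and> x $ i < b $ i)" for a b x :: R3
  by (auto simp: mem_box_cart)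

lemma bump_outside: "x \<notin> box a b \<Longrightarrow> bump n a b x = 0"
  unfolding bump_def mem_box_vec
  by (subst prod_zero_iff) (fastforce simp: flat_exp_def zero_less_mult_iff)+

lemma bump_positive: "n > 0 \<Longrightarrow> x \<in> box a b \<Longrightarrow> bump n a b x > 0"
  unfolding bump_def mem_box_vec by (intro prod_pos) (auto simp: flat_exp_def)

lemma bump_tendsto: "(\<lambda>n. bump n a b x) \<longlonglongrightarrow> indicator (box a b) x"
proof (cases "x \<in> box a b")
  case True
  have *: "(\<lambda>n. flat_exp 0 (real n * s)) \<longlonglongrightarrow> 1" if "s > 0" for s
  proof -
    have "(\<lambda>n. exp (- (inverse (real n) / s))) \<longlonglongrightarrow> exp (- (0 / s))"
      by (intro tendsto_intros lim_inverse_n) (use that in auto)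
    moreover have "\<forall>\<^sub>F n in sequentially. flat_exp 0 (real n * s) = exp (- (inverse (real n) / s))"
      using eventually_gt_at_top[of 0] by eventually_elim (use that in \<open>auto simp: flat_exp_def field_simps\<close>)
    ultimately show ?thesis by (simp add: tendsto_cong)
  qed
  have "(\<lambda>n. bump n a b x) \<longlonglongrightarrow> (\<Prod>i\<in>(UNIV::3 set). 1 * 1)"
    unfolding bump_def by (intro tendsto_prod tendsto_mult *) (use True in \<open>auto simp: mem_box_vec\<close>)
  with True show ?thesis by simp
qed (simp add: bump_outside)

lemma test_fun_bump: "test_fun (bump n a b)"
proof -
  have eq: "bump n a b = (\<lambda>x. \<Prod>i\<in>UNIV. flat_exp 0 (real n * x $ i + (- real n * a $ i)) *
      flat_exp 0 ((- real n) * x $ i + real n * b $ i))"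
    unfolding bump_def by (simp add: algebra_simps)
  have "smooth3 (bump n a b)"
    unfolding eq by (intro smooth_alg_imp_smooth3 smooth_alg_prod smooth_alg.mult smooth_alg.flat) auto
  moreover have "closure {x. bump n a b x \<noteq> 0} \<subseteq> cbox a b"
    using bump_outside box_subset_cbox by (intro closure_minimal closed_cbox) blast
  ultimately show ?thesis
    unfolding test_fun_def by (meson bounded_cbox bounded_subset closed_closure compact_eq_bounded_closed)
qed

lemma smooth3_differentiable: "smooth3 \<phi> \<Longrightarrow> \<phi> differentiable (at x)"
  by (erule smooth3.cases) auto

lemma smooth3_partial: "smooth3 \<phi> \<Longrightarrow> smooth3 (partial i \<phi>)"
  by (erule smooth3.cases) auto

lemma smooth3_continuous: "smooth3 \<phi> \<Longrightarrow> continuous_on UNIV \<phi>"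
  by (simp add: continuous_at_imp_continuous_on differentiable_imp_continuous_within smooth3_differentiable)

lemma test_fun_partial:
  assumes "test_fun \<phi>" shows "test_fun (partial i \<phi>)"
proof -
  let ?S = "closure {x. \<phi> x \<noteq> 0}"
  have "partial i \<phi> x = 0" if "x \<notin> ?S" for x
  proof -
    have "(\<phi> has_derivative (\<lambda>v. 0)) (at x)"
      by (rule has_derivative_transform_within_open[of "\<lambda>x. 0" _ _ _ "- ?S"])
        (use that closure_subset[of "{x. \<phi> x \<noteq> 0}"] in auto)
    then show ?thesis
      using frechet_derivative_at unfolding partial_def by metis
  qed
  then have "closure {x. partial i \<phi> x \<noteq> 0} \<subseteq> ?S"
    by (intro closure_minimal closed_closure) blast
  then show ?thesis
    using assms unfolding test_fun_def
    by (meson bounded_subset closed_closure compact_eq_bounded_closed smooth3_partial)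
qed

lemma test_fun_continuous: "test_fun \<phi> \<Longrightarrow> continuous_on UNIV \<phi>"
  by (simp add: test_fun_def smooth3_continuous)

lemma test_fun_borel [measurable_dest]: "test_fun \<phi> \<Longrightarrow> \<phi> \<in> borel_measurable borel"
  by (simp add: borel_measurable_continuous_onI test_fun_continuous)

lemma test_fun_bounded:
  assumes "test_fun \<phi>"
  obtains B r where "B \<ge> 0" "r > 0" "\<And>x. \<bar>\<phi> x\<bar> \<le> B" "\<And>x. norm x > r \<Longrightarrow> \<phi> x = 0"
proof -
  let ?S = "closure {x. \<phi> x \<noteq> 0}"
  have S: "compact ?S" using assms by (simp add: test_fun_def)
  have "bounded (\<phi> ` ?S)"
    using S assms by (meson compact_continuous_image compact_imp_bounded continuous_on_subset subset_UNIV test_fun_continuous)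
  then obtain B where B: "\<And>x. x \<in> ?S \<Longrightarrow> \<bar>\<phi> x\<bar> \<le> B" by (auto simp: bounded_iff)
  obtain r where r: "\<And>x. x \<in> ?S \<Longrightarrow> norm x \<le> r"
    using compact_imp_bounded[OF S] by (auto simp: bounded_iff)
  have out: "\<phi> x = 0" if "x \<notin> ?S" for x
    using that closure_subset[of "{x. \<phi> x \<noteq> 0}"] by blast
  show thesis
  proof (rule that[of "max B 0" "max r 1"])
    show "\<bar>\<phi> x\<bar> \<le> max B 0" for x using B[of x] out[of x] by (cases "x \<in> ?S") auto
    show "\<phi> x = 0" if "norm x > max r 1" for x using r[of x] out[of x] that by (cases "x \<in> ?S") auto
  qed auto
qed

lemma test_fun_square_integrable:
  assumes "test_fun \<phi>" shows "integrable lborel (\<lambda>x. (\<phi> x)\<^sup>2)"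
proof -
  obtain B r where B: "B \<ge> 0" "r > 0" "\<And>x. \<bar>\<phi> x\<bar> \<le> B" "\<And>x. norm x > r \<Longrightarrow> \<phi> x = 0"
    using test_fun_bounded[OF assms] by metis
  show ?thesis
  proof (rule Bochner_Integration.integrable_bound)
    show "integrable lborel (\<lambda>x::R3. B\<^sup>2 * indicator (cball 0 r) x)"
      by (intro integrable_mult_right integrable_real_indicator emeasure_bounded_finite bounded_cball) auto
    show "(\<lambda>x. (\<phi> x)\<^sup>2) \<in> borel_measurable lborel"
      using test_fun_borel[OF assms] by measurable
    have "(\<phi> x)\<^sup>2 \<le> B\<^sup>2" for x using B(3)[of x] by (simp add: abs_le_square_iff[symmetric] B)
    then show "AE x in lborel. norm ((\<phi> x)\<^sup>2) \<le> norm (B\<^sup>2 * indicator (cball 0 r) x)"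
      using B by (auto simp: indicator_def not_le dist_norm)
  qed
qed

lemma test_fun_shift:
  assumes "test_fun \<phi>" shows "test_fun (\<lambda>x. \<phi> (x + v))"
proof -
  have D: "((\<lambda>x. \<psi> (x + v)) has_derivative frechet_derivative \<psi> (at (x + v))) (at x)" if "smooth3 \<psi>" for \<psi> x
  proof -
    have "((\<lambda>x. x + v) has_derivative (\<lambda>h. h)) (at x)" by (auto intro!: derivative_eq_intros)
    from has_derivative_compose[OF this] show ?thesis
      using smooth3_differentiable[OF that] frechet_derivative_works by metis
  qed
  have P: "partial i (\<lambda>x. \<psi> (x + v)) = (\<lambda>x. partial i \<psi> (x + v))" if "smooth3 \<psi>" for \<psi> i
    by (subst partial_eqI[OF D[OF that]]) (simp add: partial_def)
  have "smooth3 (\<lambda>x. \<phi> (x + v))" if "smooth3 \<phi>" for \<phi>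
    using that
  proof (coinduction arbitrary: \<phi>)
    case smooth3
    have "(\<lambda>x. \<phi> (x + v)) differentiable (at x)" for x
      using D[OF smooth3] differentiable_def by blast
    then show ?case
      using P[OF smooth3] smooth3_partial[OF smooth3] by fastforce
  qed
  moreover have "compact (closure {x. \<phi> (x + v) \<noteq> 0})"
  proof -
    obtain B r where "\<And>x. norm x > r \<Longrightarrow> \<phi> x = 0"
      using test_fun_bounded[OF assms] by metis
    then have "{x. \<phi> (x + v) \<noteq> 0} \<subseteq> cball (- v) r"
      by (force simp: dist_norm not_less norm_minus_commute add.commute)
    then have "closure {x. \<phi> (x + v) \<noteq> 0} \<subseteq> cball (- v) r"
      by (intro closure_minimal) auto
    then show ?thesis
      by (meson bounded_cball bounded_subset closed_closure compact_eq_bounded_closed)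
  qed
  ultimately show ?thesis using assms by (simp add: test_fun_def)
qed

lemma partial_shift:
  assumes "test_fun \<phi>" shows "partial i (\<lambda>x. \<phi> (x + v)) x = partial i \<phi> (x + v)"
proof -
  have "((\<lambda>x. \<phi> (x + v)) has_derivative frechet_derivative \<phi> (at (x + v))) (at x)" for x
  proof -
    have "((\<lambda>x. x + v) has_derivative (\<lambda>h. h)) (at x)" by (auto intro!: derivative_eq_intros)
    from has_derivative_compose[OF this] show ?thesis
      using assms smooth3_differentiable frechet_derivative_works unfolding test_fun_def by metis
  qed
  from partial_eqI[OF this] show ?thesis by (simp add: partial_def)
qed

lemma test_fun_line_deriv:
  assumes "test_fun \<phi>"
  shows "((\<lambda>s. \<phi> (x + s *\<^sub>R axis i 1)) has_real_derivative partial i \<phi> (x + s *\<^sub>R axis i 1)) (at s)"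
proof -
  let ?y = "x + s *\<^sub>R axis i 1"
  have d: "(\<phi> has_derivative frechet_derivative \<phi> (at ?y)) (at ?y)"
    using assms smooth3_differentiable frechet_derivative_works unfolding test_fun_def by metis
  have "((\<lambda>s. x + s *\<^sub>R axis i 1) has_derivative (\<lambda>h. h *\<^sub>R axis i 1)) (at s)"
    by (auto intro!: derivative_eq_intros)
  from has_derivative_compose[OF this d] show ?thesis
    using linear_frechet_derivative[OF differentiableI[OF d]]
    by (simp add: has_field_derivative_def partial_def linear_cmul mult_commute_abs)
qed

section \<open>Square-integrable functions and translations\<close>

definition L2 :: "'a measure \<Rightarrow> ('a \<Rightarrow> real) set" where
  "L2 M = {u \<in> borel_measurable M. integrable M (\<lambda>x. (u x)\<^sup>2)}"

lemma L2_measurable [measurable_dest]: "u \<in> L2 M \<Longrightarrow> u \<in> borel_measurable M"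
  by (simp add: L2_def)

lemma L2_integrable: "u \<in> L2 M \<Longrightarrow> integrable M (\<lambda>x. (u x)\<^sup>2)"
  by (simp add: L2_def)

lemma abs_mult_le_squares: "\<bar>s * t\<bar> \<le> s\<^sup>2 + t\<^sup>2" for s t :: real
proof -
  have "0 \<le> (\<bar>s\<bar> - \<bar>t\<bar>)\<^sup>2" "0 \<le> s\<^sup>2" "0 \<le> t\<^sup>2" by auto
  then show ?thesis unfolding power2_diff power2_abs abs_mult by linarith
qed

lemma L2_mult_integrable:
  assumes "u \<in> L2 M" "v \<in> L2 M"
  shows "integrable M (\<lambda>x. u x * v x)"
proof (rule Bochner_Integration.integrable_bound)
  show "integrable M (\<lambda>x. (u x)\<^sup>2 + (v x)\<^sup>2)"
    using assms by (simp add: L2_integrable)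
  show "(\<lambda>x. u x * v x) \<in> borel_measurable M"
    using assms[THEN L2_measurable] by measurable
  show "AE x in M. norm (u x * v x) \<le> norm ((u x)\<^sup>2 + (v x)\<^sup>2)" by (simp add: abs_mult_le_squares)
qed

lemma L2_add [intro]:
  assumes "u \<in> L2 M" "v \<in> L2 M"
  shows "(\<lambda>x. u x + v x) \<in> L2 M"
proof -
  have "integrable M (\<lambda>x. (u x)\<^sup>2 + (v x)\<^sup>2 + 2 * (u x * v x))"
    using assms L2_integrable L2_mult_integrable by (intro Bochner_Integration.integrable_add integrable_mult_right)
  then show ?thesis
    using assms[THEN L2_measurable] by (simp add: L2_def power2_sum mult.assoc)
qed

lemma L2_scale [intro]: "u \<in> L2 M \<Longrightarrow> (\<lambda>x. c * u x) \<in> L2 M"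
  by (auto simp: L2_def power_mult_distrib)

lemma L2_diff [intro]: "u \<in> L2 M \<Longrightarrow> v \<in> L2 M \<Longrightarrow> (\<lambda>x. u x - v x) \<in> L2 M"
  using L2_add[of u M "\<lambda>x. - 1 * v x"] L2_scale[of v M "-1"] by simp

lemma L2_lebesgueI: "u \<in> L2 lborel \<Longrightarrow> u \<in> L2 lebesgue"
  by (auto simp: L2_def integrable_completion measurable_completion)

lemma L2_cauchy_schwarz:
  assumes "u \<in> L2 M" "v \<in> L2 M"
  shows "(\<integral>x. u x * v x \<partial>M)\<^sup>2 \<le> (\<integral>x. (u x)\<^sup>2 \<partial>M) * (\<integral>x. (v x)\<^sup>2 \<partial>M)"
proof -
  have int: "integrable M (\<lambda>x. u x * v x)" by (rule L2_mult_integrable[OF assms])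
  note [measurable] = assms[THEN L2_measurable]
  have sq: "(\<integral>\<^sup>+x. (ennreal \<bar>w x\<bar>)\<^sup>2 \<partial>M) = ennreal (\<integral>x. (w x)\<^sup>2 \<partial>M)" if "w \<in> L2 M" for w
    using that L2_integrable[OF that] by (subst nn_integral_eq_integral[symmetric]) (auto simp: ennreal_power)
  have "ennreal \<bar>\<integral>x. u x * v x \<partial>M\<bar> \<le> (\<integral>\<^sup>+x. ennreal \<bar>u x\<bar> * ennreal \<bar>v x\<bar> \<partial>M)"
    using integral_norm_bound_ennreal[OF int] by (simp add: abs_mult ennreal_mult)
  then have "(ennreal \<bar>\<integral>x. u x * v x \<partial>M\<bar>)\<^sup>2 \<le> (\<integral>\<^sup>+x. ennreal \<bar>u x\<bar> * ennreal \<bar>v x\<bar> \<partial>M)\<^sup>2"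
    by (rule power_mono_ennreal)
  also have "\<dots> \<le> (\<integral>\<^sup>+x. (ennreal \<bar>u x\<bar>)\<^sup>2 \<partial>M) * (\<integral>\<^sup>+x. (ennreal \<bar>v x\<bar>)\<^sup>2 \<partial>M)"
    by (rule Cauchy_Schwarz_nn_integral) measurable
  also have "\<dots> = ennreal ((\<integral>x. (u x)\<^sup>2 \<partial>M) * (\<integral>x. (v x)\<^sup>2 \<partial>M))"
    by (simp add: sq assms ennreal_mult)
  finally show ?thesis
    by (simp add: ennreal_power)
qed

text \<open>Cauchy-Schwarz against the indicator of \<open>A\<close>. If the integrand is not
  integrable, the Bochner integral is 0 by convention and the bound is trivial.\<close>

lemma square_set_integral_le:
  assumes [measurable]: "f \<in> borel_measurable M" "A \<in> sets M"
  shows "ennreal ((\<integral>x. indicator A x * f x \<partial>M)\<^sup>2) \<le> emeasure M A * (\<integral>\<^sup>+x. indicator A x * ennreal ((f x)\<^sup>2) \<partial>M)"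
proof (cases "integrable M (\<lambda>x. indicator A x * f x)")
  case True
  have "ennreal \<bar>\<integral>x. indicator A x * f x \<partial>M\<bar> \<le> (\<integral>\<^sup>+x. indicator A x * (indicator A x * ennreal \<bar>f x\<bar>) \<partial>M)"
    using integral_norm_bound_ennreal[OF True]
    by (auto simp: abs_mult ennreal_mult indicator_def intro!: nn_integral_mono elim!: order_trans)
  then have "(ennreal \<bar>\<integral>x. indicator A x * f x \<partial>M\<bar>)\<^sup>2 \<le> (\<integral>\<^sup>+x. indicator A x * (indicator A x * ennreal \<bar>f x\<bar>) \<partial>M)\<^sup>2"
    by (rule power_mono_ennreal)
  also have "\<dots> \<le> (\<integral>\<^sup>+x. (indicator A x)\<^sup>2 \<partial>M) * (\<integral>\<^sup>+x. (indicator A x * ennreal \<bar>f x\<bar>)\<^sup>2 \<partial>M)"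
    by (rule Cauchy_Schwarz_nn_integral) measurable
  also have "(\<integral>\<^sup>+x. (indicator A x)\<^sup>2 \<partial>M) = (\<integral>\<^sup>+x. indicator A x \<partial>M)"
    by (intro nn_integral_cong) (simp add: indicator_def)
  also have "(\<integral>\<^sup>+x. (indicator A x * ennreal \<bar>f x\<bar>)\<^sup>2 \<partial>M) = (\<integral>\<^sup>+x. indicator A x * ennreal ((f x)\<^sup>2) \<partial>M)"
    by (intro nn_integral_cong) (simp add: indicator_def ennreal_power)
  finally show ?thesis by (simp add: ennreal_power)
qed (simp add: not_integrable_integral_eq)

lemma L2_nn_integralI:
  assumes [measurable]: "u \<in> borel_measurable M" and "(\<integral>\<^sup>+x. ennreal ((u x)\<^sup>2) \<partial>M) \<le> ennreal c" "c \<ge> 0"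
  shows "u \<in> L2 M" "(\<integral>x. (u x)\<^sup>2 \<partial>M) \<le> c"
proof -
  have int: "integrable M (\<lambda>x. (u x)\<^sup>2)"
    using assms(2) by (intro integrableI_nonneg) (auto intro: le_less_trans)
  then show "u \<in> L2 M" by (simp add: L2_def)
  show "(\<integral>x. (u x)\<^sup>2 \<partial>M) \<le> c"
    using assms nn_integral_eq_integral[OF int] by (simp add: ennreal_le_iff)
qed

lemma L2_nn_integral: "u \<in> L2 M \<Longrightarrow> (\<integral>\<^sup>+x. ennreal ((u x)\<^sup>2) \<partial>M) = ennreal (\<integral>x. (u x)\<^sup>2 \<partial>M)"
  by (intro nn_integral_eq_integral L2_integrable) auto

lemma nn_integral_shift:
  fixes f :: "'a::euclidean_space \<Rightarrow> ennreal"
  assumes [measurable]: "f \<in> borel_measurable borel"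
  shows "(\<integral>\<^sup>+x. f (x + v) \<partial>lborel) = (\<integral>\<^sup>+x. f x \<partial>lborel)"
proof -
  have "(\<integral>\<^sup>+x. f x \<partial>lborel) = (\<integral>\<^sup>+x. f x \<partial>(distr lborel borel ((+) v)))"
    by (simp add: lborel_distr_plus)
  also have "\<dots> = (\<integral>\<^sup>+x. f (v + x) \<partial>lborel)"
    by (rule nn_integral_distr) auto
  finally show ?thesis by (simp add: add.commute)
qed

lemma integral_shift:
  fixes f :: "'a::euclidean_space \<Rightarrow> real"
  assumes [measurable]: "f \<in> borel_measurable borel"
  shows "(\<integral>x. f (x + v) \<partial>lborel) = (\<integral>x. f x \<partial>lborel)"
proof -
  have "(\<integral>x. f x \<partial>lborel) = (\<integral>x. f x \<partial>(distr lborel borel ((+) v)))"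
    by (simp add: lborel_distr_plus)
  also have "\<dots> = (\<integral>x. f (v + x) \<partial>lborel)"
    by (rule integral_distr) auto
  finally show ?thesis by (simp add: add.commute)
qed

lemma L2_shift:
  fixes u :: "'a::euclidean_space \<Rightarrow> real"
  assumes "u \<in> L2 lborel"
  shows "(\<lambda>x. u (x + v)) \<in> L2 lborel" "(\<integral>x. (u (x + v))\<^sup>2 \<partial>lborel) = (\<integral>x. (u x)\<^sup>2 \<partial>lborel)"
proof -
  have [measurable]: "u \<in> borel_measurable borel" using L2_measurable[OF assms] by simp
  have "(\<integral>\<^sup>+x. ennreal ((u (x + v))\<^sup>2) \<partial>lborel) = (\<integral>\<^sup>+x. ennreal ((u x)\<^sup>2) \<partial>lborel)"
    by (rule nn_integral_shift) measurable
  then show "(\<lambda>x. u (x + v)) \<in> L2 lborel"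
    using L2_nn_integral[OF assms] by (intro L2_nn_integralI(1)[where c="\<integral>x. (u x)\<^sup>2 \<partial>lborel"]) auto
  show "(\<integral>x. (u (x + v))\<^sup>2 \<partial>lborel) = (\<integral>x. (u x)\<^sup>2 \<partial>lborel)"
    using integral_shift[of "\<lambda>x. (u x)\<^sup>2" v] by simp
qed

section \<open>The fundamental lemma of the calculus of variations\<close>

text \<open>The densities of the positive and the negative part of \<open>p\<close> are measures
  that agree on open boxes, a pi-system that generates the Borel sets and exhausts the space with
  finite measure; hence they coincide.\<close>

lemma AE_eq_0_if_box_integrals_0:
  fixes p :: "'a::euclidean_space \<Rightarrow> real"
  assumes int: "\<And>a b. integrable lborel (\<lambda>x. p x * indicator (box a b) x)"
    and 0: "\<And>a b. (\<integral>x. p x * indicator (box a b) x \<partial>lborel) = 0"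
    and [measurable]: "p \<in> borel_measurable borel"
  shows "AE x in lborel. p x = 0"
proof -
  \<comment> \<open>\<open>ennreal\<close> cuts negative values to 0, so these are the densities of
    the two parts of \<open>p\<close>.\<close>
  define dp where "dp = density lborel (\<lambda>x. ennreal (p x))"
  define dn where "dn = density lborel (\<lambda>x. ennreal (- p x))"
  have ep: "emeasure dp (box a b) = (\<integral>\<^sup>+x. ennreal (p x * indicator (box a b) x) \<partial>lborel)" for a b
    unfolding dp_def by (subst emeasure_density) (auto intro!: nn_integral_cong simp: indicator_def)
  have en: "emeasure dn (box a b) = (\<integral>\<^sup>+x. ennreal (- (p x * indicator (box a b) x)) \<partial>lborel)" for a b
    unfolding dn_def by (subst emeasure_density) (auto intro!: nn_integral_cong simp: indicator_def)
  have fin: "emeasure dp (box a b) \<noteq> \<infinity>" "emeasure dn (box a b) \<noteq> \<infinity>" for a b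
    unfolding ep en using int[of a b] unfolding real_integrable_def by auto
  have eq: "emeasure dp (box a b) = emeasure dn (box a b)" for a b
  proof -
    have "enn2real (emeasure dp (box a b)) = enn2real (emeasure dn (box a b))"
      using 0[of a b] unfolding ep en by (subst (asm) real_lebesgue_integral_def[OF int]) simp
    then show ?thesis using fin[of a b] by (metis ennreal_enn2real_if infinity_ennreal_def)
  qed
  have "dp = dn"
  proof (rule measure_eqI_generator_eq)
    let ?E = "range (\<lambda>(a, b). box a b::'a set)"
    show "Int_stable ?E"
      by (auto simp: Int_stable_def box_Int_box)
    show "?E \<subseteq> Pow UNIV" "sets dp = sigma_sets UNIV ?E" "sets dn = sigma_sets UNIV ?E"
      by (simp_all add: borel_eq_box dp_def dn_def)
    let ?A = "\<lambda>n::nat. box (- (real n *\<^sub>R One)) (real n *\<^sub>R One) :: 'a set"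
    show "range ?A \<subseteq> ?E" "(\<Union>i. ?A i) = UNIV"
      unfolding UN_box_eq_UNIV by auto
    show "emeasure dp (?A i) \<noteq> \<infinity>" for i using fin by auto
    show "emeasure dp X = emeasure dn X" if "X \<in> ?E" for X
      using that eq by auto
  qed
  then have "AE x in lborel. ennreal (p x) = ennreal (- p x)"
    unfolding dp_def dn_def by (intro sigma_finite_measure.density_unique[OF sigma_finite_lborel]) auto
  moreover have "r = 0" if "ennreal r = ennreal (- r)" for r
    using that by (cases "r \<ge> 0") (auto simp: ennreal_neg ennreal_eq_0_iff dest: sym)
  ultimately show ?thesis by (auto elim: eventually_mono)
qed

lemma L2_mult_indicator_box_integrable:
  assumes "p \<in> L2 lborel"
  shows "integrable lborel (\<lambda>x::R3. p x * indicator (box a b) x)"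
proof (rule L2_mult_integrable[OF assms])
  have "(\<lambda>x. (indicator (box a b) x)\<^sup>2) = (indicator (box a b) :: R3 \<Rightarrow> real)"
    by (auto simp: indicator_def)
  moreover have "integrable lborel (indicator (box a b) :: R3 \<Rightarrow> real)"
    by (rule integrable_real_indicator[OF _ emeasure_lborel_box_finite]) simp
  ultimately show "indicator (box a b) \<in> L2 lborel"
    by (simp add: L2_def)
qed

text \<open>Bumps are dominated by the indicator of their box and converge to it, so a function that
  vanishes against all bumps has vanishing integrals over all boxes.\<close>

theorem fundamental_lemma:
  assumes p: "p \<in> L2 lborel" and 0: "\<And>\<phi>. test_fun \<phi> \<Longrightarrow> (\<integral>x. p x * \<phi> x \<partial>lborel) = 0"
  shows "AE x in lborel. p x = 0"
proof (rule AE_eq_0_if_box_integrals_0)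
  have [measurable]: "p \<in> borel_measurable borel" using L2_measurable[OF p] by simp
  note [measurable] = test_fun_borel[OF test_fun_bump]
  show "p \<in> borel_measurable borel" by measurable
  show int: "integrable lborel (\<lambda>x. p x * indicator (box a b) x)" for a b
    by (rule L2_mult_indicator_box_integrable[OF p])
  show "(\<integral>x. p x * indicator (box a b) x \<partial>lborel) = 0" for a b
  proof -
    have "(\<lambda>n. \<integral>x. p x * bump n a b x \<partial>lborel) \<longlonglongrightarrow> (\<integral>x. p x * indicator (box a b) x \<partial>lborel)"
    proof (rule integral_dominated_convergence)
      show "integrable lborel (\<lambda>x. norm (p x * indicator (box a b) x))" using int by simp
      show "AE x in lborel. (\<lambda>n. p x * bump n a b x) \<longlonglongrightarrow> p x * indicator (box a b) x"
        by (auto intro!: tendsto_mult bump_tendsto)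
      show "AE x in lborel. norm (p x * bump n a b x) \<le> norm (p x * indicator (box a b) x)" for n
        using bump_bounds[of n a b] bump_outside
        by (auto simp: indicator_def abs_mult intro!: mult_left_le)
    qed measurable
    then show ?thesis
      by (simp add: 0[OF test_fun_bump] LIMSEQ_const_iff)
  qed
qed

section \<open>Translations and weak derivatives\<close>

text \<open>The Fubini hypothesis for \<open>weak_grad_line\<close>: the integrand is at most
  \<open>p(x + s c)^2 + r(x)^2\<close>, whose integral over \<open>x\<close> does not depend on
  \<open>s\<close>, and \<open>s\<close> stays in a bounded interval.\<close>

lemma shift_prod_integrable:
  fixes p r :: "R3 \<Rightarrow> real"
  assumes p: "p \<in> L2 lborel" and r: "r \<in> L2 lborel"
  shows "integrable (lborel \<Otimes>\<^sub>M lborel) (\<lambda>(x, s). indicator {0..h} s * (p (x + s *\<^sub>R c) * r x))"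
proof (rule Bochner_Integration.integrable_bound)
  have [measurable]: "p \<in> borel_measurable borel" "r \<in> borel_measurable borel"
    using L2_measurable[OF p] L2_measurable[OF r] by simp_all
  show "(\<lambda>(x, s). indicator {0..h} s * (p (x + s *\<^sub>R c) * r x)) \<in> borel_measurable (lborel \<Otimes>\<^sub>M lborel)"
    by measurable
  let ?f = "\<lambda>(x, s). indicator {0..h} s * ((p (x + s *\<^sub>R c))\<^sup>2 + (r x)\<^sup>2)"
  show "integrable (lborel \<Otimes>\<^sub>M lborel) ?f"
  proof (rule integrableI_nonneg)
    show "?f \<in> borel_measurable (lborel \<Otimes>\<^sub>M lborel)" by measurable
    show "AE z in lborel \<Otimes>\<^sub>M lborel. 0 \<le> ?f z"
      by (rule AE_I2) (simp add: case_prod_beta)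
    have "(\<integral>\<^sup>+z. ennreal (?f z) \<partial>(lborel \<Otimes>\<^sub>M lborel)) = (\<integral>\<^sup>+s. \<integral>\<^sup>+x. ennreal (?f (x, s)) \<partial>lborel \<partial>lborel)"
      by (rule lborel_pair.nn_integral_snd[symmetric]) measurable
    also have "\<dots> = (\<integral>\<^sup>+s. ennreal (\<integral>x. (p x)\<^sup>2 \<partial>lborel) * indicator {0..h} s
        + ennreal (\<integral>x. (r x)\<^sup>2 \<partial>lborel) * indicator {0..h} s \<partial>lborel)"
    proof (rule nn_integral_cong)
      fix s :: real
      have "(\<integral>\<^sup>+x. ennreal (?f (x, s)) \<partial>lborel) =
         (\<integral>\<^sup>+x. indicator {0..h} s * ennreal ((p (x + s *\<^sub>R c))\<^sup>2) + indicator {0..h} s * ennreal ((r x)\<^sup>2) \<partial>lborel)"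
        by (intro nn_integral_cong) (auto simp: indicator_def ennreal_plus)
      also have "\<dots> = indicator {0..h} s * (\<integral>\<^sup>+x. ennreal ((p (x + s *\<^sub>R c))\<^sup>2) \<partial>lborel) + indicator {0..h} s * (\<integral>\<^sup>+x. ennreal ((r x)\<^sup>2) \<partial>lborel)"
        by (subst nn_integral_add) (auto simp: nn_integral_cmult)
      also have "(\<integral>\<^sup>+x. ennreal ((p (x + s *\<^sub>R c))\<^sup>2) \<partial>lborel) = ennreal (\<integral>x. (p x)\<^sup>2 \<partial>lborel)"
        using nn_integral_shift[of "\<lambda>x. ennreal ((p x)\<^sup>2)" "s *\<^sub>R c"] L2_nn_integral[OF p] by simp
      also note L2_nn_integral[OF r]
      finally show "(\<integral>\<^sup>+x. ennreal (?f (x, s)) \<partial>lborel) = ennreal (\<integral>x. (p x)\<^sup>2 \<partial>lborel) * indicator {0..h} s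
        + ennreal (\<integral>x. (r x)\<^sup>2 \<partial>lborel) * indicator {0..h} s"
        by (simp add: mult.commute)
    qed
    also have "\<dots> < \<infinity>"
      by (subst nn_integral_add) (auto simp: nn_integral_cmult_indicator ennreal_mult_less_top emeasure_lborel_Icc_eq)
    finally show "(\<integral>\<^sup>+z. ennreal (?f z) \<partial>(lborel \<Otimes>\<^sub>M lborel)) < \<infinity>" .
  qed
  show "AE z in lborel \<Otimes>\<^sub>M lborel. norm (case z of (x, s) \<Rightarrow> indicator {0..h} s * (p (x + s *\<^sub>R c) * r x)) \<le> norm (?f z)"
  proof (rule AE_I2, clarify)
    fix x s
    have "\<bar>p (x + s *\<^sub>R c) * r x\<bar> \<le> \<bar>(p (x + s *\<^sub>R c))\<^sup>2 + (r x)\<^sup>2\<bar>"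
      using abs_mult_le_squares[of "p (x + s *\<^sub>R c)" "r x"] by linarith
    then show "norm (indicator {0..h} s * (p (x + s *\<^sub>R c) * r x)) \<le> norm (indicator {0..h} s * ((p (x + s *\<^sub>R c))\<^sup>2 + (r x)\<^sup>2))"
      by (cases "s \<in> {0..h}") simp_all
  qed
qed

text \<open>Cauchy-Schwarz on \<open>[0, h]\<close> gives one factor \<open>h\<close>; Tonelli with
  translation invariance gives the other.\<close>

lemma line_average_L2:
  fixes g :: "R3 \<Rightarrow> real" and c :: R3
  assumes g: "g \<in> L2 lborel" and h: "h \<ge> 0"
  defines "G \<equiv> \<lambda>x. \<integral>s. indicator {0..h} s * g (x + s *\<^sub>R c) \<partial>lborel"
  shows "G \<in> L2 lborel" "(\<integral>x. (G x)\<^sup>2 \<partial>lborel) \<le> h\<^sup>2 * (\<integral>x. (g x)\<^sup>2 \<partial>lborel)"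
proof -
  have [measurable]: "g \<in> borel_measurable borel"
    using L2_measurable[OF g] by simp
  have [measurable]: "G \<in> borel_measurable borel"
  proof -
    have "G \<in> borel_measurable lborel" unfolding G_def
      by (rule lborel.borel_measurable_lebesgue_integral) measurable
    then show ?thesis by simp
  qed
  have "(\<integral>\<^sup>+x. ennreal ((G x)\<^sup>2) \<partial>lborel) \<le> (\<integral>\<^sup>+x. ennreal h * (\<integral>\<^sup>+s. indicator {0..h} s * ennreal ((g (x + s *\<^sub>R c))\<^sup>2) \<partial>lborel) \<partial>lborel)"
  proof (rule nn_integral_mono)
    fix x
    show "ennreal ((G x)\<^sup>2) \<le> ennreal h * (\<integral>\<^sup>+s. indicator {0..h} s * ennreal ((g (x + s *\<^sub>R c))\<^sup>2) \<partial>lborel)"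
      unfolding G_def using square_set_integral_le[of "\<lambda>s. g (x + s *\<^sub>R c)" lborel "{0..h}"] h by simp
  qed
  also have "\<dots> = ennreal h * (\<integral>\<^sup>+x. \<integral>\<^sup>+s. indicator {0..h} s * ennreal ((g (x + s *\<^sub>R c))\<^sup>2) \<partial>lborel \<partial>lborel)"
    by (rule nn_integral_cmult) measurable
  also have "(\<integral>\<^sup>+x. \<integral>\<^sup>+s. indicator {0..h} s * ennreal ((g (x + s *\<^sub>R c))\<^sup>2) \<partial>lborel \<partial>lborel)
     = (\<integral>\<^sup>+s. \<integral>\<^sup>+x. indicator {0..h} s * ennreal ((g (x + s *\<^sub>R c))\<^sup>2) \<partial>lborel \<partial>lborel)"
    by (rule lborel_pair.Fubini'[symmetric]) measurable
  also have "\<dots> = (\<integral>\<^sup>+s. ennreal (\<integral>x. (g x)\<^sup>2 \<partial>lborel) * indicator {0..h} s \<partial>lborel)"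
  proof (rule nn_integral_cong)
    fix s :: real
    show "(\<integral>\<^sup>+x. indicator {0..h} s * ennreal ((g (x + s *\<^sub>R c))\<^sup>2) \<partial>lborel) = ennreal (\<integral>x. (g x)\<^sup>2 \<partial>lborel) * indicator {0..h} s"
      using nn_integral_shift[of "\<lambda>x. ennreal ((g x)\<^sup>2)" "s *\<^sub>R c"] L2_nn_integral[OF g]
      by (simp add: nn_integral_cmult mult.commute)
  qed
  also have "\<dots> = ennreal (\<integral>x. (g x)\<^sup>2 \<partial>lborel) * ennreal h"
    using h by (subst nn_integral_cmult_indicator) auto
  also have "ennreal h * \<dots> = ennreal (h\<^sup>2 * (\<integral>x. (g x)\<^sup>2 \<partial>lborel))"
    using h by (simp add: ennreal_mult power2_eq_square mult_ac)
  finally have *: "(\<integral>\<^sup>+x. ennreal ((G x)\<^sup>2) \<partial>lborel) \<le> ennreal (h\<^sup>2 * (\<integral>x. (g x)\<^sup>2 \<partial>lborel))" .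
  show "G \<in> L2 lborel" "(\<integral>x. (G x)\<^sup>2 \<partial>lborel) \<le> h\<^sup>2 * (\<integral>x. (g x)\<^sup>2 \<partial>lborel)"
    by (intro L2_nn_integralI[OF _ *]; simp)+
qed

lemma test_fun_L2: "test_fun \<phi> \<Longrightarrow> \<phi> \<in> L2 lborel"
  using test_fun_square_integrable test_fun_borel by (auto simp: L2_def)

lemma has_weak_grad_lborel:
  assumes "has_weak_grad u g" "u \<in> borel_measurable borel" "(\<lambda>x. g x $ i) \<in> borel_measurable borel" "test_fun \<phi>"
  shows "(\<integral>x. u x * partial i \<phi> x \<partial>lborel) = - (\<integral>x. g x $ i * \<phi> x \<partial>lborel)"
proof -
  note [measurable] = assms(2,3) test_fun_borel[OF assms(4)] test_fun_borel[OF test_fun_partial[OF assms(4)]]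
  show ?thesis
    using assms(1,4) unfolding has_weak_grad_def by (auto simp: integral_completion)
qed

text \<open>Against a test function the translation moves onto it, where the fundamental theorem of
  calculus applies along the line; Fubini and the definition of the weak gradient for the translated
  test function bring the derivative back to \<open>u\<close>. The fundamental lemma turns the
  tested identity into one almost everywhere.\<close>

lemma weak_grad_line:
  assumes wg: "has_weak_grad u g" and u: "u \<in> L2 lborel" and g: "(\<lambda>x. g x $ i) \<in> L2 lborel" and h: "h \<ge> 0"
  shows "AE x in lborel. u (x + h *\<^sub>R axis i 1) - u x = (\<integral>s. indicator {0..h} s * g (x + s *\<^sub>R axis i 1) $ i \<partial>lborel)"
proof -
  define e :: R3 where "e = axis i 1"
  define gi where "gi x = g x $ i" for x
  define G where "G x = (\<integral>s. indicator {0..h} s * gi (x + s *\<^sub>R e) \<partial>lborel)" for x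
  have gi: "gi \<in> L2 lborel" using g by (simp add: gi_def[abs_def])
  have [measurable]: "u \<in> borel_measurable borel" "gi \<in> borel_measurable borel"
    using L2_measurable[OF u] L2_measurable[OF gi] by simp_all
  have G: "G \<in> L2 lborel" unfolding G_def[abs_def] by (rule line_average_L2[OF gi h])
  have [measurable]: "G \<in> borel_measurable borel" using L2_measurable[OF G] by simp
  have key: "(\<integral>x. (u (x + h *\<^sub>R e) - u x) * \<phi> x \<partial>lborel) = (\<integral>x. G x * \<phi> x \<partial>lborel)" if t: "test_fun \<phi>" for \<phi>
  proof -
    note [measurable] = test_fun_borel[OF t] test_fun_borel[OF test_fun_partial[OF t]]
    note int = L2_mult_integrable[OF u test_fun_L2[OF t]]
      L2_mult_integrable[OF L2_shift(1)[OF u] test_fun_L2[OF t]]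
      L2_mult_integrable[OF u test_fun_L2[OF test_fun_shift[OF t]]]
    have "(\<integral>x. (u (x + h *\<^sub>R e) - u x) * \<phi> x \<partial>lborel) = (\<integral>x. u (x + h *\<^sub>R e) * \<phi> x \<partial>lborel) - (\<integral>x. u x * \<phi> x \<partial>lborel)"
      using int by (simp add: left_diff_distrib)
    also have "(\<integral>x. u (x + h *\<^sub>R e) * \<phi> x \<partial>lborel) = (\<integral>x. u x * \<phi> (x + - h *\<^sub>R e) \<partial>lborel)"
      using integral_shift[of "\<lambda>x. u x * \<phi> (x + - h *\<^sub>R e)" "h *\<^sub>R e"] by simp
    also have "\<dots> - (\<integral>x. u x * \<phi> x \<partial>lborel) = (\<integral>x. u x * (\<phi> (x + - h *\<^sub>R e) - \<phi> x) \<partial>lborel)"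
      using int(1) int(3)[of "- h *\<^sub>R e"] by (simp add: right_diff_distrib)
    \<comment> \<open>The test function is translated by \<open>- h e\<close>, so its line
      derivative carries a minus sign; it cancels later against the one in the definition of the
      weak gradient.\<close>
    also have "\<dots> = (\<integral>x. (\<integral>s. - (indicator {0..h} s * (partial i \<phi> (x + s *\<^sub>R (- e)) * u x)) \<partial>lborel) \<partial>lborel)"
    proof (rule Bochner_Integration.integral_cong[OF refl])
      fix x
      have "((\<lambda>s. \<phi> (x + (- s) *\<^sub>R e)) has_real_derivative - partial i \<phi> (x + (- s) *\<^sub>R e)) (at s)" for s
      proof -
        have "((\<lambda>s. - s) has_real_derivative - 1) (at s)" by (auto intro!: derivative_eq_intros)
        from DERIV_chain2[OF test_fun_line_deriv[OF t, of x i "- s"] this]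
        show ?thesis by (simp add: e_def)
      qed
      moreover have "isCont (\<lambda>s. - partial i \<phi> (x + (- s) *\<^sub>R e)) s" for s
      proof -
        have "continuous_on UNIV (\<lambda>s. x + (- s) *\<^sub>R e)" by (intro continuous_intros)
        then have "continuous_on UNIV (\<lambda>s. - partial i \<phi> (x + (- s) *\<^sub>R e))"
          by (rule continuous_on_minus[OF continuous_on_compose2[OF test_fun_continuous[OF test_fun_partial[OF t]]]]) auto
        then show ?thesis by (simp add: continuous_on_eq_continuous_at)
      qed
      ultimately have "(\<integral>s. - partial i \<phi> (x + (- s) *\<^sub>R e) * indicator {0..h} s \<partial>lborel) = \<phi> (x + (- h) *\<^sub>R e) - \<phi> (x + (- 0) *\<^sub>R e)"
        using h by (intro integral_FTC_Icc_real) auto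
      then have "u x * (\<phi> (x + - h *\<^sub>R e) - \<phi> x) = (\<integral>s. u x * (- partial i \<phi> (x + (- s) *\<^sub>R e) * indicator {0..h} s) \<partial>lborel)"
        by (subst integral_mult_right_zero) simp
      also have "\<dots> = (\<integral>s. - (indicator {0..h} s * (partial i \<phi> (x + s *\<^sub>R (- e)) * u x)) \<partial>lborel)"
        by (intro Bochner_Integration.integral_cong) (auto simp: algebra_simps)
      finally show "u x * (\<phi> (x + - h *\<^sub>R e) - \<phi> x) = \<dots>" .
    qed
    also have "\<dots> = - (\<integral>x. (\<integral>s. (indicator {0..h} s * (partial i \<phi> (x + s *\<^sub>R (- e)) * u x)) \<partial>lborel) \<partial>lborel)"
      by simp
    also have "(\<integral>x. (\<integral>s. (indicator {0..h} s * (partial i \<phi> (x + s *\<^sub>R (- e)) * u x)) \<partial>lborel) \<partial>lborel)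
      = (\<integral>s. (\<integral>x. (indicator {0..h} s * (partial i \<phi> (x + s *\<^sub>R (- e)) * u x)) \<partial>lborel) \<partial>lborel)"
      by (rule lborel_pair.Fubini_integral[symmetric], rule shift_prod_integrable[OF test_fun_L2[OF test_fun_partial[OF t]] u])
    also have "\<dots> = (\<integral>s. - (\<integral>x. indicator {0..h} s * (gi (x + s *\<^sub>R e) * \<phi> x) \<partial>lborel) \<partial>lborel)"
    proof (rule Bochner_Integration.integral_cong[OF refl])
      fix s :: real
      have "(\<integral>x. u x * partial i \<phi> (x + s *\<^sub>R (- e)) \<partial>lborel) = - (\<integral>x. gi x * \<phi> (x + s *\<^sub>R (- e)) \<partial>lborel)"
        using has_weak_grad_lborel[OF wg _ _ test_fun_shift[OF t, of "s *\<^sub>R (- e)"], of i]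
        unfolding partial_shift[OF t] by (simp add: gi_def[abs_def, symmetric] flip: gi_def)
      also have "(\<integral>x. gi x * \<phi> (x + s *\<^sub>R (- e)) \<partial>lborel) = (\<integral>x. gi (x + s *\<^sub>R e) * \<phi> x \<partial>lborel)"
        using integral_shift[of "\<lambda>x. gi x * \<phi> (x + s *\<^sub>R (- e))" "s *\<^sub>R e"] by simp
      finally show "(\<integral>x. indicator {0..h} s * (partial i \<phi> (x + s *\<^sub>R (- e)) * u x) \<partial>lborel) =
          - (\<integral>x. indicator {0..h} s * (gi (x + s *\<^sub>R e) * \<phi> x) \<partial>lborel)"
        by (simp add: mult.commute[of "partial _ _ _"])
    qed
    also have "\<dots> = - (\<integral>s. (\<integral>x. indicator {0..h} s * (gi (x + s *\<^sub>R e) * \<phi> x) \<partial>lborel) \<partial>lborel)"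
      by simp
    also have "(\<integral>s. (\<integral>x. indicator {0..h} s * (gi (x + s *\<^sub>R e) * \<phi> x) \<partial>lborel) \<partial>lborel)
       = (\<integral>x. (\<integral>s. indicator {0..h} s * (gi (x + s *\<^sub>R e) * \<phi> x) \<partial>lborel) \<partial>lborel)"
      by (rule lborel_pair.Fubini_integral, rule shift_prod_integrable[OF gi test_fun_L2[OF t]])
    also have "\<dots> = (\<integral>x. G x * \<phi> x \<partial>lborel)"
      unfolding G_def by (simp add: mult.assoc[symmetric])
    finally show ?thesis by simp
  qed
  have "AE x in lborel. (u (x + h *\<^sub>R e) - u x) - G x = 0"
  proof (rule fundamental_lemma)
    show "(\<lambda>x. (u (x + h *\<^sub>R e) - u x) - G x) \<in> L2 lborel"
      by (intro L2_diff L2_shift(1) u G)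
    fix \<phi> assume t: "test_fun \<phi>"
    have "integrable lborel (\<lambda>x. (u (x + h *\<^sub>R e) - u x) * \<phi> x)" "integrable lborel (\<lambda>x. G x * \<phi> x)"
      by (intro L2_mult_integrable L2_diff L2_shift(1) u G test_fun_L2 t)+
    then show "(\<integral>x. ((u (x + h *\<^sub>R e) - u x) - G x) * \<phi> x \<partial>lborel) = 0"
      using key[OF t] by (simp add: left_diff_distrib[of "_ - _"])
  qed
  then show ?thesis by (simp add: G_def gi_def e_def)
qed

lemma translation_estimate_axis:
  assumes wg: "has_weak_grad u g" and u: "u \<in> L2 lborel" and g: "(\<lambda>x. g x $ i) \<in> L2 lborel"
  shows "(\<integral>x. (u (x + h *\<^sub>R axis i 1) - u x)\<^sup>2 \<partial>lborel) \<le> h\<^sup>2 * (\<integral>x. (g x $ i)\<^sup>2 \<partial>lborel)"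
proof -
  have [measurable]: "u \<in> borel_measurable borel" "(\<lambda>x. g x $ i) \<in> borel_measurable borel"
    using L2_measurable[OF u] L2_measurable[OF g] by simp_all
  have pos: "(\<integral>x. (u (x + h *\<^sub>R axis i 1) - u x)\<^sup>2 \<partial>lborel) \<le> h\<^sup>2 * (\<integral>x. (g x $ i)\<^sup>2 \<partial>lborel)" if h: "h \<ge> 0" for h
  proof -
    have [measurable]: "(\<lambda>x. \<integral>s. indicator {0..h} s * g (x + s *\<^sub>R axis i 1) $ i \<partial>lborel) \<in> borel_measurable lborel"
      using line_average_L2(1)[OF g h, THEN L2_measurable] .
    have "(\<integral>x. (u (x + h *\<^sub>R axis i 1) - u x)\<^sup>2 \<partial>lborel) = (\<integral>x. (\<integral>s. indicator {0..h} s * g (x + s *\<^sub>R axis i 1) $ i \<partial>lborel)\<^sup>2 \<partial>lborel)"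
      using weak_grad_line[OF wg u g h] by (intro integral_cong_AE) (auto elim!: eventually_mono)
    also have "\<dots> \<le> h\<^sup>2 * (\<integral>x. (g x $ i)\<^sup>2 \<partial>lborel)"
      by (rule line_average_L2(2)[OF g h])
    finally show ?thesis .
  qed
  show ?thesis
  proof (cases "h \<ge> 0")
    case False
    \<comment> \<open>For \<open>h < 0\<close>, a translation turns the difference into one with the
      positive step \<open>- h\<close>.\<close>
    have "(\<integral>x. (u (x + h *\<^sub>R axis i 1) - u x)\<^sup>2 \<partial>lborel) = (\<integral>x. (u x - u (x + (- h) *\<^sub>R axis i 1))\<^sup>2 \<partial>lborel)"
      using integral_shift[of "\<lambda>x. (u x - u (x + (- h) *\<^sub>R axis i 1))\<^sup>2" "h *\<^sub>R axis i 1"] by simp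
    also have "\<dots> \<le> (- h)\<^sup>2 * (\<integral>x. (g x $ i)\<^sup>2 \<partial>lborel)"
      using pos[of "- h"] False by (simp add: power2_commute)
    finally show ?thesis by simp
  qed (rule pos)
qed

section \<open>The Sobolev inequality\<close>

abbreviation count_int :: "int measure" where "count_int \<equiv> count_space UNIV"
abbreviation count_int3 :: "(int \<times> int \<times> int) measure" where "count_int3 \<equiv> count_space UNIV"

lemma nn_integral_count_swap:
  "(\<integral>\<^sup>+a. \<integral>\<^sup>+b. f a b \<partial>count_space UNIV \<partial>count_space UNIV) = (\<integral>\<^sup>+b. \<integral>\<^sup>+a. f a b \<partial>count_space UNIV \<partial>count_space UNIV)"
  using nn_integral_fst_count_space[of "\<lambda>(a, b). f a b"] nn_integral_snd_count_space[of "\<lambda>(a, b). f a b"] by simp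

lemma nn_integral_count_int3:
  "(\<integral>\<^sup>+p. f p \<partial>count_int3) = (\<integral>\<^sup>+a. \<integral>\<^sup>+b. \<integral>\<^sup>+c. f (a, b, c) \<partial>count_int \<partial>count_int \<partial>count_int)"
  unfolding nn_integral_fst_count_space[of f, symmetric]
    nn_integral_fst_count_space[of "\<lambda>p. f (_, p)", symmetric] ..

text \<open>Sum out \<open>a\<close> first. Cauchy-Schwarz over \<open>(b, c)\<close> separates
  \<open>\<alpha>\<close> from the inner sum \<open>K b c\<close>, and a second one over
  \<open>a\<close> bounds \<open>K^2\<close> by a function of \<open>c\<close> times a function of
  \<open>b\<close>.\<close>

lemma loomis_whitney:
  fixes \<alpha> \<beta> \<gamma> :: "int \<Rightarrow> int \<Rightarrow> ennreal"
  shows "(\<integral>\<^sup>+(a, b, c). \<alpha> b c * \<beta> a c * \<gamma> a b \<partial>count_int3)\<^sup>2 \<le>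
    (\<integral>\<^sup>+b. \<integral>\<^sup>+c. (\<alpha> b c)\<^sup>2 \<partial>count_int \<partial>count_int) * (\<integral>\<^sup>+a. \<integral>\<^sup>+c. (\<beta> a c)\<^sup>2 \<partial>count_int \<partial>count_int)
      * (\<integral>\<^sup>+a. \<integral>\<^sup>+b. (\<gamma> a b)\<^sup>2 \<partial>count_int \<partial>count_int)"
proof -
  define K where "K b c = (\<integral>\<^sup>+a. \<beta> a c * \<gamma> a b \<partial>count_int)" for b c
  have "(\<integral>\<^sup>+(a, b, c). \<alpha> b c * \<beta> a c * \<gamma> a b \<partial>count_int3) =
      (\<integral>\<^sup>+b. \<integral>\<^sup>+a. \<integral>\<^sup>+c. \<alpha> b c * \<beta> a c * \<gamma> a b \<partial>count_int \<partial>count_int \<partial>count_int)"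
    unfolding nn_integral_count_int3 prod.case by (rule nn_integral_count_swap)
  also have "\<dots> = (\<integral>\<^sup>+b. \<integral>\<^sup>+c. \<integral>\<^sup>+a. \<alpha> b c * \<beta> a c * \<gamma> a b \<partial>count_int \<partial>count_int \<partial>count_int)"
    by (intro nn_integral_cong nn_integral_count_swap)
  also have "\<dots> = (\<integral>\<^sup>+b. \<integral>\<^sup>+c. \<alpha> b c * K b c \<partial>count_int \<partial>count_int)"
    unfolding K_def by (simp add: mult.assoc nn_integral_cmult)
  also have "\<dots> = (\<integral>\<^sup>+p. \<alpha> (fst p) (snd p) * K (fst p) (snd p) \<partial>count_space UNIV)"
    using nn_integral_fst_count_space[of "\<lambda>p. \<alpha> (fst p) (snd p) * K (fst p) (snd p)"] by simp
  finally have "(\<integral>\<^sup>+(a, b, c). \<alpha> b c * \<beta> a c * \<gamma> a b \<partial>count_int3)\<^sup>2 \<le>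
      (\<integral>\<^sup>+p. (\<alpha> (fst p) (snd p))\<^sup>2 \<partial>count_space UNIV) * (\<integral>\<^sup>+p. (K (fst p) (snd p))\<^sup>2 \<partial>count_space UNIV)"
    by (simp add: Cauchy_Schwarz_nn_integral)
  also have "(\<integral>\<^sup>+p. (\<alpha> (fst p) (snd p))\<^sup>2 \<partial>count_space UNIV) = (\<integral>\<^sup>+b. \<integral>\<^sup>+c. (\<alpha> b c)\<^sup>2 \<partial>count_int \<partial>count_int)"
    using nn_integral_fst_count_space[of "\<lambda>p. (\<alpha> (fst p) (snd p))\<^sup>2"] by simp
  also have "(\<integral>\<^sup>+p. (K (fst p) (snd p))\<^sup>2 \<partial>count_space UNIV) = (\<integral>\<^sup>+b. \<integral>\<^sup>+c. (K b c)\<^sup>2 \<partial>count_int \<partial>count_int)"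
    using nn_integral_fst_count_space[of "\<lambda>p. (K (fst p) (snd p))\<^sup>2"] by simp
  finally have *: "(\<integral>\<^sup>+(a, b, c). \<alpha> b c * \<beta> a c * \<gamma> a b \<partial>count_int3)\<^sup>2 \<le>
      (\<integral>\<^sup>+b. \<integral>\<^sup>+c. (\<alpha> b c)\<^sup>2 \<partial>count_int \<partial>count_int) * (\<integral>\<^sup>+b. \<integral>\<^sup>+c. (K b c)\<^sup>2 \<partial>count_int \<partial>count_int)" .
  have "(\<integral>\<^sup>+b. \<integral>\<^sup>+c. (K b c)\<^sup>2 \<partial>count_int \<partial>count_int) \<le> (\<integral>\<^sup>+b. \<integral>\<^sup>+c. (\<integral>\<^sup>+a. (\<beta> a c)\<^sup>2 \<partial>count_int) * (\<integral>\<^sup>+a. (\<gamma> a b)\<^sup>2 \<partial>count_int) \<partial>count_int \<partial>count_int)"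
    unfolding K_def by (intro nn_integral_mono Cauchy_Schwarz_nn_integral) auto
  also have "\<dots> = (\<integral>\<^sup>+c. \<integral>\<^sup>+a. (\<beta> a c)\<^sup>2 \<partial>count_int \<partial>count_int) * (\<integral>\<^sup>+b. \<integral>\<^sup>+a. (\<gamma> a b)\<^sup>2 \<partial>count_int \<partial>count_int)"
    by (simp add: nn_integral_multc nn_integral_cmult)
  also have "(\<integral>\<^sup>+c. \<integral>\<^sup>+a. (\<beta> a c)\<^sup>2 \<partial>count_int \<partial>count_int) = (\<integral>\<^sup>+a. \<integral>\<^sup>+c. (\<beta> a c)\<^sup>2 \<partial>count_int \<partial>count_int)"
    by (rule nn_integral_count_swap)
  also have "(\<integral>\<^sup>+b. \<integral>\<^sup>+a. (\<gamma> a b)\<^sup>2 \<partial>count_int \<partial>count_int) = (\<integral>\<^sup>+a. \<integral>\<^sup>+b. (\<gamma> a b)\<^sup>2 \<partial>count_int \<partial>count_int)"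
    by (rule nn_integral_count_swap)
  finally show ?thesis
    using order_trans[OF * mult_left_mono] by (simp add: mult.assoc)
qed

lemma sum_le_nn_integral_count:
  assumes "finite A"
  shows "sum f A \<le> (\<integral>\<^sup>+x. f x \<partial>count_space UNIV)"
proof -
  have "sum f A = (\<integral>\<^sup>+x. f x \<partial>count_space A)"
    using assms by (simp add: nn_integral_count_space_finite)
  also have "\<dots> = (\<integral>\<^sup>+x. f x * indicator A x \<partial>count_space UNIV)"
    by (rule nn_integral_count_space_indicator) simp
  also have "\<dots> \<le> (\<integral>\<^sup>+x. f x \<partial>count_space UNIV)"
    by (intro nn_integral_mono) (auto simp: indicator_def)
  finally show ?thesis .
qed

text \<open>A square-summable sequence tends to 0, so telescoping to the right from \<open>k\<close>
  leaves at most the sum of all jumps.\<close>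

lemma fourth_power_le_total_variation:
  fixes f :: "int \<Rightarrow> real"
  assumes fin: "(\<integral>\<^sup>+k. ennreal ((f k)\<^sup>2) \<partial>count_int) < \<infinity>"
  shows "ennreal (f k ^ 4) \<le> (\<integral>\<^sup>+j. ennreal \<bar>f (j + 1) ^ 4 - f j ^ 4\<bar> \<partial>count_int)" (is "_ \<le> ?T")
proof -
  have inj: "inj_on (\<lambda>n::nat. k + int n) A" for A by (auto simp: inj_on_def)
  have "(\<lambda>n. (f (k + int n))\<^sup>2) \<longlonglongrightarrow> 0"
  proof (rule summable_LIMSEQ_zero, rule summableI_nonneg_bounded)
    show "(\<Sum>i<n. (f (k + int i))\<^sup>2) \<le> enn2real (\<integral>\<^sup>+k. ennreal ((f k)\<^sup>2) \<partial>count_int)" for n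
    proof -
      have "ennreal (\<Sum>i<n. (f (k + int i))\<^sup>2) = (\<Sum>j\<in>(\<lambda>i. k + int i) ` {..<n}. ennreal ((f j)\<^sup>2))"
        by (simp add: sum.reindex[OF inj])
      also have "\<dots> \<le> (\<integral>\<^sup>+k. ennreal ((f k)\<^sup>2) \<partial>count_int)"
        by (rule sum_le_nn_integral_count) simp
      finally have "enn2real (ennreal (\<Sum>i<n. (f (k + int i))\<^sup>2)) \<le> enn2real (\<integral>\<^sup>+k. ennreal ((f k)\<^sup>2) \<partial>count_int)"
        using fin by (intro enn2real_mono) auto
      then show ?thesis by (simp add: sum_nonneg)
    qed
  qed auto
  then have "(\<lambda>n. ((f (k + int n))\<^sup>2)\<^sup>2) \<longlonglongrightarrow> 0\<^sup>2"
    by (intro tendsto_intros)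
  then have lim: "(\<lambda>n. ennreal (f (k + int n) ^ 4) + ?T) \<longlonglongrightarrow> ennreal 0 + ?T"
    by (intro tendsto_add tendsto_ennrealI) (simp_all add: power_mult[symmetric])
  have step: "f k ^ 4 \<le> f (k + int n) ^ 4 + (\<Sum>i<n. \<bar>f (k + int i + 1) ^ 4 - f (k + int i) ^ 4\<bar>)" for n
  proof (induction n)
    case (Suc n)
    have "f (k + int n) ^ 4 \<le> f (k + int (Suc n)) ^ 4 + \<bar>f (k + int n + 1) ^ 4 - f (k + int n) ^ 4\<bar>"
      by (simp add: algebra_simps)
    with Suc show ?case by simp
  qed simp
  have "ennreal (f k ^ 4) \<le> ennreal (f (k + int n) ^ 4) + ?T" for n
  proof -
    have "ennreal (f k ^ 4) \<le> ennreal (f (k + int n) ^ 4) + ennreal (\<Sum>i<n. \<bar>f (k + int i + 1) ^ 4 - f (k + int i) ^ 4\<bar>)"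
      using ennreal_leI[OF step[of n]] by (simp add: sum_nonneg ennreal_plus)
    also have "ennreal (\<Sum>i<n. \<bar>f (k + int i + 1) ^ 4 - f (k + int i) ^ 4\<bar>) = (\<Sum>j\<in>(\<lambda>i. k + int i) ` {..<n}. ennreal \<bar>f (j + 1) ^ 4 - f j ^ 4\<bar>)"
      by (simp add: sum.reindex[OF inj])
    also have "\<dots> \<le> ?T" by (rule sum_le_nn_integral_count) simp
    finally show ?thesis by (simp add: add_left_mono)
  qed
  then show ?thesis using LIMSEQ_le_const[OF lim] by auto
qed

text \<open>Infinity is a separate case because \<open>enn2real\<close> sends it to 0.\<close>

definition ennreal_sqrt :: "ennreal \<Rightarrow> ennreal" where
  "ennreal_sqrt x = (if x = \<infinity> then \<infinity> else ennreal (sqrt (enn2real x)))"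

lemma ennreal_sqrt_square [simp]: "(ennreal_sqrt x)\<^sup>2 = x"
  by (cases x) (auto simp: ennreal_sqrt_def ennreal_power)

lemma ennreal_le_sqrt:
  assumes "ennreal (y ^ 4) \<le> x" shows "ennreal (y\<^sup>2) \<le> ennreal_sqrt x"
proof (cases x)
  case (real r)
  with assms have "(y\<^sup>2)\<^sup>2 \<le> r" by (simp add: power_mult[symmetric])
  then have "y\<^sup>2 \<le> sqrt r" by (rule real_le_rsqrt)
  then show ?thesis using real by (simp add: ennreal_sqrt_def)
qed (simp add: ennreal_sqrt_def)

text \<open>The squared cofactor is bounded by sixth powers, so Cauchy-Schwarz reproduces the very
  sum that is to be estimated. The 8 is \<open>2 * 4\<close>, from
  \<open>(x + y)^2 \<le> 2 (x^2 + y^2)\<close> and from the power mean inequality for cubes.\<close>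

lemma fourth_power_diff_le:
  "(ennreal \<bar>x ^ 4 - y ^ 4\<bar>) \<le> ennreal \<bar>x - y\<bar> * ennreal (\<bar>x + y\<bar> * (x\<^sup>2 + y\<^sup>2))"
  "(\<bar>x + y\<bar> * (x\<^sup>2 + y\<^sup>2))\<^sup>2 \<le> 8 * (x ^ 6 + y ^ 6)" for x y :: real
proof -
  have "x ^ 4 - y ^ 4 = (x - y) * ((x + y) * (x\<^sup>2 + y\<^sup>2))"
    by (simp add: algebra_simps power2_eq_square power4_eq_xxxx)
  then show "(ennreal \<bar>x ^ 4 - y ^ 4\<bar>) \<le> ennreal \<bar>x - y\<bar> * ennreal (\<bar>x + y\<bar> * (x\<^sup>2 + y\<^sup>2))"
    by (simp add: abs_mult ennreal_mult[symmetric])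
  have 1: "(x + y)\<^sup>2 \<le> 2 * (x\<^sup>2 + y\<^sup>2)"
    using zero_le_power2[of "x - y"] by (simp add: power2_sum power2_diff)
  have 2: "(a + b) ^ 3 \<le> 4 * (a ^ 3 + b ^ 3)" if "a \<ge> 0" "b \<ge> 0" for a b :: real
  proof -
    have "4 * (a ^ 3 + b ^ 3) - (a + b) ^ 3 = 3 * ((a + b) * (a - b)\<^sup>2)"
      by (simp add: algebra_simps power2_eq_square power3_eq_cube)
    moreover have "0 \<le> 3 * ((a + b) * (a - b)\<^sup>2)" using that by simp
    ultimately show ?thesis by linarith
  qed
  have "(\<bar>x + y\<bar> * (x\<^sup>2 + y\<^sup>2))\<^sup>2 = (x + y)\<^sup>2 * (x\<^sup>2 + y\<^sup>2)\<^sup>2" by (simp add: power_mult_distrib)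
  also have "\<dots> \<le> 2 * (x\<^sup>2 + y\<^sup>2) * (x\<^sup>2 + y\<^sup>2)\<^sup>2" by (intro mult_right_mono 1) auto
  also have "\<dots> = 2 * (x\<^sup>2 + y\<^sup>2) ^ 3" by (simp add: power3_eq_cube power2_eq_square)
  also have "\<dots> \<le> 2 * (4 * ((x\<^sup>2) ^ 3 + (y\<^sup>2) ^ 3))" by (intro mult_left_mono 2) auto
  finally show "(\<bar>x + y\<bar> * (x\<^sup>2 + y\<^sup>2))\<^sup>2 \<le> 8 * (x ^ 6 + y ^ 6)" by (simp add: power_mult[symmetric])
qed

text \<open>Cauchy-Schwarz on the factorised difference. The bijection \<open>s\<close> leaves the
  sum of sixth powers unchanged, so the two end points of an edge contribute \<open>8 S\<close>
  each.\<close>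

lemma discrete_chain_rule:
  fixes U :: "int \<times> int \<times> int \<Rightarrow> real"
  assumes bij: "bij s" and S: "S = (\<integral>\<^sup>+p. ennreal (U p ^ 6) \<partial>count_int3)"
  shows "(\<integral>\<^sup>+p. ennreal \<bar>U (s p) ^ 4 - U p ^ 4\<bar> \<partial>count_int3)\<^sup>2 \<le> 16 * S * (\<integral>\<^sup>+p. ennreal ((U (s p) - U p)\<^sup>2) \<partial>count_int3)"
proof -
  let ?w = "\<lambda>p. \<bar>U (s p) + U p\<bar> * ((U (s p))\<^sup>2 + (U p)\<^sup>2)"
  have "(\<integral>\<^sup>+p. ennreal \<bar>U (s p) ^ 4 - U p ^ 4\<bar> \<partial>count_int3)\<^sup>2 \<le> (\<integral>\<^sup>+p. ennreal \<bar>U (s p) - U p\<bar> * ennreal (?w p) \<partial>count_int3)\<^sup>2"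
    by (intro power_mono_ennreal nn_integral_mono fourth_power_diff_le)
  also have "\<dots> \<le> (\<integral>\<^sup>+p. (ennreal \<bar>U (s p) - U p\<bar>)\<^sup>2 \<partial>count_int3) * (\<integral>\<^sup>+p. (ennreal (?w p))\<^sup>2 \<partial>count_int3)"
    by (rule Cauchy_Schwarz_nn_integral) auto
  finally have *: "(\<integral>\<^sup>+p. ennreal \<bar>U (s p) ^ 4 - U p ^ 4\<bar> \<partial>count_int3)\<^sup>2 \<le>
      (\<integral>\<^sup>+p. (ennreal \<bar>U (s p) - U p\<bar>)\<^sup>2 \<partial>count_int3) * (\<integral>\<^sup>+p. (ennreal (?w p))\<^sup>2 \<partial>count_int3)" .
  have "(\<integral>\<^sup>+p. (ennreal (?w p))\<^sup>2 \<partial>count_int3) \<le> (\<integral>\<^sup>+p. 8 * (ennreal (U (s p) ^ 6) + ennreal (U p ^ 6)) \<partial>count_int3)"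
  proof (rule nn_integral_mono)
    fix p
    have "(ennreal (?w p))\<^sup>2 = ennreal ((?w p)\<^sup>2)" by (simp add: ennreal_power)
    also have "\<dots> \<le> ennreal (8 * (U (s p) ^ 6 + U p ^ 6))" by (rule ennreal_leI[OF fourth_power_diff_le(2)])
    also have "\<dots> = 8 * (ennreal (U (s p) ^ 6) + ennreal (U p ^ 6))"
      by (simp add: ennreal_mult ennreal_plus)
    finally show "(ennreal (?w p))\<^sup>2 \<le> 8 * (ennreal (U (s p) ^ 6) + ennreal (U p ^ 6))" .
  qed
  also have "\<dots> = 8 * ((\<integral>\<^sup>+p. ennreal (U (s p) ^ 6) \<partial>count_int3) + S)"
    by (simp add: nn_integral_cmult nn_integral_add S)
  also have "(\<integral>\<^sup>+p. ennreal (U (s p) ^ 6) \<partial>count_int3) = S"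
    unfolding S using bij by (intro nn_integral_bij_count_space)
  also have "8 * (S + S) = 16 * S" by (simp add: mult_2[symmetric] mult.assoc[symmetric])
  finally show ?thesis
    using order_trans[OF * mult_left_mono] by (simp add: ennreal_power mult.commute)
qed

text \<open>On the lattice square-summability implies summability of sixth powers, so the
  Gagliardo--Nirenberg absorption argument needs no truncation.\<close>

theorem discrete_sobolev:
  fixes U :: "int \<times> int \<times> int \<Rightarrow> real"
  assumes fin: "(\<integral>\<^sup>+p. ennreal ((U p)\<^sup>2) \<partial>count_int3) < \<infinity>"
  shows "(\<integral>\<^sup>+p. ennreal (U p ^ 6) \<partial>count_int3) \<le> 4096 *
      ((\<integral>\<^sup>+(a, b, c). ennreal ((U (a + 1, b, c) - U (a, b, c))\<^sup>2) \<partial>count_int3) *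
       (\<integral>\<^sup>+(a, b, c). ennreal ((U (a, b + 1, c) - U (a, b, c))\<^sup>2) \<partial>count_int3) *
       (\<integral>\<^sup>+(a, b, c). ennreal ((U (a, b, c + 1) - U (a, b, c))\<^sup>2) \<partial>count_int3))" (is "_ \<le> 4096 * (?E1 * ?E2 * ?E3)")
proof -
  define S where "S = (\<integral>\<^sup>+p. ennreal (U p ^ 6) \<partial>count_int3)"
  define s1 s2 s3 :: "int \<times> int \<times> int \<Rightarrow> int \<times> int \<times> int"
    where s_def: "s1 = (\<lambda>(a, b, c). (a + 1, b, c))" "s2 = (\<lambda>(a, b, c). (a, b + 1, c))" "s3 = (\<lambda>(a, b, c). (a, b, c + 1))"
  have "bij s1" unfolding s_def
    by (rule bij_betw_byWitness[where f'="\<lambda>(a, b, c). (a - 1, b, c)"]) auto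
  moreover have "bij s2" unfolding s_def
    by (rule bij_betw_byWitness[where f'="\<lambda>(a, b, c). (a, b - 1, c)"]) auto
  moreover have "bij s3" unfolding s_def
    by (rule bij_betw_byWitness[where f'="\<lambda>(a, b, c). (a, b, c - 1)"]) auto
  ultimately have bij: "bij s1" "bij s2" "bij s3" by auto
  have pt: "ennreal (f q) \<le> (\<integral>\<^sup>+p. ennreal (f p) \<partial>count_space UNIV)" for f :: "'b \<Rightarrow> real" and q
    using sum_le_nn_integral_count[of "{q}" "\<lambda>p. ennreal (f p)"] by simp
  define Q where "Q = enn2real (\<integral>\<^sup>+p. ennreal ((U p)\<^sup>2) \<partial>count_int3)"
  have Q: "(\<integral>\<^sup>+p. ennreal ((U p)\<^sup>2) \<partial>count_int3) = ennreal Q" using fin by (simp add: Q_def)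
  have Q0: "Q \<ge> 0" by (simp add: Q_def)
  have UQ: "(U p)\<^sup>2 \<le> Q" for p using pt[of "\<lambda>p. (U p)\<^sup>2" p] Q Q0 by simp
  \<comment> \<open>Every squared entry is at most the whole square sum \<open>Q\<close>, so
    \<open>U^6 \<le> Q^2 U^2\<close> is summable.\<close>
  have S_fin: "S < \<infinity>"
  proof -
    have "S \<le> (\<integral>\<^sup>+p. ennreal (Q\<^sup>2) * ennreal ((U p)\<^sup>2) \<partial>count_int3)"
      unfolding S_def
    proof (rule nn_integral_mono)
      fix p
      have "U p ^ 6 = ((U p)\<^sup>2)\<^sup>2 * (U p)\<^sup>2" by (simp add: power_mult[symmetric] power_add[symmetric])
      also have "\<dots> \<le> Q\<^sup>2 * (U p)\<^sup>2" using UQ[of p] by (intro mult_right_mono power_mono) auto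
      finally show "ennreal (U p ^ 6) \<le> ennreal (Q\<^sup>2) * ennreal ((U p)\<^sup>2)"
        by (simp add: ennreal_mult[symmetric] ennreal_leI)
    qed
    also have "\<dots> < \<infinity>" using Q by (simp add: nn_integral_cmult ennreal_mult_less_top)
    finally show ?thesis .
  qed
  define T1 where "T1 b c = (\<integral>\<^sup>+a. ennreal \<bar>U (a + 1, b, c) ^ 4 - U (a, b, c) ^ 4\<bar> \<partial>count_int)" for b c
  define T2 where "T2 a c = (\<integral>\<^sup>+b. ennreal \<bar>U (a, b + 1, c) ^ 4 - U (a, b, c) ^ 4\<bar> \<partial>count_int)" for a c
  define T3 where "T3 a b = (\<integral>\<^sup>+c. ennreal \<bar>U (a, b, c + 1) ^ 4 - U (a, b, c) ^ 4\<bar> \<partial>count_int)" for a b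
  have line: "(\<integral>\<^sup>+k. ennreal ((U (\<iota> k))\<^sup>2) \<partial>count_int) < \<infinity>" if "inj \<iota>" for \<iota>
  proof -
    have "(\<integral>\<^sup>+k. ennreal ((U (\<iota> k))\<^sup>2) \<partial>count_int) = (\<integral>\<^sup>+p. ennreal ((U p)\<^sup>2) \<partial>count_space (range \<iota>))"
      using that by (intro nn_integral_bij_count_space) (simp add: bij_betw_def)
    also have "\<dots> = (\<integral>\<^sup>+p. ennreal ((U p)\<^sup>2) * indicator (range \<iota>) p \<partial>count_space UNIV)"
      by (rule nn_integral_count_space_indicator) simp
    also have "\<dots> \<le> (\<integral>\<^sup>+p. ennreal ((U p)\<^sup>2) \<partial>count_int3)"
      by (intro nn_integral_mono) (auto simp: indicator_def)
    finally show ?thesis using fin by (rule le_less_trans)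
  qed
  have le1: "ennreal (U (a, b, c) ^ 4) \<le> T1 b c" for a b c
    unfolding T1_def by (rule fourth_power_le_total_variation[of "\<lambda>a. U (a, b, c)"], rule line) (auto simp: inj_def)
  have le2: "ennreal (U (a, b, c) ^ 4) \<le> T2 a c" for a b c
    unfolding T2_def by (rule fourth_power_le_total_variation[of "\<lambda>b. U (a, b, c)"], rule line) (auto simp: inj_def)
  have le3: "ennreal (U (a, b, c) ^ 4) \<le> T3 a b" for a b c
    unfolding T3_def by (rule fourth_power_le_total_variation[of "\<lambda>c. U (a, b, c)"], rule line) (auto simp: inj_def)
  \<comment> \<open>\<open>U^6\<close> is a product of three squares. Each is at most the root of a
    total variation along one axis, which no longer depends on that coordinate: the shape required
    by \<open>loomis_whitney\<close>.\<close>
  have "S \<le> (\<integral>\<^sup>+(a, b, c). ennreal_sqrt (T1 b c) * ennreal_sqrt (T2 a c) * ennreal_sqrt (T3 a b) \<partial>count_int3)"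
    unfolding S_def
  proof (rule nn_integral_mono, clarify)
    fix a b c
    have "ennreal (U (a, b, c) ^ 6) = ennreal ((U (a, b, c))\<^sup>2) * ennreal ((U (a, b, c))\<^sup>2) * ennreal ((U (a, b, c))\<^sup>2)"
      by (simp add: ennreal_mult[symmetric] power_add[symmetric])
    also have "\<dots> \<le> ennreal_sqrt (T1 b c) * ennreal_sqrt (T2 a c) * ennreal_sqrt (T3 a b)"
      by (intro mult_mono ennreal_le_sqrt le1 le2 le3) auto
    finally show "ennreal (U (a, b, c) ^ 6) \<le> ennreal_sqrt (T1 b c) * ennreal_sqrt (T2 a c) * ennreal_sqrt (T3 a b)" .
  qed
  then have "S\<^sup>2 \<le> (\<integral>\<^sup>+(a, b, c). ennreal_sqrt (T1 b c) * ennreal_sqrt (T2 a c) * ennreal_sqrt (T3 a b) \<partial>count_int3)\<^sup>2"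
    by (rule power_mono_ennreal)
  also have "\<dots> \<le> (\<integral>\<^sup>+b. \<integral>\<^sup>+c. T1 b c \<partial>count_int \<partial>count_int) * (\<integral>\<^sup>+a. \<integral>\<^sup>+c. T2 a c \<partial>count_int \<partial>count_int)
      * (\<integral>\<^sup>+a. \<integral>\<^sup>+b. T3 a b \<partial>count_int \<partial>count_int)"
    using loomis_whitney[of "\<lambda>b c. ennreal_sqrt (T1 b c)" "\<lambda>a c. ennreal_sqrt (T2 a c)" "\<lambda>a b. ennreal_sqrt (T3 a b)"] by simp
  also have "(\<integral>\<^sup>+b. \<integral>\<^sup>+c. T1 b c \<partial>count_int \<partial>count_int) = (\<integral>\<^sup>+p. ennreal \<bar>U (s1 p) ^ 4 - U p ^ 4\<bar> \<partial>count_int3)"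
    unfolding T1_def nn_integral_count_int3 s_def prod.case
    by (rule trans[OF nn_integral_cong[OF nn_integral_count_swap] nn_integral_count_swap])
  also have "(\<integral>\<^sup>+a. \<integral>\<^sup>+c. T2 a c \<partial>count_int \<partial>count_int) = (\<integral>\<^sup>+p. ennreal \<bar>U (s2 p) ^ 4 - U p ^ 4\<bar> \<partial>count_int3)"
    unfolding T2_def nn_integral_count_int3 s_def prod.case
    by (rule nn_integral_cong[OF nn_integral_count_swap])
  also have "(\<integral>\<^sup>+a. \<integral>\<^sup>+b. T3 a b \<partial>count_int \<partial>count_int) = (\<integral>\<^sup>+p. ennreal \<bar>U (s3 p) ^ 4 - U p ^ 4\<bar> \<partial>count_int3)"
    unfolding T3_def nn_integral_count_int3 s_def prod.case ..
  finally have "(S\<^sup>2)\<^sup>2 \<le> ((\<integral>\<^sup>+p. ennreal \<bar>U (s1 p) ^ 4 - U p ^ 4\<bar> \<partial>count_int3) * (\<integral>\<^sup>+p. ennreal \<bar>U (s2 p) ^ 4 - U p ^ 4\<bar> \<partial>count_int3)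
      * (\<integral>\<^sup>+p. ennreal \<bar>U (s3 p) ^ 4 - U p ^ 4\<bar> \<partial>count_int3))\<^sup>2"
    by (rule power_mono_ennreal)
  also have "\<dots> \<le> (16 * S * (\<integral>\<^sup>+p. ennreal ((U (s1 p) - U p)\<^sup>2) \<partial>count_int3)) * (16 * S * (\<integral>\<^sup>+p. ennreal ((U (s2 p) - U p)\<^sup>2) \<partial>count_int3))
      * (16 * S * (\<integral>\<^sup>+p. ennreal ((U (s3 p) - U p)\<^sup>2) \<partial>count_int3))"
    unfolding power_mult_distrib by (intro mult_mono discrete_chain_rule bij S_def) auto
  also have "(\<integral>\<^sup>+p. ennreal ((U (s1 p) - U p)\<^sup>2) \<partial>count_int3) = ?E1"
    by (intro nn_integral_cong) (auto simp: s_def)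
  also have "(\<integral>\<^sup>+p. ennreal ((U (s2 p) - U p)\<^sup>2) \<partial>count_int3) = ?E2"
    by (intro nn_integral_cong) (auto simp: s_def)
  also have "(\<integral>\<^sup>+p. ennreal ((U (s3 p) - U p)\<^sup>2) \<partial>count_int3) = ?E3"
    by (intro nn_integral_cong) (auto simp: s_def)
  \<comment> \<open>In short \<open>S^4 \<le> 16^3 S^3 E1 E2 E3\<close>, the origin of 4096. The
    factor \<open>S^3\<close> can be cancelled because \<open>S\<close> is finite and, in the
    remaining case, nonzero.\<close>
  finally have *: "(S\<^sup>2)\<^sup>2 \<le> (16 * S * ?E1) * (16 * S * ?E2) * (16 * S * ?E3)" .
  show ?thesis
  proof (cases "S = 0")
    case True then show ?thesis by (simp add: S_def)
  next
    case False
    have "S ^ 3 * S \<le> S ^ 3 * (4096 * (?E1 * ?E2 * ?E3))"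
      using * by (simp add: power2_eq_square power3_eq_cube mult_ac)
    then have "S \<le> 4096 * (?E1 * ?E2 * ?E3)"
      by (subst (asm) ennreal_mult_le_mult_iff) (use False S_fin in \<open>auto simp: power_eq_top_ennreal\<close>)
    then show ?thesis by (simp add: S_def)
  qed
qed

section \<open>Averages over grid cubes\<close>

definition cube_index :: "real \<Rightarrow> R3 \<Rightarrow> int \<times> int \<times> int" where
  "cube_index h x = (\<lfloor>x $ 1 / h\<rfloor>, \<lfloor>x $ 2 / h\<rfloor>, \<lfloor>x $ 3 / h\<rfloor>)"

text \<open>As fibres of \<open>cube_index\<close> the cubes partition the space by construction;
  for \<open>h > 0\<close> they are half-open.\<close>

definition cube :: "real \<Rightarrow> int \<times> int \<times> int \<Rightarrow> R3 set" where
  "cube h p = {x. cube_index h x = p}"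

definition cube_mean :: "real \<Rightarrow> (R3 \<Rightarrow> real) \<Rightarrow> int \<times> int \<times> int \<Rightarrow> real" where
  "cube_mean h u p = (\<integral>x. indicator (cube h p) x * u x \<partial>lborel) / h ^ 3"

lemma measurable_cube_index [measurable]: "cube_index h \<in> borel \<rightarrow>\<^sub>M count_space UNIV"
proof -
  have "(\<lambda>x. (\<lfloor>x $ 1 / h\<rfloor>, \<lfloor>x $ 2 / h\<rfloor>, \<lfloor>x $ 3 / h\<rfloor>)) \<in> borel \<rightarrow>\<^sub>M (count_int \<Otimes>\<^sub>M (count_int \<Otimes>\<^sub>M count_int) :: (int \<times> int \<times> int) measure)"
    by measurable
  then show ?thesis
    by (simp add: cube_index_def[abs_def] pair_measure_countable)
qed

lemma cube_sets [measurable]: "cube h p \<in> sets borel"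
proof -
  have "cube_index h -` {p} \<inter> space borel \<in> sets borel"
    by (rule measurable_sets[OF measurable_cube_index]) simp
  then show ?thesis by (simp add: cube_def vimage_def)
qed

text \<open>Open and closed box have the same volume, so this sandwich settles the measure of the
  half-open cube.\<close>

lemma cube_between:
  assumes h: "h > 0"
  defines "l \<equiv> \<lambda>(a, b, c). vector [h * of_int a, h * of_int b, h * of_int c] :: R3"
  shows "box (l p) (l p + (\<chi> i. h)) \<subseteq> cube h p" "cube h p \<subseteq> cbox (l p) (l p + (\<chi> i. h))"
proof -
  have fl: "\<lfloor>y / h\<rfloor> = k \<longleftrightarrow> h * of_int k \<le> y \<and> y < h * of_int k + h" for y k
    using h by (simp add: floor_eq_iff field_simps)
  obtain a b c where p: "p = (a, b, c)" by (cases p)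
  show "box (l p) (l p + (\<chi> i. h)) \<subseteq> cube h p" "cube h p \<subseteq> cbox (l p) (l p + (\<chi> i. h))"
    unfolding p l_def cube_def cube_index_def
    by (auto simp: mem_box_cart forall_3 fl)
qed

lemma emeasure_cube:
  assumes h: "h > 0"
  shows "emeasure lborel (cube h p) = ennreal (h ^ 3)"
proof -
  obtain l :: R3 where l: "box l (l + (\<chi> i. h)) \<subseteq> cube h p" "cube h p \<subseteq> cbox l (l + (\<chi> i. h))"
    using cube_between[OF h] by blast
  have "measure lborel (cbox l (l + (\<chi> i. h))) = h ^ 3"
    using h by (subst content_cbox_cart) (auto simp: interval_ne_empty_cart)
  then have "emeasure lborel (cbox l (l + (\<chi> i. h))) = ennreal (h ^ 3)"
    using emeasure_lborel_cbox_finite by (metis emeasure_eq_ennreal_measure less_top infinity_ennreal_def)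
  moreover have "emeasure lborel (box l (l + (\<chi> i. h))) = emeasure lborel (cbox l (l + (\<chi> i. h)))"
    by (simp add: emeasure_lborel_box_eq emeasure_lborel_cbox_eq)
  moreover have "emeasure lborel (box l (l + (\<chi> i. h))) \<le> emeasure lborel (cube h p)"
    "emeasure lborel (cube h p) \<le> emeasure lborel (cbox l (l + (\<chi> i. h)))"
    using l by (auto intro!: emeasure_mono)
  ultimately show ?thesis by simp
qed

lemma indicator_cube_L2:
  assumes "h > 0" shows "indicator (cube h p) \<in> L2 lborel"
proof -
  have "(\<lambda>x. (indicator (cube h p) x)\<^sup>2) = (indicator (cube h p) :: R3 \<Rightarrow> real)"
    by (auto simp: indicator_def)
  moreover have "integrable lborel (indicator (cube h p) :: R3 \<Rightarrow> real)"
    by (rule integrable_real_indicator) (auto simp: emeasure_cube assms)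
  ultimately show ?thesis by (simp add: L2_def)
qed

lemma nn_integral_cube_partition:
  fixes f :: "R3 \<Rightarrow> ennreal"
  assumes [measurable]: "f \<in> borel_measurable borel"
  shows "(\<integral>\<^sup>+p. \<integral>\<^sup>+x. indicator (cube h p) x * f x \<partial>lborel \<partial>count_int3) = (\<integral>\<^sup>+x. f x \<partial>lborel)"
proof -
  have "(\<integral>\<^sup>+p. \<integral>\<^sup>+x. indicator (cube h p) x * f x \<partial>lborel \<partial>count_int3) = (\<integral>\<^sup>+x. \<integral>\<^sup>+p. indicator (cube h p) x * f x \<partial>count_int3 \<partial>lborel)"
    by (rule nn_integral_count_space_nn_integral[symmetric]) auto
  also have "\<dots> = (\<integral>\<^sup>+x. \<integral>\<^sup>+p. f x * indicator {cube_index h x} p \<partial>count_int3 \<partial>lborel)"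
    by (intro nn_integral_cong) (auto simp: cube_def indicator_def)
  also have "\<dots> = (\<integral>\<^sup>+x. f x \<partial>lborel)"
    by (simp add: nn_integral_cmult_indicator)
  finally show ?thesis .
qed

lemma nn_integral_cube_index:
  assumes h: "h > 0"
  shows "(\<integral>\<^sup>+x. F (cube_index h x) \<partial>lborel) = ennreal (h ^ 3) * (\<integral>\<^sup>+p. F p \<partial>count_int3)"
proof -
  have [measurable]: "(\<lambda>x. F (cube_index h x)) \<in> borel_measurable borel"
    by (rule measurable_compose[OF measurable_cube_index]) simp
  have "(\<integral>\<^sup>+x. F (cube_index h x) \<partial>lborel) = (\<integral>\<^sup>+p. \<integral>\<^sup>+x. indicator (cube h p) x * F (cube_index h x) \<partial>lborel \<partial>count_int3)"
    by (rule nn_integral_cube_partition[symmetric]) measurable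
  also have "\<dots> = (\<integral>\<^sup>+p. \<integral>\<^sup>+x. F p * indicator (cube h p) x \<partial>lborel \<partial>count_int3)"
    by (intro nn_integral_cong) (auto simp: cube_def indicator_def)
  also have "\<dots> = (\<integral>\<^sup>+p. ennreal (h ^ 3) * F p \<partial>count_int3)"
    by (simp add: nn_integral_cmult_indicator emeasure_cube h mult.commute)
  finally show ?thesis by (simp add: nn_integral_cmult)
qed

text \<open>Jensen's inequality on every cube, summed over the partition.\<close>

lemma cube_mean_contraction:
  assumes h: "h > 0" and u: "u \<in> L2 lborel"
  shows "ennreal (h ^ 3) * (\<integral>\<^sup>+p. ennreal ((cube_mean h u p)\<^sup>2) \<partial>count_int3) \<le> ennreal (\<integral>x. (u x)\<^sup>2 \<partial>lborel)"
proof -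
  have [measurable]: "u \<in> borel_measurable borel" using L2_measurable[OF u] by simp
  have "ennreal (h ^ 3) * (\<integral>\<^sup>+p. ennreal ((cube_mean h u p)\<^sup>2) \<partial>count_int3) = (\<integral>\<^sup>+p. ennreal (h ^ 3) * ennreal ((cube_mean h u p)\<^sup>2) \<partial>count_int3)"
    by (simp add: nn_integral_cmult)
  also have "\<dots> \<le> (\<integral>\<^sup>+p. \<integral>\<^sup>+x. indicator (cube h p) x * ennreal ((u x)\<^sup>2) \<partial>lborel \<partial>count_int3)"
  proof (rule nn_integral_mono)
    fix p
    have *: "k * (r / k)\<^sup>2 = 1 / k * r\<^sup>2" if "k > 0" for k r :: real
      using that by (simp add: power2_eq_square)
    have "ennreal (h ^ 3) * ennreal ((cube_mean h u p)\<^sup>2) = ennreal (1 / h ^ 3) * ennreal ((\<integral>x. indicator (cube h p) x * u x \<partial>lborel)\<^sup>2)"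
      unfolding cube_mean_def using h *[of "h ^ 3"] by (simp only: ennreal_mult[symmetric] zero_le_power zero_le_power2 zero_le_divide_1_iff less_imp_le zero_less_power)
    also have "\<dots> \<le> ennreal (1 / h ^ 3) * (emeasure lborel (cube h p) * (\<integral>\<^sup>+x. indicator (cube h p) x * ennreal ((u x)\<^sup>2) \<partial>lborel))"
      by (intro mult_left_mono square_set_integral_le) auto
    also have "\<dots> = ennreal (1 / h ^ 3 * h ^ 3) * (\<integral>\<^sup>+x. indicator (cube h p) x * ennreal ((u x)\<^sup>2) \<partial>lborel)"
      using h by (simp only: emeasure_cube ennreal_mult zero_le_divide_1_iff zero_le_power less_imp_le mult.assoc)
    finally show "ennreal (h ^ 3) * ennreal ((cube_mean h u p)\<^sup>2) \<le> (\<integral>\<^sup>+x. indicator (cube h p) x * ennreal ((u x)\<^sup>2) \<partial>lborel)"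
      using h by simp
  qed
  also have "\<dots> = (\<integral>\<^sup>+x. ennreal ((u x)\<^sup>2) \<partial>lborel)"
    by (rule nn_integral_cube_partition) measurable
  finally show ?thesis using L2_nn_integral[OF u] by simp
qed

text \<open>Stated over \<open>lborel\<close> because for Borel \<open>u\<close> the function
  \<open>u(x + v)\<close> is jointly measurable in \<open>x\<close> and \<open>v\<close>, as Tonelli
  requires.\<close>

definition weak_pair :: "(R3 \<Rightarrow> real) \<Rightarrow> (R3 \<Rightarrow> R3) \<Rightarrow> bool" where
  "weak_pair u g \<longleftrightarrow> has_weak_grad u g \<and> u \<in> L2 lborel \<and> (\<forall>i. (\<lambda>x. g x $ i) \<in> L2 lborel)"

definition energy :: "(R3 \<Rightarrow> R3) \<Rightarrow> real" where
  "energy g = (\<integral>x. (norm (g x))\<^sup>2 \<partial>lborel)"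

lemma norm_sq_R3: "(norm (x :: R3))\<^sup>2 = (x $ 1)\<^sup>2 + (x $ 2)\<^sup>2 + (x $ 3)\<^sup>2"
  by (simp add: norm_eq_sqrt_inner inner_vec_def sum_3 power2_eq_square)

lemma energy_eq:
  assumes "\<And>i. (\<lambda>x. g x $ i) \<in> L2 lborel"
  shows "energy g = (\<integral>x. (g x $ 1)\<^sup>2 \<partial>lborel) + (\<integral>x. (g x $ 2)\<^sup>2 \<partial>lborel) + (\<integral>x. (g x $ 3)\<^sup>2 \<partial>lborel)"
  unfolding energy_def norm_sq_R3
  using assms[THEN L2_integrable] by simp

lemma component_le_energy:
  assumes "\<And>i. (\<lambda>x. g x $ i) \<in> L2 lborel"
  shows "(\<integral>x. (g x $ i)\<^sup>2 \<partial>lborel) \<le> energy g"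
  using exhaust_3[of i] unfolding energy_eq[OF assms] by (auto intro!: add_nonneg_nonneg)

text \<open>Move along one axis at a time. Splitting the square into three costs a factor 3, and
  there are three moves of size at most \<open>h\<close>, hence 9.\<close>

lemma translation_estimate:
  assumes w: "weak_pair u g" and v: "\<And>i. \<bar>v $ i\<bar> \<le> h"
  shows "(\<integral>x. (u (x + v) - u x)\<^sup>2 \<partial>lborel) \<le> 9 * h\<^sup>2 * energy g"
proof -
  have u: "u \<in> L2 lborel" and wg: "has_weak_grad u g" and g: "\<And>i. (\<lambda>x. g x $ i) \<in> L2 lborel"
    using w by (auto simp: weak_pair_def)
  have [measurable]: "u \<in> borel_measurable borel" using L2_measurable[OF u] by simp
  define e where "e i = v $ i *\<^sub>R (axis i 1 :: R3)" for i
  have v_eq: "v = e 1 + e 2 + e 3"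
    by (simp add: vec_eq_iff e_def forall_3 axis_def)
  have D: "(\<integral>x. (u (x + c + e i) - u (x + c))\<^sup>2 \<partial>lborel) \<le> h\<^sup>2 * energy g" for c i
  proof -
    have "(\<integral>x. (u (x + c + e i) - u (x + c))\<^sup>2 \<partial>lborel) = (\<integral>x. (u (x + e i) - u x)\<^sup>2 \<partial>lborel)"
      using integral_shift[of "\<lambda>x. (u (x + e i) - u x)\<^sup>2" c] by simp
    also have "\<dots> \<le> (v $ i)\<^sup>2 * (\<integral>x. (g x $ i)\<^sup>2 \<partial>lborel)"
      unfolding e_def by (rule translation_estimate_axis[OF wg u g])
    also have "\<dots> \<le> h\<^sup>2 * energy g"
      using v[of i] by (intro mult_mono component_le_energy g) (auto simp: abs_le_square_iff[symmetric])
    finally show ?thesis .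
  qed
  have DI: "integrable lborel (\<lambda>x. (u (x + c + d) - u (x + c))\<^sup>2)" for c d
    using L2_diff[OF L2_shift(1)[OF u, of "c + d"] L2_shift(1)[OF u, of c]] by (simp add: L2_integrable add.assoc)
  have sq: "(a + b + c)\<^sup>2 \<le> 3 * (a\<^sup>2 + b\<^sup>2 + c\<^sup>2)" for a b c :: real
  proof -
    have "0 \<le> (a - b)\<^sup>2 + (b - c)\<^sup>2 + (a - c)\<^sup>2" by simp
    then show ?thesis by (simp add: power2_eq_square algebra_simps)
  qed
  let ?A = "\<lambda>x. (u (x + 0 + e 1) - u (x + 0))\<^sup>2"
  let ?B = "\<lambda>x. (u (x + e 1 + e 2) - u (x + e 1))\<^sup>2"
  let ?C = "\<lambda>x. (u (x + (e 1 + e 2) + e 3) - u (x + (e 1 + e 2)))\<^sup>2"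
  have "(\<integral>x. (u (x + v) - u x)\<^sup>2 \<partial>lborel) \<le> (\<integral>x. 3 * (?A x + ?B x + ?C x) \<partial>lborel)"
  proof (rule integral_mono)
    show "integrable lborel (\<lambda>x. (u (x + v) - u x)\<^sup>2)"
      using DI[of 0 v] by simp
    show "integrable lborel (\<lambda>x. 3 * (?A x + ?B x + ?C x))"
      by (intro integrable_mult_right Bochner_Integration.integrable_add DI)
    show "(u (x + v) - u x)\<^sup>2 \<le> 3 * (?A x + ?B x + ?C x)" for x
      using sq[of "u (x + e 1) - u x" "u (x + e 1 + e 2) - u (x + e 1)" "u (x + (e 1 + e 2) + e 3) - u (x + (e 1 + e 2))"]
      by (simp add: v_eq add.assoc)
  qed
  also have "\<dots> = 3 * ((\<integral>x. ?A x \<partial>lborel) + (\<integral>x. ?B x \<partial>lborel) + (\<integral>x. ?C x \<partial>lborel))"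
    using DI[of 0 "e 1"] DI[of "e 1" "e 2"] DI[of "e 1 + e 2" "e 3"] by (simp add: add.assoc)
  also have "\<dots> \<le> 3 * (h\<^sup>2 * energy g + h\<^sup>2 * energy g + h\<^sup>2 * energy g)"
    by (intro mult_left_mono add_mono D) auto
  finally show ?thesis by (simp add: mult_ac)
qed

lemma cube_index_near:
  assumes "h > 0" "cube_index h (x + v) = cube_index h x"
  shows "\<bar>v $ i\<bar> \<le> h"
proof -
  have *: "\<bar>t\<bar> \<le> h" if "\<lfloor>(s + t) / h\<rfloor> = \<lfloor>s / h\<rfloor>" for s t
  proof -
    have "\<bar>(s + t) / h - s / h\<bar> \<le> 1" using that by linarith
    then have "\<bar>t / h\<bar> \<le> 1" by (simp add: add_divide_distrib)
    then show ?thesis using assms(1) by (simp add: abs_divide)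
  qed
  show ?thesis using assms(2) *[of "x $ i" "v $ i"] exhaust_3[of i] by (auto simp: cube_index_def)
qed

text \<open>Jensen on each cube and \<open>y = x + v\<close> reduce the oscillation to translations by \<open>v\<close> of size \<open>h\<close>;
  \<open>72 = 9 \<cdot> 8\<close>, where \<open>8 h\<^sup>3\<close> is the volume of the set of admissible \<open>v\<close>.\<close>

lemma cube_mean_approx:
  assumes w: "weak_pair u g" and h: "h > 0"
  shows "(\<integral>\<^sup>+x. ennreal ((u x - cube_mean h u (cube_index h x))\<^sup>2) \<partial>lborel) \<le> ennreal (72 * h\<^sup>2 * energy g)"
proof -
  have u: "u \<in> L2 lborel" using w by (auto simp: weak_pair_def)
  have [measurable]: "u \<in> borel_measurable borel" using L2_measurable[OF u] by simp
  have [measurable]: "(\<lambda>z. cube_index h (fst z + snd z)) \<in> borel \<Otimes>\<^sub>M borel \<rightarrow>\<^sub>M count_space UNIV"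
    "(\<lambda>z. cube_index h (fst z)) \<in> (borel :: R3 measure) \<Otimes>\<^sub>M (borel :: R3 measure) \<rightarrow>\<^sub>M count_space UNIV"
    by (intro measurable_compose[OF _ measurable_cube_index]; measurable)+
  have e0: "energy g \<ge> 0" by (simp add: energy_def)
  let ?D = "\<lambda>x v. ennreal ((u (x + v) - u x)\<^sup>2)"
  let ?B = "cbox (\<chi> i. - h) (\<chi> i. h) :: R3 set"
  have "(\<integral>\<^sup>+x. ennreal ((u x - cube_mean h u (cube_index h x))\<^sup>2) \<partial>lborel)
     \<le> (\<integral>\<^sup>+x. ennreal (1 / h ^ 3) * (\<integral>\<^sup>+v. indicator ?B v * ?D x v \<partial>lborel) \<partial>lborel)"
  proof (rule nn_integral_mono)
    fix x
    let ?Q = "cube h (cube_index h x)"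
    note iQ = indicator_cube_L2[OF h, of "cube_index h x"]
    have i1: "integrable lborel (\<lambda>y. indicator ?Q y * u y)" by (rule L2_mult_integrable[OF iQ u])
    have i2: "integrable lborel (\<lambda>y. indicator ?Q y * u x)"
      by (intro integrable_mult_left integrable_real_indicator) (auto simp: emeasure_cube h)
    have "measure lborel ?Q = h ^ 3" using emeasure_cube[OF h] h by (simp add: measure_def)
    then have "u x - cube_mean h u (cube_index h x) = (\<integral>y. indicator ?Q y * (u x - u y) \<partial>lborel) / h ^ 3"
      using h i1 i2 by (simp add: cube_mean_def right_diff_distrib diff_divide_distrib)
    then have "ennreal ((u x - cube_mean h u (cube_index h x))\<^sup>2) = ennreal (1 / (h ^ 3)\<^sup>2) * ennreal ((\<integral>y. indicator ?Q y * (u x - u y) \<partial>lborel)\<^sup>2)"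
      by (simp add: power_divide ennreal_mult[symmetric])
    also have "\<dots> \<le> ennreal (1 / (h ^ 3)\<^sup>2) * (emeasure lborel ?Q * (\<integral>\<^sup>+y. indicator ?Q y * ennreal ((u x - u y)\<^sup>2) \<partial>lborel))"
      by (intro mult_left_mono square_set_integral_le) auto
    also have "\<dots> = ennreal (1 / (h ^ 3)\<^sup>2 * h ^ 3) * (\<integral>\<^sup>+y. indicator ?Q y * ennreal ((u x - u y)\<^sup>2) \<partial>lborel)"
      using h by (simp only: emeasure_cube ennreal_mult zero_le_divide_1_iff zero_le_power zero_le_power2 less_imp_le mult.assoc)
    also have "1 / (h ^ 3)\<^sup>2 * h ^ 3 = 1 / h ^ 3"
      using h by (simp only: power2_eq_square times_divide_eq_left mult_1 nonzero_divide_mult_cancel_right[of "h ^ 3"] zero_less_power less_imp_neq[symmetric] not_False_eq_True)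
    also have "(\<integral>\<^sup>+y. indicator ?Q y * ennreal ((u x - u y)\<^sup>2) \<partial>lborel) = (\<integral>\<^sup>+v. indicator ?Q (v + x) * ennreal ((u x - u (v + x))\<^sup>2) \<partial>lborel)"
      by (rule nn_integral_shift[symmetric]) measurable
    also have "\<dots> \<le> (\<integral>\<^sup>+v. indicator ?B v * ?D x v \<partial>lborel)"
    proof (rule nn_integral_mono)
      fix v
      have "v \<in> ?B" if "v + x \<in> ?Q"
        using that cube_index_near[OF h, of x v] by (auto simp: cube_def mem_box_cart abs_le_iff add.commute minus_le_iff)
      then show "indicator ?Q (v + x) * ennreal ((u x - u (v + x))\<^sup>2) \<le> indicator ?B v * ?D x v"
        by (auto simp: indicator_def power2_commute add.commute)
    qed
    finally show "ennreal ((u x - cube_mean h u (cube_index h x))\<^sup>2) \<le> ennreal (1 / h ^ 3) * (\<integral>\<^sup>+v. indicator ?B v * ?D x v \<partial>lborel)"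
      by (simp add: mult_left_mono)
  qed
  also have "\<dots> = ennreal (1 / h ^ 3) * (\<integral>\<^sup>+x. \<integral>\<^sup>+v. indicator ?B v * ?D x v \<partial>lborel \<partial>lborel)"
    by (rule nn_integral_cmult) measurable
  also have "(\<integral>\<^sup>+x. \<integral>\<^sup>+v. indicator ?B v * ?D x v \<partial>lborel \<partial>lborel) = (\<integral>\<^sup>+v. \<integral>\<^sup>+x. indicator ?B v * ?D x v \<partial>lborel \<partial>lborel)"
    by (rule lborel_pair.Fubini'[symmetric]) measurable
  finally have *: "(\<integral>\<^sup>+x. ennreal ((u x - cube_mean h u (cube_index h x))\<^sup>2) \<partial>lborel) \<le>
     ennreal (1 / h ^ 3) * (\<integral>\<^sup>+v. \<integral>\<^sup>+x. indicator ?B v * ?D x v \<partial>lborel \<partial>lborel)" .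
  have "(\<integral>\<^sup>+v. \<integral>\<^sup>+x. indicator ?B v * ?D x v \<partial>lborel \<partial>lborel) \<le> (\<integral>\<^sup>+v. ennreal (9 * h\<^sup>2 * energy g) * indicator ?B v \<partial>lborel)"
  proof (rule nn_integral_mono)
    fix v :: R3
    show "(\<integral>\<^sup>+x. indicator ?B v * ?D x v \<partial>lborel) \<le> ennreal (9 * h\<^sup>2 * energy g) * indicator ?B v"
    proof (cases "v \<in> ?B")
      case True
      then have "\<bar>v $ i\<bar> \<le> h" for i by (auto simp: mem_box_cart abs_le_iff minus_le_iff)
      from translation_estimate[OF w this] L2_nn_integral[OF L2_diff[OF L2_shift(1)[OF u, of v] u]] True
      show ?thesis by (simp add: ennreal_leI)
    qed simp
  qed
  also have "\<dots> = ennreal (9 * h\<^sup>2 * energy g) * emeasure lborel ?B"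
    by (rule nn_integral_cmult_indicator) simp
  also have "emeasure lborel ?B = ennreal (8 * h ^ 3)"
  proof -
    have "measure lborel ?B = 8 * h ^ 3"
      using h by (subst content_cbox_cart) (auto simp: interval_ne_empty_cart power_mult_distrib)
    then show ?thesis
      using emeasure_lborel_cbox_finite by (metis emeasure_eq_ennreal_measure less_top infinity_ennreal_def)
  qed
  also have "ennreal (9 * h\<^sup>2 * energy g) * ennreal (8 * h ^ 3) = ennreal (h ^ 3) * ennreal (72 * h\<^sup>2 * energy g)"
    using h e0 by (simp add: ennreal_mult[symmetric] mult_ac)
  finally have "ennreal (1 / h ^ 3) * (\<integral>\<^sup>+v. \<integral>\<^sup>+x. indicator ?B v * ?D x v \<partial>lborel \<partial>lborel) \<le> ennreal (1 / h ^ 3) * (ennreal (h ^ 3) * ennreal (72 * h\<^sup>2 * energy g))"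
    by (rule mult_left_mono) simp
  also have "\<dots> = ennreal (72 * h\<^sup>2 * energy g)"
    using h e0 by (simp add: ennreal_mult[symmetric])
  finally show ?thesis using * by (rule order_trans[rotated])
qed

lemma cube_shift:
  assumes "h > 0"
  shows "cube_index h (x + h *\<^sub>R axis 1 1) = (\<lambda>(a, b, c). (a + 1, b, c)) (cube_index h x)"
    "cube_index h (x + h *\<^sub>R axis 2 1) = (\<lambda>(a, b, c). (a, b + 1, c)) (cube_index h x)"
    "cube_index h (x + h *\<^sub>R axis 3 1) = (\<lambda>(a, b, c). (a, b, c + 1)) (cube_index h x)"
  using assms by (simp_all add: cube_index_def axis_def add_divide_distrib)

text \<open>A translation that permutes the cubes turns a difference of two averages into the
  average of a difference.\<close>

lemma cube_mean_shift:
  assumes h: "h > 0" and u: "u \<in> L2 lborel"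
    and s: "\<And>x. cube_index h (x + v) = s (cube_index h x)" and inj: "inj s"
  shows "cube_mean h u (s p) - cube_mean h u p = cube_mean h (\<lambda>x. u (x + v) - u x) p"
proof -
  have [measurable]: "u \<in> borel_measurable borel" using L2_measurable[OF u] by simp
  have ind: "indicator (cube h (s p)) (x + v) = (indicator (cube h p) x :: real)" for x
    using s[of x] inj_eq[OF inj] by (auto simp: cube_def indicator_def)
  have "(\<integral>x. indicator (cube h (s p)) x * u x \<partial>lborel) = (\<integral>x. indicator (cube h p) x * u (x + v) \<partial>lborel)"
    using integral_shift[of "\<lambda>x. indicator (cube h (s p)) x * u x" v] by (simp add: ind)
  then show ?thesis
    using L2_mult_integrable[OF indicator_cube_L2[OF h] u, of p] L2_mult_integrable[OF indicator_cube_L2[OF h] L2_shift(1)[OF u], of p v]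
    by (simp add: cube_mean_def right_diff_distrib diff_divide_distrib)
qed

text \<open>Contraction of averages puts \<open>h^3\<close> on the left and the translation estimate
  puts \<open>h^2\<close> on the right; the quotient \<open>1 / h\<close> is the scaling on which
  \<open>sobolev_inequality\<close> relies.\<close>

lemma cube_mean_diff_sum:
  assumes w: "weak_pair u g" and h: "h > 0"
    and s: "\<And>x. cube_index h (x + h *\<^sub>R axis i 1) = s (cube_index h x)" and inj: "inj s"
  shows "(\<integral>\<^sup>+p. ennreal ((cube_mean h u (s p) - cube_mean h u p)\<^sup>2) \<partial>count_int3) \<le> ennreal (energy g / h)"
proof -
  have u: "u \<in> L2 lborel" and wg: "has_weak_grad u g" and g: "\<And>i. (\<lambda>x. g x $ i) \<in> L2 lborel"
    using w by (auto simp: weak_pair_def)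
  let ?w = "\<lambda>x. u (x + h *\<^sub>R axis i 1) - u x"
  let ?I = "\<integral>\<^sup>+p. ennreal ((cube_mean h ?w p)\<^sup>2) \<partial>count_int3"
  have "ennreal (h ^ 3) * ?I \<le> ennreal (\<integral>x. (?w x)\<^sup>2 \<partial>lborel)"
    by (intro cube_mean_contraction h L2_diff L2_shift u)
  also have "\<dots> \<le> ennreal (h\<^sup>2 * energy g)"
    using translation_estimate_axis[OF wg u g] mult_left_mono[OF component_le_energy[OF g], of "h\<^sup>2"]
    by (intro ennreal_leI) (meson order_trans zero_le_power2)
  finally have "ennreal (1 / h ^ 3) * (ennreal (h ^ 3) * ?I) \<le> ennreal (1 / h ^ 3) * ennreal (h\<^sup>2 * energy g)"
    by (rule mult_left_mono) simp
  also have "ennreal (1 / h ^ 3) * (ennreal (h ^ 3) * ?I) = ?I"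
    using h by (simp add: mult.assoc[symmetric] ennreal_mult[symmetric])
  also have "ennreal (1 / h ^ 3) * ennreal (h\<^sup>2 * energy g) = ennreal (energy g / h)"
    using h by (subst ennreal_mult[symmetric]) (auto simp: energy_def power2_eq_square power3_eq_cube)
  finally show ?thesis by (simp add: cube_mean_shift[OF h u s inj])
qed

text \<open>The exponent 6 is critical in dimension three: the lattice bound
  \<open>4096 (E / h)^3\<close> times the cell volume \<open>h^3\<close> is independent of the mesh.
  The averages converge to \<open>u\<close> in L2 as the mesh shrinks, so Fatou along an almost
  everywhere convergent subsequence concludes.\<close>

theorem sobolev_inequality:
  assumes w: "weak_pair u g"
  shows "(\<integral>\<^sup>+x. ennreal (u x ^ 6) \<partial>lborel) \<le> ennreal (4096 * energy g ^ 3)"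
proof -
  have u: "u \<in> L2 lborel" using w by (auto simp: weak_pair_def)
  have [measurable]: "u \<in> borel_measurable borel" using L2_measurable[OF u] by simp
  have e0: "energy g \<ge> 0" by (simp add: energy_def)
  have step: "(\<integral>\<^sup>+x. ennreal (cube_mean h u (cube_index h x) ^ 6) \<partial>lborel) \<le> ennreal (4096 * energy g ^ 3)" if h: "h > 0" for h
  proof -
    let ?U = "cube_mean h u"
    have fin: "(\<integral>\<^sup>+p. ennreal ((?U p)\<^sup>2) \<partial>count_int3) < \<infinity>"
    proof (rule ccontr)
      assume "\<not> ?thesis"
      then have "ennreal (h ^ 3) * (\<integral>\<^sup>+p. ennreal ((?U p)\<^sup>2) \<partial>count_int3) = \<infinity>"
        using h by (simp add: ennreal_mult_top less_top[symmetric])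
      with cube_mean_contraction[OF h u] show False by (simp add: top_unique)
    qed
    have E1: "(\<integral>\<^sup>+(a, b, c). ennreal ((?U (a + 1, b, c) - ?U (a, b, c))\<^sup>2) \<partial>count_int3) \<le> ennreal (energy g / h)"
    proof -
      have "(\<integral>\<^sup>+p. ennreal ((?U ((\<lambda>(a, b, c). (a + 1, b, c)) p) - ?U p)\<^sup>2) \<partial>count_int3) \<le> ennreal (energy g / h)"
        by (rule cube_mean_diff_sum[OF w h cube_shift(1)[OF h]]) (auto simp: inj_def)
      then show ?thesis by (simp add: case_prod_unfold)
    qed
    have E2: "(\<integral>\<^sup>+(a, b, c). ennreal ((?U (a, b + 1, c) - ?U (a, b, c))\<^sup>2) \<partial>count_int3) \<le> ennreal (energy g / h)"
    proof -
      have "(\<integral>\<^sup>+p. ennreal ((?U ((\<lambda>(a, b, c). (a, b + 1, c)) p) - ?U p)\<^sup>2) \<partial>count_int3) \<le> ennreal (energy g / h)"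
        by (rule cube_mean_diff_sum[OF w h cube_shift(2)[OF h]]) (auto simp: inj_def)
      then show ?thesis by (simp add: case_prod_unfold)
    qed
    have E3: "(\<integral>\<^sup>+(a, b, c). ennreal ((?U (a, b, c + 1) - ?U (a, b, c))\<^sup>2) \<partial>count_int3) \<le> ennreal (energy g / h)"
    proof -
      have "(\<integral>\<^sup>+p. ennreal ((?U ((\<lambda>(a, b, c). (a, b, c + 1)) p) - ?U p)\<^sup>2) \<partial>count_int3) \<le> ennreal (energy g / h)"
        by (rule cube_mean_diff_sum[OF w h cube_shift(3)[OF h]]) (auto simp: inj_def)
      then show ?thesis by (simp add: case_prod_unfold)
    qed
    have "(\<integral>\<^sup>+p. ennreal (?U p ^ 6) \<partial>count_int3) \<le> 4096 * (ennreal (energy g / h) * ennreal (energy g / h) * ennreal (energy g / h))"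
      by (rule order_trans[OF discrete_sobolev[OF fin] mult_left_mono[OF mult_mono[OF mult_mono[OF E1 E2] E3]]]) auto
    also have "\<dots> = ennreal (4096 * (energy g / h) ^ 3)"
    proof -
      have "4096 * (ennreal k * ennreal k * ennreal k) = ennreal (4096 * k ^ 3)" if "k \<ge> 0" for k
        using that by (simp add: ennreal_mult power3_eq_cube)
      then show ?thesis using h e0 by simp
    qed
    finally have "ennreal (h ^ 3) * (\<integral>\<^sup>+p. ennreal (?U p ^ 6) \<partial>count_int3) \<le> ennreal (h ^ 3) * ennreal (4096 * (energy g / h) ^ 3)"
      by (rule mult_left_mono) simp
    also have "\<dots> = ennreal (4096 * energy g ^ 3)"
      using h e0 by (subst ennreal_mult[symmetric]) (auto simp: power_divide)
    finally show ?thesis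
      using nn_integral_cube_index[OF h, of "\<lambda>p. ennreal (?U p ^ 6)"] by simp
  qed
  define H where "H n = inverse (real (Suc n))" for n
  define A where "A n x = cube_mean (H n) u (cube_index (H n) x)" for n x
  have H: "H n > 0" for n by (simp add: H_def)
  have [measurable]: "A n \<in> borel_measurable borel" for n
    unfolding A_def by (rule measurable_compose[OF measurable_cube_index]) simp
  have D: "(\<lambda>x. u x - A n x) \<in> L2 lborel" "(\<integral>x. (u x - A n x)\<^sup>2 \<partial>lborel) \<le> 72 * (H n)\<^sup>2 * energy g" for n
    using cube_mean_approx[OF w H] e0 unfolding A_def[symmetric]
    by (intro L2_nn_integralI[where c="72 * (H n)\<^sup>2 * energy g"]; auto)+
  have "(\<lambda>n. 72 * (H n)\<^sup>2 * energy g) \<longlonglongrightarrow> 72 * 0\<^sup>2 * energy g"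
    unfolding H_def by (intro tendsto_intros LIMSEQ_inverse_real_of_nat)
  then have H0: "(\<lambda>n. 72 * (H n)\<^sup>2 * energy g) \<longlonglongrightarrow> 0" by simp
  have "(\<lambda>n. \<integral>x. norm ((u x - A n x)\<^sup>2) \<partial>lborel) \<longlonglongrightarrow> 0"
  proof (rule tendsto_sandwich[OF _ _ tendsto_const H0])
    show "\<forall>\<^sub>F n in sequentially. (\<integral>x. norm ((u x - A n x)\<^sup>2) \<partial>lborel) \<le> 72 * (H n)\<^sup>2 * energy g"
      using D(2) by (intro always_eventually) simp
  qed simp
  from tendsto_L1_AE_subseq[OF L2_integrable[OF D(1)] this]
  obtain r where r: "strict_mono r" "AE x in lborel. (\<lambda>n. (u x - A (r n) x)\<^sup>2) \<longlonglongrightarrow> 0" by blast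
  have "(\<integral>\<^sup>+x. ennreal (u x ^ 6) \<partial>lborel) = (\<integral>\<^sup>+x. liminf (\<lambda>n. ennreal (A (r n) x ^ 6)) \<partial>lborel)"
    using r(2)
  proof (intro nn_integral_cong_AE, eventually_elim)
    fix x assume "(\<lambda>n. (u x - A (r n) x)\<^sup>2) \<longlonglongrightarrow> 0"
    then have "(\<lambda>n. sqrt ((u x - A (r n) x)\<^sup>2)) \<longlonglongrightarrow> sqrt 0" by (rule tendsto_real_sqrt)
    then have "(\<lambda>n. u x - A (r n) x) \<longlonglongrightarrow> 0" by (simp add: tendsto_rabs_zero_iff)
    then have "(\<lambda>n. u x - (u x - A (r n) x)) \<longlonglongrightarrow> u x - 0" by (intro tendsto_intros)
    then have "(\<lambda>n. ennreal (A (r n) x ^ 6)) \<longlonglongrightarrow> ennreal (u x ^ 6)"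
      by (intro tendsto_ennrealI tendsto_power) simp
    from lim_imp_Liminf[OF sequentially_bot this]
    show "ennreal (u x ^ 6) = liminf (\<lambda>n. ennreal (A (r n) x ^ 6))" by simp
  qed
  also have "\<dots> \<le> liminf (\<lambda>n. \<integral>\<^sup>+x. ennreal (A (r n) x ^ 6) \<partial>lborel)"
    by (rule nn_integral_liminf) measurable
  also have "\<dots> \<le> ennreal (4096 * energy g ^ 3)"
    using step[OF H] by (intro Liminf_le) (auto simp: A_def[symmetric])
  finally show ?thesis .
qed

section \<open>Sobolev functions on Lebesgue space\<close>

lemma borel_representative:
  fixes u :: "'a::euclidean_space \<Rightarrow> real"
  assumes "u \<in> L2 lebesgue"
  obtains u' where "u' \<in> L2 lborel" "AE x in lebesgue. u x = u' x"
proof -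
  obtain u' where u': "u' \<in> borel_measurable lborel" "AE x in lborel. u x = u' x"
    using completion_ex_borel_measurable_real[of u lborel] L2_measurable[OF assms] by blast
  have ae: "AE x in lebesgue. u x = u' x" using u'(2) by (rule AE_completion)
  have "integrable lebesgue (\<lambda>x. (u' x)\<^sup>2)"
    using L2_integrable[OF assms] ae L2_measurable[OF assms] measurable_completion[OF u'(1)]
    by (subst integrable_cong_AE[where g="\<lambda>x. (u x)\<^sup>2"]) (auto elim!: eventually_mono)
  then have "u' \<in> L2 lborel"
    using u'(1) by (auto simp: L2_def integrable_completion)
  with ae show thesis using that by blast
qed

lemma test_fun_L2_lebesgue: "test_fun \<phi> \<Longrightarrow> \<phi> \<in> L2 lebesgue"
  by (intro L2_lebesgueI test_fun_L2)

lemma fundamental_lemma_lebesgue: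
  assumes p: "p \<in> L2 lebesgue" and 0: "\<And>\<phi>. test_fun \<phi> \<Longrightarrow> (\<integral>x. p x * \<phi> x \<partial>lebesgue) = 0"
  shows "AE x in lebesgue. p x = 0"
proof -
  obtain p' where p': "p' \<in> L2 lborel" "AE x in lebesgue. p x = p' x"
    using borel_representative[OF p] .
  have "AE x in lborel. p' x = 0"
  proof (rule fundamental_lemma[OF p'(1)])
    fix \<phi> assume t: "test_fun \<phi>"
    note [measurable] = L2_measurable[OF p] L2_measurable[OF p'(1)] L2_measurable[OF L2_lebesgueI[OF p'(1)]]
      L2_measurable[OF test_fun_L2[OF t]] L2_measurable[OF test_fun_L2_lebesgue[OF t]]
    have "(\<integral>x. p' x * \<phi> x \<partial>lborel) = (\<integral>x. p' x * \<phi> x \<partial>lebesgue)"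
      by (rule integral_completion[symmetric]) measurable
    also have "\<dots> = (\<integral>x. p x * \<phi> x \<partial>lebesgue)"
      using p'(2) by (intro integral_cong_AE) (auto elim!: eventually_mono)
    finally show "(\<integral>x. p' x * \<phi> x \<partial>lborel) = 0" using 0[OF t] by simp
  qed
  then have "AE x in lebesgue. p' x = 0" by (rule AE_completion)
  with p'(2) show ?thesis by eventually_elim simp
qed

text \<open>Working form of membership in \<open>H1\<close>, see \<open>H1_iff\<close>: once all
  components lie in L2, the integrability clauses of \<open>has_weak_grad\<close> follow.\<close>

definition sobolev_pair :: "(R3 \<Rightarrow> real) \<Rightarrow> (R3 \<Rightarrow> R3) \<Rightarrow> bool" where
  "sobolev_pair u g \<longleftrightarrow> u \<in> L2 lebesgue \<and> (\<forall>i. (\<lambda>x. g x $ i) \<in> L2 lebesgue) \<and>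
     (\<forall>\<phi> i. test_fun \<phi> \<longrightarrow> (\<integral>x. u x * partial i \<phi> x \<partial>lebesgue) = - (\<integral>x. g x $ i * \<phi> x \<partial>lebesgue))"

definition dirichlet :: "(R3 \<Rightarrow> R3) \<Rightarrow> (R3 \<Rightarrow> R3) \<Rightarrow> real" where
  "dirichlet g k = (\<integral>x. g x \<bullet> k x \<partial>lebesgue)"

lemma sobolev_pairD:
  assumes "sobolev_pair u g"
  shows "u \<in> L2 lebesgue" "(\<lambda>x. g x $ i) \<in> L2 lebesgue"
    "test_fun \<phi> \<Longrightarrow> (\<integral>x. u x * partial i \<phi> x \<partial>lebesgue) = - (\<integral>x. g x $ i * \<phi> x \<partial>lebesgue)"
  using assms by (auto simp: sobolev_pair_def)

lemma sobolev_pair_weak_grad: "sobolev_pair u g \<Longrightarrow> has_weak_grad u g"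
  unfolding has_weak_grad_def
  by (intro conjI allI impI L2_measurable[OF sobolev_pairD(2)] sobolev_pairD(3)
      L2_mult_integrable[OF sobolev_pairD(1)] L2_mult_integrable[OF sobolev_pairD(2)]
      test_fun_L2_lebesgue test_fun_partial)

lemma inner_R3: "x \<bullet> y = x $ 1 * y $ 1 + x $ 2 * y $ 2 + x $ 3 * y $ 3" for x y :: R3
  by (simp add: inner_vec_def sum_3)

lemma integrable_inner:
  assumes "\<And>i. (\<lambda>x. g x $ i) \<in> L2 M" "\<And>i. (\<lambda>x. k x $ i) \<in> L2 M"
  shows "integrable M (\<lambda>x. g x \<bullet> (k x :: R3))"
  unfolding inner_R3 by (intro Bochner_Integration.integrable_add L2_mult_integrable assms)

lemma dirichlet_sum:
  assumes "\<And>i. (\<lambda>x. g x $ i) \<in> L2 lebesgue" "\<And>i. (\<lambda>x. k x $ i) \<in> L2 lebesgue"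
  shows "dirichlet g k = (\<integral>x. g x $ 1 * k x $ 1 \<partial>lebesgue) + (\<integral>x. g x $ 2 * k x $ 2 \<partial>lebesgue) + (\<integral>x. g x $ 3 * k x $ 3 \<partial>lebesgue)"
  unfolding dirichlet_def inner_R3
  using L2_mult_integrable[OF assms(1) assms(2)] by simp

lemma H1_iff: "u \<in> H1 \<longleftrightarrow> (\<exists>g. sobolev_pair u g)"
  and weak_grad_pair: "u \<in> H1 \<Longrightarrow> sobolev_pair u (weak_grad u)"
proof -
  have *: "sobolev_pair u g" if u: "u \<in> L2 lebesgue" and g: "has_weak_grad u g" "integrable lebesgue (\<lambda>x. (norm (g x))\<^sup>2)" for g
  proof -
    have m [measurable]: "\<And>i. (\<lambda>x. g x $ i) \<in> borel_measurable lebesgue" using g(1) by (simp add: has_weak_grad_def)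
    have "integrable lebesgue (\<lambda>x. (g x $ i)\<^sup>2)" for i
      by (rule Bochner_Integration.integrable_bound[OF g(2)])
        (auto intro!: power_mono component_le_norm_cart simp: abs_le_square_iff[symmetric])
    then show ?thesis using u g m by (auto simp: sobolev_pair_def L2_def has_weak_grad_def)
  qed
  have **: "has_weak_grad u g \<and> integrable lebesgue (\<lambda>x. (norm (g x))\<^sup>2)" if "sobolev_pair u g" for g
    using sobolev_pair_weak_grad[OF that] integrable_inner[OF sobolev_pairD(2)[OF that] sobolev_pairD(2)[OF that]]
    by (simp add: power2_norm_eq_inner)
  show "u \<in> H1 \<longleftrightarrow> (\<exists>g. sobolev_pair u g)"
  proof
    assume "u \<in> H1"
    then obtain g where "u \<in> L2 lebesgue" "has_weak_grad u g" "integrable lebesgue (\<lambda>x. (norm (g x))\<^sup>2)"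
      unfolding H1_def L2_def by blast
    from *[OF this] show "\<exists>g. sobolev_pair u g" by blast
  next
    assume "\<exists>g. sobolev_pair u g"
    then obtain g where g: "sobolev_pair u g" ..
    from sobolev_pairD(1)[OF g] **[OF g] show "u \<in> H1" unfolding H1_def L2_def by blast
  qed
  show "sobolev_pair u (weak_grad u)" if "u \<in> H1"
  proof -
    have "\<exists>g. has_weak_grad u g \<and> integrable lebesgue (\<lambda>x. (norm (g x))\<^sup>2)" and u: "u \<in> L2 lebesgue"
      using that by (auto simp: H1_def L2_def)
    from someI_ex[OF this(1)] show ?thesis
      unfolding weak_grad_def[symmetric] by (intro * u) auto
  qed
qed

text \<open>The difference of two weak gradients vanishes against all test functions. As
  \<open>weak_grad\<close> is an arbitrary choice, this is what allows computing with it, up to null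
  sets.\<close>

lemma sobolev_pair_unique:
  assumes "sobolev_pair u g" "sobolev_pair u k"
  shows "AE x in lebesgue. g x = k x"
proof -
  have "AE x in lebesgue. g x $ i - k x $ i = 0" for i
  proof (rule fundamental_lemma_lebesgue)
    show "(\<lambda>x. g x $ i - k x $ i) \<in> L2 lebesgue" by (intro L2_diff sobolev_pairD(2)[OF assms(1)] sobolev_pairD(2)[OF assms(2)])
    fix \<phi> assume t: "test_fun \<phi>"
    show "(\<integral>x. (g x $ i - k x $ i) * \<phi> x \<partial>lebesgue) = 0"
      using sobolev_pairD(3)[OF assms(1) t, of i] sobolev_pairD(3)[OF assms(2) t, of i]
        L2_mult_integrable[OF sobolev_pairD(2)[OF assms(1)] test_fun_L2_lebesgue[OF t], of i]
        L2_mult_integrable[OF sobolev_pairD(2)[OF assms(2)] test_fun_L2_lebesgue[OF t], of i]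
      by (simp add: left_diff_distrib)
  qed
  then have "AE x in lebesgue. \<forall>i. g x $ i - k x $ i = 0" by (simp add: AE_all_countable)
  then show ?thesis by eventually_elim (simp add: vec_eq_iff)
qed

lemma sobolev_pair_linear:
  assumes u: "sobolev_pair u g" and v: "sobolev_pair v k"
  shows "sobolev_pair (\<lambda>x. s * u x + t * v x) (\<lambda>x. s *\<^sub>R g x + t *\<^sub>R k x)"
  unfolding sobolev_pair_def
proof (intro conjI allI impI)
  show "(\<lambda>x. s * u x + t * v x) \<in> L2 lebesgue"
    by (intro L2_add L2_scale sobolev_pairD(1)[OF u] sobolev_pairD(1)[OF v])
  show "(\<lambda>x. (s *\<^sub>R g x + t *\<^sub>R k x) $ i) \<in> L2 lebesgue" for i
    unfolding vector_add_component vector_scaleR_component real_scaleR_def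
    by (intro L2_add L2_scale sobolev_pairD(2)[OF u] sobolev_pairD(2)[OF v])
  fix \<phi> i assume p: "test_fun \<phi>"
  note i1 = L2_mult_integrable[OF sobolev_pairD(1)[OF u] test_fun_L2_lebesgue[OF test_fun_partial[OF p, of i]]]
  note i2 = L2_mult_integrable[OF sobolev_pairD(1)[OF v] test_fun_L2_lebesgue[OF test_fun_partial[OF p, of i]]]
  note i3 = L2_mult_integrable[OF sobolev_pairD(2)[OF u] test_fun_L2_lebesgue[OF p], of i]
  note i4 = L2_mult_integrable[OF sobolev_pairD(2)[OF v] test_fun_L2_lebesgue[OF p], of i]
  have "(\<integral>x. (s * u x + t * v x) * partial i \<phi> x \<partial>lebesgue) = s * (\<integral>x. u x * partial i \<phi> x \<partial>lebesgue) + t * (\<integral>x. v x * partial i \<phi> x \<partial>lebesgue)"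
    using i1 i2 by (simp add: distrib_right mult.assoc)
  moreover have "(\<integral>x. (s *\<^sub>R g x + t *\<^sub>R k x) $ i * \<phi> x \<partial>lebesgue) = s * (\<integral>x. g x $ i * \<phi> x \<partial>lebesgue) + t * (\<integral>x. k x $ i * \<phi> x \<partial>lebesgue)"
    using i3 i4 by (simp add: distrib_right mult.assoc)
  ultimately show "(\<integral>x. (s * u x + t * v x) * partial i \<phi> x \<partial>lebesgue) = - (\<integral>x. (s *\<^sub>R g x + t *\<^sub>R k x) $ i * \<phi> x \<partial>lebesgue)"
    using sobolev_pairD(3)[OF u p, of i] sobolev_pairD(3)[OF v p, of i] by simp
qed

lemma H1_linear:
  assumes "u \<in> H1" "v \<in> H1"
  shows "(\<lambda>x. s * u x + t * v x) \<in> H1"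
    "AE x in lebesgue. weak_grad (\<lambda>x. s * u x + t * v x) x = s *\<^sub>R weak_grad u x + t *\<^sub>R weak_grad v x"
proof -
  have *: "sobolev_pair (\<lambda>x. s * u x + t * v x) (\<lambda>x. s *\<^sub>R weak_grad u x + t *\<^sub>R weak_grad v x)"
    by (intro sobolev_pair_linear weak_grad_pair assms)
  then show H: "(\<lambda>x. s * u x + t * v x) \<in> H1" using H1_iff by blast
  show "AE x in lebesgue. weak_grad (\<lambda>x. s * u x + t * v x) x = s *\<^sub>R weak_grad u x + t *\<^sub>R weak_grad v x"
    by (rule sobolev_pair_unique[OF weak_grad_pair[OF H] *])
qed

text \<open>The bridge to Borel measurable data, where the translation and cube arguments live; only
  null sets change.\<close>

lemma sobolev_pair_borel:
  assumes u: "sobolev_pair u g"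
  obtains u' g' where "weak_pair u' g'" "AE x in lebesgue. u x = u' x" "AE x in lebesgue. g x = g' x"
    "energy g' = dirichlet g g"
proof -
  obtain u' where u': "u' \<in> L2 lborel" "AE x in lebesgue. u x = u' x"
    using borel_representative[OF sobolev_pairD(1)[OF u]] .
  have "\<forall>i. \<exists>k. k \<in> L2 lborel \<and> (AE x in lebesgue. g x $ i = k x)"
    using borel_representative[OF sobolev_pairD(2)[OF u]] by metis
  then obtain k where k: "\<And>i. k i \<in> L2 lborel" "\<And>i. AE x in lebesgue. g x $ i = k i x" by metis
  define g' where "g' x = (\<chi> i. k i x)" for x
  have "AE x in lebesgue. \<forall>i. g x $ i = k i x" using k(2) by (simp add: AE_all_countable)
  then have gg: "AE x in lebesgue. g x = g' x" by eventually_elim (simp add: vec_eq_iff g'_def)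
  note [measurable] = L2_measurable[OF sobolev_pairD(1)[OF u]] L2_measurable[OF sobolev_pairD(2)[OF u]]
    L2_measurable[OF L2_lebesgueI[OF u'(1)]] L2_measurable[OF L2_lebesgueI[OF k(1)]]
  have g'i: "(\<lambda>x. g' x $ i) \<in> L2 lborel" for i using k(1) by (simp add: g'_def)
  have "sobolev_pair u' g'"
    unfolding sobolev_pair_def
  proof (intro conjI allI impI L2_lebesgueI u'(1) g'i)
    fix \<phi> i assume t: "test_fun \<phi>"
    note [measurable] = L2_measurable[OF test_fun_L2_lebesgue[OF t]] L2_measurable[OF test_fun_L2_lebesgue[OF test_fun_partial[OF t]]]
    have "(\<integral>x. u' x * partial i \<phi> x \<partial>lebesgue) = (\<integral>x. u x * partial i \<phi> x \<partial>lebesgue)"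
      using u'(2) by (intro integral_cong_AE) (auto elim!: eventually_mono)
    moreover have "(\<integral>x. g' x $ i * \<phi> x \<partial>lebesgue) = (\<integral>x. g x $ i * \<phi> x \<partial>lebesgue)"
      using gg by (intro integral_cong_AE) (auto elim!: eventually_mono simp: g'_def)
    ultimately show "(\<integral>x. u' x * partial i \<phi> x \<partial>lebesgue) = - (\<integral>x. g' x $ i * \<phi> x \<partial>lebesgue)"
      using sobolev_pairD(3)[OF u t, of i] by simp
  qed
  then have w: "weak_pair u' g'"
    using sobolev_pair_weak_grad u'(1) g'i by (auto simp: weak_pair_def)
  have int: "integrable lebesgue (\<lambda>x. g x \<bullet> g x)" "integrable lebesgue (\<lambda>x. g' x \<bullet> g' x)"
    by (intro integrable_inner sobolev_pairD(2)[OF u] L2_lebesgueI g'i)+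
  have "energy g' = (\<integral>x. g' x \<bullet> g' x \<partial>lebesgue)"
    unfolding energy_def power2_norm_eq_inner
    by (rule integral_completion[symmetric], rule borel_measurable_integrable, intro integrable_inner g'i)
  also have "\<dots> = dirichlet g g"
    unfolding dirichlet_def using gg borel_measurable_integrable[OF int(1)] borel_measurable_integrable[OF int(2)]
    by (intro integral_cong_AE) (auto elim!: eventually_mono)
  finally show thesis using that w u'(2) gg by blast
qed

lemma sobolev_L6:
  assumes u: "sobolev_pair u g"
  shows "integrable lebesgue (\<lambda>x. u x ^ 6)" "(\<integral>x. u x ^ 6 \<partial>lebesgue) \<le> 4096 * dirichlet g g ^ 3"
proof -
  obtain u' g' where w: "weak_pair u' g'" "AE x in lebesgue. u x = u' x" "AE x in lebesgue. g x = g' x"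
    "energy g' = dirichlet g g"
    using sobolev_pair_borel[OF u] .
  have [measurable]: "u \<in> borel_measurable lebesgue" by (rule L2_measurable[OF sobolev_pairD(1)[OF u]])
  have d0: "dirichlet g g \<ge> 0" by (simp add: dirichlet_def)
  have "(\<integral>\<^sup>+x. ennreal (u x ^ 6) \<partial>lebesgue) = (\<integral>\<^sup>+x. ennreal (u' x ^ 6) \<partial>lebesgue)"
    using w(2) by (intro nn_integral_cong_AE) (auto elim!: eventually_mono)
  also have "\<dots> \<le> ennreal (4096 * dirichlet g g ^ 3)"
    using sobolev_inequality[OF w(1)] by (simp add: nn_integral_completion w(4))
  finally have *: "(\<integral>\<^sup>+x. ennreal (u x ^ 6) \<partial>lebesgue) \<le> ennreal (4096 * dirichlet g g ^ 3)" .
  show int: "integrable lebesgue (\<lambda>x. u x ^ 6)"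
    using * by (intro integrableI_nonneg) (auto intro: le_less_trans)
  show "(\<integral>x. u x ^ 6 \<partial>lebesgue) \<le> 4096 * dirichlet g g ^ 3"
    using * d0 by (subst (asm) nn_integral_eq_integral[OF int]) auto
qed

section \<open>Completeness of L2 and closedness of the Sobolev class\<close>

lemma L2_add_square_le:
  assumes "u \<in> L2 M" "v \<in> L2 M"
  shows "(\<integral>x. (u x + v x)\<^sup>2 \<partial>M) \<le> 2 * (\<integral>x. (u x)\<^sup>2 \<partial>M) + 2 * (\<integral>x. (v x)\<^sup>2 \<partial>M)"
proof -
  have "(\<integral>x. (u x + v x)\<^sup>2 \<partial>M) \<le> (\<integral>x. 2 * (u x)\<^sup>2 + 2 * (v x)\<^sup>2 \<partial>M)"
  proof (rule integral_mono)
    show "integrable M (\<lambda>x. (u x + v x)\<^sup>2)" by (intro L2_integrable L2_add assms)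
    show "integrable M (\<lambda>x. 2 * (u x)\<^sup>2 + 2 * (v x)\<^sup>2)" using assms by (simp add: L2_integrable)
    show "(u x + v x)\<^sup>2 \<le> 2 * (u x)\<^sup>2 + 2 * (v x)\<^sup>2" for x
      using zero_le_power2[of "u x - v x"] by (simp add: power2_sum power2_diff)
  qed
  then show ?thesis using assms by (simp add: L2_integrable)
qed

text \<open>Riesz-Fischer by a rapidly Cauchy subsequence: squared increments below
  \<open>4^-k\<close> remain summable after weighting by \<open>2^k\<close>, which gives absolute
  convergence almost everywhere. Fatou along the subsequence shows that the pointwise limit is also
  the limit in L2.\<close>

theorem L2_complete:
  fixes f :: "nat \<Rightarrow> 'a \<Rightarrow> real"
  assumes f: "\<And>n. f n \<in> L2 M"
    and cauchy: "\<And>e. e > 0 \<Longrightarrow> \<exists>N. \<forall>m\<ge>N. \<forall>n\<ge>N. (\<integral>x. (f m x - f n x)\<^sup>2 \<partial>M) < e"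
  obtains F where "F \<in> L2 M" "(\<lambda>n. \<integral>x. (f n x - F x)\<^sup>2 \<partial>M) \<longlonglongrightarrow> 0"
proof -
  have "\<forall>k. \<exists>N. \<forall>m\<ge>N. \<forall>n\<ge>N. (\<integral>x. (f m x - f n x)\<^sup>2 \<partial>M) < (1/4) ^ k"
    using cauchy by simp
  then obtain N where N: "\<And>k m n. m \<ge> N k \<Longrightarrow> n \<ge> N k \<Longrightarrow> (\<integral>x. (f m x - f n x)\<^sup>2 \<partial>M) < (1/4) ^ k"
    by metis
  \<comment> \<open>Cumulative sums make the indices monotone, at least \<open>N k\<close> and at
    least \<open>k\<close>, all at once.\<close>
  define r where "r k = (\<Sum>j\<le>k. N j) + k" for k
  have rN: "r k \<ge> N k" for k
  proof -
    have "N k \<le> (\<Sum>j\<le>k. N j)" by (rule member_le_sum) auto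
    then show ?thesis by (simp add: r_def)
  qed
  have r_mono: "r (Suc k) \<ge> r k" for k by (simp add: r_def)
  have rk: "r k \<ge> k" for k by (simp add: r_def)
  define d where "d k x = f (r (Suc k)) x - f (r k) x" for k x
  have [measurable]: "\<And>n. f n \<in> borel_measurable M" by (rule L2_measurable[OF f])
  have dL: "d k \<in> L2 M" for k unfolding d_def[abs_def] by (intro L2_diff f)
  have [measurable]: "\<And>k. d k \<in> borel_measurable M" by (rule L2_measurable[OF dL])
  have "(\<integral>x. (d k x)\<^sup>2 \<partial>M) < (1/4) ^ k" for k
    unfolding d_def by (intro N order_trans[OF rN r_mono] rN)
  then have "(\<integral>\<^sup>+x. ennreal (2 ^ k * (d k x)\<^sup>2) \<partial>M) \<le> ennreal ((1/2) ^ k)" for k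
  proof -
    have "(\<integral>\<^sup>+x. ennreal (2 ^ k * (d k x)\<^sup>2) \<partial>M) = ennreal (2 ^ k * (\<integral>x. (d k x)\<^sup>2 \<partial>M))"
      using L2_integrable[OF dL, of k] by (subst nn_integral_eq_integral) auto
    also have "2 ^ k * (\<integral>x. (d k x)\<^sup>2 \<partial>M) \<le> 2 ^ k * (1/4) ^ k"
      using \<open>(\<integral>x. (d k x)\<^sup>2 \<partial>M) < (1/4) ^ k\<close> by (intro mult_left_mono) auto
    also have "(2::real) ^ k * (1/4) ^ k = (1/2) ^ k" by (simp add: power_mult_distrib[symmetric])
    finally show ?thesis by (simp add: ennreal_leI)
  qed
  then have "(\<Sum>k. \<integral>\<^sup>+x. ennreal (2 ^ k * (d k x)\<^sup>2) \<partial>M) \<le> (\<Sum>k. ennreal ((1/2) ^ k))"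
    by (intro suminf_le) auto
  also have "\<dots> = ennreal (\<Sum>k. (1/2) ^ k)"
    by (rule suminf_ennreal2) (auto simp: summable_geometric)
  also have "\<dots> < \<infinity>" by simp
  finally have "(\<integral>\<^sup>+x. (\<Sum>k. ennreal (2 ^ k * (d k x)\<^sup>2)) \<partial>M) < \<infinity>"
    by (subst nn_integral_suminf) auto
  then have "AE x in M. (\<Sum>k. ennreal (2 ^ k * (d k x)\<^sup>2)) \<noteq> \<infinity>"
    by (intro nn_integral_PInf_AE) auto
  then have conv: "AE x in M. convergent (\<lambda>k. f (r k) x)"
  proof eventually_elim
    case (elim x)
    then have s: "summable (\<lambda>k. 2 ^ k * (d k x)\<^sup>2)"
      by (intro summable_suminf_not_top) auto
    have "summable (\<lambda>k. d k x)"
    proof (rule summable_comparison_test)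
      show "summable (\<lambda>k. 2 ^ k * (d k x)\<^sup>2 + (1/2) ^ k)"
        by (intro summable_add s summable_geometric) auto
      \<comment> \<open>Passing from squares to absolute values with \<open>c = 2^k\<close> costs
        only a geometric series.\<close>
      have "\<bar>a\<bar> \<le> c * a\<^sup>2 + 1 / c" if "c > 0" for a c :: real
      proof -
        have "0 \<le> (c * \<bar>a\<bar> - 1)\<^sup>2 + c * \<bar>a\<bar>" using that by simp
        then have "c * \<bar>a\<bar> \<le> c * (c * a\<^sup>2 + 1 / c)"
          using that by (simp add: power2_eq_square algebra_simps)
        then show ?thesis using that by simp
      qed
      from this[of "2 ^ _"] show "\<exists>N. \<forall>k\<ge>N. norm (d k x) \<le> 2 ^ k * (d k x)\<^sup>2 + (1/2) ^ k"
        by (simp add: power_one_over)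
    qed
    then have "convergent (\<lambda>n. \<Sum>k<n. d k x)" by (simp add: summable_iff_convergent)
    moreover have "(\<Sum>k<n. d k x) = f (r n) x - f (r 0) x" for n
      unfolding d_def by (rule sum_lessThan_telescope)
    ultimately have "convergent (\<lambda>n. f (r n) x - f (r 0) x)" by simp
    then show ?case
      using convergent_add_const_right_iff[of "\<lambda>n. f (r n) x" "- f (r 0) x"] by simp
  qed
  define F where "F x = lim (\<lambda>k. f (r k) x)" for x
  have [measurable]: "F \<in> borel_measurable M" unfolding F_def by measurable
  have bound: "(\<integral>\<^sup>+x. ennreal ((f n x - F x)\<^sup>2) \<partial>M) \<le> ennreal e"
    if n: "n \<ge> K" and K: "\<And>m n. m \<ge> K \<Longrightarrow> n \<ge> K \<Longrightarrow> (\<integral>x. (f m x - f n x)\<^sup>2 \<partial>M) < e" for K n e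
  proof -
    have "(\<integral>\<^sup>+x. ennreal ((f n x - F x)\<^sup>2) \<partial>M) = (\<integral>\<^sup>+x. liminf (\<lambda>k. ennreal ((f n x - f (r k) x)\<^sup>2)) \<partial>M)"
      using conv
    proof (intro nn_integral_cong_AE, eventually_elim)
      case (elim x)
      then have "(\<lambda>k. f (r k) x) \<longlonglongrightarrow> F x" by (simp add: F_def convergent_LIMSEQ_iff)
      then have "(\<lambda>k. ennreal ((f n x - f (r k) x)\<^sup>2)) \<longlonglongrightarrow> ennreal ((f n x - F x)\<^sup>2)"
        by (intro tendsto_ennrealI tendsto_intros)
      from lim_imp_Liminf[OF sequentially_bot this] show ?case by simp
    qed
    also have "\<dots> \<le> liminf (\<lambda>k. \<integral>\<^sup>+x. ennreal ((f n x - f (r k) x)\<^sup>2) \<partial>M)"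
      by (rule nn_integral_liminf) measurable
    also have "\<dots> \<le> ennreal e"
    proof (rule Liminf_le[OF sequentially_bot], rule eventually_mono[OF eventually_ge_at_top[of K]])
      fix k assume "K \<le> k"
      then have "(\<integral>x. (f n x - f (r k) x)\<^sup>2 \<partial>M) < e" using rk[of k] by (intro K n) auto
      then show "(\<integral>\<^sup>+x. ennreal ((f n x - f (r k) x)\<^sup>2) \<partial>M) \<le> ennreal e"
        using L2_nn_integral[OF L2_diff[OF f f, of n "r k"]] by (simp add: ennreal_leI)
    qed
    finally show ?thesis .
  qed
  have diffL: "(\<lambda>x. f n x - F x) \<in> L2 M \<and> (\<integral>x. (f n x - F x)\<^sup>2 \<partial>M) \<le> e"
    if "n \<ge> K" "\<And>m n. m \<ge> K \<Longrightarrow> n \<ge> K \<Longrightarrow> (\<integral>x. (f m x - f n x)\<^sup>2 \<partial>M) < e" "e > 0" for K n e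
    using L2_nn_integralI[OF _ bound[OF that(1,2)]] that(3) by auto
  have "F \<in> L2 M"
  proof -
    obtain K where "\<And>m n. m \<ge> K \<Longrightarrow> n \<ge> K \<Longrightarrow> (\<integral>x. (f m x - f n x)\<^sup>2 \<partial>M) < 1"
      using cauchy[of 1] by auto
    from diffL[OF order_refl this] have "(\<lambda>x. f K x - F x) \<in> L2 M" by simp
    from L2_diff[OF f this, of K] show ?thesis by simp
  qed
  moreover have "(\<lambda>n. \<integral>x. (f n x - F x)\<^sup>2 \<partial>M) \<longlonglongrightarrow> 0"
  proof (rule LIMSEQ_I)
    fix e :: real assume e: "e > 0"
    obtain K where K: "\<And>m n. m \<ge> K \<Longrightarrow> n \<ge> K \<Longrightarrow> (\<integral>x. (f m x - f n x)\<^sup>2 \<partial>M) < e / 2"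
      using cauchy[of "e / 2"] e by auto
    have "(\<integral>x. (f n x - F x)\<^sup>2 \<partial>M) < e" if "n \<ge> K" for n
    proof -
      have "(\<integral>x. (f n x - F x)\<^sup>2 \<partial>M) \<le> e / 2" using diffL[OF that K] e by simp
      then show ?thesis using e by linarith
    qed
    then show "\<exists>no. \<forall>n\<ge>no. norm ((\<integral>x. (f n x - F x)\<^sup>2 \<partial>M) - 0) < e"
      by (intro exI[of _ K]) simp
  qed
  ultimately show thesis using that by blast
qed

lemma L2_tendsto_mult:
  assumes f: "\<And>n. f n \<in> L2 M" "F \<in> L2 M" "(\<lambda>n. \<integral>x. (f n x - F x)\<^sup>2 \<partial>M) \<longlonglongrightarrow> 0" and w: "w \<in> L2 M"
  shows "(\<lambda>n. \<integral>x. f n x * w x \<partial>M) \<longlonglongrightarrow> (\<integral>x. F x * w x \<partial>M)"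
proof -
  have "(\<lambda>n. sqrt ((\<integral>x. (f n x - F x)\<^sup>2 \<partial>M) * (\<integral>x. (w x)\<^sup>2 \<partial>M))) \<longlonglongrightarrow> sqrt (0 * (\<integral>x. (w x)\<^sup>2 \<partial>M))"
    by (intro tendsto_intros f)
  then have lim: "(\<lambda>n. sqrt ((\<integral>x. (f n x - F x)\<^sup>2 \<partial>M) * (\<integral>x. (w x)\<^sup>2 \<partial>M))) \<longlonglongrightarrow> 0"
    by simp
  have "norm ((\<integral>x. f n x * w x \<partial>M) - (\<integral>x. F x * w x \<partial>M)) \<le> sqrt ((\<integral>x. (f n x - F x)\<^sup>2 \<partial>M) * (\<integral>x. (w x)\<^sup>2 \<partial>M))" for n
  proof -
    have "(\<integral>x. f n x * w x \<partial>M) - (\<integral>x. F x * w x \<partial>M) = (\<integral>x. (f n x - F x) * w x \<partial>M)"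
      using L2_mult_integrable[OF f(1) w, of n] L2_mult_integrable[OF f(2) w] by (simp add: left_diff_distrib)
    then show ?thesis
      using L2_cauchy_schwarz[OF L2_diff[OF f(1,2)] w, of n] by (intro real_le_rsqrt) simp
  qed
  from Lim_null_comparison[OF always_eventually[OF allI, OF this] lim] show ?thesis by (simp add: LIM_zero_iff)
qed

lemma L2_tendsto_square:
  assumes f: "\<And>n. f n \<in> L2 M" "F \<in> L2 M" "(\<lambda>n. \<integral>x. (f n x - F x)\<^sup>2 \<partial>M) \<longlonglongrightarrow> 0"
  shows "(\<lambda>n. \<integral>x. (f n x)\<^sup>2 \<partial>M) \<longlonglongrightarrow> (\<integral>x. (F x)\<^sup>2 \<partial>M)"
proof -
  have "(\<integral>x. (f n x)\<^sup>2 \<partial>M) = (\<integral>x. (f n x - F x)\<^sup>2 \<partial>M) + 2 * (\<integral>x. f n x * F x \<partial>M) - (\<integral>x. (F x)\<^sup>2 \<partial>M)" for n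
    using L2_integrable[OF f(1), of n] L2_integrable[OF f(2)] L2_mult_integrable[OF f(1,2), of n]
    by (simp add: power2_diff mult.assoc)
  moreover have "(\<lambda>n. (\<integral>x. (f n x - F x)\<^sup>2 \<partial>M) + 2 * (\<integral>x. f n x * F x \<partial>M) - (\<integral>x. (F x)\<^sup>2 \<partial>M)) \<longlonglongrightarrow> 0 + 2 * (\<integral>x. F x * F x \<partial>M) - (\<integral>x. (F x)\<^sup>2 \<partial>M)"
    by (intro tendsto_intros f L2_tendsto_mult)
  ultimately show ?thesis by (simp add: power2_eq_square)
qed

lemma dirichlet_nonneg: "dirichlet g g \<ge> 0"
  by (simp add: dirichlet_def)

text \<open>Instead of extracting a weakly convergent subsequence of gradients, minimise the Dirichlet
  energy over all Sobolev pairs that are \<open>L2\<close>-close to the limit; by the parallelogram law a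
  minimising sequence has strongly convergent gradients.\<close>

theorem sobolev_closed:
  assumes pair: "\<And>n. sobolev_pair (v n) (k n)" and u: "u \<in> L2 lebesgue"
    and conv: "(\<lambda>n. \<integral>x. (v n x - u x)\<^sup>2 \<partial>lebesgue) \<longlonglongrightarrow> 0"
    and en: "(\<lambda>n. dirichlet (k n) (k n)) \<longlonglongrightarrow> \<kappa>"
  obtains G where "sobolev_pair u G" "dirichlet G G \<le> \<kappa>"
proof -
  define \<iota> where "\<iota> n = inverse (real (Suc n))" for n
  have \<iota>_mono: "\<iota> m \<le> \<iota> n" if "n \<le> m" for m n
    using that by (simp add: \<iota>_def le_imp_inverse_le)
  have \<iota>_pos: "\<iota> n > 0" for n by (simp add: \<iota>_def)
  have \<iota>_lim: "\<iota> \<longlonglongrightarrow> 0" unfolding \<iota>_def by (rule LIMSEQ_inverse_real_of_nat)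
  define A where "A n = {(w, g). sobolev_pair w g \<and> (\<integral>x. (w x - u x)\<^sup>2 \<partial>lebesgue) \<le> \<iota> n}" for n
  define E where "E g = dirichlet g g" for g
  \<comment> \<open>\<open>A n\<close> shrinks with \<open>n\<close>, so these infima increase; they
    stay below \<open>\<kappa>\<close> because the given sequence eventually enters every
    \<open>A n\<close>. Hence they converge.\<close>
  define I where "I n = (INF z\<in>A n. E (snd z))" for n
  have bdd: "bdd_below ((\<lambda>z. E (snd z)) ` A n)" for n
    by (rule bdd_belowI2[of _ 0]) (simp add: E_def dirichlet_nonneg)
  have A_mono: "A m \<subseteq> A n" if "n \<le> m" for m n
  proof -
    show ?thesis using \<iota>_mono[OF that] unfolding A_def by (auto intro: order_trans)
  qed
  have evA: "eventually (\<lambda>m. (v m, k m) \<in> A n) sequentially" for n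
    using order_tendstoD(2)[OF conv \<iota>_pos, of n] pair
    by (auto simp: A_def elim!: eventually_mono)
  then have ne: "A n \<noteq> {}" for n
    using eventually_happens'[OF sequentially_bot evA[of n]] by blast
  have I_le: "I n \<le> \<kappa>" for n
  proof (rule tendsto_lowerbound[OF en _ sequentially_bot])
    show "\<forall>\<^sub>F m in sequentially. I n \<le> dirichlet (k m) (k m)"
      using evA[of n]
    proof eventually_elim
      case (elim m)
      from cINF_lower[OF bdd this] show ?case by (simp add: I_def E_def)
    qed
  qed
  have I_mono: "I n \<le> I m" if "n \<le> m" for m n
    unfolding I_def by (intro cINF_superset_mono ne bdd A_mono that) auto
  have "\<exists>z\<in>A n. E (snd z) < I n + \<iota> n" for n
    using cINF_less_iff[OF ne bdd, of n "I n + \<iota> n"] \<iota>_pos[of n] by (simp add: I_def)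
  then obtain z where z: "\<And>n. z n \<in> A n" "\<And>n. E (snd (z n)) < I n + \<iota> n"
    by metis
  define w g where "w n = fst (z n)" and "g n = snd (z n)" for n
  have pr: "sobolev_pair (w n) (g n)" and dist: "(\<integral>x. (w n x - u x)\<^sup>2 \<partial>lebesgue) \<le> \<iota> n" for n
    using z(1)[of n] by (auto simp: A_def w_def g_def)
  have Eg: "E (g n) < I n + \<iota> n" for n using z(2) by (simp add: g_def)
  have gL: "(\<lambda>x. g n x $ i) \<in> L2 lebesgue" for n i by (rule sobolev_pairD(2)[OF pr])
  \<comment> \<open>The midpoint of the two competitors is still admissible in \<open>A n\<close>,
    so its energy is at least \<open>I n\<close>; the parallelogram law then bounds the energy of
    the difference.\<close>
  have par: "E (\<lambda>x. g n x - g m x) \<le> 2 * (I m - I n) + 4 * \<iota> n" if "n \<le> m" for n m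
  proof -
    let ?mid = "\<lambda>x. (1/2) *\<^sub>R g n x + (1/2) *\<^sub>R g m x"
    let ?wmid = "\<lambda>x. (1/2) * w n x + (1/2) * w m x"
    have wL: "(\<lambda>x. w j x - u x) \<in> L2 lebesgue" for j by (intro L2_diff sobolev_pairD(1)[OF pr] u)
    have "(\<integral>x. (?wmid x - u x)\<^sup>2 \<partial>lebesgue) = (1/4) * (\<integral>x. ((w n x - u x) + (w m x - u x))\<^sup>2 \<partial>lebesgue)"
      by (subst integral_mult_right_zero[symmetric]) (intro Bochner_Integration.integral_cong, auto simp: power2_eq_square field_simps)
    also have "\<dots> \<le> (1/4) * (2 * (\<integral>x. (w n x - u x)\<^sup>2 \<partial>lebesgue) + 2 * (\<integral>x. (w m x - u x)\<^sup>2 \<partial>lebesgue))"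
      by (intro mult_left_mono L2_add_square_le wL) auto
    also have "\<dots> \<le> \<iota> n"
    proof -
      have "\<iota> m \<le> \<iota> n" using that by (intro \<iota>_mono) simp
      moreover have "1 / 4 * (2 * a + 2 * b) \<le> c" if "a \<le> c" "b \<le> d" "d \<le> c" for a b c d :: real
        using that by simp
      ultimately show ?thesis using dist[of n] dist[of m] by blast
    qed
    finally have "(?wmid, ?mid) \<in> A n"
      using sobolev_pair_linear[OF pr[of n] pr[of m], of "1/2" "1/2"] unfolding A_def by blast
    then have "I n \<le> E ?mid" unfolding I_def using bdd by (intro cINF_lower2) auto
    moreover have "E (\<lambda>x. g n x - g m x) = 2 * E (g n) + 2 * E (g m) - 4 * E ?mid"
    proof -
      note i = integrable_inner[OF gL gL]
      have "(g n x - g m x) \<bullet> (g n x - g m x) = 2 * (g n x \<bullet> g n x) + 2 * (g m x \<bullet> g m x) - 4 * (?mid x \<bullet> ?mid x)" for x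
        by (simp add: inner_diff inner_add algebra_simps)
      moreover have "integrable lebesgue (\<lambda>x. ?mid x \<bullet> ?mid x)"
        by (intro integrable_inner sobolev_pairD(2)[OF sobolev_pair_linear[OF pr pr]])
      ultimately show ?thesis
        using i[of n n] i[of m m] unfolding E_def dirichlet_def by simp
    qed
    moreover have "\<iota> m \<le> \<iota> n" using that by (intro \<iota>_mono) simp
    moreover have "a \<le> 2 * (Im - In) + 4 * \<iota>n"
      if "In \<le> Emid" "a = 2 * En + 2 * Em - 4 * Emid" "\<iota>m \<le> \<iota>n" "En < In + \<iota>n" "Em < Im + \<iota>m"
      for a Im In \<iota>n \<iota>m Emid En Em :: real
      using that by simp
    ultimately show ?thesis using Eg[of n] Eg[of m] by blast
  qed
  have "incseq I" using I_mono by (simp add: incseq_def)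
  then obtain l where "I \<longlonglongrightarrow> l" using incseq_convergent[of I \<kappa>] I_le by blast
  then have "convergent I" by (rule convergentI)
  have comp: "(\<integral>x. (g n x $ i - g m x $ i)\<^sup>2 \<partial>lebesgue) \<le> E (\<lambda>x. g n x - g m x)" for n m i
    unfolding E_def dirichlet_def
  proof (rule integral_mono)
    show "integrable lebesgue (\<lambda>x. (g n x $ i - g m x $ i)\<^sup>2)" by (intro L2_integrable L2_diff gL)
    show "integrable lebesgue (\<lambda>x. (g n x - g m x) \<bullet> (g n x - g m x))"
      by (intro integrable_inner; simp; intro L2_diff gL)
    show "(g n x $ i - g m x $ i)\<^sup>2 \<le> (g n x - g m x) \<bullet> (g n x - g m x)" for x
      using component_le_norm_cart[of "g n x - g m x" i] abs_le_square_iff[of "(g n x - g m x) $ i" "norm (g n x - g m x)"]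
      by (simp add: power2_norm_eq_inner)
  qed
  have "\<exists>F. F \<in> L2 lebesgue \<and> (\<lambda>n. \<integral>x. (g n x $ i - F x)\<^sup>2 \<partial>lebesgue) \<longlonglongrightarrow> 0" for i
  proof (rule L2_complete[of "\<lambda>n x. g n x $ i" lebesgue])
    show "(\<lambda>x. g n x $ i) \<in> L2 lebesgue" for n by (rule gL)
    fix e :: real assume e: "e > 0"
    have "Cauchy I" using \<open>convergent I\<close> by (rule convergent_Cauchy)
    \<comment> \<open>Quantities below \<open>e / 8\<close> enter \<open>par\<close> with weights 2
      and 4, and \<open>6 / 8 < 1\<close>.\<close>
    then obtain N1 where N1: "\<And>m n. m \<ge> N1 \<Longrightarrow> n \<ge> N1 \<Longrightarrow> \<bar>I m - I n\<bar> < e / 8"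
      using e unfolding Cauchy_def dist_real_def by (meson divide_pos_pos zero_less_numeral)
    obtain N2 where N2: "\<iota> N2 < e / 8"
      using reals_Archimedean[of "e / 8"] e by (auto simp: \<iota>_def)
    have le: "(\<integral>x. (g n x $ i - g m x $ i)\<^sup>2 \<partial>lebesgue) < e" if "n \<ge> max N1 N2" "n \<le> m" for n m
    proof -
      have "\<iota> n \<le> \<iota> N2" using that by (intro \<iota>_mono) simp
      moreover have "I m - I n < e / 8" using abs_ge_self N1[of m n] that by (metis le_less_trans max.bounded_iff order_trans)
      moreover have "2 * a + 4 * b < e" if "b \<le> c" "a < e / 8" "c < e / 8" for a b c
        using that e by simp
      ultimately have "2 * (I m - I n) + 4 * \<iota> n < e" using N2 by blast
      then show ?thesis using comp[of n i m] par[OF that(2)] by (meson le_less_trans)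
    qed
    show "\<exists>N. \<forall>m\<ge>N. \<forall>n\<ge>N. (\<integral>x. (g m x $ i - g n x $ i)\<^sup>2 \<partial>lebesgue) < e"
    proof (intro exI allI impI)
      fix m n assume mn: "m \<ge> max N1 N2" "n \<ge> max N1 N2"
      show "(\<integral>x. (g m x $ i - g n x $ i)\<^sup>2 \<partial>lebesgue) < e"
        using le[OF mn(1)] le[OF mn(2)] by (cases "m \<le> n") (auto simp: power2_commute[of "g m _ $ i"])
    qed
  next
    fix F assume "F \<in> L2 lebesgue" "(\<lambda>n. \<integral>x. (g n x $ i - F x)\<^sup>2 \<partial>lebesgue) \<longlonglongrightarrow> 0"
    then show ?thesis by blast
  qed
  then have "\<forall>i. \<exists>F. F \<in> L2 lebesgue \<and> (\<lambda>n. \<integral>x. (g n x $ i - F x)\<^sup>2 \<partial>lebesgue) \<longlonglongrightarrow> 0"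
    by (rule allI)
  from choice[OF this]
  obtain F where F: "\<And>i. F i \<in> L2 lebesgue" "\<And>i. (\<lambda>n. \<integral>x. (g n x $ i - F i x)\<^sup>2 \<partial>lebesgue) \<longlonglongrightarrow> 0"
    by blast
  define G where "G x = (\<chi> i. F i x)" for x
  have G_i: "G x $ i = F i x" for x i by (simp add: G_def)
  have wu: "(\<lambda>n. \<integral>x. (w n x - u x)\<^sup>2 \<partial>lebesgue) \<longlonglongrightarrow> 0"
  proof (rule tendsto_sandwich[OF _ _ tendsto_const \<iota>_lim])
    show "\<forall>\<^sub>F n in sequentially. (\<integral>x. (w n x - u x)\<^sup>2 \<partial>lebesgue) \<le> \<iota> n"
      by (intro always_eventually allI dist)
  qed simp
  have "sobolev_pair u G"
    unfolding sobolev_pair_def G_i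
  proof (intro conjI allI impI u F)
    fix \<phi> i assume t: "test_fun \<phi>"
    have "(\<lambda>n. \<integral>x. w n x * partial i \<phi> x \<partial>lebesgue) \<longlonglongrightarrow> (\<integral>x. u x * partial i \<phi> x \<partial>lebesgue)"
      by (intro L2_tendsto_mult wu u sobolev_pairD(1)[OF pr] test_fun_L2_lebesgue test_fun_partial t)
    moreover have "(\<lambda>n. - (\<integral>x. g n x $ i * \<phi> x \<partial>lebesgue)) \<longlonglongrightarrow> - (\<integral>x. F i x * \<phi> x \<partial>lebesgue)"
      by (intro tendsto_minus L2_tendsto_mult F gL test_fun_L2_lebesgue t)
    ultimately show "(\<integral>x. u x * partial i \<phi> x \<partial>lebesgue) = - (\<integral>x. F i x * \<phi> x \<partial>lebesgue)"
      using sobolev_pairD(3)[OF pr t, of _ i] LIMSEQ_unique by simp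
  qed
  moreover have "dirichlet G G \<le> \<kappa>"
  proof (rule LIMSEQ_le)
    have GL: "(\<lambda>x. G x $ i) \<in> L2 lebesgue" for i by (simp add: G_i F)
    have "(\<lambda>n. (\<integral>x. (g n x $ 1)\<^sup>2 \<partial>lebesgue) + (\<integral>x. (g n x $ 2)\<^sup>2 \<partial>lebesgue) + (\<integral>x. (g n x $ 3)\<^sup>2 \<partial>lebesgue))
      \<longlonglongrightarrow> (\<integral>x. (F 1 x)\<^sup>2 \<partial>lebesgue) + (\<integral>x. (F 2 x)\<^sup>2 \<partial>lebesgue) + (\<integral>x. (F 3 x)\<^sup>2 \<partial>lebesgue)"
      by (intro tendsto_add L2_tendsto_square F gL)
    then show "(\<lambda>n. E (g n)) \<longlonglongrightarrow> dirichlet G G"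
      unfolding E_def by (simp add: dirichlet_sum[OF gL gL] dirichlet_sum[OF GL GL] G_i power2_eq_square)
    show "(\<lambda>n. \<kappa> + \<iota> n) \<longlonglongrightarrow> \<kappa>"
      using tendsto_add[OF tendsto_const[of \<kappa>] \<iota>_lim] by simp
    show "\<exists>N. \<forall>n\<ge>N. E (g n) \<le> \<kappa> + \<iota> n"
    proof (intro exI allI impI)
      show "E (g n) \<le> \<kappa> + \<iota> n" for n using Eg[of n] I_le[of n] by linarith
    qed
  qed
  ultimately show thesis using that by blast
qed

section \<open>Coercive potentials and compactness\<close>

text \<open>The mean value theorem bounds the quotients and \<open>\<psi>\<close> supplies the
  bounded support for dominated convergence. The sign of \<open>c\<close> is free so that forward
  and backward quotients are both covered.\<close>

lemma difference_quotient_tendsto: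
  assumes \<phi>: "test_fun \<phi>" and \<psi>: "test_fun \<psi>" and c: "c \<noteq> 0"
  defines "h \<equiv> \<lambda>n. c * inverse (real (Suc n))"
  shows "(\<lambda>n. \<integral>x. (\<phi> (x + h n *\<^sub>R axis i 1) - \<phi> x) / h n * \<psi> x \<partial>lborel) \<longlonglongrightarrow> (\<integral>x. partial i \<phi> x * \<psi> x \<partial>lborel)"
proof -
  obtain B r where B: "B \<ge> 0" "\<And>x. \<bar>partial i \<phi> x\<bar> \<le> B"
    using test_fun_bounded[OF test_fun_partial[OF \<phi>]] by metis
  obtain B' r' where B': "B' \<ge> 0" "\<And>x. \<bar>\<psi> x\<bar> \<le> B'" "\<And>x. norm x > r' \<Longrightarrow> \<psi> x = 0"
    using test_fun_bounded[OF \<psi>] by metis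
  note [measurable] = test_fun_borel[OF \<phi>] test_fun_borel[OF \<psi>] test_fun_borel[OF test_fun_partial[OF \<phi>]]
  have h0: "h n \<noteq> 0" for n using c by (simp add: h_def)
  have hlim: "h \<longlonglongrightarrow> 0"
    unfolding h_def using tendsto_mult[OF tendsto_const[of c] LIMSEQ_inverse_real_of_nat] by simp
  have quot: "\<bar>(\<phi> (x + t *\<^sub>R axis i 1) - \<phi> x) / t\<bar> \<le> B" if "t \<noteq> 0" for x t
  proof -
    have "\<bar>\<phi> (x + t *\<^sub>R axis i 1) - \<phi> (x + 0 *\<^sub>R axis i 1)\<bar> \<le> B * \<bar>t - 0\<bar>"
      using field_differentiable_bound[of UNIV "\<lambda>s. \<phi> (x + s *\<^sub>R axis i 1)" "\<lambda>s. partial i \<phi> (x + s *\<^sub>R axis i 1)" B t 0]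
        test_fun_line_deriv[OF \<phi>] B by simp
    then show ?thesis using that by (simp add: divide_le_eq abs_divide)
  qed
  show ?thesis
  proof (rule integral_dominated_convergence)
    show "integrable lborel (\<lambda>x::R3. B * B' * indicator (cball 0 r') x)"
      by (intro integrable_mult_right integrable_real_indicator emeasure_bounded_finite bounded_cball) auto
    show "AE x in lborel. (\<lambda>n. (\<phi> (x + h n *\<^sub>R axis i 1) - \<phi> x) / h n * \<psi> x) \<longlonglongrightarrow> partial i \<phi> x * \<psi> x"
    proof (rule AE_I2, rule tendsto_mult[OF _ tendsto_const])
      fix x
      have "((\<lambda>t. (\<phi> (x + (0 + t) *\<^sub>R axis i 1) - \<phi> (x + 0 *\<^sub>R axis i 1)) / t) \<longlongrightarrow> partial i \<phi> (x + 0 *\<^sub>R axis i 1)) (at 0)"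
        using test_fun_line_deriv[OF \<phi>, of x i 0] by (rule DERIV_D)
      moreover have "filterlim h (at 0) sequentially"
        using hlim h0 by (simp add: filterlim_at)
      ultimately show "(\<lambda>n. (\<phi> (x + h n *\<^sub>R axis i 1) - \<phi> x) / h n) \<longlonglongrightarrow> partial i \<phi> x"
        using filterlim_compose by fastforce
    qed
    show "AE x in lborel. norm ((\<phi> (x + h n *\<^sub>R axis i 1) - \<phi> x) / h n * \<psi> x) \<le> B * B' * indicator (cball 0 r') x" for n
    proof (rule AE_I2)
      fix x
      show "norm ((\<phi> (x + h n *\<^sub>R axis i 1) - \<phi> x) / h n * \<psi> x) \<le> B * B' * indicator (cball 0 r') x"
      proof (cases "x \<in> cball 0 r'")
        case True
        have "\<bar>(\<phi> (x + h n *\<^sub>R axis i 1) - \<phi> x) / h n\<bar> * \<bar>\<psi> x\<bar> \<le> B * B'"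
          by (intro mult_mono quot h0 B' B) auto
        then show ?thesis using True by (simp add: abs_mult)
      qed (use B'(3) in \<open>simp add: not_le\<close>)
    qed
  qed measurable
qed

text \<open>The limit of a summation by parts: by translation invariance, the backward quotient of
  \<open>\<psi>\<close> against \<open>\<phi>\<close> is minus the forward quotient of
  \<open>\<phi>\<close> against \<open>\<psi>\<close>.\<close>

lemma test_fun_sobolev_pair:
  assumes \<phi>: "test_fun \<phi>"
  shows "sobolev_pair \<phi> (\<lambda>x. \<chi> i. partial i \<phi> x)"
  unfolding sobolev_pair_def vec_lambda_beta
proof (intro conjI allI impI test_fun_L2_lebesgue test_fun_partial \<phi>)
  fix \<psi> i assume \<psi>: "test_fun \<psi>"
  let ?e = "axis i 1 :: R3"
  let ?h = "\<lambda>n. inverse (real (Suc n))"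
  note [measurable] = test_fun_borel[OF \<phi>] test_fun_borel[OF \<psi>]
    test_fun_borel[OF test_fun_partial[OF \<phi>]] test_fun_borel[OF test_fun_partial[OF \<psi>]]
  have "(\<integral>x. (\<psi> (x + (- 1 * ?h n) *\<^sub>R ?e) - \<psi> x) / (- 1 * ?h n) * \<phi> x \<partial>lborel) =
      - (\<integral>x. (\<phi> (x + (1 * ?h n) *\<^sub>R ?e) - \<phi> x) / (1 * ?h n) * \<psi> x \<partial>lborel)" for n
  proof -
    let ?t = "?h n"
    note i1 = L2_mult_integrable[OF test_fun_L2[OF \<psi>] test_fun_L2[OF \<phi>]]
    note i2 = L2_mult_integrable[OF L2_shift(1)[OF test_fun_L2[OF \<psi>], of "(- ?t) *\<^sub>R ?e"] test_fun_L2[OF \<phi>]]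
    note i3 = L2_mult_integrable[OF L2_shift(1)[OF test_fun_L2[OF \<phi>], of "?t *\<^sub>R ?e"] test_fun_L2[OF \<psi>]]
    have eq: "(\<integral>x. \<psi> (x + (- ?t) *\<^sub>R ?e) * \<phi> x \<partial>lborel) = (\<integral>x. \<phi> (x + ?t *\<^sub>R ?e) * \<psi> x \<partial>lborel)"
      using integral_shift[of "\<lambda>x. \<psi> (x + (- ?t) *\<^sub>R ?e) * \<phi> x" "?t *\<^sub>R ?e"] by (simp add: mult.commute)
    have "(\<integral>x. (\<psi> (x + (- 1 * ?t) *\<^sub>R ?e) - \<psi> x) / (- 1 * ?t) * \<phi> x \<partial>lborel) = (\<integral>x. (- inverse ?t) * (\<psi> (x + (- ?t) *\<^sub>R ?e) * \<phi> x - \<psi> x * \<phi> x) \<partial>lborel)"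
      by (intro Bochner_Integration.integral_cong) (auto simp: field_simps)
    also have "\<dots> = (- inverse ?t) * ((\<integral>x. \<psi> (x + (- ?t) *\<^sub>R ?e) * \<phi> x \<partial>lborel) - (\<integral>x. \<psi> x * \<phi> x \<partial>lborel))"
      unfolding integral_mult_right_zero by (subst Bochner_Integration.integral_diff[OF i2 i1]) (rule refl)
    also have "\<dots> = - (inverse ?t * ((\<integral>x. \<phi> (x + ?t *\<^sub>R ?e) * \<psi> x \<partial>lborel) - (\<integral>x. \<psi> x * \<phi> x \<partial>lborel)))"
      unfolding eq by (simp only: mult_minus_left)
    also have "(\<integral>x. \<phi> (x + ?t *\<^sub>R ?e) * \<psi> x \<partial>lborel) - (\<integral>x. \<psi> x * \<phi> x \<partial>lborel) = (\<integral>x. \<phi> (x + ?t *\<^sub>R ?e) * \<psi> x - \<psi> x * \<phi> x \<partial>lborel)"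
      by (rule Bochner_Integration.integral_diff[OF i3 i1, symmetric])
    also have "inverse ?t * \<dots> = (\<integral>x. (\<phi> (x + (1 * ?t) *\<^sub>R ?e) - \<phi> x) / (1 * ?t) * \<psi> x \<partial>lborel)"
      unfolding integral_mult_right_zero[symmetric]
      by (intro Bochner_Integration.integral_cong) (auto simp: field_simps)
    finally show ?thesis .
  qed
  then have "(\<lambda>n. - (\<integral>x. (\<phi> (x + (1 * ?h n) *\<^sub>R ?e) - \<phi> x) / (1 * ?h n) * \<psi> x \<partial>lborel)) \<longlonglongrightarrow> (\<integral>x. partial i \<psi> x * \<phi> x \<partial>lborel)"
    using difference_quotient_tendsto[OF \<psi> \<phi>, of "- 1" i] by (simp only:)
  moreover have "(\<lambda>n. - (\<integral>x. (\<phi> (x + (1 * ?h n) *\<^sub>R ?e) - \<phi> x) / (1 * ?h n) * \<psi> x \<partial>lborel)) \<longlonglongrightarrow> - (\<integral>x. partial i \<phi> x * \<psi> x \<partial>lborel)"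
    by (intro tendsto_minus difference_quotient_tendsto[OF \<phi> \<psi>]) simp
  ultimately have "(\<integral>x. partial i \<psi> x * \<phi> x \<partial>lborel) = - (\<integral>x. partial i \<phi> x * \<psi> x \<partial>lborel)"
    by (rule LIMSEQ_unique)
  then show "(\<integral>x. \<phi> x * partial i \<psi> x \<partial>lebesgue) = - (\<integral>x. partial i \<phi> x * \<psi> x \<partial>lebesgue)"
    by (simp add: integral_completion mult.commute)
qed

lemma finite_cube_index_ball:
  assumes "h > 0" shows "finite (cube_index h ` cball 0 R)"
proof -
  define M where "M = \<lceil>R / h\<rceil> + 1"
  have "\<lfloor>x $ i / h\<rfloor> \<in> {-M..M}" if "x \<in> cball 0 R" for x :: R3 and i
  proof -
    have "\<bar>x $ i\<bar> \<le> R" using that component_le_norm_cart[of x i] by simp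
    then have "\<bar>x $ i / h\<bar> \<le> R / h" using assms by (simp add: abs_divide divide_right_mono)
    then show ?thesis unfolding M_def atLeastAtMost_iff by linarith
  qed
  then have "cube_index h ` cball 0 R \<subseteq> {-M..M} \<times> {-M..M} \<times> {-M..M}"
    by (simp add: cube_index_def image_subset_iff)
  then show ?thesis by (rule finite_subset) simp
qed

text \<open>Split \<open>w\<close> into its cube averages and the rest. The rest costs
  \<open>2 * 72 h^2\<close> times the energy; only the finitely many cubes meeting the ball
  contribute averages, and \<open>h^3\<close> times a squared average is the squared integral
  divided by \<open>h^3\<close>.\<close>

lemma local_mass_le_cube_integrals:
  assumes w: "sobolev_pair w g" and h: "h > 0"
  shows "(\<integral>x. indicator (cball 0 R) x * (w x)\<^sup>2 \<partial>lebesgue) \<le> 144 * h\<^sup>2 * dirichlet g g +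
    2 / h ^ 3 * (\<Sum>z\<in>cube_index h ` cball 0 R. (\<integral>x. indicator (cube h z) x * w x \<partial>lebesgue)\<^sup>2)"
proof -
  obtain u k where u: "weak_pair u k" "AE x in lebesgue. w x = u x" "energy k = dirichlet g g"
    using sobolev_pair_borel[OF w] by metis
  define Z where "Z = cube_index h ` cball 0 R"
  have Z: "finite Z" unfolding Z_def by (rule finite_cube_index_ball[OF h])
  have uL: "u \<in> L2 lborel" using u(1) by (simp add: weak_pair_def)
  have [measurable]: "w \<in> borel_measurable lebesgue" by (rule L2_measurable[OF sobolev_pairD(1)[OF w]])
  have [measurable]: "u \<in> borel_measurable borel" "u \<in> borel_measurable lebesgue"
    using L2_measurable[OF uL] L2_measurable[OF L2_lebesgueI[OF uL]] by simp_all
  have [measurable]: "cube h z \<in> sets lebesgue" "cball 0 R \<in> sets (lebesgue :: R3 measure)" for z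
    by (auto intro!: sets_completionI_sets)
  have [measurable]: "(\<lambda>x. cube_mean h u (cube_index h x)) \<in> borel_measurable borel"
    by (rule measurable_compose[OF measurable_cube_index]) simp
  define I where "I z = (\<integral>x. indicator (cube h z) x * w x \<partial>lebesgue)" for z
  have I: "I z = h ^ 3 * cube_mean h u z" for z
  proof -
    have "I z = (\<integral>x. indicator (cube h z) x * u x \<partial>lebesgue)"
      unfolding I_def using u(2) by (intro integral_cong_AE) (auto elim!: eventually_mono)
    also have "\<dots> = (\<integral>x. indicator (cube h z) x * u x \<partial>lborel)"
      by (rule integral_completion) measurable
    finally show ?thesis using h by (simp add: cube_mean_def)
  qed
  define b where "b = (\<Sum>z\<in>Z. (cube_mean h u z)\<^sup>2)"
  have "(\<integral>\<^sup>+x. ennreal (indicator (cball 0 R) x * (w x)\<^sup>2) \<partial>lebesgue) = (\<integral>\<^sup>+x. ennreal (indicator (cball 0 R) x * (u x)\<^sup>2) \<partial>lebesgue)"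
    using u(2) by (intro nn_integral_cong_AE) (auto elim!: eventually_mono)
  also have "\<dots> = (\<integral>\<^sup>+x. ennreal (indicator (cball 0 R) x * (u x)\<^sup>2) \<partial>lborel)"
    by (rule nn_integral_completion)
  also have "\<dots> \<le> (\<integral>\<^sup>+x. 2 * ennreal ((u x - cube_mean h u (cube_index h x))\<^sup>2)
      + 2 * (indicator Z (cube_index h x) * ennreal ((cube_mean h u (cube_index h x))\<^sup>2)) \<partial>lborel)"
  proof (rule nn_integral_mono)
    fix x
    let ?c = "cube_mean h u (cube_index h x)"
    show "ennreal (indicator (cball 0 R) x * (u x)\<^sup>2) \<le> 2 * ennreal ((u x - ?c)\<^sup>2) + 2 * (indicator Z (cube_index h x) * ennreal (?c\<^sup>2))"
    proof (cases "x \<in> cball 0 R")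
      case True
      then have iz: "cube_index h x \<in> Z" by (simp add: Z_def)
      have "(u x)\<^sup>2 \<le> 2 * (u x - ?c)\<^sup>2 + 2 * ?c\<^sup>2"
      proof -
        have "0 \<le> (u x - 2 * ?c)\<^sup>2" by simp
        then show ?thesis by (simp add: power2_eq_square algebra_simps)
      qed
      then have "ennreal ((u x)\<^sup>2) \<le> ennreal (2 * (u x - ?c)\<^sup>2 + 2 * ?c\<^sup>2)" by (rule ennreal_leI)
      also have "\<dots> = 2 * ennreal ((u x - ?c)\<^sup>2) + 2 * ennreal (?c\<^sup>2)"
        by (simp add: ennreal_plus ennreal_mult)
      finally show ?thesis using True iz by simp
    qed simp
  qed
  also have "\<dots> = 2 * (\<integral>\<^sup>+x. ennreal ((u x - cube_mean h u (cube_index h x))\<^sup>2) \<partial>lborel)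
      + 2 * (\<integral>\<^sup>+x. indicator Z (cube_index h x) * ennreal ((cube_mean h u (cube_index h x))\<^sup>2) \<partial>lborel)"
  proof -
    have [measurable]: "(\<lambda>x. indicator Z (cube_index h x) * ennreal ((cube_mean h u (cube_index h x))\<^sup>2)) \<in> borel_measurable borel"
      by (rule measurable_compose[OF measurable_cube_index]) simp
    show ?thesis by (simp add: nn_integral_add nn_integral_cmult)
  qed
  also have "(\<integral>\<^sup>+x. indicator Z (cube_index h x) * ennreal ((cube_mean h u (cube_index h x))\<^sup>2) \<partial>lborel)
      = ennreal (h ^ 3) * (\<integral>\<^sup>+p. indicator Z p * ennreal ((cube_mean h u p)\<^sup>2) \<partial>count_int3)"
    by (rule nn_integral_cube_index[OF h])
  also have "(\<integral>\<^sup>+p. indicator Z p * ennreal ((cube_mean h u p)\<^sup>2) \<partial>count_int3) = (\<integral>\<^sup>+p. ennreal ((cube_mean h u p)\<^sup>2) \<partial>count_space Z)"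
    by (subst nn_integral_count_space_indicator) (simp_all add: mult.commute)
  also have "\<dots> = ennreal b"
    using Z by (simp add: nn_integral_count_space_finite b_def)
  finally have "(\<integral>\<^sup>+x. ennreal (indicator (cball 0 R) x * (w x)\<^sup>2) \<partial>lebesgue) \<le>
      2 * (\<integral>\<^sup>+x. ennreal ((u x - cube_mean h u (cube_index h x))\<^sup>2) \<partial>lborel) + 2 * (ennreal (h ^ 3) * ennreal b)" .
  also have "\<dots> \<le> 2 * ennreal (72 * h\<^sup>2 * energy k) + 2 * (ennreal (h ^ 3) * ennreal b)"
    by (intro add_right_mono mult_left_mono cube_mean_approx u h) auto
  also have "\<dots> = ennreal (144 * h\<^sup>2 * dirichlet g g + 2 * h ^ 3 * b)"
  proof -
    have b: "b \<ge> 0" by (simp add: b_def sum_nonneg)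
    have "2 * ennreal s + 2 * (ennreal t * ennreal b) = ennreal (2 * s + 2 * t * b)" if "s \<ge> 0" "t \<ge> 0" for s t
      using that b by (simp add: ennreal_plus ennreal_mult mult.assoc)
    from this[of "72 * h\<^sup>2 * energy k" "h ^ 3"] show ?thesis
      using h dirichlet_nonneg[of g] u(3) by (simp add: mult.assoc)
  qed
  finally have "enn2real (\<integral>\<^sup>+x. ennreal (indicator (cball 0 R) x * (w x)\<^sup>2) \<partial>lebesgue) \<le> enn2real (ennreal (144 * h\<^sup>2 * dirichlet g g + 2 * h ^ 3 * b))"
    by (intro enn2real_mono) auto
  moreover have "0 \<le> 144 * h\<^sup>2 * dirichlet g g + 2 * h ^ 3 * b"
    using h dirichlet_nonneg[of g] by (simp add: b_def sum_nonneg)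
  moreover have "(\<integral>x. indicator (cball 0 R) x * (w x)\<^sup>2 \<partial>lebesgue) = enn2real (\<integral>\<^sup>+x. ennreal (indicator (cball 0 R) x * (w x)\<^sup>2) \<partial>lebesgue)"
    by (rule integral_eq_nn_integral) auto
  ultimately have "(\<integral>x. indicator (cball 0 R) x * (w x)\<^sup>2 \<partial>lebesgue) \<le> 144 * h\<^sup>2 * dirichlet g g + 2 * h ^ 3 * b"
    by simp
  also have "2 * h ^ 3 * b = 2 / h ^ 3 * (\<Sum>z\<in>Z. (I z)\<^sup>2)"
  proof -
    have "(\<Sum>z\<in>Z. (I z)\<^sup>2) = (h ^ 3)\<^sup>2 * b"
      unfolding b_def I power_mult_distrib by (rule sum_distrib_left[symmetric])
    moreover have "2 * k * b = 2 / k * (k\<^sup>2 * b)" if "k > 0" for k :: real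
      using that by (simp add: power2_eq_square)
    ultimately show ?thesis using h by simp
  qed
  finally show ?thesis by (simp add: I_def Z_def)
qed

lemma L2_ball_integrable:
  assumes "u \<in> L2 lebesgue" shows "integrable lebesgue (\<lambda>x::R3. indicator (cball 0 R) x * (u x)\<^sup>2)"
proof -
  have "cball 0 R \<in> sets (lebesgue :: R3 measure)" by (auto intro!: sets_completionI_sets)
  from integrable_mult_indicator[OF this L2_integrable[OF assms]] show ?thesis by simp
qed

lemma L2_AE_subseq:
  fixes f :: "nat \<Rightarrow> 'a \<Rightarrow> real"
  assumes f: "\<And>n. f n \<in> L2 M" "F \<in> L2 M" "(\<lambda>n. \<integral>x. (f n x - F x)\<^sup>2 \<partial>M) \<longlonglongrightarrow> 0"
  obtains r :: "nat \<Rightarrow> nat" where "strict_mono r" "AE x in M. (\<lambda>n. f (r n) x) \<longlonglongrightarrow> F x"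
proof -
  have "\<exists>r::nat\<Rightarrow>nat. strict_mono r \<and> (AE x in M. (\<lambda>n. (f (r n) x - F x)\<^sup>2) \<longlonglongrightarrow> 0)"
    by (rule tendsto_L1_AE_subseq) (use f(3) in \<open>auto intro!: L2_integrable L2_diff f(1,2)\<close>)
  then obtain r :: "nat \<Rightarrow> nat" where r: "strict_mono r" "AE x in M. (\<lambda>n. (f (r n) x - F x)\<^sup>2) \<longlonglongrightarrow> 0"
    by blast
  have "AE x in M. (\<lambda>n. f (r n) x) \<longlonglongrightarrow> F x"
    using r(2)
  proof eventually_elim
    case (elim x)
    then have "(\<lambda>n. sqrt ((f (r n) x - F x)\<^sup>2)) \<longlonglongrightarrow> sqrt 0" by (rule tendsto_real_sqrt)
    then have "(\<lambda>n. f (r n) x - F x) \<longlonglongrightarrow> 0" by (simp add: tendsto_rabs_zero_iff)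
    then show ?case by (simp add: LIM_zero_iff)
  qed
  with r(1) show thesis using that by blast
qed

section \<open>The energy space of a coercive potential\<close>

locale coercive_potential =
  fixes V :: "R3 \<Rightarrow> real"
  assumes V_cont: "continuous_on UNIV V" and V_nonneg: "\<And>x. V x \<ge> 0"
    and V_coercive: "filterlim V at_top at_infinity"
begin

lemma V_measurable [measurable]: "V \<in> borel_measurable borel" "V \<in> borel_measurable lebesgue"
  using borel_measurable_continuous_onI[OF V_cont] by (auto intro: measurable_completion)

definition ip :: "(R3 \<Rightarrow> real) \<Rightarrow> (R3 \<Rightarrow> real) \<Rightarrow> real" where
  "ip u v = (\<integral>x. weak_grad u x \<bullet> weak_grad v x \<partial>lebesgue) + (\<integral>x. V x * u x * v x \<partial>lebesgue)"

lemma normsq_ip: "normsq V u = ip u u"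
  unfolding normsq_def ip_def power2_norm_eq_inner by (simp add: power2_eq_square mult.assoc)

lemma H1V_D:
  assumes "u \<in> H1V V"
  shows "u \<in> H1" "u \<in> L2 lebesgue" "sobolev_pair u (weak_grad u)" "u \<in> borel_measurable lebesgue"
    "integrable lebesgue (\<lambda>x. V x * (u x)\<^sup>2)"
  using assms weak_grad_pair sobolev_pairD(1) L2_measurable by (auto simp: H1V_def)

text \<open>Moves the weight into the function, so that the L2 lemmas apply to the potential part of
  the norm.\<close>

lemma sqrtV_L2:
  assumes "u \<in> H1V V" shows "(\<lambda>x. sqrt (V x) * u x) \<in> L2 lebesgue"
  using H1V_D(4,5)[OF assms] by (auto simp: L2_def power_mult_distrib V_nonneg)

lemma integrable_Vmult:
  assumes "u \<in> H1V V" "v \<in> H1V V" shows "integrable lebesgue (\<lambda>x. V x * u x * v x)"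
proof -
  have "(\<lambda>x. sqrt (V x) * u x * (sqrt (V x) * v x)) = (\<lambda>x. V x * u x * v x)"
    using V_nonneg by (auto simp: fun_eq_iff)
  with L2_mult_integrable[OF sqrtV_L2[OF assms(1)] sqrtV_L2[OF assms(2)]] show ?thesis by simp
qed

lemma integrable_grad_inner:
  assumes "u \<in> H1" "v \<in> H1" shows "integrable lebesgue (\<lambda>x. weak_grad u x \<bullet> weak_grad v x)"
  by (intro integrable_inner sobolev_pairD(2)[OF weak_grad_pair] assms)

lemma H1V_linear:
  assumes u: "u \<in> H1V V" and v: "v \<in> H1V V"
  shows "(\<lambda>x. s * u x + t * v x) \<in> H1V V"
proof -
  have "(\<lambda>x. s * (sqrt (V x) * u x) + t * (sqrt (V x) * v x)) \<in> L2 lebesgue"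
    by (intro L2_add L2_scale sqrtV_L2 u v)
  from L2_integrable[OF this] have "integrable lebesgue (\<lambda>x. (sqrt (V x) * (s * u x + t * v x))\<^sup>2)"
    by (simp add: algebra_simps)
  then show ?thesis
    using H1_linear(1)[OF H1V_D(1)[OF u] H1V_D(1)[OF v]] by (simp add: H1V_def power_mult_distrib V_nonneg)
qed

lemma H1V_scale: "u \<in> H1V V \<Longrightarrow> (\<lambda>x. s * u x) \<in> H1V V"
  using H1V_linear[of u u s 0] by simp

lemma ip_commute: "ip u v = ip v u"
  unfolding ip_def by (simp add: inner_commute mult.assoc mult.commute[of "u _"])

lemma ip_linear:
  assumes u: "u \<in> H1V V" and v: "v \<in> H1V V" and w: "w \<in> H1V V"
  shows "ip (\<lambda>x. s * u x + t * v x) w = s * ip u w + t * ip v w"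
proof -
  note H = H1V_D(1)[OF u] H1V_D(1)[OF v] H1V_D(1)[OF w]
  note i = integrable_grad_inner[OF H(1,3)] integrable_grad_inner[OF H(2,3)]
  have "(\<integral>x. weak_grad (\<lambda>x. s * u x + t * v x) x \<bullet> weak_grad w x \<partial>lebesgue) =
      (\<integral>x. s * (weak_grad u x \<bullet> weak_grad w x) + t * (weak_grad v x \<bullet> weak_grad w x) \<partial>lebesgue)"
  proof (rule integral_cong_AE)
    show "AE x in lebesgue. weak_grad (\<lambda>x. s * u x + t * v x) x \<bullet> weak_grad w x = s * (weak_grad u x \<bullet> weak_grad w x) + t * (weak_grad v x \<bullet> weak_grad w x)"
      using H1_linear(2)[OF H(1,2), of s t] by eventually_elim (simp add: inner_add_left)
    show "(\<lambda>x. weak_grad (\<lambda>x. s * u x + t * v x) x \<bullet> weak_grad w x) \<in> borel_measurable lebesgue"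
      by (intro borel_measurable_integrable integrable_grad_inner H H1_linear)
    show "(\<lambda>x. s * (weak_grad u x \<bullet> weak_grad w x) + t * (weak_grad v x \<bullet> weak_grad w x)) \<in> borel_measurable lebesgue"
      using i by (intro borel_measurable_integrable Bochner_Integration.integrable_add integrable_mult_right)
  qed
  also have "\<dots> = s * (\<integral>x. weak_grad u x \<bullet> weak_grad w x \<partial>lebesgue) + t * (\<integral>x. weak_grad v x \<bullet> weak_grad w x \<partial>lebesgue)"
    using i by simp
  finally have 1: "(\<integral>x. weak_grad (\<lambda>x. s * u x + t * v x) x \<bullet> weak_grad w x \<partial>lebesgue) = \<dots>" .
  have "(\<integral>x. V x * (s * u x + t * v x) * w x \<partial>lebesgue) = (\<integral>x. s * (V x * u x * w x) + t * (V x * v x * w x) \<partial>lebesgue)"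
    by (intro Bochner_Integration.integral_cong) (auto simp: algebra_simps)
  also have "\<dots> = s * (\<integral>x. V x * u x * w x \<partial>lebesgue) + t * (\<integral>x. V x * v x * w x \<partial>lebesgue)"
    using integrable_Vmult[OF u w] integrable_Vmult[OF v w] by simp
  finally show ?thesis using 1 by (simp add: ip_def algebra_simps)
qed

lemma normsq_linear:
  assumes u: "u \<in> H1V V" and v: "v \<in> H1V V"
  shows "normsq V (\<lambda>x. s * u x + t * v x) = s\<^sup>2 * normsq V u + 2 * s * t * ip u v + t\<^sup>2 * normsq V v"
proof -
  let ?w = "\<lambda>x. s * u x + t * v x"
  have "ip ?w ?w = s * ip u ?w + t * ip v ?w" by (intro ip_linear u v H1V_linear)
  also have "ip u ?w = s * ip u u + t * ip v u" unfolding ip_commute[of u ?w] by (intro ip_linear u v)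
  also have "ip v ?w = s * ip u v + t * ip v v" unfolding ip_commute[of v ?w] by (intro ip_linear u v)
  finally show ?thesis
    unfolding normsq_ip by (simp add: ip_commute[of v u] power2_eq_square algebra_simps)
qed

lemma normsq_scale: "u \<in> H1V V \<Longrightarrow> normsq V (\<lambda>x. s * u x) = s\<^sup>2 * normsq V u"
  using normsq_linear[of u u s 0] by simp

lemma Vsq_nonneg: "(\<integral>x. V x * (u x)\<^sup>2 \<partial>lebesgue) \<ge> 0"
  by (simp add: V_nonneg)

lemma normsq_split: "normsq V u = dirichlet (weak_grad u) (weak_grad u) + (\<integral>x. V x * (u x)\<^sup>2 \<partial>lebesgue)"
  unfolding normsq_def dirichlet_def power2_norm_eq_inner ..

lemma normsq_nonneg: "normsq V u \<ge> 0"
  unfolding normsq_split using dirichlet_nonneg Vsq_nonneg by (intro add_nonneg_nonneg)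

lemma dirichlet_le_normsq: "dirichlet (weak_grad u) (weak_grad u) \<le> normsq V u"
  unfolding normsq_split using Vsq_nonneg by simp

text \<open>Coercivity gives \<open>V \<ge> K\<close> off a ball, hence
  \<open>u^2 \<le> V u^2 / K\<close> there, with a radius that does not depend on
  \<open>u\<close>.\<close>

lemma tail_bound:
  assumes "K > 0"
  obtains R where "\<And>u. u \<in> H1V V \<Longrightarrow> (\<integral>x. (u x)\<^sup>2 \<partial>lebesgue) \<le> (\<integral>x. indicator (cball 0 R) x * (u x)\<^sup>2 \<partial>lebesgue) + normsq V u / K"
proof -
  obtain R where R: "\<And>x. norm x \<ge> R \<Longrightarrow> V x \<ge> K"
    using V_coercive unfolding filterlim_at_top eventually_at_infinity by blast
  show thesis
  proof (rule that)
    fix u assume u: "u \<in> H1V V"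
    note [measurable] = H1V_D(4)[OF u]
    have [measurable]: "cball 0 R \<in> sets (lebesgue :: R3 measure)" by (auto intro!: sets_completionI_sets)
    have i1: "integrable lebesgue (\<lambda>x. indicator (cball 0 R) x * (u x)\<^sup>2)"
      by (rule L2_ball_integrable[OF H1V_D(2)[OF u]])
    have "(\<integral>x. (u x)\<^sup>2 \<partial>lebesgue) \<le> (\<integral>x. indicator (cball 0 R) x * (u x)\<^sup>2 + V x * (u x)\<^sup>2 / K \<partial>lebesgue)"
    proof (rule integral_mono)
      show "integrable lebesgue (\<lambda>x. indicator (cball 0 R) x * (u x)\<^sup>2 + V x * (u x)\<^sup>2 / K)"
        using i1 H1V_D(5)[OF u] by simp
      show "integrable lebesgue (\<lambda>x. (u x)\<^sup>2)" by (rule L2_integrable[OF H1V_D(2)[OF u]])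
      fix x
      show "(u x)\<^sup>2 \<le> indicator (cball 0 R) x * (u x)\<^sup>2 + V x * (u x)\<^sup>2 / K"
      proof (cases "x \<in> cball 0 R")
        case True then show ?thesis using V_nonneg[of x] assms by simp
      next
        case False
        then have "K * (u x)\<^sup>2 \<le> V x * (u x)\<^sup>2" using R[of x] by (intro mult_right_mono) auto
        then show ?thesis using assms False by (simp add: field_simps)
      qed
    qed
    also have "\<dots> = (\<integral>x. indicator (cball 0 R) x * (u x)\<^sup>2 \<partial>lebesgue) + (\<integral>x. V x * (u x)\<^sup>2 \<partial>lebesgue) / K"
      using i1 H1V_D(5)[OF u] by simp
    also have "(\<integral>x. V x * (u x)\<^sup>2 \<partial>lebesgue) / K \<le> normsq V u / K"
      using assms dirichlet_nonneg by (intro divide_right_mono) (simp_all add: normsq_split)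
    finally show "(\<integral>x. (u x)\<^sup>2 \<partial>lebesgue) \<le> (\<integral>x. indicator (cball 0 R) x * (u x)\<^sup>2 \<partial>lebesgue) + normsq V u / K"
      by simp
  qed
qed

lemma L6_bound:
  assumes "u \<in> H1V V"
  shows "integrable lebesgue (\<lambda>x. u x ^ 6)" "(\<integral>x. u x ^ 6 \<partial>lebesgue) \<le> 4096 * normsq V u ^ 3"
proof -
  note s = sobolev_L6[OF H1V_D(3)[OF assms]]
  show "integrable lebesgue (\<lambda>x. u x ^ 6)" by (rule s)
  have "4096 * dirichlet (weak_grad u) (weak_grad u) ^ 3 \<le> 4096 * normsq V u ^ 3"
    by (intro mult_left_mono power_mono dirichlet_le_normsq dirichlet_nonneg) auto
  with s(2) show "(\<integral>x. u x ^ 6 \<partial>lebesgue) \<le> 4096 * normsq V u ^ 3" by (rule order_trans)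
qed

text \<open>Off a ball coercivity suffices. Inside, where \<open>V\<close> may vanish,
  \<open>u^2 \<le> \<theta> + u^6 / \<theta>^2\<close> and the Sobolev inequality take over;
  \<open>\<theta>\<close> of the size of the squared norm makes both terms homogeneous of the right
  degree.\<close>

lemma poincare:
  obtains C where "C > 0" "\<And>u. u \<in> H1V V \<Longrightarrow> (\<integral>x. (u x)\<^sup>2 \<partial>lebesgue) \<le> C * normsq V u"
proof -
  obtain R where R: "\<And>u. u \<in> H1V V \<Longrightarrow> (\<integral>x. (u x)\<^sup>2 \<partial>lebesgue) \<le> (\<integral>x. indicator (cball 0 R) x * (u x)\<^sup>2 \<partial>lebesgue) + normsq V u / 1"
    using tail_bound[of 1] by auto
  define b where "b = measure lebesgue (cball 0 R :: R3 set)"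
  have b0: "b \<ge> 0" by (simp add: b_def)
  show thesis
  \<comment> \<open>\<open>b\<close> is the volume of the ball, 4096 the Sobolev constant, and the
    last 1 pays for the tail.\<close>
  proof (rule that[of "b + 4097"])
    fix u assume u: "u \<in> H1V V"
    note [measurable] = H1V_D(4)[OF u]
    have cb [measurable]: "cball 0 R \<in> sets (lebesgue :: R3 measure)" by (auto intro!: sets_completionI_sets)
    have i0: "integrable lebesgue (indicator (cball 0 R) :: R3 \<Rightarrow> real)"
    proof -
      have "integrable lborel (indicator (cball 0 R) :: R3 \<Rightarrow> real)"
        by (rule integrable_real_indicator[OF _ emeasure_bounded_finite[OF bounded_cball]]) simp
      then show ?thesis by (simp add: integrable_completion)
    qed
    have i1: "integrable lebesgue (\<lambda>x. indicator (cball 0 R) x * (u x)\<^sup>2)"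
      by (rule L2_ball_integrable[OF H1V_D(2)[OF u]])
    \<comment> \<open>\<open>\<theta>\<close> lies strictly above the squared norm, which may be 0,
      so that division is safe; afterwards it is lowered to the squared norm.\<close>
    have *: "(\<integral>x. indicator (cball 0 R) x * (u x)\<^sup>2 \<partial>lebesgue) \<le> (b + 4096) * \<theta>" if \<theta>: "\<theta> > normsq V u" for \<theta>
    proof -
      have \<theta>0: "\<theta> > 0" using \<theta> normsq_nonneg[of u] by linarith
      have "(\<integral>x. indicator (cball 0 R) x * (u x)\<^sup>2 \<partial>lebesgue) \<le> (\<integral>x. \<theta> * indicator (cball 0 R) x + u x ^ 6 / \<theta>\<^sup>2 \<partial>lebesgue)"
      proof (rule integral_mono)
        show "integrable lebesgue (\<lambda>x. \<theta> * indicator (cball 0 R) x + u x ^ 6 / \<theta>\<^sup>2)"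
          using i0 L6_bound(1)[OF u] by simp
        show "integrable lebesgue (\<lambda>x. indicator (cball 0 R) x * (u x)\<^sup>2)" by (rule i1)
        fix x
        have "(u x)\<^sup>2 \<le> \<theta> + u x ^ 6 / \<theta>\<^sup>2"
        proof (cases "(u x)\<^sup>2 \<le> \<theta>")
          case False
          then have "\<theta>\<^sup>2 \<le> ((u x)\<^sup>2)\<^sup>2" using \<theta>0 by (intro power_mono) auto
          then have "\<theta>\<^sup>2 * (u x)\<^sup>2 \<le> ((u x)\<^sup>2)\<^sup>2 * (u x)\<^sup>2" by (rule mult_right_mono) simp
          then have "\<theta>\<^sup>2 * (u x)\<^sup>2 \<le> u x ^ 6" by (simp add: power_mult[symmetric] power_add[symmetric])
          then have "(u x)\<^sup>2 \<le> u x ^ 6 / \<theta>\<^sup>2" using \<theta>0 by (simp add: field_simps)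
          then show ?thesis using \<theta>0 by simp
        qed (simp add: add_increasing2)
        then show "indicator (cball 0 R) x * (u x)\<^sup>2 \<le> \<theta> * indicator (cball 0 R) x + u x ^ 6 / \<theta>\<^sup>2"
          using \<theta>0 by (auto simp: indicator_def)
      qed
      also have "\<dots> = \<theta> * b + (\<integral>x. u x ^ 6 \<partial>lebesgue) / \<theta>\<^sup>2"
        using i0 L6_bound(1)[OF u] cb by (simp add: b_def)
      also have "(\<integral>x. u x ^ 6 \<partial>lebesgue) / \<theta>\<^sup>2 \<le> 4096 * \<theta> ^ 3 / \<theta>\<^sup>2"
      proof (intro divide_right_mono)
        have "4096 * normsq V u ^ 3 \<le> 4096 * \<theta> ^ 3"
          using \<theta> normsq_nonneg by (intro mult_left_mono power_mono) auto
        then show "(\<integral>x. u x ^ 6 \<partial>lebesgue) \<le> 4096 * \<theta> ^ 3" using L6_bound(2)[OF u] by linarith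
      qed simp
      also have "4096 * \<theta> ^ 3 / \<theta>\<^sup>2 = 4096 * \<theta>" using \<theta>0 by (simp add: power2_eq_square power3_eq_cube)
      finally show ?thesis by (simp add: algebra_simps)
    qed
    have "(\<integral>x. indicator (cball 0 R) x * (u x)\<^sup>2 \<partial>lebesgue) / (b + 4096) \<le> normsq V u"
      by (rule dense_ge) (use * b0 in \<open>simp add: divide_le_eq mult.commute\<close>)
    then have "(\<integral>x. indicator (cball 0 R) x * (u x)\<^sup>2 \<partial>lebesgue) \<le> (b + 4096) * normsq V u"
      using b0 by (simp add: divide_le_eq mult.commute)
    then show "(\<integral>x. (u x)\<^sup>2 \<partial>lebesgue) \<le> (b + 4097) * normsq V u"
      using R[OF u] by (simp add: algebra_simps)
  qed (use b0 in simp)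
qed

text \<open>Compactness in quantitative form: up to a small multiple of the squared norm, finitely
  many linear functionals control the mass. One half of \<open>e\<close> pays for the tail, the
  other for the oscillation within cubes.\<close>

lemma mass_le_cube_integrals:
  assumes "e > 0"
  obtains j Z C where "finite Z" "C \<ge> 0" "\<And>u. u \<in> H1V V \<Longrightarrow> (\<integral>x. (u x)\<^sup>2 \<partial>lebesgue) \<le> e * normsq V u +
      C * (\<Sum>z\<in>Z. (\<integral>x. indicator (cube (inverse (real (Suc j))) z) x * u x \<partial>lebesgue)\<^sup>2)"
proof -
  obtain R where R: "\<And>u. u \<in> H1V V \<Longrightarrow> (\<integral>x. (u x)\<^sup>2 \<partial>lebesgue) \<le> (\<integral>x. indicator (cball 0 R) x * (u x)\<^sup>2 \<partial>lebesgue) + normsq V u / (2 / e)"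
    using tail_bound[of "2 / e"] assms by auto
  \<comment> \<open>A mesh below both 1 and \<open>e / 288\<close> satisfies
    \<open>144 h^2 \<le> e / 2\<close>.\<close>
  obtain j where j: "inverse (real (Suc j)) < min 1 (e / 288)"
    using reals_Archimedean[of "min 1 (e / 288)"] assms by auto
  define h where "h = inverse (real (Suc j))"
  have h: "h > 0" by (simp add: h_def)
  have "h * h \<le> 1 * (e / 288)" using j h by (intro mult_mono) (auto simp: h_def)
  then have hh: "144 * h\<^sup>2 \<le> e / 2" by (simp add: power2_eq_square)
  show thesis
  proof (rule that[of "cube_index h ` cball 0 R" "2 / h ^ 3" j])
    fix u assume u: "u \<in> H1V V"
    have "144 * h\<^sup>2 * dirichlet (weak_grad u) (weak_grad u) \<le> e / 2 * normsq V u"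
      using assms by (intro mult_mono hh dirichlet_le_normsq dirichlet_nonneg) auto
    moreover have "normsq V u / (2 / e) = e / 2 * normsq V u" by simp
    ultimately have "(\<integral>x. (u x)\<^sup>2 \<partial>lebesgue) \<le> e / 2 * normsq V u +
      2 / h ^ 3 * (\<Sum>z\<in>cube_index h ` cball 0 R. (\<integral>x. indicator (cube h z) x * u x \<partial>lebesgue)\<^sup>2) + e / 2 * normsq V u"
      using R[OF u] local_mass_le_cube_integrals[OF H1V_D(3)[OF u] h, of R] by linarith
    then show "(\<integral>x. (u x)\<^sup>2 \<partial>lebesgue) \<le> e * normsq V u +
      2 / h ^ 3 * (\<Sum>z\<in>cube_index h ` cball 0 R. (\<integral>x. indicator (cube (inverse (real (Suc j))) z) x * u x \<partial>lebesgue)\<^sup>2)"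
      unfolding h_def[symmetric] by linarith
  qed (use h finite_cube_index_ball[OF h] in auto)
qed

text \<open>Over all meshes \<open>1 / (j + 1)\<close> there are only countably many cube integrals.
  A diagonal subsequence makes all of them converge, and \<open>mass_le_cube_integrals\<close>
  applied to differences gives an L2 Cauchy sequence.\<close>

theorem rellich:
  fixes u :: "nat \<Rightarrow> R3 \<Rightarrow> real"
  assumes u: "\<And>n. u n \<in> H1V V" and K: "\<And>n. normsq V (u n) \<le> K"
  obtains r U where "strict_mono (r :: nat \<Rightarrow> nat)" "U \<in> L2 lebesgue"
    "(\<lambda>n. \<integral>x. (u (r n) x - U x)\<^sup>2 \<partial>lebesgue) \<longlonglongrightarrow> 0" "AE x in lebesgue. (\<lambda>n. u (r n) x) \<longlonglongrightarrow> U x"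
proof -
  obtain C where C: "C > 0" "\<And>u. u \<in> H1V V \<Longrightarrow> (\<integral>x. (u x)\<^sup>2 \<partial>lebesgue) \<le> C * normsq V u"
    using poincare by blast
  have K0: "K \<ge> 0" using K[of 0] normsq_nonneg[of "u 0"] by linarith
  define I where "I n p = (\<integral>x. indicator (cube (inverse (real (Suc (fst p)))) (snd p)) x * u n x \<partial>lebesgue)" for n p
  have bound: "norm (I n p) \<le> sqrt (C * K)" for n p
  proof -
    let ?h = "inverse (real (Suc (fst p)))"
    have L: "indicator (cube ?h (snd p)) \<in> L2 lebesgue"
      by (intro L2_lebesgueI indicator_cube_L2) simp
    have "(\<integral>x. (indicat_real (cube ?h (snd p)) x)\<^sup>2 \<partial>lebesgue) = (\<integral>x. indicat_real (cube ?h (snd p)) x \<partial>lebesgue)"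
      by (intro Bochner_Integration.integral_cong) (auto simp: indicator_def)
    also have "\<dots> = ?h ^ 3"
      using emeasure_cube[of ?h "snd p"] by (simp add: measure_def sets_completionI_sets)
    also have "\<dots> \<le> 1" by (intro power_le_one) (auto simp: inverse_le_1_iff)
    finally have m: "(\<integral>x. (indicat_real (cube ?h (snd p)) x)\<^sup>2 \<partial>lebesgue) \<le> 1" .
    have "(I n p)\<^sup>2 \<le> (\<integral>x. (indicat_real (cube ?h (snd p)) x)\<^sup>2 \<partial>lebesgue) * (\<integral>x. (u n x)\<^sup>2 \<partial>lebesgue)"
      unfolding I_def by (rule L2_cauchy_schwarz[OF L H1V_D(2)[OF u]])
    also have "\<dots> \<le> 1 * (C * K)"
    proof (rule mult_mono[OF m])
      show "(\<integral>x. (u n x)\<^sup>2 \<partial>lebesgue) \<le> C * K"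
        using C(2)[OF u, of n] mult_left_mono[OF K, of C n] C(1) by linarith
    qed auto
    finally show ?thesis by (simp add: real_le_rsqrt)
  qed
  obtain k :: "nat \<Rightarrow> nat" where k: "strict_mono k" "\<And>p. p \<in> UNIV \<Longrightarrow> \<exists>l. (\<lambda>n. I (k n) p) \<longlonglongrightarrow> l"
  proof (rule function_convergent_subsequence[of "UNIV :: (nat \<times> int \<times> int \<times> int) set" I "sqrt (C * K)"])
    show "countable (UNIV :: (nat \<times> int \<times> int \<times> int) set)" by simp
    show "norm (I n p) \<le> sqrt (C * K)" for n p by (rule bound)
  qed (rule that)
  have cauchy: "\<exists>N. \<forall>m\<ge>N. \<forall>n\<ge>N. (\<integral>x. (u (k m) x - u (k n) x)\<^sup>2 \<partial>lebesgue) < e" if e: "e > 0" for e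
  proof -
    \<comment> \<open>A difference of two members has squared norm at most \<open>4 K\<close>, so
      this choice leaves at most \<open>e / 2\<close> for the norm term; \<open>K + 1\<close> keeps
      the denominator positive.\<close>
    define e' where "e' = e / (8 * (K + 1))"
    have e'0: "e' > 0" using e K0 by (simp add: e'_def)
    have "e' * (8 * (K + 1)) = e" using K0 by (simp add: e'_def)
    then have "8 * (e' * K) + 8 * e' = e" by (simp add: distrib_left)
    then have e': "e' > 0" "e' * (4 * K) \<le> e / 2" using e'0 by simp_all
    obtain j Z D where Z: "finite Z" "D \<ge> 0" "\<And>u. u \<in> H1V V \<Longrightarrow> (\<integral>x. (u x)\<^sup>2 \<partial>lebesgue) \<le> e' * normsq V u +
      D * (\<Sum>z\<in>Z. (\<integral>x. indicator (cube (inverse (real (Suc j))) z) x * u x \<partial>lebesgue)\<^sup>2)"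
      by (rule mass_le_cube_integrals[OF e'(1)]) (rule that)
    \<comment> \<open>With every squared difference of integrals at most \<open>\<eta>\<close>,
      \<open>D\<close> times their sum over \<open>Z\<close> stays below
      \<open>e / 2\<close>.\<close>
    define \<eta> where "\<eta> = e / (2 * (D + 1) * (card Z + 1))"
    have \<eta>: "\<eta> > 0" using e Z(2) by (simp add: \<eta>_def)
    have "\<exists>N. \<forall>m\<ge>N. \<forall>n\<ge>N. \<bar>I (k m) (j, z) - I (k n) (j, z)\<bar> < sqrt \<eta>" for z
    proof -
      have "Cauchy (\<lambda>n. I (k n) (j, z))" using k(2)[OF UNIV_I] LIMSEQ_imp_Cauchy by blast
      then show ?thesis using \<eta> unfolding Cauchy_def dist_real_def by simp
    qed
    then obtain N where N: "\<And>z m n. m \<ge> N z \<Longrightarrow> n \<ge> N z \<Longrightarrow> \<bar>I (k m) (j, z) - I (k n) (j, z)\<bar> < sqrt \<eta>"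
      by metis
    show ?thesis
    proof (intro exI allI impI)
      fix m n assume mn: "m \<ge> Max (insert 0 (N ` Z))" "n \<ge> Max (insert 0 (N ` Z))"
      let ?w = "\<lambda>x. 1 * u (k m) x + (- 1) * u (k n) x"
      have w: "?w \<in> H1V V" by (intro H1V_linear u)
      let ?Iw = "\<lambda>z. \<integral>x. indicator (cube (inverse (real (Suc j))) z) x * ?w x \<partial>lebesgue"
      have Iw: "?Iw z = I (k m) (j, z) - I (k n) (j, z)" for z
      proof -
        have L: "indicator (cube (inverse (real (Suc j))) z) \<in> L2 lebesgue"
          by (intro L2_lebesgueI indicator_cube_L2) simp
        show ?thesis
          using L2_mult_integrable[OF L H1V_D(2)[OF u[of "k m"]]] L2_mult_integrable[OF L H1V_D(2)[OF u[of "k n"]]]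
          by (simp add: I_def right_diff_distrib)
      qed
      have "(\<Sum>z\<in>Z. (?Iw z)\<^sup>2) \<le> (\<Sum>z\<in>Z. \<eta>)"
      proof (rule sum_mono)
        fix z assume z: "z \<in> Z"
        have "N z \<le> Max (insert 0 (N ` Z))" using Z(1) z by (intro Max_ge) auto
        then have "\<bar>I (k m) (j, z) - I (k n) (j, z)\<bar> < sqrt \<eta>" using mn by (intro N) auto
        then have "(\<bar>I (k m) (j, z) - I (k n) (j, z)\<bar>)\<^sup>2 \<le> (sqrt \<eta>)\<^sup>2" by (intro power_mono) auto
        then show "(?Iw z)\<^sup>2 \<le> \<eta>" using \<eta> unfolding Iw by simp
      qed
      then have "D * (\<Sum>z\<in>Z. (?Iw z)\<^sup>2) \<le> D * (card Z * \<eta>)" using Z(2) by (intro mult_left_mono) auto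
      also have "\<dots> < e / 2"
      proof -
        have "D * card Z < (D + 1) * (card Z + 1)" using Z(2) by (simp add: algebra_simps add_nonneg_pos)
        then have "D * card Z * \<eta> < (D + 1) * (card Z + 1) * \<eta>" using \<eta> by (rule mult_strict_right_mono)
        also have "\<dots> = e / 2" using Z(2) by (simp add: \<eta>_def divide_simps)
        finally show ?thesis by (simp add: mult.assoc)
      qed
      finally have 2: "D * (\<Sum>z\<in>Z. (?Iw z)\<^sup>2) < e / 2" .
      have "normsq V ?w \<le> 4 * K"
      proof -
        have "normsq V ?w + normsq V (\<lambda>x. 1 * u (k m) x + 1 * u (k n) x) = 2 * normsq V (u (k m)) + 2 * normsq V (u (k n))"
          unfolding normsq_linear[OF u u] by simp
        then show ?thesis
          using K[of "k m"] K[of "k n"] normsq_nonneg[of "\<lambda>x. 1 * u (k m) x + 1 * u (k n) x"] by linarith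
      qed
      then have "e' * normsq V ?w \<le> e' * (4 * K)" using e' by (intro mult_left_mono) auto
      then have "(\<integral>x. (?w x)\<^sup>2 \<partial>lebesgue) < e" using Z(3)[OF w] 2 e'(2) by linarith
      then show "(\<integral>x. (u (k m) x - u (k n) x)\<^sup>2 \<partial>lebesgue) < e" by simp
    qed
  qed
  obtain U where U: "U \<in> L2 lebesgue" "(\<lambda>n. \<integral>x. (u (k n) x - U x)\<^sup>2 \<partial>lebesgue) \<longlonglongrightarrow> 0"
    using L2_complete[of "\<lambda>n. u (k n)" lebesgue] H1V_D(2)[OF u] cauchy by blast
  obtain r' :: "nat \<Rightarrow> nat" where r': "strict_mono r'" "AE x in lebesgue. (\<lambda>n. u (k (r' n)) x) \<longlonglongrightarrow> U x"
    using L2_AE_subseq[of "\<lambda>n. u (k n)", OF H1V_D(2)[OF u] U] by blast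
  show thesis
  proof (rule that[of "k \<circ> r'" U])
    show "strict_mono (k \<circ> r')" using k(1) r'(1) by (rule strict_mono_o)
    show "(\<lambda>n. \<integral>x. (u ((k \<circ> r') n) x - U x)\<^sup>2 \<partial>lebesgue) \<longlonglongrightarrow> 0"
      using LIMSEQ_subseq_LIMSEQ[OF U(2) r'(1)] by (simp add: o_def)
  qed (use U(1) r'(2) in auto)
qed

text \<open>A bump on the unit cube qualifies, since the continuous \<open>V\<close> is bounded
  there. It is the seed for a point of the Nehari set.\<close>

lemma H1V_nonzero:
  obtains u where "u \<in> H1V V" "\<not> (AE x in lebesgue. u x = 0)"
proof -
  let ?a = "(\<chi> i. 0) :: R3" and ?b = "(\<chi> i. 1) :: R3"
  let ?u = "bump 1 ?a ?b"
  note t = test_fun_bump[of 1 ?a ?b]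
  note [measurable] = L2_measurable[OF test_fun_L2_lebesgue[OF t]]
  have H: "?u \<in> H1" using H1_iff test_fun_sobolev_pair[OF t] by blast
  have "bounded (V ` cbox ?a ?b)"
    by (intro compact_imp_bounded compact_continuous_image continuous_on_subset[OF V_cont] compact_cbox) auto
  then obtain M where M: "\<And>x. x \<in> cbox ?a ?b \<Longrightarrow> \<bar>V x\<bar> \<le> M" unfolding bounded_iff by auto
  have "integrable lebesgue (\<lambda>x. V x * (?u x)\<^sup>2)"
  proof (rule Bochner_Integration.integrable_bound)
    show "integrable lebesgue (\<lambda>x. M * (?u x)\<^sup>2)"
      by (intro integrable_mult_right L2_integrable test_fun_L2_lebesgue t)
    show "AE x in lebesgue. norm (V x * (?u x)\<^sup>2) \<le> norm (M * (?u x)\<^sup>2)"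
    proof (rule AE_I2)
      fix x
      show "norm (V x * (?u x)\<^sup>2) \<le> norm (M * (?u x)\<^sup>2)"
      proof (cases "x \<in> box ?a ?b")
        case True
        then have "\<bar>V x\<bar> \<le> \<bar>M\<bar>" using M[of x] box_subset_cbox by fastforce
        then show ?thesis by (simp add: abs_mult mult_right_mono)
      qed (simp add: bump_outside)
    qed
  qed measurable
  then have HV: "?u \<in> H1V V" using H by (simp add: H1V_def)
  have "\<not> (AE x in lebesgue. ?u x = 0)"
  proof
    assume "AE x in lebesgue. ?u x = 0"
    then have "AE x in lebesgue. x \<notin> box ?a ?b"
      by eventually_elim (use bump_positive[of 1 _ ?a ?b] in force)
    then have "box ?a ?b \<in> null_sets lebesgue"
      by (subst AE_iff_null_sets) (auto intro!: sets_completionI_sets)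
    then have "emeasure lborel (box ?a ?b) = 0" by (auto simp: null_sets_def)
    moreover have "(1/2) *\<^sub>R ?b \<in> box ?a ?b" by (simp add: mem_box_vec)
    ultimately show False using open_not_negligible[of "box ?a ?b"]
      by (metis \<open>box ?a ?b \<in> null_sets lebesgue\<close> empty_iff negligible_iff_null_sets open_box)
  qed
  with HV show thesis using that by blast
qed

end

section \<open>The nonlinearity\<close>

lemma le_Limsup_sequence:
  fixes X :: "'a \<Rightarrow> ereal"
  assumes p: "filterlim p F sequentially" and lim: "(\<lambda>n. X (p n)) \<longlonglongrightarrow> y"
  shows "y \<le> Limsup F X"
proof (rule ccontr)
  assume "\<not> ?thesis"
  then have "Limsup F X < y" by simp
  then obtain z where z: "Limsup F X < z" "z < y" using dense by blast
  from z(1) have "\<forall>\<^sub>F x in F. X x < z" using Limsup_le_iff[of F X "Limsup F X"] by auto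
  then have "\<forall>\<^sub>F n in sequentially. X (p n) < z" using p unfolding filterlim_iff by blast
  then have "y \<le> z"
    by (intro tendsto_upperbound[OF lim _ sequentially_bot]) (auto elim: eventually_mono)
  with z(2) show False by simp
qed

text \<open>For \<open>v < 0\<close> the quotient is read backwards, with base points \<open>s n + l n\<close>.\<close>

lemma limit_of_quotients_in_clarke_subdiff:
  assumes s: "s \<longlonglongrightarrow> t" and l: "l \<longlonglongrightarrow> 0" "\<And>n. l n > 0"
    and q: "(\<lambda>n. (g (s n + l n) - g (s n)) / l n) \<longlonglongrightarrow> \<xi>"
  shows "\<xi> \<in> clarke_subdiff g t"
  unfolding clarke_subdiff_def mem_Collect_eq
proof
  fix v :: real
  have flt: "filterlim (\<lambda>n. (s' n, l' n)) (nhds t \<times>\<^sub>F at_right 0) sequentially"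
    if "s' \<longlonglongrightarrow> t" "l' \<longlonglongrightarrow> 0" "\<And>n. l' n > 0" for s' l' :: "nat \<Rightarrow> real"
  proof (rule filterlim_Pair[OF that(1)])
    have "\<forall>n. l' n \<in> {0<..} \<and> l' n \<noteq> 0" using that(3) by (metis greaterThan_iff less_irrefl)
    then show "filterlim l' (at_right 0) sequentially"
      unfolding filterlim_at using that(2) by (simp add: always_eventually)
  qed
  let ?X = "\<lambda>(s, l). ereal ((g (s + l * v) - g s) / l)"
  obtain s' l' where p: "s' \<longlonglongrightarrow> t" "l' \<longlonglongrightarrow> 0" "\<And>n. l' n > 0"
    and X: "\<And>n. (g (s' n + l' n * v) - g (s' n)) / l' n = (g (s n + l n) - g (s n)) / l n * v"
  proof -
    consider "v > 0" | "v < 0" | "v = 0" by linarith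
    then show thesis
    proof cases
      case 1
      have "(\<lambda>n. l n / v) \<longlonglongrightarrow> 0 / v" by (intro tendsto_intros l) (use 1 in simp)
      then show thesis using that[of s "\<lambda>n. l n / v"] 1 s l(2) by simp
    next
      case 2
      have "(\<lambda>n. l n / (- v)) \<longlonglongrightarrow> 0 / (- v)" by (intro tendsto_intros l) (use 2 in simp)
      moreover have "(\<lambda>n. s n + l n) \<longlonglongrightarrow> t + 0" by (intro tendsto_intros s l)
      moreover have "(g (s n + l n + l n / (- v) * v) - g (s n + l n)) / (l n / (- v)) = (g (s n + l n) - g (s n)) / l n * v" for n
      proof -
        have "s n + l n + l n / (- v) * v = s n" using 2 by simp
        moreover have "(x - y) / (z / (- v)) = (y - x) / z * v" if "z > 0" for x y z :: real
          using that 2 by (simp add: field_simps)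
        ultimately show ?thesis using l(2)[of n] by simp
      qed
      moreover have "l n / (- v) > 0" for n using 2 l(2)[of n] by (intro divide_pos_pos) auto
      ultimately show thesis using that[of "\<lambda>n. s n + l n" "\<lambda>n. l n / (- v)"] by simp
    next
      case 3
      show thesis using that[of s l] s l 3 by simp
    qed
  qed
  have "(\<lambda>n. ereal ((g (s n + l n) - g (s n)) / l n * v)) \<longlonglongrightarrow> ereal (\<xi> * v)"
    by (intro tendsto_ereal tendsto_mult q tendsto_const)
  then have "(\<lambda>n. ?X (s' n, l' n)) \<longlonglongrightarrow> ereal (\<xi> * v)" by (simp add: X)
  then show "ereal (\<xi> * v) \<le> clarke_dd g t v"
    unfolding clarke_dd_def by (intro le_Limsup_sequence[OF flt[OF p]])
qed

text \<open>By compactness: pairs that violate the bound arbitrarily close to \<open>t\<close> have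
  bounded quotients by the Lipschitz condition, and a limit of these is a Clarke subgradient at most
  \<open>m - e\<close>.\<close>

lemma clarke_subdiff_dini:
  assumes lip: "L-lipschitz_on (ball t d) g" and d: "d > 0"
    and sub: "\<And>\<xi>. \<xi> \<in> clarke_subdiff g t \<Longrightarrow> m \<le> \<xi>" and e: "e > 0"
  shows "\<exists>\<delta>>0. \<forall>s s'. \<bar>s - t\<bar> < \<delta> \<longrightarrow> \<bar>s' - t\<bar> < \<delta> \<longrightarrow> s < s' \<longrightarrow> (m - e) * (s' - s) \<le> g s' - g s"
proof (rule ccontr)
  assume neg: "\<not> ?thesis"
  have "\<exists>p. \<bar>fst p - t\<bar> < min d (inverse (real (Suc n))) \<and> \<bar>snd p - t\<bar> < min d (inverse (real (Suc n))) \<and> fst p < snd p \<and> g (snd p) - g (fst p) < (m - e) * (snd p - fst p)" for n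
  proof -
    have "min d (inverse (real (Suc n))) > 0" using d by simp
    with neg obtain s s' where "\<bar>s - t\<bar> < min d (inverse (real (Suc n)))" "\<bar>s' - t\<bar> < min d (inverse (real (Suc n)))" "s < s'" "\<not> (m - e) * (s' - s) \<le> g s' - g s"
      by blast
    then show ?thesis by (intro exI[of _ "(s, s')"]) auto
  qed
  then have "\<forall>n. \<exists>p. \<bar>fst p - t\<bar> < min d (inverse (real (Suc n))) \<and> \<bar>snd p - t\<bar> < min d (inverse (real (Suc n))) \<and> fst p < snd p \<and> g (snd p) - g (fst p) < (m - e) * (snd p - fst p)"
    by (rule allI)
  from choice[OF this] obtain p where p: "\<And>n. \<bar>fst (p n) - t\<bar> < min d (inverse (real (Suc n))) \<and> \<bar>snd (p n) - t\<bar> < min d (inverse (real (Suc n))) \<and> fst (p n) < snd (p n) \<and> g (snd (p n)) - g (fst (p n)) < (m - e) * (snd (p n) - fst (p n))"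
    by blast
  define s s' where "s n = fst (p n)" and "s' n = snd (p n)" for n
  have P: "\<bar>s n - t\<bar> < d" "\<bar>s' n - t\<bar> < d" "\<bar>s n - t\<bar> < inverse (real (Suc n))" "\<bar>s' n - t\<bar> < inverse (real (Suc n))" "s n < s' n"
    "g (s' n) - g (s n) < (m - e) * (s' n - s n)" for n
    using p[of n] unfolding s_def s'_def by auto
  have lims: "f \<longlonglongrightarrow> t" if "\<And>n. \<bar>f n - t\<bar> < inverse (real (Suc n))" for f
  proof -
    have "(\<lambda>n. f n - t) \<longlonglongrightarrow> 0"
      by (rule Lim_null_comparison[OF always_eventually[OF allI] LIMSEQ_inverse_real_of_nat]) (use that in \<open>simp add: less_imp_le\<close>)
    then show ?thesis by (simp add: LIM_zero_iff)
  qed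
  note sl = lims[of s, OF P(3)] and sl' = lims[of s', OF P(4)]
  define Q where "Q n = (g (s' n) - g (s n)) / (s' n - s n)" for n
  have "\<bar>Q n\<bar> \<le> L" for n
  proof -
    have "\<bar>g (s' n) - g (s n)\<bar> \<le> L * \<bar>s' n - s n\<bar>"
      using lipschitz_onD[OF lip, of "s' n" "s n"] P(1,2)[of n] by (simp add: dist_real_def abs_minus_commute)
    then show ?thesis using P(5)[of n] by (simp add: Q_def abs_divide divide_le_eq)
  qed
  then have "bounded (range Q)" unfolding bounded_iff by (intro exI[of _ L]) auto
  then obtain \<xi> r where r: "strict_mono (r :: nat \<Rightarrow> nat)" "(Q \<circ> r) \<longlonglongrightarrow> \<xi>"
    using bounded_imp_convergent_subsequence by blast
  have "\<xi> \<in> clarke_subdiff g t"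
  proof (rule limit_of_quotients_in_clarke_subdiff[of "s \<circ> r" _ "\<lambda>n. s' (r n) - s (r n)"])
    show "(s \<circ> r) \<longlonglongrightarrow> t" by (rule LIMSEQ_subseq_LIMSEQ[OF sl r(1)])
    have "(\<lambda>n. (s' \<circ> r) n - (s \<circ> r) n) \<longlonglongrightarrow> t - t"
      by (intro tendsto_diff LIMSEQ_subseq_LIMSEQ[OF sl r(1)] LIMSEQ_subseq_LIMSEQ[OF sl' r(1)])
    then show "(\<lambda>n. s' (r n) - s (r n)) \<longlonglongrightarrow> 0" by simp
    show "s' (r n) - s (r n) > 0" for n using P(5) by simp
    show "(\<lambda>n. (g ((s \<circ> r) n + (s' (r n) - s (r n))) - g ((s \<circ> r) n)) / (s' (r n) - s (r n))) \<longlonglongrightarrow> \<xi>"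
      using r(2) by (simp add: Q_def o_def)
  qed
  from sub[OF this] have "m \<le> \<xi>" .
  moreover have "\<xi> \<le> m - e"
  proof (rule LIMSEQ_le_const2[OF r(2)])
    have "Q n \<le> m - e" for n using P(5,6)[of n] by (simp add: Q_def divide_le_eq mult.commute less_imp_le)
    then show "\<exists>N. \<forall>n\<ge>N. (Q \<circ> r) n \<le> m - e" by auto
  qed
  ultimately show False using e by simp
qed

text \<open>If the subdifferential were empty, \<open>clarke_subdiff_dini\<close> would apply with
  every \<open>m\<close>; a slope of at least \<open>\<bar>L\<bar> + 1\<close> contradicts the
  Lipschitz bound.\<close>

lemma clarke_subdiff_nonempty:
  assumes lip: "L-lipschitz_on (ball t d) g" and d: "d > 0"
  shows "clarke_subdiff g t \<noteq> {}"
proof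
  assume emp: "clarke_subdiff g t = {}"
  obtain \<delta> where \<delta>: "\<delta> > 0" "\<And>s s'. \<bar>s - t\<bar> < \<delta> \<Longrightarrow> \<bar>s' - t\<bar> < \<delta> \<Longrightarrow> s < s' \<Longrightarrow> (\<bar>L\<bar> + 2 - 1) * (s' - s) \<le> g s' - g s"
    using clarke_subdiff_dini[OF lip d, of "\<bar>L\<bar> + 2" 1] emp by auto
  define h where "h = min \<delta> d / 2"
  have h: "h > 0" "h < \<delta>" "h < d" using \<delta> d by (auto simp: h_def)
  have "(\<bar>L\<bar> + 1) * h \<le> g (t + h) - g t" using \<delta>(2)[of t "t + h"] h by (simp add: add.commute)
  moreover have "g (t + h) - g t \<le> L * h"
    using lipschitz_onD[OF lip, of "t + h" t] h by (simp add: dist_real_def abs_le_iff)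
  moreover have "L * h \<le> \<bar>L\<bar> * h" using h by (intro mult_right_mono) auto
  ultimately show False using h by (simp add: distrib_right)
qed

text \<open>Formally \<open>(g / s^3)' = (g' - 3 g / s) / s^3 \<ge> 0\<close>, but \<open>g\<close>
  need not be differentiable. The assumed slope bound limits the decrease of the quotient to
  \<open>\<eta> (s' - s)\<close> on short intervals around each point; bisection adds these up over
  \<open>[a, b]\<close>, and then \<open>\<eta>\<close> goes to 0.\<close>

lemma cubic_quotient_mono:
  fixes g :: "real \<Rightarrow> real"
  assumes cont: "continuous_on UNIV g"
    and dini: "\<And>t e. t > 0 \<Longrightarrow> e > 0 \<Longrightarrow> \<exists>\<delta>>0. \<forall>s s'. \<bar>s - t\<bar> < \<delta> \<longrightarrow> \<bar>s' - t\<bar> < \<delta> \<longrightarrow> s < s' \<longrightarrow> (3 * g t / t - e) * (s' - s) \<le> g s' - g s"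
    and ab: "0 < a" "a \<le> b"
  shows "g a / a ^ 3 \<le> g b / b ^ 3"
proof -
  define k where "k s = g s / s ^ 3" for s
  have near: "\<exists>d>0. \<forall>s s'. s \<le> x \<and> x \<le> s' \<and> s' - s < d \<longrightarrow> k s - k s' \<le> \<eta> * (s' - s)" if x: "x > 0" and \<eta>: "\<eta> > 0" for x \<eta>
  proof -
    \<comment> \<open>Since \<open>s' > x / 2\<close>, the total error
      \<open>2 e (s' - s) = \<eta> (s' - s) (x / 2)^3\<close> is absorbed by
      \<open>\<eta> (s' - s) s'^3\<close>.\<close>
    define e where "e = \<eta> * x ^ 3 / 16"
    have e: "e > 0" using x \<eta> by (simp add: e_def)
    obtain \<delta>1 where \<delta>1: "\<delta>1 > 0" "\<And>s s'. \<bar>s - x\<bar> < \<delta>1 \<Longrightarrow> \<bar>s' - x\<bar> < \<delta>1 \<Longrightarrow> s < s' \<Longrightarrow> (3 * g x / x - e) * (s' - s) \<le> g s' - g s"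
      using dini[OF x e] by blast
    \<comment> \<open>\<open>k s\<close> times the difference quotient of the cube between
      \<open>s\<close> and \<open>s'\<close>; on the diagonal it equals \<open>3 g x / x\<close>,
      the slope in the hypothesis.\<close>
    let ?H = "\<lambda>p. g (fst p) * ((snd p)\<^sup>2 + fst p * snd p + (fst p)\<^sup>2) / (fst p) ^ 3"
    have gc: "isCont g x" using cont by (simp add: continuous_on_eq_continuous_at)
    have "(?H \<longlongrightarrow> g x * (x\<^sup>2 + x * x + x\<^sup>2) / x ^ 3) (at (x, x))"
    proof -
      have f: "(fst \<longlongrightarrow> x) (at (x, x))" "(snd \<longlongrightarrow> x) (at (x, x))"
        by (auto intro!: tendsto_eq_intros)
      show ?thesis
        by (intro tendsto_intros f isCont_tendsto_compose[OF gc]) (use x in simp)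
    qed
    moreover have "g x * (x\<^sup>2 + x * x + x\<^sup>2) / x ^ 3 = 3 * g x / x"
      using x by (simp add: power2_eq_square power3_eq_cube)
    ultimately have "(?H \<longlongrightarrow> 3 * g x / x) (at (x, x))" by simp
    then obtain \<delta>2 where \<delta>2: "\<delta>2 > 0" "\<And>p. p \<noteq> (x, x) \<Longrightarrow> dist p (x, x) < \<delta>2 \<Longrightarrow> dist (?H p) (3 * g x / x) < e"
      using e unfolding Lim_at by (metis dist_pos_lt)
    define d where "d = min (min \<delta>1 (x / 2)) (\<delta>2 / 2)"
    have d: "d > 0" "d \<le> \<delta>1" "d \<le> x / 2" "d \<le> \<delta>2 / 2" using \<delta>1 \<delta>2 x by (auto simp: d_def)
    show ?thesis
    proof (intro exI[of _ d] conjI allI impI d)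
      fix s s' assume ss: "s \<le> x \<and> x \<le> s' \<and> s' - s < d"
      show "k s - k s' \<le> \<eta> * (s' - s)"
      proof (cases "s = s'")
        case False
        then have lt: "s < s'" using ss by linarith
        have s0: "s > 0" "s' > x / 2" "s' > 0" using ss d x by linarith+
        have H: "?H (s, s') \<le> 3 * g x / x + e"
        proof -
          have "dist (s, s') (x, x) \<le> \<bar>s - x\<bar> + \<bar>s' - x\<bar>"
            using sqrt_sum_squares_le_sum_abs[of "s - x" "s' - x"] by (simp add: dist_Pair_Pair dist_real_def)
          also have "\<dots> < \<delta>2" using ss d \<delta>2(1) by linarith
          finally have "dist (?H (s, s')) (3 * g x / x) < e" using lt by (intro \<delta>2) auto
          then show ?thesis by (simp add: dist_real_def abs_less_iff)
        qed
        have "(3 * g x / x - e) * (s' - s) \<le> g s' - g s" using ss d lt by (intro \<delta>1) linarith+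
        moreover have "k s * (s' ^ 3 - s ^ 3) = ?H (s, s') * (s' - s)"
        proof -
          have "s' ^ 3 - s ^ 3 = (s'\<^sup>2 + s * s' + s\<^sup>2) * (s' - s)"
            by (simp add: power2_eq_square power3_eq_cube algebra_simps)
          then show ?thesis by (simp add: k_def)
        qed
        moreover have "?H (s, s') * (s' - s) \<le> (3 * g x / x + e) * (s' - s)"
          using H lt by (intro mult_right_mono) auto
        ultimately have "k s * (s' ^ 3 - s ^ 3) - (g s' - g s) \<le> 2 * e * (s' - s)"
          by (simp add: algebra_simps)
        moreover have "k s * (s' ^ 3 - s ^ 3) - (g s' - g s) = (k s - k s') * s' ^ 3"
          using s0 by (simp add: k_def algebra_simps)
        ultimately have "(k s - k s') * s' ^ 3 \<le> 2 * e * (s' - s)" by simp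
        also have "2 * e * (s' - s) = \<eta> * (s' - s) * (x / 2) ^ 3" by (simp add: e_def power_divide)
        also have "\<dots> \<le> \<eta> * (s' - s) * s' ^ 3"
          using \<eta> lt s0 x by (intro mult_left_mono power_mono) auto
        finally show ?thesis using s0 by simp
      qed simp
    qed
  qed
  have "k a - k b \<le> \<eta> * (b - a)" if \<eta>: "\<eta> > 0" for \<eta>
    using ab(2)
  proof (induction rule: Bolzano)
    case (trans a b c)
    then show ?case by (simp add: right_diff_distrib)
  next
    case (local x)
    then show ?case using near[of x \<eta>] \<eta> ab(1) by auto
  qed
  then have *: "k a - k b \<le> \<eta> * (b - a + 1)" if "\<eta> > 0" for \<eta>
    using that by (fastforce simp: distrib_left intro: order_trans)
  have "(k a - k b) / (b - a + 1) \<le> 0"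
    by (rule dense_ge) (use * ab in \<open>simp add: divide_le_eq\<close>)
  then show ?thesis using ab by (simp add: k_def divide_le_0_iff)
qed

section \<open>Nonlinearities with a monotone cubic quotient\<close>

text \<open>The last clause says that \<open>g t / t^3\<close> is nondecreasing in
  \<open>\<bar>t\<bar>\<close> on each half-line, multiplied out so that \<open>r = 0\<close> and
  \<open>t = 0\<close> are included.\<close>

definition superquartic :: "(real \<Rightarrow> real) \<Rightarrow> bool" where
  "superquartic g \<longleftrightarrow> continuous_on UNIV g \<and> g 0 = 0 \<and> (\<forall>t. t \<noteq> 0 \<longrightarrow> 0 < g t * t) \<and>
     (\<forall>t r. 0 \<le> r \<longrightarrow> r \<le> 1 \<longrightarrow> g (r * t) * (r * t) \<le> r ^ 4 * (g t * t))"

text \<open>Divided by \<open>t^2\<close>, the subgradient condition reads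
  \<open>\<xi> \<ge> 3 g t / t\<close>, the input of \<open>cubic_quotient_mono\<close>. Positivity
  of \<open>g t * t\<close> can be read off as well because the subdifferential is nonempty.\<close>

lemma superquarticI:
  fixes g :: "real \<Rightarrow> real"
  assumes lip: "\<And>t. \<exists>d>0. \<exists>L. L-lipschitz_on (ball t d) g" and g0: "g 0 = 0"
    and sub: "\<And>t \<xi>. t \<noteq> 0 \<Longrightarrow> \<xi> \<in> clarke_subdiff g t \<Longrightarrow> 0 < 3 * g t * t \<and> 3 * g t * t \<le> \<xi> * t\<^sup>2"
  shows "superquartic g"
proof -
  have cont: "continuous_on UNIV g"
    unfolding continuous_on_eq_continuous_at[OF open_UNIV]
  proof
    fix t
    obtain d L where "d > 0" "L-lipschitz_on (ball t d) g" using lip by blast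
    then show "isCont g t"
      using lipschitz_on_continuous_on[of L "ball t d" g] continuous_on_eq_continuous_at[of "ball t d" g] by simp
  qed
  have dini: "\<exists>\<delta>>0. \<forall>s s'. \<bar>s - t\<bar> < \<delta> \<longrightarrow> \<bar>s' - t\<bar> < \<delta> \<longrightarrow> s < s' \<longrightarrow> (3 * g t / t - e) * (s' - s) \<le> g s' - g s"
    if "t \<noteq> 0" "e > 0" for t e
  proof -
    obtain d L where dL: "d > 0" "L-lipschitz_on (ball t d) g" using lip by blast
    show ?thesis
    proof (rule clarke_subdiff_dini[OF dL(2,1) _ that(2)])
      fix \<xi> assume "\<xi> \<in> clarke_subdiff g t"
      then have "3 * g t * t \<le> \<xi> * t\<^sup>2" using sub that by blast
      then have "3 * g t / t * t\<^sup>2 \<le> \<xi> * t\<^sup>2" using that by (simp add: power2_eq_square)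
      then show "3 * g t / t \<le> \<xi>" by (rule mult_right_le_imp_le) (use that in simp)
    qed
  qed
  have pos: "0 < g t * t" if "t \<noteq> 0" for t
  proof -
    obtain d L where dL: "d > 0" "L-lipschitz_on (ball t d) g" using lip by blast
    then obtain \<xi> where "\<xi> \<in> clarke_subdiff g t" using clarke_subdiff_nonempty by blast
    from sub[OF that this] show ?thesis by (simp add: mult.commute)
  qed
  have main: "f (r * t) * (r * t) \<le> r ^ 4 * (f t * t)"
    if f: "\<And>a b. 0 < a \<Longrightarrow> a \<le> b \<Longrightarrow> f a / a ^ 3 \<le> f b / b ^ 3" and rt: "0 < r" "r \<le> 1" "0 < t" for f :: "real \<Rightarrow> real" and r t
  proof -
    have "r * t > 0" "r * t \<le> t" using rt by auto
    then have "f (r * t) / (r * t) ^ 3 * (r * t) ^ 4 \<le> f t / t ^ 3 * (r * t) ^ 4"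
      by (intro mult_right_mono f) auto
    moreover have "y / s ^ 3 * s ^ 4 = y * s" if "s > 0" for y s :: real
      using that by (simp add: power3_eq_cube power4_eq_xxxx)
    ultimately show ?thesis using \<open>r * t > 0\<close> rt by (simp add: power_mult_distrib power3_eq_cube power4_eq_xxxx mult_ac)
  qed
  have mono: "g a / a ^ 3 \<le> g b / b ^ 3" if "0 < a" "a \<le> b" for a b
    using dini by (intro cubic_quotient_mono[OF cont _ that]) auto
  \<comment> \<open>The negative half-line is treated through the reflection
    \<open>- g (- t)\<close>.\<close>
  have mono': "- g (- a) / a ^ 3 \<le> - g (- b) / b ^ 3" if "0 < a" "a \<le> b" for a b
  proof (rule cubic_quotient_mono[OF _ _ that])
    show "continuous_on UNIV (\<lambda>t. - g (- t))"
      by (intro continuous_on_minus continuous_on_compose2[OF cont] continuous_intros) auto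
    fix t e :: real assume t: "t > 0" "e > 0"
    then obtain \<delta> where \<delta>: "\<delta> > 0" "\<And>s s'. \<bar>s - - t\<bar> < \<delta> \<Longrightarrow> \<bar>s' - - t\<bar> < \<delta> \<Longrightarrow> s < s' \<Longrightarrow> (3 * g (- t) / (- t) - e) * (s' - s) \<le> g s' - g s"
      using dini[of "- t" e] by auto
    show "\<exists>\<delta>>0. \<forall>s s'. \<bar>s - t\<bar> < \<delta> \<longrightarrow> \<bar>s' - t\<bar> < \<delta> \<longrightarrow> s < s' \<longrightarrow> (3 * - g (- t) / t - e) * (s' - s) \<le> - g (- s') - - g (- s)"
    proof (intro exI[of _ \<delta>] conjI allI impI \<delta>(1))
      fix s s' assume "\<bar>s - t\<bar> < \<delta>" "\<bar>s' - t\<bar> < \<delta>" "s < s'"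
      then show "(3 * - g (- t) / t - e) * (s' - s) \<le> - g (- s') - - g (- s)"
        using \<delta>(2)[of "- s'" "- s"] by simp
    qed
  qed
  have "g (r * t) * (r * t) \<le> r ^ 4 * (g t * t)" if r: "0 \<le> r" "r \<le> 1" for r t
  proof -
    consider "r = 0 \<or> t = 0" | "r > 0" "t > 0" | "r > 0" "t < 0" using r by linarith
    then show ?thesis
    proof cases
      case 2
      then show ?thesis by (intro main mono r)
    next
      case 3
      then show ?thesis using main[of "\<lambda>t. - g (- t)" r "- t"] mono' r by simp
    qed (auto simp: g0)
  qed
  then show ?thesis using cont g0 pos by (auto simp: superquartic_def)
qed

locale superquartic_fun =
  fixes g :: "real \<Rightarrow> real" and G :: "real \<Rightarrow> real"
  assumes sq: "superquartic g" and G_def: "\<And>t. G t = (LBINT s=0..t. g s)"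
begin

lemma g_props: "continuous_on UNIV g" "g 0 = 0" "t \<noteq> 0 \<Longrightarrow> 0 < g t * t" "0 \<le> g t * t"
  "0 \<le> r \<Longrightarrow> r \<le> 1 \<Longrightarrow> g (r * t) * (r * t) \<le> r ^ 4 * (g t * t)"
proof -
  show "0 \<le> g t * t"
  proof (cases "t = 0")
    case False
    then have "0 < g t * t" using sq unfolding superquartic_def by blast
    then show ?thesis by (rule less_imp_le)
  qed simp
qed (use sq in \<open>simp_all add: superquartic_def\<close>)

lemma G_deriv: "(G has_real_derivative g t) (at t)"
proof -
  have "((\<lambda>u. LBINT y=0..u. g y) has_vector_derivative g t) (at t within {- \<bar>t\<bar> - 1 .. \<bar>t\<bar> + 1})"
    by (rule interval_integral_FTC2[where c=0, unfolded zero_ereal_def[symmetric]])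
      (auto intro: continuous_on_subset[OF g_props(1)])
  then have "((\<lambda>u. LBINT y=0..u. g y) has_vector_derivative g t) (at t)"
    by (subst (asm) at_within_Icc_at) auto
  moreover have "G = (\<lambda>u. LBINT y=0..u. g y)" by (auto simp: G_def)
  ultimately show ?thesis by (simp add: has_real_derivative_iff_has_vector_derivative)
qed

lemma G_0: "G 0 = 0" by (simp add: G_def flip: zero_ereal_def)

lemma G_ray_deriv: "((\<lambda>r. G (r * t)) has_real_derivative g (r * t) * t) (at r)"
proof -
  have "((\<lambda>r. r * t) has_real_derivative t) (at r)" by (auto intro!: derivative_eq_intros)
  from DERIV_chain2[OF G_deriv this] show ?thesis .
qed

text \<open>\<open>G (r t) - r^4 / 4 * (g t t)\<close> decreases up to \<open>r = 1\<close> and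
  increases afterwards, since its derivative \<open>g (r t) t - r^3 g t t\<close> changes sign there
  by monotonicity of the cubic quotient. Both \<open>remainder_mono\<close> and the energy maximum
  along rays rest on this inequality.\<close>

lemma G_scale_le:
  assumes "r \<ge> 0" shows "G t - G (r * t) \<le> (1 - r ^ 4) / 4 * (g t * t)"
proof -
  define \<Phi> where "\<Phi> r = G (r * t) - r ^ 4 / 4 * (g t * t)" for r
  have D: "(\<Phi> has_real_derivative g (r * t) * t - r ^ 3 * (g t * t)) (at r)" for r
    unfolding \<Phi>_def by (auto intro!: derivative_eq_intros G_ray_deriv)
  have "\<Phi> 1 \<le> \<Phi> r"
  proof (cases "r \<le> 1")
    case True
    show ?thesis
    proof (rule DERIV_nonpos_imp_nonincreasing[OF True])
      fix z assume z: "r \<le> z" "z \<le> 1"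
      show "\<exists>y. (\<Phi> has_real_derivative y) (at z) \<and> y \<le> 0"
      proof (cases "z = 0")
        case True then show ?thesis using D[of z] g_props(2) by auto
      next
        case False
        then have "z > 0" using z assms by linarith
        then have "z * (g (z * t) * t) \<le> z * (z ^ 3 * (g t * t))"
          using g_props(5)[of z t] z by (simp add: power4_eq_xxxx power3_eq_cube mult_ac)
        then have "g (z * t) * t \<le> z ^ 3 * (g t * t)" using \<open>z > 0\<close> by simp
        then show ?thesis using D[of z] by auto
      qed
    qed
  next
    case False
    then have "1 \<le> r" by simp
    then show ?thesis
    proof (rule DERIV_nonneg_imp_nondecreasing)
      fix z :: real assume z: "1 \<le> z" "z \<le> r"
      \<comment> \<open>For \<open>z \<ge> 1\<close> the scaling inequality is used backwards, from
        \<open>z t\<close> down to \<open>t\<close>.\<close>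
      have "g (inverse z * (z * t)) * (inverse z * (z * t)) \<le> inverse z ^ 4 * (g (z * t) * (z * t))"
        using z by (intro g_props(5)) (auto simp: inverse_le_1_iff)
      then have "g t * t \<le> inverse z ^ 4 * (g (z * t) * (z * t))" using z by (simp add: mult.assoc[symmetric])
      then have "z ^ 3 * (g t * t) \<le> z ^ 3 * (inverse z ^ 4 * (g (z * t) * (z * t)))" using z by (intro mult_left_mono) auto
      also have "\<dots> = g (z * t) * t" using z by (simp add: power4_eq_xxxx power3_eq_cube field_simps)
      finally show "\<exists>y. (\<Phi> has_real_derivative y) (at z) \<and> 0 \<le> y" using D[of z] by auto
    qed
  qed
  then show ?thesis by (simp add: \<Phi>_def algebra_simps diff_divide_distrib)
qed

lemma G_le: "4 * G t \<le> g t * t"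
  using G_scale_le[of 0 t] G_0 by simp

lemma G_nonneg: "G t \<ge> 0"
proof -
  have "G (0 * t) \<le> G (1 * t)"
  proof (rule DERIV_nonneg_imp_nondecreasing[of 0 1 "\<lambda>r. G (r * t)"])
    fix z :: real assume z: "0 \<le> z" "z \<le> 1"
    have "g (z * t) * t \<ge> 0"
    proof (cases "z = 0")
      case False
      then have "z > 0" using z by simp
      then show ?thesis using g_props(4)[of "z * t"] by (simp add: zero_le_mult_iff mult.left_commute[of _ z])
    qed (simp add: g_props(2))
    then show "\<exists>y. ((\<lambda>r. G (r * t)) has_real_derivative y) (at z) \<and> 0 \<le> y" using G_ray_deriv by blast
  qed simp
  then show ?thesis using G_0 by simp
qed

text \<open>The bound of \<open>G_scale_le\<close> and that of the cubic quotient carry the same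
  term \<open>r^4 / 4 * (g t t)\<close>, which cancels.\<close>

lemma remainder_mono:
  assumes "0 \<le> r" "r \<le> 1"
  shows "g (r * t) * (r * t) / 4 - G (r * t) \<le> g t * t / 4 - G t"
proof -
  have "G t - G (r * t) \<le> (1 - r ^ 4) / 4 * (g t * t)" using assms by (intro G_scale_le)
  also have "\<dots> = g t * t / 4 - r ^ 4 * (g t * t) / 4" by (simp add: algebra_simps diff_divide_distrib)
  finally show ?thesis using g_props(5)[OF assms, of t] by linarith
qed

lemma G_mvt: "\<exists>\<theta>\<in>{0..1}. G (x + y) - G x = g (x + \<theta> * y) * y"
proof -
  have "((\<lambda>r. G (x + r * y)) has_real_derivative g (x + r * y) * y) (at r)" for r
  proof -
    have "((\<lambda>r. x + r * y) has_real_derivative y) (at r)" by (auto intro!: derivative_eq_intros)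
    from DERIV_chain2[OF G_deriv this] show ?thesis .
  qed
  from MVT2[of 0 1 "\<lambda>r. G (x + r * y)", OF _ this] obtain z where "0 < z" "z < 1" "G (x + 1 * y) - G (x + 0 * y) = (1 - 0) * (g (x + z * y) * y)"
    by auto
  then show ?thesis by (intro bexI[of _ z]) auto
qed

text \<open>Between the two regimes nothing bounds \<open>g\<close> directly. There the value at
  distance \<open>R + 1\<close> on the same side of 0, which already belongs to the outer regime, is
  carried inwards with the factor \<open>(t / (R + 1))^4\<close>.\<close>

lemma growth:
  assumes e: "e \<ge> 0" and small: "\<And>t. \<bar>t\<bar> < \<delta> \<Longrightarrow> \<bar>g t\<bar> \<le> e * \<bar>t\<bar>"
    and large: "\<And>t. \<bar>t\<bar> > R \<Longrightarrow> \<bar>g t\<bar> \<le> e * \<bar>t\<bar> ^ 5" and R: "R > 0"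
  shows "g t * t \<le> e * t\<^sup>2 + e * t ^ 6 + e * (R + 1)\<^sup>2 * t ^ 4"
proof -
  have sq: "\<bar>t\<bar> * \<bar>t\<bar> = t\<^sup>2" "\<bar>t\<bar> ^ 5 * \<bar>t\<bar> = t ^ 6" for t :: real
    by (simp_all add: power2_eq_square numeral_eq_Suc abs_mult mult_ac)
  have nn: "0 \<le> e * t\<^sup>2" "0 \<le> e * t ^ 6" "0 \<le> e * (R + 1)\<^sup>2 * t ^ 4" for t
    using e by auto
  have ab: "g t * t \<le> \<bar>g t\<bar> * \<bar>t\<bar>" for t by (simp add: abs_mult[symmetric])
  consider "\<bar>t\<bar> < \<delta>" | "\<bar>t\<bar> > R" | "\<bar>t\<bar> \<le> R" by linarith
  then show ?thesis
  proof cases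
    case 1
    have "\<bar>g t\<bar> * \<bar>t\<bar> \<le> e * \<bar>t\<bar> * \<bar>t\<bar>" by (intro mult_right_mono small 1) auto
    then show ?thesis using ab[of t] nn(2,3)[of t] sq[of t] by (simp add: mult.assoc)
  next
    case 2
    have "\<bar>g t\<bar> * \<bar>t\<bar> \<le> e * \<bar>t\<bar> ^ 5 * \<bar>t\<bar>" by (intro mult_right_mono large 2) auto
    then show ?thesis using ab[of t] nn(1,3)[of t] sq[of t] by (simp add: mult.assoc)
  next
    case 3
    define r where "r = \<bar>t\<bar> / (R + 1)"
    define \<tau> where "\<tau> = sgn t * (R + 1)"
    have r: "0 \<le> r" "r \<le> 1" using 3 R by (auto simp: r_def)
    have rt: "r * \<tau> = t" using R by (simp add: r_def \<tau>_def mult.commute abs_mult_sgn sgn_mult_abs)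
    have "g t * t \<le> r ^ 4 * (g \<tau> * \<tau>)" using g_props(5)[OF r, of \<tau>] by (simp add: rt)
    also have "g \<tau> * \<tau> \<le> e * (R + 1) ^ 6"
    proof (cases "t = 0")
      case False
      then have "\<bar>\<tau>\<bar> = R + 1" using R by (simp add: \<tau>_def abs_mult abs_sgn_eq)
      then have "\<bar>g \<tau>\<bar> * \<bar>\<tau>\<bar> \<le> e * \<bar>\<tau>\<bar> ^ 5 * \<bar>\<tau>\<bar>" by (intro mult_right_mono large) auto
      then show ?thesis using ab[of \<tau>] \<open>\<bar>\<tau>\<bar> = R + 1\<close> by (simp add: numeral_eq_Suc mult_ac)
    qed (use e R in \<open>simp add: \<tau>_def\<close>)
    then have "r ^ 4 * (g \<tau> * \<tau>) \<le> r ^ 4 * (e * (R + 1) ^ 6)" by (intro mult_left_mono) auto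
    also have "r ^ 4 * (e * (R + 1) ^ 6) = e * (R + 1)\<^sup>2 * t ^ 4"
    proof -
      have "r * (R + 1) = \<bar>t\<bar>" using R by (simp add: r_def)
      then have "(r * (R + 1)) ^ 4 = t ^ 4" by (simp add: power_even_abs)
      moreover have "r ^ 4 * (e * (R + 1) ^ 6) = e * (R + 1)\<^sup>2 * (r * (R + 1)) ^ 4"
        by (simp add: power_mult_distrib power_add[symmetric] mult_ac flip: power_add)
      ultimately show ?thesis by simp
    qed
    finally show ?thesis using nn(1,2)[of t] by linarith
  qed
qed

end

section \<open>Measure theory for limits and compositions\<close>

lemma sigma_finite_lebesgue: "sigma_finite_measure (lebesgue :: 'a::euclidean_space measure)"
proof
  obtain A :: "'a set set" where "countable A" "A \<subseteq> sets lborel" "\<Union>A = space lborel" "\<forall>a\<in>A. emeasure lborel a \<noteq> \<infinity>"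
    using sigma_finite_measure.sigma_finite_countable[OF sigma_finite_lborel] by blast
  then show "\<exists>A. countable A \<and> A \<subseteq> sets (lebesgue :: 'a measure) \<and> \<Union>A = space lebesgue \<and> (\<forall>a\<in>A. emeasure lebesgue a \<noteq> \<infinity>)"
    by (intro exI[of _ A]) (auto simp: subset_iff)
qed

interpretation lebesgue: sigma_finite_measure lebesgue
  by (rule sigma_finite_lebesgue)

interpretation lebesgue_pair: pair_sigma_finite lebesgue lebesgue ..

text \<open>Fatou with convergent upper bounds \<open>c n\<close> in place of the integrals, so that
  the parts of an energy can be estimated one by one.\<close>

lemma fatou_real:
  fixes p :: "nat \<Rightarrow> 'a \<Rightarrow> real"
  assumes p: "\<And>n. integrable M (p n)" "\<And>n. AE x in M. 0 \<le> p n x"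
    and lim: "AE x in M. (\<lambda>n. p n x) \<longlonglongrightarrow> P x" and P [measurable]: "P \<in> borel_measurable M"
    and c: "\<And>n. (\<integral>x. p n x \<partial>M) \<le> c n" "c \<longlonglongrightarrow> C"
  shows "integrable M P" "(\<integral>x. P x \<partial>M) \<le> C" "AE x in M. 0 \<le> P x"
proof -
  have [measurable]: "\<And>n. p n \<in> borel_measurable M" using p(1) by auto
  have "AE x in M. \<forall>n. 0 \<le> p n x" using p(2) by (simp add: AE_all_countable)
  with lim show pos: "AE x in M. 0 \<le> P x"
  proof eventually_elim
    case (elim x)
    then show ?case by (intro LIMSEQ_le_const[OF elim(1)]) auto
  qed
  have C0: "C \<ge> 0"
  proof (rule LIMSEQ_le_const[OF c(2)])
    have "0 \<le> (\<integral>x. p n x \<partial>M)" for n by (rule integral_nonneg_AE) (rule p)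
    then show "\<exists>N. \<forall>n\<ge>N. 0 \<le> c n" using c(1) order_trans by blast
  qed
  have "(\<integral>\<^sup>+x. ennreal (P x) \<partial>M) = (\<integral>\<^sup>+x. liminf (\<lambda>n. ennreal (p n x)) \<partial>M)"
  proof (rule nn_integral_cong_AE, use lim in eventually_elim)
    case (elim x)
    from lim_imp_Liminf[OF sequentially_bot tendsto_ennrealI[OF elim]] show ?case by simp
  qed
  also have "\<dots> \<le> liminf (\<lambda>n. \<integral>\<^sup>+x. ennreal (p n x) \<partial>M)"
    by (rule nn_integral_liminf) measurable
  also have "\<dots> \<le> liminf (\<lambda>n. ennreal (c n))"
    using c(1) nn_integral_eq_integral[OF p(1) p(2)] by (intro Liminf_mono always_eventually allI) (simp add: ennreal_leI)
  also have "\<dots> = ennreal C"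
    by (rule lim_imp_Liminf[OF sequentially_bot tendsto_ennrealI[OF c(2)]])
  finally have *: "(\<integral>\<^sup>+x. ennreal (P x) \<partial>M) \<le> ennreal C" .
  show int: "integrable M P"
    using * pos by (intro integrableI_nonneg) (auto intro: le_less_trans)
  show "(\<integral>x. P x \<partial>M) \<le> C"
    using * C0 nn_integral_eq_integral[OF int pos] by simp
qed

text \<open>Rounding \<open>v\<close> down to multiples of \<open>1 / (n + 1)\<close> leaves
  countably many values, where measurability is clear; continuity in the second argument carries it
  to the limit.\<close>

lemma caratheodory_measurable:
  fixes h :: "'a \<Rightarrow> real \<Rightarrow> real"
  assumes m: "\<And>t. (\<lambda>x. h x t) \<in> borel_measurable M" and c: "\<And>x. continuous_on UNIV (h x)"
    and v [measurable]: "v \<in> borel_measurable M"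
  shows "(\<lambda>x. h x (v x)) \<in> borel_measurable M"
proof (rule borel_measurable_LIMSEQ_real)
  define w where "w n x = of_int \<lfloor>v x * real (Suc n)\<rfloor> / real (Suc n)" for n x
  show "(\<lambda>x. h x (w n x)) \<in> borel_measurable M" for n
  proof -
    have [measurable]: "(\<lambda>x. \<lfloor>v x * real (Suc n)\<rfloor>) \<in> M \<rightarrow>\<^sub>M count_space UNIV" by measurable
    have "(\<lambda>x. h x (of_int i / real (Suc n))) \<in> borel_measurable M" for i by (rule m)
    from measurable_compose_countable[of "\<lambda>i x. h x (of_int i / real (Suc n))", OF this \<open>(\<lambda>x. \<lfloor>v x * real (Suc n)\<rfloor>) \<in> M \<rightarrow>\<^sub>M count_space UNIV\<close>]
    show ?thesis by (simp add: w_def)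
  qed
  fix x
  have "\<bar>w n x - v x\<bar> \<le> inverse (real (Suc n))" for n
  proof -
    have "\<bar>of_int \<lfloor>v x * real (Suc n)\<rfloor> - v x * real (Suc n)\<bar> \<le> 1" by linarith
    then have "\<bar>(of_int \<lfloor>v x * real (Suc n)\<rfloor> - v x * real (Suc n)) / real (Suc n)\<bar> \<le> 1 / real (Suc n)"
      unfolding abs_divide by (simp add: divide_right_mono)
    then show ?thesis by (simp add: w_def diff_divide_distrib inverse_eq_divide)
  qed
  then have "(\<lambda>n. w n x - v x) \<longlonglongrightarrow> 0"
    by (intro Lim_null_comparison[OF always_eventually[OF allI] LIMSEQ_inverse_real_of_nat]) simp
  then have "(\<lambda>n. w n x) \<longlonglongrightarrow> v x" by (simp add: LIM_zero_iff)
  moreover have "isCont (h x) (v x)" using c[of x] by (simp add: continuous_on_eq_continuous_at)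
  ultimately show "(\<lambda>n. h x (w n x)) \<longlonglongrightarrow> h x (v x)" by (rule isCont_tendsto_compose[rotated])
qed

text \<open>L2 intersected with L6. On it \<open>f x (u x) * v x\<close> is integrable, and sums of
  absolute values stay inside for elementary reasons, so dominating functions are taken from
  here.\<close>

definition L26 :: "(R3 \<Rightarrow> real) set" where
  "L26 = {u \<in> L2 lebesgue. integrable lebesgue (\<lambda>x. u x ^ 6)}"

lemma L26_D: "u \<in> L26 \<Longrightarrow> u \<in> L2 lebesgue" "u \<in> L26 \<Longrightarrow> integrable lebesgue (\<lambda>x. u x ^ 6)"
  "u \<in> L26 \<Longrightarrow> u \<in> borel_measurable lebesgue"
  by (auto simp: L26_def L2_def)

lemma L26_scale: "u \<in> L26 \<Longrightarrow> (\<lambda>x. c * u x) \<in> L26"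
  by (auto simp: L26_def power_mult_distrib)

lemma L26_abs_add:
  assumes u: "u \<in> L26" and v: "v \<in> L26" shows "(\<lambda>x. \<bar>u x\<bar> + \<bar>v x\<bar>) \<in> L26"
proof -
  note [measurable] = L26_D(3)[OF u] L26_D(3)[OF v]
  have abs: "(\<lambda>x. \<bar>w x\<bar>) \<in> L2 lebesgue" if "w \<in> L26" for w
    using L26_D(1)[OF that] by (auto simp: L2_def)
  have "integrable lebesgue (\<lambda>x. (\<bar>u x\<bar> + \<bar>v x\<bar>) ^ 6)"
  proof (rule Bochner_Integration.integrable_bound)
    show "integrable lebesgue (\<lambda>x. 64 * (u x ^ 6 + v x ^ 6))" using L26_D(2)[OF u] L26_D(2)[OF v] by simp
    show "AE x in lebesgue. norm ((\<bar>u x\<bar> + \<bar>v x\<bar>) ^ 6) \<le> norm (64 * (u x ^ 6 + v x ^ 6))"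
    proof (rule AE_I2)
      fix x
      have "(s + t) ^ 6 \<le> 64 * (s ^ 6 + t ^ 6)" if "0 \<le> s" "0 \<le> t" for s t :: real
      proof -
        have "(s + t) ^ 6 \<le> (2 * max s t) ^ 6" using that by (intro power_mono) auto
        also have "\<dots> = 64 * (max s t) ^ 6" by (simp add: power_mult_distrib)
        also have "(max s t) ^ 6 \<le> s ^ 6 + t ^ 6" using that by (simp add: max_def)
        finally show ?thesis by simp
      qed
      from this[of "\<bar>u x\<bar>" "\<bar>v x\<bar>"] show "norm ((\<bar>u x\<bar> + \<bar>v x\<bar>) ^ 6) \<le> norm (64 * (u x ^ 6 + v x ^ 6))"
        by (simp add: power_even_abs)
    qed
  qed measurable
  then show ?thesis using L2_add[OF abs[OF u] abs[OF v]] by (simp add: L26_def)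
qed

lemma (in coercive_potential) H1V_L26: "u \<in> H1V V \<Longrightarrow> u \<in> L26"
  using H1V_D(2) L6_bound(1) by (simp add: L26_def)

section \<open>The nonlinearity and its growth\<close>

locale nonlinearity =
  fixes f :: "R3 \<Rightarrow> real \<Rightarrow> real"
  assumes f_meas: "\<And>t. (\<lambda>x. f x t) \<in> borel_measurable lebesgue"
    and f_loclip: "\<And>x t. \<exists>\<delta>>0. \<exists>L. L-lipschitz_on (ball t \<delta>) (f x)"
    and f1: "\<And>\<epsilon>. \<epsilon> > 0 \<Longrightarrow> \<exists>\<delta>>0. \<forall>x t. 0 < \<bar>t\<bar> \<and> \<bar>t\<bar> < \<delta> \<longrightarrow> \<bar>f x t / t\<bar> < \<epsilon>"
    and f2: "\<And>\<epsilon>. \<epsilon> > 0 \<Longrightarrow> \<exists>R. \<forall>x t. \<bar>t\<bar> > R \<longrightarrow> \<bar>f x t / t ^ 5\<bar> < \<epsilon>"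
    and f3: "\<And>M. \<exists>R. \<forall>x t. \<bar>t\<bar> > R \<longrightarrow> Fprim f x t / t ^ 4 > M"
    and f4: "AE x in lebesgue. \<forall>t. t \<noteq> 0 \<longrightarrow> (\<forall>\<xi> \<in> clarke_subdiff (f x) t.
               0 < 3 * f x t * t \<and> 3 * f x t * t \<le> \<xi> * t\<^sup>2)"
begin

lemma f_cont: "continuous_on UNIV (f x)"
  unfolding continuous_on_eq_continuous_at[OF open_UNIV]
proof
  fix t
  obtain d L where "d > 0" "L-lipschitz_on (ball t d) (f x)" using f_loclip by blast
  then show "isCont (f x) t"
    using lipschitz_on_continuous_on[of L "ball t d" "f x"] continuous_on_eq_continuous_at[of "ball t d" "f x"] by simp
qed

lemma f_small:
  assumes "e > 0" obtains \<delta> where "\<delta> > 0" "\<And>x t. t \<noteq> 0 \<Longrightarrow> \<bar>t\<bar> < \<delta> \<Longrightarrow> \<bar>f x t\<bar> \<le> e * \<bar>t\<bar>"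
proof -
  obtain \<delta> where \<delta>: "\<delta> > 0" "\<And>x t. 0 < \<bar>t\<bar> \<and> \<bar>t\<bar> < \<delta> \<Longrightarrow> \<bar>f x t / t\<bar> < e"
    using f1[OF assms] by blast
  have "\<bar>f x t\<bar> \<le> e * \<bar>t\<bar>" if "t \<noteq> 0" "\<bar>t\<bar> < \<delta>" for x t
    using \<delta>(2)[of t x] that by (simp add: abs_divide divide_less_eq)
  with \<delta>(1) show thesis using that by blast
qed

text \<open>\<open>f1\<close> speaks of \<open>t \<noteq> 0\<close> only; the value at 0 comes from
  continuity.\<close>

lemma f_0: "f x 0 = 0"
proof -
  obtain \<delta> where \<delta>: "\<delta> > 0" "\<And>x t. t \<noteq> 0 \<Longrightarrow> \<bar>t\<bar> < \<delta> \<Longrightarrow> \<bar>f x t\<bar> \<le> 1 * \<bar>t\<bar>"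
    using f_small[of 1] by auto
  have "isCont (f x) 0" using f_cont[of x] by (simp add: continuous_on_eq_continuous_at)
  then have l: "(f x \<longlongrightarrow> f x 0) (at 0)" by (simp add: isCont_def)
  have "(f x \<longlongrightarrow> 0) (at 0)"
  proof (rule Lim_null_comparison)
    show "\<forall>\<^sub>F t in at 0. norm (f x t) \<le> \<bar>t\<bar>"
      unfolding eventually_at using \<delta> by (intro exI[of _ \<delta>]) auto
    show "((\<lambda>t. \<bar>t\<bar>) \<longlongrightarrow> 0) (at (0::real))" by (auto intro!: tendsto_eq_intros)
  qed
  with l show ?thesis by (rule tendsto_unique[OF at_neq_bot])
qed

lemma AE_superquartic: "AE x in lebesgue. superquartic_fun (f x) (Fprim f x)"
  using f4
proof eventually_elim
  case (elim x)
  have "superquartic (f x)"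
    using elim by (intro superquarticI f_loclip f_0) blast
  then show ?case by unfold_locales (simp_all add: Fprim_def)
qed

lemma f_comp_measurable:
  assumes "v \<in> borel_measurable lebesgue" shows "(\<lambda>x. f x (v x)) \<in> borel_measurable lebesgue"
  by (rule caratheodory_measurable[OF f_meas f_cont assms])

lemma f_joint_measurable: "(\<lambda>(x, s). f x s) \<in> borel_measurable (lebesgue \<Otimes>\<^sub>M lborel)"
proof -
  have "(\<lambda>p. f (fst p) (snd p)) \<in> borel_measurable (lebesgue \<Otimes>\<^sub>M lborel)"
    by (rule caratheodory_measurable[of "\<lambda>p. f (fst p)"])
      (auto intro!: f_cont measurable_compose[OF measurable_fst f_meas])
  then show ?thesis by (simp add: case_prod_unfold)
qed

lemma F_cont: "continuous_on UNIV (Fprim f x)"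
proof -
  have "isCont (Fprim f x) t" for t
  proof -
    have "((\<lambda>u. LBINT y=0..u. f x y) has_vector_derivative f x t) (at t within {- \<bar>t\<bar> - 1 .. \<bar>t\<bar> + 1})"
      by (rule interval_integral_FTC2[where c=0, unfolded zero_ereal_def[symmetric]])
        (auto intro: continuous_on_subset[OF f_cont])
    then have "((\<lambda>u. LBINT y=0..u. f x y) has_vector_derivative f x t) (at t)"
      by (subst (asm) at_within_Icc_at) auto
    moreover have "Fprim f x = (\<lambda>u. LBINT y=0..u. f x y)" by (auto simp: Fprim_def)
    ultimately show ?thesis by (simp add: has_vector_derivative_continuous)
  qed
  then show ?thesis by (simp add: continuous_at_imp_continuous_on)
qed

lemma F_comp_measurable:
  assumes "v \<in> borel_measurable lebesgue" shows "(\<lambda>x. Fprim f x (v x)) \<in> borel_measurable lebesgue"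
proof (rule caratheodory_measurable[OF _ F_cont assms])
  fix t
  note [measurable] = f_joint_measurable
  have *: "(\<lambda>x. \<integral>s. indicator A s * f x s \<partial>lborel) \<in> borel_measurable lebesgue" if [measurable]: "A \<in> sets borel" for A
    by (rule lborel.borel_measurable_lebesgue_integral) measurable
  have [measurable]: "einterval a b \<in> sets borel" for a b by simp
  show "(\<lambda>x. Fprim f x t) \<in> borel_measurable lebesgue"
    unfolding Fprim_def interval_lebesgue_integral_def set_lebesgue_integral_def
    using *[of "einterval 0 (ereal t)"] *[of "einterval (ereal t) 0"] by simp
qed

text \<open>The quartic term of \<open>growth\<close> is moved to either end by
  \<open>t^4 \<le> c t^2 + t^6 / c\<close>. A small factor on \<open>t^2\<close> keeps the Nehari
  set away from 0; a small factor on \<open>t^6\<close> controls the critical power in the passage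
  to the limit. Half of \<open>e\<close> is reserved for what the splitting adds.\<close>

lemma f_growth:
  assumes "e > 0"
  obtains C where "C \<ge> 0" "AE x in lebesgue. \<forall>t. f x t * t \<le> e * t\<^sup>2 + C * t ^ 6"
    "AE x in lebesgue. \<forall>t. f x t * t \<le> C * t\<^sup>2 + e * t ^ 6"
proof -
  define e' where "e' = e / 2"
  have e': "e' > 0" using assms by (simp add: e'_def)
  obtain \<delta> where \<delta>: "\<delta> > 0" "\<And>x t. t \<noteq> 0 \<Longrightarrow> \<bar>t\<bar> < \<delta> \<Longrightarrow> \<bar>f x t\<bar> \<le> e' * \<bar>t\<bar>"
    using f_small[OF e'] by blast
  obtain R0 where R0: "\<And>x t. \<bar>t\<bar> > R0 \<Longrightarrow> \<bar>f x t / t ^ 5\<bar> < e'" using f2[OF e'] by blast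
  define R where "R = max R0 1"
  have R: "R > 0" by (simp add: R_def)
  have large: "\<bar>f x t\<bar> \<le> e' * \<bar>t\<bar> ^ 5" if "\<bar>t\<bar> > R" for x t
  proof -
    have "t \<noteq> 0" "\<bar>t\<bar> > R0" using that by (auto simp: R_def)
    then show ?thesis using R0[of t x] by (simp add: abs_divide divide_less_eq power_abs)
  qed
  have small: "\<bar>f x t\<bar> \<le> e' * \<bar>t\<bar>" if "\<bar>t\<bar> < \<delta>" for x t
    using \<delta>(2)[of t x] that by (cases "t = 0") (simp_all add: f_0)
  define K where "K = (R + 1)\<^sup>2"
  have K: "K > 0" using R by (simp add: K_def)
  have quart: "t ^ 4 \<le> c * t\<^sup>2 + 1 / c * t ^ 6" if "c > 0" for c t :: real
  proof -
    have "0 \<le> (c - t\<^sup>2)\<^sup>2 + c * t\<^sup>2" using that by simp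
    then have "c * t\<^sup>2 \<le> c * c + t\<^sup>2 * t\<^sup>2" by (simp add: power2_eq_square algebra_simps)
    then have "c * t\<^sup>2 * t\<^sup>2 \<le> (c * c + t\<^sup>2 * t\<^sup>2) * t\<^sup>2" by (rule mult_right_mono) simp
    then have "c * t ^ 4 \<le> c * (c * t\<^sup>2 + 1 / c * t ^ 6)"
      using that by (simp add: algebra_simps power_add[symmetric])
    then show ?thesis using that by simp
  qed
  have base: "AE x in lebesgue. \<forall>t. f x t * t \<le> e' * t\<^sup>2 + e' * t ^ 6 + e' * K * t ^ 4"
    using AE_superquartic
  proof eventually_elim
    case (elim x)
    then interpret superquartic_fun "f x" "Fprim f x" .
    show ?case unfolding K_def using e' by (intro allI growth small large R) auto
  qed
  show thesis
  proof (rule that[of "e' + e' * K * K"])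
    show "e' + e' * K * K \<ge> 0" using e' K by simp
    show "AE x in lebesgue. \<forall>t. f x t * t \<le> e * t\<^sup>2 + (e' + e' * K * K) * t ^ 6"
      using base
    proof eventually_elim
      case (elim x)
      show ?case
      proof
        fix t
        have "e' * K * t ^ 4 \<le> e' * K * (1 / K * t\<^sup>2 + 1 / (1 / K) * t ^ 6)"
          using e' K by (intro mult_left_mono quart) auto
        also have "\<dots> = e' * t\<^sup>2 + e' * K * K * t ^ 6" using K by (simp add: algebra_simps)
        finally show "f x t * t \<le> e * t\<^sup>2 + (e' + e' * K * K) * t ^ 6"
          using elim[rule_format, of t] by (simp add: e'_def algebra_simps)
      qed
    qed
    show "AE x in lebesgue. \<forall>t. f x t * t \<le> (e' + e' * K * K) * t\<^sup>2 + e * t ^ 6"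
      using base
    proof eventually_elim
      case (elim x)
      show ?case
      proof
        fix t
        have "e' * K * t ^ 4 \<le> e' * K * (K * t\<^sup>2 + 1 / K * t ^ 6)"
          using e' K by (intro mult_left_mono quart) auto
        also have "\<dots> = e' * K * K * t\<^sup>2 + e' * t ^ 6" using K by (simp add: algebra_simps)
        finally show "f x t * t \<le> (e' + e' * K * K) * t\<^sup>2 + e * t ^ 6"
          using elim[rule_format, of t] by (simp add: e'_def algebra_simps)
      qed
    qed
  qed
qed

text \<open>The bound depends on \<open>w\<close> alone, so one dominating function serves a whole
  sequence of arguments \<open>t\<close>.\<close>

lemma f_abs_bound:
  obtains C where "C \<ge> 0" "AE x in lebesgue. \<forall>t w. \<bar>t\<bar> \<le> w \<longrightarrow> \<bar>f x t\<bar> * w \<le> w\<^sup>2 + C * w ^ 6"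
proof -
  obtain C where C: "C \<ge> 0" "AE x in lebesgue. \<forall>t. f x t * t \<le> 1 * t\<^sup>2 + C * t ^ 6"
    using f_growth[of 1] by auto
  show thesis
  proof (rule that[OF C(1)])
    show "AE x in lebesgue. \<forall>t w. \<bar>t\<bar> \<le> w \<longrightarrow> \<bar>f x t\<bar> * w \<le> w\<^sup>2 + C * w ^ 6"
      using C(2) AE_superquartic
    proof eventually_elim
      case (elim x)
      interpret superquartic_fun "f x" "Fprim f x" by (rule elim)
      show ?case
      proof (intro allI impI)
        fix t w :: real assume tw: "\<bar>t\<bar> \<le> w"
        show "\<bar>f x t\<bar> * w \<le> w\<^sup>2 + C * w ^ 6"
        proof (cases "t = 0")
          case True
          then show ?thesis using C(1) tw by (simp add: g_props(2))
        next
          case False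
          have "\<bar>f x t\<bar> * \<bar>t\<bar> = f x t * t" using g_props(4)[of t] by (simp add: abs_mult[symmetric])
          also have "\<dots> \<le> t\<^sup>2 + C * t ^ 6" using elim(1) by simp
          also have "t\<^sup>2 + C * t ^ 6 = (\<bar>t\<bar> + C * \<bar>t\<bar> ^ 5) * \<bar>t\<bar>"
          proof -
            have "t\<^sup>2 = \<bar>t\<bar> * \<bar>t\<bar>" by (simp add: power2_eq_square)
            moreover have "t ^ 6 = \<bar>t\<bar> ^ 6" by (simp add: power_even_abs)
            moreover have "\<bar>t\<bar> ^ 6 = \<bar>t\<bar> ^ 5 * \<bar>t\<bar>" by (simp add: numeral_eq_Suc)
            ultimately show ?thesis by (simp only: distrib_right mult.assoc)
          qed
          finally have "\<bar>f x t\<bar> \<le> \<bar>t\<bar> + C * \<bar>t\<bar> ^ 5" using False by simp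
          also have "\<dots> \<le> w + C * w ^ 5" using tw C(1) by (intro add_mono mult_left_mono power_mono) auto
          finally have "\<bar>f x t\<bar> * w \<le> (w + C * w ^ 5) * w" using tw by (intro mult_right_mono) auto
          also have "\<dots> = w\<^sup>2 + C * w ^ 6" by (simp add: power2_eq_square numeral_eq_Suc algebra_simps)
          finally show ?thesis .
        qed
      qed
    qed
  qed
qed

lemma nemytskii_dominated:
  assumes W: "W \<in> L26" and w: "\<And>n. w n \<in> borel_measurable lebesgue" "w' \<in> borel_measurable lebesgue"
    and z: "\<And>n. z n \<in> borel_measurable lebesgue" "z' \<in> borel_measurable lebesgue"
    and bw: "\<And>n. AE x in lebesgue. \<bar>w n x\<bar> \<le> W x" and bz: "\<And>n. AE x in lebesgue. \<bar>z n x\<bar> \<le> W x"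
    and lw: "AE x in lebesgue. (\<lambda>n. w n x) \<longlonglongrightarrow> w' x" and lz: "AE x in lebesgue. (\<lambda>n. z n x) \<longlonglongrightarrow> z' x"
  shows "(\<lambda>n. \<integral>x. f x (w n x) * z n x \<partial>lebesgue) \<longlonglongrightarrow> (\<integral>x. f x (w' x) * z' x \<partial>lebesgue)"
    "\<And>n. integrable lebesgue (\<lambda>x. f x (w n x) * z n x)"
proof -
  obtain C where C: "C \<ge> 0" "AE x in lebesgue. \<forall>t w. \<bar>t\<bar> \<le> w \<longrightarrow> \<bar>f x t\<bar> * w \<le> w\<^sup>2 + C * w ^ 6"
    using f_abs_bound by blast
  have int: "integrable lebesgue (\<lambda>x. (W x)\<^sup>2 + C * W x ^ 6)"
    using L2_integrable[OF L26_D(1)[OF W]] L26_D(2)[OF W] by simp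
  note [measurable] = w z f_comp_measurable[OF w(1)] f_comp_measurable[OF w(2)]
  have bound: "AE x in lebesgue. norm (f x (w n x) * z n x) \<le> (W x)\<^sup>2 + C * W x ^ 6" for n
    using C(2) bw[of n] bz[of n]
  proof eventually_elim
    case (elim x)
    have "\<bar>f x (w n x)\<bar> * \<bar>z n x\<bar> \<le> \<bar>f x (w n x)\<bar> * W x" by (intro mult_left_mono elim) auto
    also have "\<dots> \<le> (W x)\<^sup>2 + C * W x ^ 6" using elim by blast
    finally show ?case by (simp add: abs_mult)
  qed
  have lim: "AE x in lebesgue. (\<lambda>n. f x (w n x) * z n x) \<longlonglongrightarrow> f x (w' x) * z' x"
    using lw lz
  proof eventually_elim
    case (elim x)
    have "isCont (f x) (w' x)" using f_cont[of x] by (simp add: continuous_on_eq_continuous_at)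
    from isCont_tendsto_compose[OF this elim(1)] elim(2) show ?case by (rule tendsto_mult)
  qed
  show "(\<lambda>n. \<integral>x. f x (w n x) * z n x \<partial>lebesgue) \<longlonglongrightarrow> (\<integral>x. f x (w' x) * z' x \<partial>lebesgue)"
    by (rule integral_dominated_convergence[OF _ _ int lim bound]) measurable
  show "integrable lebesgue (\<lambda>x. f x (w n x) * z n x)" for n
  proof (rule Bochner_Integration.integrable_bound[OF int])
    show "AE x in lebesgue. norm (f x (w n x) * z n x) \<le> norm ((W x)\<^sup>2 + C * W x ^ 6)"
      using bound[of n] by eventually_elim (metis abs_ge_self order_trans real_norm_def)
  qed measurable
qed

lemma f_mult_integrable:
  assumes u: "u \<in> L26" and v: "v \<in> L26"
  shows "integrable lebesgue (\<lambda>x. f x (u x) * v x)"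
  by (rule nemytskii_dominated(2)[OF L26_abs_add[OF u v], of "\<lambda>_. u" u "\<lambda>_. v" v]) (auto intro: L26_D u v)

lemma F_integrable:
  assumes u: "u \<in> L26" shows "integrable lebesgue (\<lambda>x. Fprim f x (u x))"
proof (rule Bochner_Integration.integrable_bound[OF f_mult_integrable[OF u u]])
  show "(\<lambda>x. Fprim f x (u x)) \<in> borel_measurable lebesgue" by (rule F_comp_measurable[OF L26_D(3)[OF u]])
  show "AE x in lebesgue. norm (Fprim f x (u x)) \<le> norm (f x (u x) * u x)"
    using AE_superquartic
  proof eventually_elim
    case (elim x)
    then interpret superquartic_fun "f x" "Fprim f x" .
    show ?case using G_nonneg[of "u x"] G_le[of "u x"] g_props(4)[of "u x"] by simp
  qed
qed

end

section \<open>The nonlocal term and the Nehari manifold\<close>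

locale bopp_podolsky =
  fixes a :: real
  assumes a_pos: "a > 0"
begin

text \<open>On the diagonal \<open>kern x x = 0 / 0 = 0\<close> instead of the limit \<open>1 / a\<close>; the diagonal is a null set.\<close>

definition kern :: "R3 \<Rightarrow> R3 \<Rightarrow> real" where
  "kern x y = (1 - exp (- dist x y / a)) / dist x y"

text \<open>The upper bound is \<open>1 + s \<le> exp s\<close>. In contrast to the Coulomb kernel
  this kernel is bounded, so the double integrals converge for integrable densities.\<close>

lemma kern_bounds: "0 \<le> kern x y" "kern x y \<le> 1 / a"
proof -
  have "1 - exp (- dist x y / a) \<ge> 0" using a_pos by simp
  then show "0 \<le> kern x y" by (simp add: kern_def)
  have "1 + (- dist x y / a) \<le> exp (- dist x y / a)" by (rule exp_ge_add_one_self)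
  then have "1 - exp (- dist x y / a) \<le> dist x y / a" by simp
  then have "kern x y \<le> dist x y / a / dist x y"
    unfolding kern_def by (intro divide_right_mono) auto
  also have "\<dots> \<le> 1 / a" using a_pos by (cases "dist x y = 0") simp_all
  finally show "kern x y \<le> 1 / a" .
qed

lemma kern_commute: "kern x y = kern y x"
  by (simp add: kern_def dist_commute)

lemma measurable_ident_lebesgue_borel [measurable]: "(\<lambda>x. x) \<in> lebesgue \<rightarrow>\<^sub>M borel"
  by (rule measurable_completion) simp

lemma kern_measurable [measurable]: "(\<lambda>p. kern (fst p) (snd p)) \<in> borel_measurable (lebesgue \<Otimes>\<^sub>M lebesgue)"
proof -
  have [measurable]: "fst \<in> (lebesgue \<Otimes>\<^sub>M lebesgue) \<rightarrow>\<^sub>M (borel :: R3 measure)" "snd \<in> (lebesgue \<Otimes>\<^sub>M lebesgue) \<rightarrow>\<^sub>M (borel :: R3 measure)"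
    using measurable_compose[OF measurable_fst measurable_ident_lebesgue_borel] measurable_compose[OF measurable_snd measurable_ident_lebesgue_borel]
    by simp_all
  show ?thesis unfolding kern_def by measurable
qed

lemma kern_measurable1 [measurable]: "kern x \<in> borel_measurable lebesgue"
  unfolding kern_def[abs_def] by (rule measurable_compose[OF measurable_ident_lebesgue_borel]) measurable

definition pot :: "(R3 \<Rightarrow> real) \<Rightarrow> R3 \<Rightarrow> real" where
  "pot p x = (\<integral>y. kern x y * p y \<partial>lebesgue)"

text \<open>Bilinear and symmetric on integrable densities; the quartic term is
  \<open>D u = B(u^2, u^2)\<close> and hence a polynomial along every line of functions.\<close>

definition B :: "(R3 \<Rightarrow> real) \<Rightarrow> (R3 \<Rightarrow> real) \<Rightarrow> real" where
  "B p r = (\<integral>x. pot p x * r x \<partial>lebesgue)"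

lemma phi_eq: "phi a u = pot (\<lambda>x. (u x)\<^sup>2)"
  by (auto simp: phi_def pot_def kern_def)

lemma kern_mult_integrable:
  assumes p: "integrable lebesgue p" shows "integrable lebesgue (\<lambda>y. kern x y * p y)"
proof (rule Bochner_Integration.integrable_bound)
  show "integrable lebesgue (\<lambda>y. 1 / a * p y)" using p by simp
  show "(\<lambda>y. kern x y * p y) \<in> borel_measurable lebesgue" using p by measurable
  show "AE y in lebesgue. norm (kern x y * p y) \<le> norm (1 / a * p y)"
    using kern_bounds[of x] a_pos by (intro AE_I2) (simp only: real_norm_def abs_mult, intro mult_right_mono, auto simp: abs_of_nonneg)
qed

lemma pair_integrable:
  assumes p: "integrable lebesgue p" and r: "integrable lebesgue r"
  shows "integrable (lebesgue \<Otimes>\<^sub>M lebesgue) (\<lambda>(x, y). kern x y * p y * r x)"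
proof (rule integrableI_bounded)
  have [measurable]: "p \<in> borel_measurable lebesgue" "r \<in> borel_measurable lebesgue" using p r by auto
  show "(\<lambda>(x, y). kern x y * p y * r x) \<in> borel_measurable (lebesgue \<Otimes>\<^sub>M lebesgue)"
    using kern_measurable unfolding case_prod_unfold by measurable
  have "(\<integral>\<^sup>+z. ennreal (norm (case z of (x, y) \<Rightarrow> kern x y * p y * r x)) \<partial>(lebesgue \<Otimes>\<^sub>M lebesgue))
     \<le> (\<integral>\<^sup>+z. (case z of (x, y) \<Rightarrow> ennreal (1 / a) * ennreal \<bar>p y\<bar> * ennreal \<bar>r x\<bar>) \<partial>(lebesgue \<Otimes>\<^sub>M lebesgue))"
  proof (rule nn_integral_mono, clarify)
    fix x y :: R3
    have "\<bar>kern x y * p y * r x\<bar> \<le> 1 / a * \<bar>p y\<bar> * \<bar>r x\<bar>"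
      unfolding abs_mult using kern_bounds[of x y] by (intro mult_right_mono) auto
    then show "ennreal (norm (kern x y * p y * r x)) \<le> ennreal (1 / a) * ennreal \<bar>p y\<bar> * ennreal \<bar>r x\<bar>"
      using a_pos by (simp add: ennreal_mult[symmetric] ennreal_leI del: ennreal_le_iff)
  qed
  also have "\<dots> = (\<integral>\<^sup>+x. \<integral>\<^sup>+y. ennreal (1 / a) * ennreal \<bar>p y\<bar> * ennreal \<bar>r x\<bar> \<partial>lebesgue \<partial>lebesgue)"
    by (subst lebesgue.nn_integral_fst[symmetric]) auto
  also have "\<dots> = ennreal (1 / a) * (\<integral>\<^sup>+y. ennreal \<bar>p y\<bar> \<partial>lebesgue) * (\<integral>\<^sup>+x. ennreal \<bar>r x\<bar> \<partial>lebesgue)"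
    by (simp add: nn_integral_multc nn_integral_cmult)
  also have "\<dots> < \<infinity>"
    using p r unfolding integrable_iff_bounded by (simp add: ennreal_mult_less_top)
  finally show "(\<integral>\<^sup>+z. ennreal (norm (case z of (x, y) \<Rightarrow> kern x y * p y * r x)) \<partial>(lebesgue \<Otimes>\<^sub>M lebesgue)) < \<infinity>" .
qed

lemma B_pair:
  assumes "integrable lebesgue p" "integrable lebesgue r"
  shows "B p r = (\<integral>z. (case z of (x, y) \<Rightarrow> kern x y * p y * r x) \<partial>(lebesgue \<Otimes>\<^sub>M lebesgue))"
    "integrable lebesgue (\<lambda>x. pot p x * r x)"
  using lebesgue_pair.integral_fst'[OF pair_integrable[OF assms]] lebesgue_pair.integrable_fst'[OF pair_integrable[OF assms]]
  by (simp_all add: B_def pot_def)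

lemma B_commute:
  assumes p: "integrable lebesgue p" and r: "integrable lebesgue r"
  shows "B p r = B r p"
proof -
  have "B p r = (\<integral>x. (\<integral>y. kern x y * p y * r x \<partial>lebesgue) \<partial>lebesgue)"
    by (simp add: B_def pot_def)
  also have "\<dots> = (\<integral>y. (\<integral>x. kern x y * p y * r x \<partial>lebesgue) \<partial>lebesgue)"
    by (rule lebesgue_pair.Fubini_integral[symmetric, OF pair_integrable[OF p r]])
  also have "\<dots> = (\<integral>y. (\<integral>x. kern y x * r x * p y \<partial>lebesgue) \<partial>lebesgue)"
    by (simp add: kern_commute[of _ "_ :: R3"] mult_ac)
  also have "\<dots> = B r p" by (simp add: B_def pot_def)
  finally show ?thesis .
qed

lemma B_linear:
  assumes p: "integrable lebesgue p" and p': "integrable lebesgue p'" and r: "integrable lebesgue r"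
  shows "B (\<lambda>x. s * p x + t * p' x) r = s * B p r + t * B p' r"
proof -
  have "pot (\<lambda>x. s * p x + t * p' x) x = s * pot p x + t * pot p' x" for x
  proof -
    have "(\<integral>y. kern x y * (s * p y + t * p' y) \<partial>lebesgue) = (\<integral>y. s * (kern x y * p y) + t * (kern x y * p' y) \<partial>lebesgue)"
      by (intro Bochner_Integration.integral_cong) (auto simp: algebra_simps)
    then show ?thesis
      using kern_mult_integrable[OF p, of x] kern_mult_integrable[OF p', of x] by (simp add: pot_def)
  qed
  then have "B (\<lambda>x. s * p x + t * p' x) r = (\<integral>x. s * (pot p x * r x) + t * (pot p' x * r x) \<partial>lebesgue)"
    unfolding B_def by (intro Bochner_Integration.integral_cong) (auto simp: algebra_simps)
  then show ?thesis
    using B_pair(2)[OF p r] B_pair(2)[OF p' r] by (simp add: B_def)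
qed

definition D :: "(R3 \<Rightarrow> real) \<Rightarrow> real" where
  "D u = (\<integral>x. phi a u x * (u x)\<^sup>2 \<partial>lebesgue)"

lemma D_B: "D u = B (\<lambda>x. (u x)\<^sup>2) (\<lambda>x. (u x)\<^sup>2)"
  by (simp add: D_def B_def phi_eq)

text \<open>Insert \<open>(t u + s v)^2 = t^2 P + 2 t s Q + s^2 R\<close> and use symmetry of
  \<open>B\<close>. At \<open>t = 1\<close> the coefficient \<open>4 B P Q\<close> of
  \<open>s\<close> is the derivative of \<open>D\<close> in direction \<open>v\<close>.\<close>

lemma D_expand:
  assumes u: "u \<in> L2 lebesgue" and v: "v \<in> L2 lebesgue"
  defines "P \<equiv> \<lambda>x. (u x)\<^sup>2" and "Q \<equiv> \<lambda>x. u x * v x" and "R \<equiv> \<lambda>x. (v x)\<^sup>2"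
  shows "D (\<lambda>x. t * u x + s * v x) = t ^ 4 * D u + 4 * t ^ 3 * s * B P Q +
    t\<^sup>2 * s\<^sup>2 * (2 * B P R + 4 * B Q Q) + 4 * t * s ^ 3 * B Q R + s ^ 4 * D v"
proof -
  have i: "integrable lebesgue P" "integrable lebesgue Q" "integrable lebesgue R"
    unfolding P_def Q_def R_def by (intro L2_integrable L2_mult_integrable u v)+
  define S where "S = (\<lambda>x. t\<^sup>2 * P x + 1 * (2 * t * s * Q x + s\<^sup>2 * R x))"
  have iS': "integrable lebesgue (\<lambda>x. 2 * t * s * Q x + s\<^sup>2 * R x)" using i by simp
  have iS: "integrable lebesgue S" unfolding S_def using i by simp
  have "(\<lambda>x. (t * u x + s * v x)\<^sup>2) = S"
    by (auto simp: S_def P_def Q_def R_def power2_eq_square algebra_simps)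
  then have "D (\<lambda>x. t * u x + s * v x) = B S S" by (simp add: D_B)
  have ex: "B S X = t\<^sup>2 * B P X + 2 * t * s * B Q X + s\<^sup>2 * B R X" if X: "integrable lebesgue X" for X
    unfolding S_def using B_linear[OF i(1) iS' X, of "t\<^sup>2" 1] B_linear[OF i(2,3) X, of "2 * t * s" "s\<^sup>2"] by simp
  have "B S S = t\<^sup>2 * B S P + 2 * t * s * B S Q + s\<^sup>2 * B S R"
    using ex[OF iS] B_commute[OF i(1) iS] B_commute[OF i(2) iS] B_commute[OF i(3) iS] by simp
  also have "\<dots> = t\<^sup>2 * (t\<^sup>2 * B P P + 2 * t * s * B P Q + s\<^sup>2 * B P R) + 2 * t * s * (t\<^sup>2 * B P Q + 2 * t * s * B Q Q + s\<^sup>2 * B Q R)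
      + s\<^sup>2 * (t\<^sup>2 * B P R + 2 * t * s * B Q R + s\<^sup>2 * B R R)"
    using ex[OF i(1)] ex[OF i(2)] ex[OF i(3)] B_commute[OF i(2,1)] B_commute[OF i(3,1)] B_commute[OF i(3,2)] by simp
  also have "\<dots> = t ^ 4 * B P P + 4 * t ^ 3 * s * B P Q + t\<^sup>2 * s\<^sup>2 * (2 * B P R + 4 * B Q Q) + 4 * t * s ^ 3 * B Q R + s ^ 4 * B R R"
    by (simp add: power2_eq_square power3_eq_cube power4_eq_xxxx algebra_simps)
  finally show ?thesis
    using \<open>D (\<lambda>x. t * u x + s * v x) = B S S\<close> by (simp add: D_B P_def R_def)
qed

lemma D_scale: "u \<in> L2 lebesgue \<Longrightarrow> D (\<lambda>x. t * u x) = t ^ 4 * D u"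
  using D_expand[of u u t 0] by simp

lemma pot_nonneg: "(\<And>x. p x \<ge> 0) \<Longrightarrow> pot p x \<ge> 0"
  unfolding pot_def by (intro Bochner_Integration.integral_nonneg mult_nonneg_nonneg kern_bounds)

lemma D_nonneg: "D u \<ge> 0"
  unfolding D_def phi_eq by (intro Bochner_Integration.integral_nonneg mult_nonneg_nonneg pot_nonneg) auto

lemma D_nn_integral:
  assumes u: "u \<in> L2 lebesgue"
  shows "ennreal (D u) = (\<integral>\<^sup>+x. \<integral>\<^sup>+y. ennreal (kern x y * (u y)\<^sup>2 * (u x)\<^sup>2) \<partial>lebesgue \<partial>lebesgue)"
proof -
  let ?f = "\<lambda>(x, y). kern x y * (u y)\<^sup>2 * (u x)\<^sup>2"
  note i = L2_integrable[OF u]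
  have "ennreal (D u) = ennreal (\<integral>z. ?f z \<partial>(lebesgue \<Otimes>\<^sub>M lebesgue))"
    using B_pair(1)[OF i i] by (simp add: D_B)
  also have "\<dots> = (\<integral>\<^sup>+z. ennreal (?f z) \<partial>(lebesgue \<Otimes>\<^sub>M lebesgue))"
    by (rule nn_integral_eq_integral[symmetric, OF pair_integrable[OF i i]])
      (simp add: case_prod_unfold kern_bounds)
  also have "\<dots> = (\<integral>\<^sup>+x. \<integral>\<^sup>+y. ennreal (?f (x, y)) \<partial>lebesgue \<partial>lebesgue)"
    by (rule lebesgue.nn_integral_fst[symmetric])
      (rule measurable_compose[OF borel_measurable_integrable[OF pair_integrable[OF i i]] measurable_ennreal])
  finally show ?thesis by simp
qed

text \<open>Fatou twice, once in each variable, for a nonnegative kernel.\<close>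

lemma D_lower_semicontinuous:
  assumes u: "\<And>n. u n \<in> L2 lebesgue" "U \<in> L2 lebesgue"
    and lim: "AE x in lebesgue. (\<lambda>n. u n x) \<longlonglongrightarrow> U x" and c: "(\<lambda>n. D (u n)) \<longlonglongrightarrow> c"
  shows "D U \<le> c"
proof -
  note [measurable] = L2_measurable[OF u(1)] L2_measurable[OF u(2)]
  have m: "(\<lambda>x. \<integral>\<^sup>+y. ennreal (kern x y * (w y)\<^sup>2 * (w x)\<^sup>2) \<partial>lebesgue) \<in> borel_measurable lebesgue" if w: "w \<in> L2 lebesgue" for w
  proof (rule lebesgue.borel_measurable_nn_integral)
    have "(\<lambda>z. ennreal ((\<lambda>(x, y). kern x y * (w y)\<^sup>2 * (w x)\<^sup>2) z)) \<in> borel_measurable (lebesgue \<Otimes>\<^sub>M lebesgue)"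
      by (rule measurable_compose[OF borel_measurable_integrable[OF pair_integrable] measurable_ennreal])
        (intro L2_integrable w)+
    then show "(\<lambda>(x, y). ennreal (kern x y * (w y)\<^sup>2 * (w x)\<^sup>2)) \<in> borel_measurable (lebesgue \<Otimes>\<^sub>M lebesgue)"
      by (simp add: case_prod_unfold)
  qed
  have c0: "c \<ge> 0" by (rule LIMSEQ_le_const[OF c]) (use D_nonneg in blast)
  have "ennreal (D U) = (\<integral>\<^sup>+x. \<integral>\<^sup>+y. ennreal (kern x y * (U y)\<^sup>2 * (U x)\<^sup>2) \<partial>lebesgue \<partial>lebesgue)"
    by (rule D_nn_integral[OF u(2)])
  also have "\<dots> \<le> (\<integral>\<^sup>+x. liminf (\<lambda>n. \<integral>\<^sup>+y. ennreal (kern x y * (u n y)\<^sup>2 * (u n x)\<^sup>2) \<partial>lebesgue) \<partial>lebesgue)"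
  proof (rule nn_integral_mono_AE, use lim in eventually_elim)
    case (elim x)
    have "(\<integral>\<^sup>+y. ennreal (kern x y * (U y)\<^sup>2 * (U x)\<^sup>2) \<partial>lebesgue) = (\<integral>\<^sup>+y. liminf (\<lambda>n. ennreal (kern x y * (u n y)\<^sup>2 * (u n x)\<^sup>2)) \<partial>lebesgue)"
    proof (rule nn_integral_cong_AE, use lim in eventually_elim)
      case (elim y)
      have "(\<lambda>n. ennreal (kern x y * (u n y)\<^sup>2 * (u n x)\<^sup>2)) \<longlonglongrightarrow> ennreal (kern x y * (U y)\<^sup>2 * (U x)\<^sup>2)"
        by (intro tendsto_ennrealI tendsto_intros elim \<open>(\<lambda>n. u n x) \<longlonglongrightarrow> U x\<close>)
      from lim_imp_Liminf[OF sequentially_bot this] show ?case by simp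
    qed
    also have "\<dots> \<le> liminf (\<lambda>n. \<integral>\<^sup>+y. ennreal (kern x y * (u n y)\<^sup>2 * (u n x)\<^sup>2) \<partial>lebesgue)"
      by (rule nn_integral_liminf) measurable
    finally show ?case .
  qed
  also have "\<dots> \<le> liminf (\<lambda>n. \<integral>\<^sup>+x. \<integral>\<^sup>+y. ennreal (kern x y * (u n y)\<^sup>2 * (u n x)\<^sup>2) \<partial>lebesgue \<partial>lebesgue)"
    by (rule nn_integral_liminf) (rule m[OF u(1)])
  also have "\<dots> = liminf (\<lambda>n. ennreal (D (u n)))" by (simp only: D_nn_integral[OF u(1)])
  also have "\<dots> = ennreal c" by (rule lim_imp_Liminf[OF sequentially_bot tendsto_ennrealI[OF c]])
  finally show ?thesis using c0 by simp
qed

end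

section \<open>The energy along rays and the Nehari set\<close>

locale bp_problem = coercive_potential V + nonlinearity f + bopp_podolsky a
  for V :: "R3 \<Rightarrow> real" and f :: "R3 \<Rightarrow> real \<Rightarrow> real" and a :: real +
  fixes q :: real
  assumes q_nz: "q \<noteq> 0"
begin

definition H :: "(R3 \<Rightarrow> real) \<Rightarrow> real" where
  "H u = (\<integral>x. f x (u x) * u x \<partial>lebesgue)"

text \<open>On a ray through a Nehari point this is positive before the point and negative after it,
  see \<open>ray_signs\<close>.\<close>

definition \<Psi> :: "(R3 \<Rightarrow> real) \<Rightarrow> real" where
  "\<Psi> u = dJ a q V f u u"

text \<open>What \<open>J - \<Psi> / 4\<close> contains besides \<open>normsq / 4\<close>; the
  quarter is chosen to cancel the nonlocal term.\<close>

definition remainder :: "(R3 \<Rightarrow> real) \<Rightarrow> real" where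
  "remainder u = (\<integral>x. f x (u x) * u x / 4 - Fprim f x (u x) \<partial>lebesgue)"

lemma dJ_eq: "dJ a q V f u v = ip u v + q\<^sup>2 * B (\<lambda>x. (u x)\<^sup>2) (\<lambda>x. u x * v x) - (\<integral>x. f x (u x) * v x \<partial>lebesgue)"
  by (simp add: dJ_def ip_def B_def phi_eq mult.assoc)

lemma \<Psi>_eq: "\<Psi> u = normsq V u + q\<^sup>2 * D u - H u"
  by (simp add: \<Psi>_def dJ_eq normsq_ip D_B H_def power2_eq_square)

lemma J_eq: "J a q V f u = normsq V u / 2 + q\<^sup>2 / 4 * D u - (\<integral>x. Fprim f x (u x) \<partial>lebesgue)"
  by (simp add: J_def D_def)

lemma Nehari_iff: "u \<in> Nehari a q V f \<longleftrightarrow> u \<in> H1V V \<and> \<not> (AE x in lebesgue. u x = 0) \<and> \<Psi> u = 0"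
  by (simp add: Nehari_def \<Psi>_def)

lemma H_integrable: "u \<in> H1V V \<Longrightarrow> integrable lebesgue (\<lambda>x. f x (u x) * u x)"
  by (intro f_mult_integrable H1V_L26)

lemma remainder_integrable: "u \<in> H1V V \<Longrightarrow> integrable lebesgue (\<lambda>x. f x (u x) * u x / 4 - Fprim f x (u x))"
  using H_integrable F_integrable[OF H1V_L26] by simp

lemma J_on_Nehari: "u \<in> H1V V \<Longrightarrow> \<Psi> u = 0 \<Longrightarrow> J a q V f u = normsq V u / 4 + remainder u"
  using H_integrable[of u] F_integrable[OF H1V_L26, of u]
  by (simp add: remainder_def J_eq \<Psi>_eq H_def field_simps)

lemma remainder_scale_mono:
  assumes u: "u \<in> H1V V" and r: "0 \<le> r" "r \<le> 1"
  shows "0 \<le> remainder (\<lambda>x. r * u x)" "remainder (\<lambda>x. r * u x) \<le> remainder u"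
proof -
  show "0 \<le> remainder (\<lambda>x. r * u x)"
    unfolding remainder_def
  proof (rule integral_nonneg_AE, use AE_superquartic in eventually_elim)
    case (elim x)
    then interpret superquartic_fun "f x" "Fprim f x" .
    show ?case using G_le[of "r * u x"] by simp
  qed
  show "remainder (\<lambda>x. r * u x) \<le> remainder u"
    unfolding remainder_def
  proof (rule integral_mono_AE)
    show "AE x in lebesgue. f x (r * u x) * (r * u x) / 4 - Fprim f x (r * u x) \<le> f x (u x) * u x / 4 - Fprim f x (u x)"
      using AE_superquartic
    proof eventually_elim
      case (elim x)
      then interpret superquartic_fun "f x" "Fprim f x" .
      show ?case by (rule remainder_mono[OF r])
    qed
  qed (intro remainder_integrable H1V_scale u)+
qed

lemma H_scale:
  assumes u: "u \<in> H1V V"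
  shows "0 \<le> t \<Longrightarrow> t \<le> 1 \<Longrightarrow> H (\<lambda>x. t * u x) \<le> t ^ 4 * H u"
    "1 \<le> t \<Longrightarrow> t ^ 4 * H u \<le> H (\<lambda>x. t * u x)"
proof -
  have *: "H (\<lambda>x. t * w x) \<le> t ^ 4 * H w" if w: "w \<in> H1V V" and t: "0 \<le> t" "t \<le> 1" for t w
  proof -
    have "H (\<lambda>x. t * w x) \<le> (\<integral>x. t ^ 4 * (f x (w x) * w x) \<partial>lebesgue)"
      unfolding H_def
    proof (rule integral_mono_AE)
      show "AE x in lebesgue. f x (t * w x) * (t * w x) \<le> t ^ 4 * (f x (w x) * w x)"
        using AE_superquartic
      proof eventually_elim
        case (elim x)
        then interpret superquartic_fun "f x" "Fprim f x" .
        show ?case by (rule g_props(5)[OF t])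
      qed
    qed (use H_integrable[OF w] H_integrable[OF H1V_scale[OF w]] in auto)
    then show ?thesis by (simp add: H_def)
  qed
  show "0 \<le> t \<Longrightarrow> t \<le> 1 \<Longrightarrow> H (\<lambda>x. t * u x) \<le> t ^ 4 * H u" by (rule *[OF u])
  assume t: "1 \<le> t"
  \<comment> \<open>The case \<open>t \<ge> 1\<close> is the first case applied to
    \<open>t u\<close> with the factor \<open>1 / t\<close>.\<close>
  have "H (\<lambda>x. inverse t * (t * u x)) \<le> inverse t ^ 4 * H (\<lambda>x. t * u x)"
    using t by (intro * H1V_scale u) (auto simp: inverse_le_1_iff)
  then have "t ^ 4 * H u \<le> t ^ 4 * (inverse t ^ 4 * H (\<lambda>x. t * u x))"
    using t by (intro mult_left_mono) (auto simp: mult.assoc[symmetric])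
  then show "t ^ 4 * H u \<le> H (\<lambda>x. t * u x)"
    using t by (simp add: mult.assoc[symmetric] power_mult_distrib[symmetric])
qed

lemma \<Psi>_scale: "u \<in> H1V V \<Longrightarrow> \<Psi> (\<lambda>x. t * u x) = t\<^sup>2 * normsq V u + q\<^sup>2 * (t ^ 4 * D u) - H (\<lambda>x. t * u x)"
  by (simp add: \<Psi>_eq normsq_scale D_scale H1V_D(2))

text \<open>By \<open>G_scale_le\<close> and the constraint \<open>H u = normsq u + q^2 D u\<close>
  the nonlocal contributions cancel, and \<open>J u - J (t u)\<close> is at least
  \<open>normsq u * (1 - t^2)^2 / 4\<close>.\<close>

lemma J_scale_le:
  assumes u: "u \<in> H1V V" "\<Psi> u = 0" and t: "t \<ge> 0"
  shows "J a q V f (\<lambda>x. t * u x) \<le> J a q V f u"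
proof -
  note i1 = H_integrable[OF u(1)] F_integrable[OF H1V_L26[OF u(1)]] F_integrable[OF H1V_L26[OF H1V_scale[OF u(1)]], of t]
  have "(\<integral>x. Fprim f x (u x) - Fprim f x (t * u x) \<partial>lebesgue) \<le> (\<integral>x. (1 - t ^ 4) / 4 * (f x (u x) * u x) \<partial>lebesgue)"
  proof (rule integral_mono_AE)
    show "AE x in lebesgue. Fprim f x (u x) - Fprim f x (t * u x) \<le> (1 - t ^ 4) / 4 * (f x (u x) * u x)"
      using AE_superquartic
    proof eventually_elim
      case (elim x)
      then interpret superquartic_fun "f x" "Fprim f x" .
      show ?case by (rule G_scale_le[OF t])
    qed
  qed (intro Bochner_Integration.integrable_diff integrable_mult_right i1)+
  then have F: "(\<integral>x. Fprim f x (u x) \<partial>lebesgue) - (\<integral>x. Fprim f x (t * u x) \<partial>lebesgue) \<le> (1 - t ^ 4) / 4 * H u"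
    using i1 by (simp add: H_def)
  have "H u = normsq V u + q\<^sup>2 * D u" using u(2) by (simp add: \<Psi>_eq)
  moreover have "0 \<le> normsq V u * (1 - t\<^sup>2)\<^sup>2" by (intro mult_nonneg_nonneg normsq_nonneg) auto
  ultimately show ?thesis
    using F unfolding J_eq normsq_scale[OF u(1)] D_scale[OF H1V_D(2)[OF u(1)]]
    by (simp add: power2_eq_square power4_eq_xxxx algebra_simps diff_divide_distrib add_divide_distrib)
qed

lemma normsq_pos:
  assumes "u \<in> H1V V" "\<not> (AE x in lebesgue. u x = 0)" shows "normsq V u > 0"
proof (rule ccontr)
  assume "\<not> ?thesis"
  then have "normsq V u = 0" using normsq_nonneg[of u] by simp
  then have "(\<integral>x. (u x)\<^sup>2 \<partial>lebesgue) \<le> 0" using poincare assms(1) by (metis mult_zero_right)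
  then have "(\<integral>x. (u x)\<^sup>2 \<partial>lebesgue) = 0" by (simp add: antisym)
  then have "AE x in lebesgue. (u x)\<^sup>2 = 0"
    using integral_nonneg_eq_0_iff_AE[OF L2_integrable[OF H1V_D(2)[OF assms(1)]]] by simp
  with assms(2) show False by simp
qed

text \<open>The factor \<open>e / P\<close> compensates the constant of \<open>poincare\<close>,
  4096 is the Sobolev constant, and the added 1 makes the cubic coefficient positive.\<close>

lemma H_upper:
  assumes "e > 0"
  obtains C where "C > 0" "\<And>u. u \<in> H1V V \<Longrightarrow> H u \<le> e * normsq V u + C * normsq V u ^ 3"
proof -
  obtain P where P: "P > 0" "\<And>u. u \<in> H1V V \<Longrightarrow> (\<integral>x. (u x)\<^sup>2 \<partial>lebesgue) \<le> P * normsq V u"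
    using poincare by blast
  have eP: "e / P > 0" using assms P(1) by simp
  obtain C where C: "C \<ge> 0" "AE x in lebesgue. \<forall>t. f x t * t \<le> e / P * t\<^sup>2 + C * t ^ 6"
    using f_growth[OF eP] by blast
  show thesis
  proof (rule that[of "C * 4096 + 1"])
    fix u assume u: "u \<in> H1V V"
    note i = L2_integrable[OF H1V_D(2)[OF u]] L6_bound(1)[OF u]
    have "H u \<le> (\<integral>x. e / P * (u x)\<^sup>2 + C * u x ^ 6 \<partial>lebesgue)"
      unfolding H_def
    proof (rule integral_mono_AE[OF H_integrable[OF u]])
      show "AE x in lebesgue. f x (u x) * u x \<le> e / P * (u x)\<^sup>2 + C * u x ^ 6"
        using C(2) by eventually_elim blast
    qed (intro Bochner_Integration.integrable_add integrable_mult_right i)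
    also have "\<dots> = e / P * (\<integral>x. (u x)\<^sup>2 \<partial>lebesgue) + C * (\<integral>x. u x ^ 6 \<partial>lebesgue)"
      using i by simp
    also have "\<dots> \<le> e / P * (P * normsq V u) + C * (4096 * normsq V u ^ 3)"
      using eP by (intro add_mono mult_left_mono P(2)[OF u] L6_bound(2)[OF u] C(1)) auto
    also have "\<dots> \<le> e * normsq V u + (C * 4096 + 1) * normsq V u ^ 3"
      using P(1) normsq_nonneg[of u] by (simp add: algebra_simps)
    finally show "H u \<le> e * normsq V u + (C * 4096 + 1) * normsq V u ^ 3" .
  qed (use C in simp)
qed

text \<open>With \<open>n = normsq u\<close>, the constraint gives
  \<open>n \<le> H u \<le> n / 2 + C n^3\<close>, hence \<open>2 C n^2 \<ge> 1\<close>. This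
  prevents minimising sequences from degenerating to 0.\<close>

lemma Nehari_norm_lower:
  obtains \<alpha> where "\<alpha> > 0" "\<And>u. u \<in> Nehari a q V f \<Longrightarrow> \<alpha> \<le> normsq V u"
proof -
  obtain C where C: "C > 0" "\<And>u. u \<in> H1V V \<Longrightarrow> H u \<le> 1 / 2 * normsq V u + C * normsq V u ^ 3"
    using H_upper[of "1 / 2"] by auto
  show thesis
  proof (rule that[of "sqrt (1 / (2 * C))"])
    fix u assume "u \<in> Nehari a q V f"
    then have u: "u \<in> H1V V" "\<not> (AE x in lebesgue. u x = 0)" "\<Psi> u = 0" by (auto simp: Nehari_iff)
    define n where "n = normsq V u"
    have n: "n > 0" unfolding n_def by (rule normsq_pos[OF u(1,2)])
    have "q\<^sup>2 * D u \<ge> 0" by (intro mult_nonneg_nonneg D_nonneg) simp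
    then have "n \<le> H u" using u(3) by (simp add: \<Psi>_eq n_def)
    also have "\<dots> \<le> 1 / 2 * n + C * n ^ 3" unfolding n_def by (rule C(2)[OF u(1)])
    finally have "n * 1 \<le> n * (2 * C * n\<^sup>2)" by (simp add: power2_eq_square power3_eq_cube algebra_simps)
    then have "1 \<le> 2 * C * n\<^sup>2" using n by simp
    then have "1 / (2 * C) \<le> n\<^sup>2" using C(1) by (simp add: divide_le_eq mult.commute)
    then show "sqrt (1 / (2 * C)) \<le> normsq V u" using n unfolding n_def[symmetric] by (intro real_le_lsqrt) auto
  qed (use C in simp)
qed

text \<open>The quadratic and the nonlocal part are polynomials in the coefficients;
  \<open>H\<close> converges by domination with a multiple of
  \<open>\<bar>u\<bar> + \<bar>v\<bar>\<close>.\<close>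

lemma \<Psi>_tendsto:
  assumes u: "u \<in> H1V V" and v: "v \<in> H1V V" and t: "t \<longlonglongrightarrow> t'" and s: "s \<longlonglongrightarrow> s'"
  shows "(\<lambda>n. \<Psi> (\<lambda>x. t n * u x + s n * v x)) \<longlonglongrightarrow> \<Psi> (\<lambda>x. t' * u x + s' * v x)"
proof -
  obtain M where M: "M > 0" "\<And>n. \<bar>t n\<bar> \<le> M" "\<And>n. \<bar>s n\<bar> \<le> M"
  proof -
    obtain K1 K2 where "K1 > 0" "\<And>n. norm (t n) \<le> K1" "K2 > 0" "\<And>n. norm (s n) \<le> K2"
      using convergent_imp_Bseq[OF convergentI[OF t]] convergent_imp_Bseq[OF convergentI[OF s]] unfolding Bseq_def by blast
    then show thesis by (intro that[of "max K1 K2"]) (auto simp: le_max_iff_disj)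
  qed
  let ?w = "\<lambda>n x. t n * u x + s n * v x"
  let ?W = "\<lambda>x. M * (\<bar>u x\<bar> + \<bar>v x\<bar>)"
  have W: "?W \<in> L26" by (intro L26_scale L26_abs_add H1V_L26 u v)
  have b: "\<bar>?w n x\<bar> \<le> ?W x" for n x
  proof -
    have "\<bar>?w n x\<bar> \<le> \<bar>t n\<bar> * \<bar>u x\<bar> + \<bar>s n\<bar> * \<bar>v x\<bar>" by (metis abs_mult abs_triangle_ineq)
    also have "\<dots> \<le> M * \<bar>u x\<bar> + M * \<bar>v x\<bar>" by (intro add_mono mult_right_mono M) auto
    finally show ?thesis by (simp add: distrib_left)
  qed
  note [measurable] = H1V_D(4)[OF u] H1V_D(4)[OF v]
  have "(\<lambda>n. H (?w n)) \<longlonglongrightarrow> H (\<lambda>x. t' * u x + s' * v x)"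
    unfolding H_def
    by (rule nemytskii_dominated(1)[OF W, of ?w "\<lambda>x. t' * u x + s' * v x" ?w "\<lambda>x. t' * u x + s' * v x"])
      (measurable, (rule AE_I2, rule b)+, (rule AE_I2, intro tendsto_intros t s)+)
  moreover have "(\<lambda>n. normsq V (?w n)) \<longlonglongrightarrow> normsq V (\<lambda>x. t' * u x + s' * v x)"
    unfolding normsq_linear[OF u v] by (intro tendsto_intros t s)
  moreover have "(\<lambda>n. D (?w n)) \<longlonglongrightarrow> D (\<lambda>x. t' * u x + s' * v x)"
    unfolding D_expand[OF H1V_D(2)[OF u] H1V_D(2)[OF v]] by (intro tendsto_intros t s)
  ultimately show ?thesis
    unfolding \<Psi>_eq by (intro tendsto_intros)
qed

lemma \<Psi>_ray_continuous:
  assumes "u \<in> H1V V" shows "continuous_on A (\<lambda>t. \<Psi> (\<lambda>x. t * u x))"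
  unfolding continuous_on_sequentially
proof (intro allI impI ballI, elim conjE)
  fix s :: "nat \<Rightarrow> real" and t :: real
  assume "s \<longlonglongrightarrow> t"
  from \<Psi>_tendsto[OF assms assms this tendsto_const[of 0]]
  show "((\<lambda>t. \<Psi> (\<lambda>x. t * u x)) \<circ> s) \<longlonglongrightarrow> \<Psi> (\<lambda>x. t * u x)" by (simp add: o_def)
qed

lemma H_AE_zero: "AE x in lebesgue. u x = 0 \<Longrightarrow> H u = 0"
  unfolding H_def by (intro integral_eq_zero_AE) (auto elim!: eventually_mono)

text \<open>Near 0 the quadratic part dominates, so \<open>\<Psi>\<close> is nonnegative at a small
  \<open>t0\<close> on the ray; the intermediate value theorem applies between \<open>t0\<close> and
  1.\<close>

lemma Nehari_projection:
  assumes u: "u \<in> H1V V" "\<not> (AE x in lebesgue. u x = 0)" "\<Psi> u \<le> 0"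
  obtains t where "0 < t" "t \<le> 1" "(\<lambda>x. t * u x) \<in> Nehari a q V f"
proof -
  obtain C where C: "C > 0" "\<And>u. u \<in> H1V V \<Longrightarrow> H u \<le> 1 / 2 * normsq V u + C * normsq V u ^ 3"
    using H_upper[of "1 / 2"] by auto
  define n where "n = normsq V u"
  have n: "n > 0" unfolding n_def by (rule normsq_pos[OF u(1,2)])
  \<comment> \<open>Small enough for \<open>t0^4 C n^2 < 1 / 2\<close>, which turns
    \<open>H_upper\<close> into \<open>H (t0 u) \<le> t0^2 n\<close>.\<close>
  define t0 where "t0 = min 1 (1 / (2 * (C * n\<^sup>2 + 1)))"
  have "C * n\<^sup>2 + 1 > 0" using C(1) by (intro add_nonneg_pos mult_nonneg_nonneg) auto
  then have t0: "0 < t0" "t0 \<le> 1" unfolding t0_def by (auto intro!: divide_pos_pos)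
  have small: "t0 ^ 4 * (C * n\<^sup>2) < 1 / 2"
  proof -
    have "t0 ^ 4 \<le> t0 ^ 1" using t0 by (intro power_decreasing) auto
    also have "t0 ^ 1 \<le> 1 / (2 * (C * n\<^sup>2 + 1))" by (simp add: t0_def)
    finally have "t0 ^ 4 * (C * n\<^sup>2) \<le> 1 / (2 * (C * n\<^sup>2 + 1)) * (C * n\<^sup>2)"
      using C by (intro mult_right_mono) auto
    also have "\<dots> < 1 / 2"
    proof -
      have "z / (2 * (z + 1)) < 1 / 2" if "z \<ge> 0" for z :: real using that by (simp add: field_simps)
      from this[of "C * n\<^sup>2"] show ?thesis using C by simp
    qed
    finally show ?thesis .
  qed
  have "\<Psi> (\<lambda>x. t0 * u x) \<ge> 0"
  proof -
    have "H (\<lambda>x. t0 * u x) \<le> 1 / 2 * (t0\<^sup>2 * n) + C * (t0\<^sup>2 * n) ^ 3"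
      using C(2)[OF H1V_scale[OF u(1)], of t0] by (simp add: normsq_scale[OF u(1)] n_def)
    also have "\<dots> = t0\<^sup>2 * n * (1 / 2 + t0 ^ 4 * (C * n\<^sup>2))"
      by (simp add: power2_eq_square power3_eq_cube power4_eq_xxxx algebra_simps)
    also have "\<dots> \<le> t0\<^sup>2 * n * 1" using small n by (intro mult_left_mono) auto
    finally have "H (\<lambda>x. t0 * u x) \<le> t0\<^sup>2 * n" by simp
    moreover have "q\<^sup>2 * (t0 ^ 4 * D u) \<ge> 0" using t0 by (intro mult_nonneg_nonneg D_nonneg) auto
    ultimately show ?thesis unfolding \<Psi>_scale[OF u(1)] n_def by linarith
  qed
  then obtain t where t: "t0 \<le> t" "t \<le> 1" "\<Psi> (\<lambda>x. t * u x) = 0"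
    using IVT2'[of "\<lambda>t. \<Psi> (\<lambda>x. t * u x)" 1 0 t0] u(3) t0 \<Psi>_ray_continuous[OF u(1)] by auto
  have "t > 0" using t t0 by linarith
  then have "(\<lambda>x. t * u x) \<in> Nehari a q V f"
    unfolding Nehari_iff using t(3) u(1,2) H1V_scale by simp
  with \<open>t > 0\<close> t(2) show thesis using that by blast
qed

text \<open>Far out on a ray \<open>H\<close> exceeds \<open>normsq + q^2 D\<close>. As
  \<open>f3\<close> speaks of large arguments only, a set where \<open>\<bar>u\<bar>\<close> exceeds
  some \<open>\<eta>\<close> and which carries mass \<open>c > 0\<close> is fixed first;
  multiplication by \<open>t\<close> pushes the values on it beyond \<open>R\<close>.\<close>

lemma Nehari_nonempty: "Nehari a q V f \<noteq> {}"
proof -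
  obtain u where u: "u \<in> H1V V" "\<not> (AE x in lebesgue. u x = 0)" using H1V_nonzero by blast
  note [measurable] = H1V_D(4)[OF u(1)]
  have i2: "integrable lebesgue (\<lambda>x. (u x)\<^sup>2)" by (rule L2_integrable[OF H1V_D(2)[OF u(1)]])
  define A where "A n = {x. \<bar>u x\<bar> > inverse (real (Suc n))}" for n
  have A [measurable]: "A n \<in> sets lebesgue" for n
  proof -
    have "{x \<in> space lebesgue. inverse (real (Suc n)) < \<bar>u x\<bar>} \<in> sets lebesgue" by measurable
    then show ?thesis by (simp add: A_def)
  qed
  have iA: "integrable lebesgue (\<lambda>x. indicator (A n) x * (u x)\<^sup>2)" for n
    using integrable_mult_indicator[OF A i2] by simp
  have "(\<lambda>n. \<integral>x. indicator (A n) x * (u x)\<^sup>2 \<partial>lebesgue) \<longlonglongrightarrow> (\<integral>x. (u x)\<^sup>2 \<partial>lebesgue)"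
  proof (rule integral_dominated_convergence[OF _ _ i2])
    show "AE x in lebesgue. (\<lambda>n. indicator (A n) x * (u x)\<^sup>2) \<longlonglongrightarrow> (u x)\<^sup>2"
    proof (rule AE_I2)
      fix x
      show "(\<lambda>n. indicator (A n) x * (u x)\<^sup>2) \<longlonglongrightarrow> (u x)\<^sup>2"
      proof (cases "u x = 0")
        case False
        then have "\<forall>\<^sub>F n in sequentially. inverse (real (Suc n)) < \<bar>u x\<bar>"
          using order_tendstoD(2)[OF LIMSEQ_inverse_real_of_nat, of "\<bar>u x\<bar>"] by simp
        then have "\<forall>\<^sub>F n in sequentially. indicator (A n) x * (u x)\<^sup>2 = (u x)\<^sup>2"
          by eventually_elim (simp add: A_def)
        then show ?thesis by (rule tendsto_eventually)
      qed simp
    qed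
    show "AE x in lebesgue. norm (indicator (A n) x * (u x)\<^sup>2) \<le> (u x)\<^sup>2" for n
      by (rule AE_I2) (simp add: indicator_def)
  qed measurable
  moreover have "(\<integral>x. (u x)\<^sup>2 \<partial>lebesgue) > 0"
  proof -
    have "(\<integral>x. (u x)\<^sup>2 \<partial>lebesgue) \<noteq> 0"
      using integral_nonneg_eq_0_iff_AE[OF i2] u(2) by simp
    moreover have "(\<integral>x. (u x)\<^sup>2 \<partial>lebesgue) \<ge> 0" by (intro Bochner_Integration.integral_nonneg) simp
    ultimately show ?thesis by (simp add: less_le)
  qed
  ultimately have "\<forall>\<^sub>F n in sequentially. 0 < (\<integral>x. indicator (A n) x * (u x)\<^sup>2 \<partial>lebesgue)"
    by (rule order_tendstoD(1))
  then obtain m where m: "0 < (\<integral>x. indicator (A m) x * (u x)\<^sup>2 \<partial>lebesgue)"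
    using eventually_happens'[OF sequentially_bot] by blast
  define \<eta> where "\<eta> = inverse (real (Suc m))"
  define c where "c = (\<integral>x. indicator (A m) x * (u x)\<^sup>2 \<partial>lebesgue)"
  have \<eta>: "\<eta> > 0" and c: "c > 0" using m by (auto simp: \<eta>_def c_def)
  \<comment> \<open>Makes the lower bound \<open>4 M t^4 \<eta>^2 c\<close> of
    \<open>H (t u)\<close> equal to \<open>t^4 (normsq u + q^2 D u)\<close>.\<close>
  define M where "M = (normsq V u + q\<^sup>2 * D u) / (4 * (\<eta>\<^sup>2 * c))"
  have M0: "M \<ge> 0" unfolding M_def using \<eta> c D_nonneg[of u] normsq_nonneg[of u] by (intro divide_nonneg_nonneg) auto
  obtain R where R: "\<And>x t. \<bar>t\<bar> > R \<Longrightarrow> Fprim f x t / t ^ 4 > M" using f3[of M] by blast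
  \<comment> \<open>The maximum with 1 serves \<open>t^2 \<le> t^4\<close> in the quadratic
    part.\<close>
  define t where "t = max 1 (\<bar>R\<bar> / \<eta>)"
  have t: "t \<ge> 1" "t * \<eta> \<ge> \<bar>R\<bar>"
    using \<eta> by (auto simp: t_def max_def field_simps)
  have "4 * M * t ^ 4 * \<eta>\<^sup>2 * c \<le> H (\<lambda>x. t * u x)"
  proof -
    have "(\<integral>x. 4 * M * t ^ 4 * \<eta>\<^sup>2 * (indicator (A m) x * (u x)\<^sup>2) \<partial>lebesgue) \<le> H (\<lambda>x. t * u x)"
      unfolding H_def
    proof (rule integral_mono_AE)
      show "AE x in lebesgue. 4 * M * t ^ 4 * \<eta>\<^sup>2 * (indicator (A m) x * (u x)\<^sup>2) \<le> f x (t * u x) * (t * u x)"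
        using AE_superquartic
      proof eventually_elim
        case (elim x)
        then interpret superquartic_fun "f x" "Fprim f x" .
        show ?case
        proof (cases "x \<in> A m")
          case True
          then have ux: "\<bar>u x\<bar> > \<eta>" by (simp add: A_def \<eta>_def)
          have "R \<le> t * \<eta>" using t by linarith
          also have "t * \<eta> < t * \<bar>u x\<bar>" using ux t by simp
          finally have "\<bar>t * u x\<bar> > R" using t by (simp add: abs_mult)
          then have "M * (t * u x) ^ 4 \<le> Fprim f x (t * u x)"
          proof -
            have "u x \<noteq> 0" using ux \<eta> by auto
            then have "(t * u x) ^ 4 > 0" using t by (simp add: zero_less_power_eq)
            then show ?thesis using R[OF \<open>\<bar>t * u x\<bar> > R\<close>, of x] by (simp add: pos_less_divide_eq)
          qed
          then have "4 * (M * (t * u x) ^ 4) \<le> f x (t * u x) * (t * u x)" using G_le[of "t * u x"] by linarith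
          moreover have "4 * M * t ^ 4 * \<eta>\<^sup>2 * (u x)\<^sup>2 \<le> 4 * (M * (t * u x) ^ 4)"
          proof -
            have "\<eta>\<^sup>2 \<le> (u x)\<^sup>2" using ux \<eta> by (simp add: abs_le_square_iff[symmetric])
            then have "4 * M * t ^ 4 * (\<eta>\<^sup>2 * (u x)\<^sup>2) \<le> 4 * M * t ^ 4 * ((u x)\<^sup>2 * (u x)\<^sup>2)"
              using M0 t by (intro mult_left_mono mult_right_mono) auto
            then show ?thesis by (simp add: power_mult_distrib power4_eq_xxxx power2_eq_square mult_ac)
          qed
          ultimately show ?thesis using True by simp
        qed (simp add: g_props(4))
      qed
    qed (use iA H_integrable[OF H1V_scale[OF u(1)]] in auto)
    then show ?thesis by (simp add: c_def)
  qed
  moreover have "4 * M * t ^ 4 * \<eta>\<^sup>2 * c = t ^ 4 * (normsq V u + q\<^sup>2 * D u)"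
    using \<eta> c by (simp add: M_def)
  moreover have "t\<^sup>2 * normsq V u \<le> t ^ 4 * normsq V u"
    using t normsq_nonneg by (intro mult_right_mono power_increasing) auto
  ultimately have "\<Psi> (\<lambda>x. t * u x) \<le> 0"
    unfolding \<Psi>_scale[OF u(1)] by (simp add: algebra_simps)
  moreover have "\<not> (AE x in lebesgue. t * u x = 0)" using u(2) t by simp
  ultimately obtain r where "(\<lambda>x. r * (t * u x)) \<in> Nehari a q V f"
    using Nehari_projection[OF H1V_scale[OF u(1)], of t] by blast
  then show ?thesis by blast
qed

end

section \<open>Existence of a ground state\<close>

context bp_problem
begin

text \<open>The critical part of the growth bound carries an arbitrarily small factor, so boundedness in
  \<open>L6\<close> suffices to apply Fatou to \<open>C u\<^sup>2 + e u\<^sup>6 - f(x,u) u \<ge> 0\<close>.\<close>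

lemma H_limit_le:
  assumes u: "\<And>n. u n \<in> H1V V" "U \<in> H1V V" and K: "\<And>n. normsq V (u n) \<le> K"
    and L2: "(\<lambda>n. \<integral>x. (u n x - U x)\<^sup>2 \<partial>lebesgue) \<longlonglongrightarrow> 0"
    and lim: "AE x in lebesgue. (\<lambda>n. u n x) \<longlonglongrightarrow> U x" and \<kappa>: "(\<lambda>n. H (u n)) \<longlonglongrightarrow> \<kappa>"
  shows "\<kappa> \<le> H U"
proof -
  define S where "S = 4096 * K ^ 3"
  have S0: "S \<ge> 0" using K[of 0] normsq_nonneg[of "u 0"] by (simp add: S_def)
  have S: "(\<integral>x. u n x ^ 6 \<partial>lebesgue) \<le> S" for n
  proof -
    have "4096 * normsq V (u n) ^ 3 \<le> S"
      unfolding S_def by (intro mult_left_mono power_mono K normsq_nonneg) auto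
    with L6_bound(2)[OF u(1), of n] show ?thesis by linarith
  qed
  have sq: "(\<lambda>n. \<integral>x. (u n x)\<^sup>2 \<partial>lebesgue) \<longlonglongrightarrow> (\<integral>x. (U x)\<^sup>2 \<partial>lebesgue)"
    by (rule L2_tendsto_square[OF H1V_D(2)[OF u(1)] H1V_D(2)[OF u(2)] L2])
  have *: "\<kappa> \<le> H U + e * S" if e: "e > 0" for e
  proof -
    obtain C where C: "C \<ge> 0" "AE x in lebesgue. \<forall>t. f x t * t \<le> C * t\<^sup>2 + e * t ^ 6"
      by (rule f_growth[OF e]) (rule that)
    define p where "p w x = C * (w x)\<^sup>2 + e * w x ^ 6 - f x (w x) * w x" for w x
    have pi: "integrable lebesgue (p w)" "(\<integral>x. p w x \<partial>lebesgue) = C * (\<integral>x. (w x)\<^sup>2 \<partial>lebesgue) + e * (\<integral>x. w x ^ 6 \<partial>lebesgue) - H w"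
      if "w \<in> H1V V" for w
      using L2_integrable[OF H1V_D(2)[OF that]] L6_bound(1)[OF that] H_integrable[OF that]
      unfolding p_def[abs_def] H_def by simp_all
    have "(\<integral>x. p U x \<partial>lebesgue) \<le> C * (\<integral>x. (U x)\<^sup>2 \<partial>lebesgue) + e * S - \<kappa>"
    proof (rule fatou_real(2)[where p="\<lambda>n. p (u n)"])
      show "integrable lebesgue (p (u n))" for n by (rule pi[OF u(1)])
      show "AE x in lebesgue. 0 \<le> p (u n) x" for n
        using C(2) by eventually_elim (simp add: p_def)
      show "AE x in lebesgue. (\<lambda>n. p (u n) x) \<longlonglongrightarrow> p U x"
        using lim
      proof eventually_elim
        case (elim x)
        have "isCont (f x) (U x)" using f_cont[of x] by (simp add: continuous_on_eq_continuous_at)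
        from isCont_tendsto_compose[OF this elim] show ?case
          unfolding p_def by (intro tendsto_intros elim)
      qed
      show "p U \<in> borel_measurable lebesgue" by (rule borel_measurable_integrable[OF pi(1)[OF u(2)]])
      show "(\<integral>x. p (u n) x \<partial>lebesgue) \<le> C * (\<integral>x. (u n x)\<^sup>2 \<partial>lebesgue) + e * S - H (u n)" for n
        unfolding pi(2)[OF u(1)] using mult_left_mono[OF S, of e n] e by simp
      show "(\<lambda>n. C * (\<integral>x. (u n x)\<^sup>2 \<partial>lebesgue) + e * S - H (u n)) \<longlonglongrightarrow> C * (\<integral>x. (U x)\<^sup>2 \<partial>lebesgue) + e * S - \<kappa>"
        by (intro tendsto_intros sq \<kappa>)
    qed
    moreover have "e * (\<integral>x. U x ^ 6 \<partial>lebesgue) \<ge> 0"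
      using e by (intro mult_nonneg_nonneg Bochner_Integration.integral_nonneg) auto
    ultimately show ?thesis unfolding pi(2)[OF u(2)] by linarith
  qed
  show ?thesis
  proof (rule field_le_epsilon)
    fix e :: real assume e: "e > 0"
    \<comment> \<open>The auxiliary \<open>e\<close> is rescaled by the L6 bound;
      \<open>S + 1\<close> avoids a zero denominator.\<close>
    have "\<kappa> \<le> H U + e / (S + 1) * S" using e S0 by (intro *) auto
    also have "e / (S + 1) * S \<le> e" using e S0 by (simp add: divide_le_eq mult_left_mono)
    finally show "\<kappa> \<le> H U + e" by simp
  qed
qed

text \<open>Gradient part, potential part and \<open>H\<close> get separate limits along one
  subsequence, because each passes to \<open>U\<close> by its own argument:
  \<open>sobolev_closed\<close>, Fatou and \<open>H_limit_le\<close>. The limit of the nonlocal part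
  is then dictated by the constraint.\<close>

theorem minimiser_exists:
  obtains w where "w \<in> Nehari a q V f" "\<And>v. v \<in> Nehari a q V f \<Longrightarrow> J a q V f w \<le> J a q V f v"
proof -
  define c where "c = (INF u\<in>Nehari a q V f. J a q V f u)"
  have J_lower: "normsq V u / 4 \<le> J a q V f u" if "u \<in> Nehari a q V f" for u
  proof -
    have u: "u \<in> H1V V" "\<Psi> u = 0" using that by (auto simp: Nehari_iff)
    show ?thesis using J_on_Nehari[OF u] remainder_scale_mono(1)[OF u(1), of 1] by simp
  qed
  have bdd: "bdd_below (J a q V f ` Nehari a q V f)"
    by (rule bdd_belowI2[of _ 0]) (use J_lower normsq_nonneg in \<open>meson divide_nonneg_pos order_trans zero_less_numeral\<close>)
  have "\<exists>u\<in>Nehari a q V f. J a q V f u < c + inverse (real (Suc n))" for n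
    using cINF_less_iff[OF Nehari_nonempty bdd, of "c + inverse (real (Suc n))"] by (simp add: c_def)
  then obtain u0 where u0: "\<And>n. u0 n \<in> Nehari a q V f" "\<And>n. J a q V f (u0 n) < c + inverse (real (Suc n))"
    by metis
  have u0H: "u0 n \<in> H1V V" "\<Psi> (u0 n) = 0" for n using u0(1)[of n] by (auto simp: Nehari_iff)
  \<comment> \<open>Along the sequence \<open>normsq u / 4 \<le> J u < c + 1\<close>.\<close>
  define K where "K = 4 * (c + 1)"
  have K: "normsq V (u0 n) \<le> K" for n
  proof -
    have "inverse (real (Suc n)) \<le> 1" by (simp add: inverse_le_1_iff)
    then show ?thesis using J_lower[OF u0(1)[of n]] u0(2)[of n] by (simp add: K_def)
  qed
  obtain r U where r: "strict_mono (r :: nat \<Rightarrow> nat)" and U: "U \<in> L2 lebesgue"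
    "(\<lambda>n. \<integral>x. (u0 (r n) x - U x)\<^sup>2 \<partial>lebesgue) \<longlonglongrightarrow> 0" "AE x in lebesgue. (\<lambda>n. u0 (r n) x) \<longlonglongrightarrow> U x"
    using rellich[OF u0H(1) K] .
  obtain C where C: "C > 0" "\<And>u. u \<in> H1V V \<Longrightarrow> H u \<le> 1 * normsq V u + C * normsq V u ^ 3"
    using H_upper[of 1] by auto
  define d where "d n = dirichlet (weak_grad (u0 (r n))) (weak_grad (u0 (r n)))" for n
  define m where "m n = (\<integral>x. V x * (u0 (r n) x)\<^sup>2 \<partial>lebesgue)" for n
  define \<tau> where "\<tau> n = (d n, m n, H (u0 (r n)))" for n
  have "bounded (range \<tau>)"
  proof -
    have "\<tau> n \<in> {0..K} \<times> {0..K} \<times> {0..1 * K + C * K ^ 3}" for n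
    proof -
      let ?u = "u0 (r n)"
      have "normsq V ?u = d n + m n" unfolding d_def m_def by (rule normsq_split)
      moreover have "0 \<le> d n" "0 \<le> m n" unfolding d_def m_def by (rule dirichlet_nonneg Vsq_nonneg)+
      moreover have "0 \<le> H ?u"
        unfolding H_def
      proof (rule integral_nonneg_AE, use AE_superquartic in eventually_elim)
        case (elim x)
        then interpret superquartic_fun "f x" "Fprim f x" .
        show ?case by (rule g_props(4))
      qed
      moreover have "H ?u \<le> 1 * K + C * K ^ 3"
      proof -
        have "1 * normsq V ?u + C * normsq V ?u ^ 3 \<le> 1 * K + C * K ^ 3"
          using C(1) by (intro add_mono mult_left_mono power_mono K normsq_nonneg) auto
        with C(2)[OF u0H(1), of "r n"] show ?thesis by linarith
      qed
      ultimately show ?thesis using K[of "r n"] by (simp add: \<tau>_def)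
    qed
    then have "range \<tau> \<subseteq> {0..K} \<times> {0..K} \<times> {0..1 * K + C * K ^ 3}" by blast
    then show ?thesis by (rule bounded_subset[rotated]) (intro bounded_Times bounded_closed_interval)
  qed
  then obtain l r' where r': "strict_mono (r' :: nat \<Rightarrow> nat)" "(\<tau> \<circ> r') \<longlonglongrightarrow> l"
    using bounded_imp_convergent_subsequence by blast
  obtain k1 k2 k3 where l: "l = (k1, k2, k3)" by (cases l)
  define u where "u n = u0 (r (r' n))" for n
  have uH: "u n \<in> H1V V" "\<Psi> (u n) = 0" "u n \<in> Nehari a q V f" for n
    using u0H u0(1) by (auto simp: u_def)
  have lim1: "(\<lambda>n. dirichlet (weak_grad (u n)) (weak_grad (u n))) \<longlonglongrightarrow> k1"
    using tendsto_fst[OF r'(2)] by (simp add: \<tau>_def d_def u_def l o_def)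
  have lim2: "(\<lambda>n. \<integral>x. V x * (u n x)\<^sup>2 \<partial>lebesgue) \<longlonglongrightarrow> k2"
    using tendsto_fst[OF tendsto_snd[OF r'(2)]] by (simp add: \<tau>_def m_def u_def l o_def)
  have lim3: "(\<lambda>n. H (u n)) \<longlonglongrightarrow> k3"
    using tendsto_snd[OF tendsto_snd[OF r'(2)]] by (simp add: \<tau>_def u_def l o_def)
  have limN: "(\<lambda>n. normsq V (u n)) \<longlonglongrightarrow> k1 + k2"
    unfolding normsq_split by (intro tendsto_add lim1 lim2)
  have uL2: "(\<lambda>n. \<integral>x. (u n x - U x)\<^sup>2 \<partial>lebesgue) \<longlonglongrightarrow> 0"
    using LIMSEQ_subseq_LIMSEQ[OF U(2) r'(1)] by (simp add: u_def o_def)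
  have uAE: "AE x in lebesgue. (\<lambda>n. u n x) \<longlonglongrightarrow> U x"
    using U(3)
  proof eventually_elim
    case (elim x)
    from LIMSEQ_subseq_LIMSEQ[OF this r'(1)] show ?case by (simp add: u_def o_def)
  qed
  note [measurable] = L2_measurable[OF U(1)]
  obtain G where G: "sobolev_pair U G" "dirichlet G G \<le> k1"
    using sobolev_closed[OF H1V_D(3)[OF uH(1)] U(1) uL2 lim1] by blast
  have UH1: "U \<in> H1" using G(1) H1_iff by blast
  have VU: "integrable lebesgue (\<lambda>x. V x * (U x)\<^sup>2)" "(\<integral>x. V x * (U x)\<^sup>2 \<partial>lebesgue) \<le> k2"
  proof -
    have *: "AE x in lebesgue. (\<lambda>n. V x * (u n x)\<^sup>2) \<longlonglongrightarrow> V x * (U x)\<^sup>2"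
      using uAE by eventually_elim (intro tendsto_intros)
    have pos: "AE x in lebesgue. 0 \<le> V x * (u n x)\<^sup>2" for n by (simp add: V_nonneg)
    show "integrable lebesgue (\<lambda>x. V x * (U x)\<^sup>2)" "(\<integral>x. V x * (U x)\<^sup>2 \<partial>lebesgue) \<le> k2"
      by (rule fatou_real[OF H1V_D(5)[OF uH(1)] pos * _ order_refl lim2]; measurable)+
  qed
  have UH: "U \<in> H1V V" using UH1 VU(1) by (simp add: H1V_def)
  have NU: "normsq V U \<le> k1 + k2"
  proof -
    have gw: "AE x in lebesgue. weak_grad U x = G x"
      by (rule sobolev_pair_unique[OF weak_grad_pair[OF UH1] G(1)])
    have m1: "(\<lambda>x. weak_grad U x \<bullet> weak_grad U x) \<in> borel_measurable lebesgue"
      by (intro borel_measurable_integrable integrable_grad_inner UH1)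
    have m2: "(\<lambda>x. G x \<bullet> G x) \<in> borel_measurable lebesgue"
      by (intro borel_measurable_integrable integrable_inner sobolev_pairD(2)[OF G(1)])
    have "dirichlet (weak_grad U) (weak_grad U) = dirichlet G G"
      unfolding dirichlet_def by (rule integral_cong_AE[OF m1 m2]) (use gw in eventually_elim, simp)
    then show ?thesis unfolding normsq_split using G(2) VU(2) by linarith
  qed
  have HU: "k3 \<le> H U"
    by (rule H_limit_le[where K=K, OF uH(1) UH _ uL2 uAE lim3]) (simp add: u_def K)
  \<comment> \<open>The constraint is solved for \<open>D\<close>, which is where
    \<open>q \<noteq> 0\<close> enters.\<close>
  have limD: "(\<lambda>n. D (u n)) \<longlonglongrightarrow> (k3 - (k1 + k2)) / q\<^sup>2"
  proof -
    have "D (u n) = (H (u n) - normsq V (u n)) / q\<^sup>2" for n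
      using uH(2)[of n] q_nz by (simp add: \<Psi>_eq field_simps)
    then show ?thesis by (simp only:) (intro tendsto_intros lim3 limN, use q_nz in simp)
  qed
  have DU: "q\<^sup>2 * D U \<le> k3 - (k1 + k2)"
  proof -
    have "D U \<le> (k3 - (k1 + k2)) / q\<^sup>2"
      by (rule D_lower_semicontinuous[OF H1V_D(2)[OF uH(1)] U(1) uAE limD])
    then show ?thesis using q_nz by (simp add: pos_le_divide_eq mult.commute)
  qed
  have Jlim: "(\<lambda>n. J a q V f (u n)) \<longlonglongrightarrow> c"
  proof -
    have "(\<lambda>n. c + inverse (real (Suc n))) \<longlonglongrightarrow> c"
      using tendsto_add[OF tendsto_const[of c] LIMSEQ_inverse_real_of_nat] by simp
    then have up: "(\<lambda>n. c + inverse (real (Suc (r (r' n))))) \<longlonglongrightarrow> c"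
      using LIMSEQ_subseq_LIMSEQ[OF _ strict_mono_o[OF r r'(1)]] by (fastforce simp: o_def)
    show ?thesis
    proof (rule tendsto_sandwich[OF always_eventually always_eventually tendsto_const up]; rule allI)
      show "c \<le> J a q V f (u n)" for n unfolding c_def by (rule cINF_lower[OF bdd uH(3)])
      show "J a q V f (u n) \<le> c + inverse (real (Suc (r (r' n))))" for n
        unfolding u_def by (rule less_imp_le[OF u0(2)])
    qed
  qed
  \<comment> \<open>Fatou for the nonnegative integrand; on the Nehari set its integral is
    \<open>J - normsq / 4\<close>, whose limit is known.\<close>
  have RU: "remainder U \<le> c - (k1 + k2) / 4"
    unfolding remainder_def
  proof (rule fatou_real(2)[where p="\<lambda>n x. f x (u n x) * u n x / 4 - Fprim f x (u n x)"])
    show "integrable lebesgue (\<lambda>x. f x (u n x) * u n x / 4 - Fprim f x (u n x))" for n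
      by (rule remainder_integrable[OF uH(1)])
    show "AE x in lebesgue. 0 \<le> f x (u n x) * u n x / 4 - Fprim f x (u n x)" for n
      using AE_superquartic
    proof eventually_elim
      case (elim x)
      then interpret superquartic_fun "f x" "Fprim f x" .
      show ?case using G_le[of "u n x"] by simp
    qed
    show "AE x in lebesgue. (\<lambda>n. f x (u n x) * u n x / 4 - Fprim f x (u n x)) \<longlonglongrightarrow> f x (U x) * U x / 4 - Fprim f x (U x)"
      using uAE
    proof eventually_elim
      case (elim x)
      have "isCont (f x) (U x)" "isCont (Fprim f x) (U x)"
        using f_cont[of x] F_cont[of x] by (simp_all add: continuous_on_eq_continuous_at)
      from this[THEN isCont_tendsto_compose, OF elim] show ?case
        by (intro tendsto_intros elim) auto
    qed
    show "(\<lambda>x. f x (U x) * U x / 4 - Fprim f x (U x)) \<in> borel_measurable lebesgue"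
      by (rule borel_measurable_integrable[OF remainder_integrable[OF UH]])
    show "(\<integral>x. f x (u n x) * u n x / 4 - Fprim f x (u n x) \<partial>lebesgue) \<le> J a q V f (u n) - normsq V (u n) / 4" for n
      using J_on_Nehari[OF uH(1,2), of n] by (simp add: remainder_def)
    show "(\<lambda>n. J a q V f (u n) - normsq V (u n) / 4) \<longlonglongrightarrow> c - (k1 + k2) / 4"
      by (intro tendsto_intros Jlim limN) simp
  qed
  \<comment> \<open>Otherwise \<open>H U = 0\<close>, although
    \<open>H (u n) \<ge> normsq (u n) \<ge> \<alpha>\<close> keeps the limit
    \<open>k3 \<le> H U\<close> positive.\<close>
  have Unz: "\<not> (AE x in lebesgue. U x = 0)"
  proof
    assume "AE x in lebesgue. U x = 0"
    then have "H U = 0" by (rule H_AE_zero)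
    obtain \<alpha> where \<alpha>: "\<alpha> > 0" "\<And>u. u \<in> Nehari a q V f \<Longrightarrow> \<alpha> \<le> normsq V u"
      using Nehari_norm_lower by blast
    have "\<alpha> \<le> H (u n)" for n
    proof -
      have "q\<^sup>2 * D (u n) \<ge> 0" by (intro mult_nonneg_nonneg D_nonneg) simp
      then show ?thesis using \<alpha>(2)[OF uH(3), of n] uH(2)[of n] by (simp add: \<Psi>_eq)
    qed
    then have "\<alpha> \<le> k3" by (intro LIMSEQ_le_const[OF lim3]) blast
    then show False using HU \<open>H U = 0\<close> \<alpha>(1) by linarith
  qed
  \<comment> \<open>The three limit estimates combine to
    \<open>normsq U + q^2 D U \<le> k3 \<le> H U\<close>.\<close>
  have "\<Psi> U \<le> 0" unfolding \<Psi>_eq using NU DU HU by linarith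
  then obtain t where t: "0 < t" "t \<le> 1" "(\<lambda>x. t * U x) \<in> Nehari a q V f"
    using Nehari_projection[OF UH Unz] by blast
  have "J a q V f (\<lambda>x. t * U x) = t\<^sup>2 * normsq V U / 4 + remainder (\<lambda>x. t * U x)"
    using J_on_Nehari[of "\<lambda>x. t * U x"] t(3) by (simp add: Nehari_iff normsq_scale[OF UH])
  also have "\<dots> \<le> normsq V U / 4 + remainder U"
  proof -
    have "t\<^sup>2 * normsq V U \<le> 1 * normsq V U"
      using t by (intro mult_right_mono normsq_nonneg) (auto simp: power_le_one)
    then show ?thesis using remainder_scale_mono(2)[OF UH, of t] t by simp
  qed
  also have "\<dots> \<le> c"
  proof -
    have "x / 4 + y \<le> z" if "x \<le> w" "y \<le> z - w / 4" for w x y z :: real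
      using that by simp
    then show ?thesis using NU RU by blast
  qed
  finally have "J a q V f (\<lambda>x. t * U x) \<le> c" .
  then show thesis
    using that[OF t(3)] cINF_lower[OF bdd] unfolding c_def by (meson order_trans)
qed

section \<open>Criticality of a minimiser\<close>

text \<open>The nonlocal part scales by \<open>t^4\<close> and \<open>H\<close> compares with
  \<open>t^4 H u\<close> in the favourable direction, while the quadratic part scales by
  \<open>t^2\<close>; its strict positivity makes the signs strict.\<close>

lemma ray_signs:
  assumes u: "u \<in> Nehari a q V f"
  shows "0 < t \<Longrightarrow> t < 1 \<Longrightarrow> \<Psi> (\<lambda>x. t * u x) > 0" "1 < t \<Longrightarrow> \<Psi> (\<lambda>x. t * u x) < 0"
proof -
  have uH: "u \<in> H1V V" "\<not> (AE x in lebesgue. u x = 0)" "\<Psi> u = 0" using u by (auto simp: Nehari_iff)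
  have N: "normsq V u > 0" by (rule normsq_pos[OF uH(1,2)])
  have Hu: "H u = normsq V u + q\<^sup>2 * D u" using uH(3) by (simp add: \<Psi>_eq)
  show "\<Psi> (\<lambda>x. t * u x) > 0" if t: "0 < t" "t < 1"
  proof -
    have "H (\<lambda>x. t * u x) \<le> t ^ 4 * H u" using t by (intro H_scale uH) auto
    moreover have "t ^ 4 * normsq V u < t\<^sup>2 * normsq V u"
      using t N by (intro mult_strict_right_mono power_strict_decreasing) auto
    ultimately show ?thesis unfolding \<Psi>_scale[OF uH(1)] Hu by (simp add: algebra_simps)
  qed
  show "\<Psi> (\<lambda>x. t * u x) < 0" if t: "1 < t"
  proof -
    have "t ^ 4 * H u \<le> H (\<lambda>x. t * u x)" using t by (intro H_scale uH) auto
    moreover have "t\<^sup>2 * normsq V u < t ^ 4 * normsq V u"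
      using t N by (intro mult_strict_right_mono power_strict_increasing) auto
    ultimately show ?thesis unfolding \<Psi>_scale[OF uH(1)] Hu by (simp add: algebra_simps)
  qed
qed

text \<open>\<open>\<Psi>\<close> has strict signs at \<open>(1 - \<delta>) u\<close> and
  \<open>(1 + \<delta>) u\<close>; continuity preserves them when \<open>u\<close> is replaced by
  \<open>u + s v\<close> with small \<open>s\<close>, and a zero lies in between.\<close>

lemma nearby_Nehari:
  assumes u: "u \<in> Nehari a q V f" and v: "v \<in> H1V V" and \<delta>: "0 < \<delta>" "\<delta> < 1"
  obtains s t where "0 < s" "s < \<delta>" "\<bar>t - 1\<bar> \<le> \<delta>" "(\<lambda>x. t * (u x + s * v x)) \<in> Nehari a q V f"
proof -
  have uH: "u \<in> H1V V" using u by (auto simp: Nehari_iff)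
  let ?s = "\<lambda>n. inverse (real (Suc n))"
  have lim: "(\<lambda>n. \<Psi> (\<lambda>x. t * u x + (t * ?s n) * v x)) \<longlonglongrightarrow> \<Psi> (\<lambda>x. t * u x)" for t
  proof -
    have "(\<lambda>n. t * ?s n) \<longlonglongrightarrow> t * 0" by (intro tendsto_intros LIMSEQ_inverse_real_of_nat)
    from \<Psi>_tendsto[OF uH v tendsto_const[of t] this] show ?thesis by simp
  qed
  have "\<forall>\<^sub>F n in sequentially. \<Psi> (\<lambda>x. (1 - \<delta>) * u x + ((1 - \<delta>) * ?s n) * v x) > 0"
    using ray_signs(1)[OF u, of "1 - \<delta>"] \<delta> by (intro order_tendstoD(1)[OF lim]) auto
  moreover have "\<forall>\<^sub>F n in sequentially. \<Psi> (\<lambda>x. (1 + \<delta>) * u x + ((1 + \<delta>) * ?s n) * v x) < 0"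
    using ray_signs(2)[OF u, of "1 + \<delta>"] \<delta> by (intro order_tendstoD(2)[OF lim]) auto
  moreover have "\<forall>\<^sub>F n in sequentially. ?s n < \<delta>"
    by (rule order_tendstoD(2)[OF LIMSEQ_inverse_real_of_nat \<delta>(1)])
  ultimately have "\<forall>\<^sub>F n in sequentially. \<Psi> (\<lambda>x. (1 - \<delta>) * u x + ((1 - \<delta>) * ?s n) * v x) > 0 \<and>
      \<Psi> (\<lambda>x. (1 + \<delta>) * u x + ((1 + \<delta>) * ?s n) * v x) < 0 \<and> ?s n < \<delta>"
    by eventually_elim simp
  from eventually_happens'[OF sequentially_bot this] obtain n where n:
    "\<Psi> (\<lambda>x. (1 - \<delta>) * u x + ((1 - \<delta>) * ?s n) * v x) > 0"
    "\<Psi> (\<lambda>x. (1 + \<delta>) * u x + ((1 + \<delta>) * ?s n) * v x) < 0" "?s n < \<delta>" by blast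
  define w where "w x = u x + ?s n * v x" for x
  have w: "w \<in> H1V V" using H1V_linear[OF uH v, of 1 "?s n"] by (simp add: w_def[abs_def])
  have ray: "(\<lambda>x. t * u x + (t * ?s n) * v x) = (\<lambda>x. t * w x)" for t
    by (simp add: w_def distrib_left mult.assoc)
  have "\<exists>t. 1 - \<delta> \<le> t \<and> t \<le> 1 + \<delta> \<and> \<Psi> (\<lambda>x. t * w x) = 0"
    using n(1,2) \<delta> unfolding ray by (intro IVT2' \<Psi>_ray_continuous w) auto
  then obtain t where t: "1 - \<delta> \<le> t" "t \<le> 1 + \<delta>" "\<Psi> (\<lambda>x. t * w x) = 0" by blast
  \<comment> \<open>If \<open>w\<close> vanished almost everywhere, \<open>H\<close> would be 0 on
    its ray and \<open>\<Psi>\<close> nonnegative at \<open>1 + \<delta>\<close>.\<close>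
  have "\<not> (AE x in lebesgue. w x = 0)"
  proof
    assume "AE x in lebesgue. w x = 0"
    then have "AE x in lebesgue. (1 + \<delta>) * w x = 0" by eventually_elim simp
    then have "H (\<lambda>x. (1 + \<delta>) * w x) = 0" by (rule H_AE_zero)
    moreover have "0 \<le> q\<^sup>2 * D (\<lambda>x. (1 + \<delta>) * w x)" by (intro mult_nonneg_nonneg D_nonneg) simp
    moreover have "0 \<le> normsq V (\<lambda>x. (1 + \<delta>) * w x)" by (rule normsq_nonneg)
    ultimately show False using n(2) unfolding ray \<Psi>_eq by linarith
  qed
  moreover have "t > 0" using t(1) \<delta> by linarith
  ultimately have "(\<lambda>x. t * w x) \<in> Nehari a q V f"
    unfolding Nehari_iff using t(3) H1V_scale[OF w] by simp
  then show thesis using that[of "?s n" t] n(3) t(1,2) by (simp add: w_def abs_le_iff)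
qed

text \<open>The base point \<open>t n u\<close> moves with \<open>n\<close>, as the comparison in
  \<open>minimiser_one_sided\<close> requires. Norm and nonlocal part are polynomials; in the
  \<open>F\<close> part the mean value theorem replaces the quotient by \<open>f\<close> at an
  intermediate point, and domination applies.\<close>

lemma J_directional:
  assumes u: "u \<in> H1V V" and v: "v \<in> H1V V" and t: "t \<longlonglongrightarrow> 1" and \<rho>: "\<rho> \<longlonglongrightarrow> 0" "\<And>n. \<rho> n \<noteq> 0"
  shows "(\<lambda>n. (J a q V f (\<lambda>x. t n * u x + \<rho> n * v x) - J a q V f (\<lambda>x. t n * u x)) / \<rho> n) \<longlonglongrightarrow> dJ a q V f u v"
proof -
  let ?w = "\<lambda>n x. t n * u x + \<rho> n * v x"
  define P Q R where "P = (\<lambda>x. (u x)\<^sup>2)" and "Q = (\<lambda>x. u x * v x)" and "R = (\<lambda>x. (v x)\<^sup>2)"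
  note [measurable] = H1V_D(4)[OF u] H1V_D(4)[OF v]
  have wH: "?w n \<in> H1V V" "(\<lambda>x. t n * u x) \<in> H1V V" for n by (intro H1V_linear H1V_scale u v)+
  have N: "(\<lambda>n. (normsq V (?w n) - normsq V (\<lambda>x. t n * u x)) / \<rho> n) \<longlonglongrightarrow> 2 * ip u v"
  proof -
    have "(normsq V (?w n) - normsq V (\<lambda>x. t n * u x)) / \<rho> n = 2 * t n * ip u v + \<rho> n * normsq V v" for n
      using \<rho>(2)[of n] unfolding normsq_linear[OF u v] normsq_scale[OF u] by (simp add: field_simps power2_eq_square)
    moreover have "(\<lambda>n. 2 * t n * ip u v + \<rho> n * normsq V v) \<longlonglongrightarrow> 2 * 1 * ip u v + 0 * normsq V v"
      by (intro tendsto_intros t \<rho>)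
    ultimately show ?thesis by simp
  qed
  have Dl: "(\<lambda>n. (D (?w n) - D (\<lambda>x. t n * u x)) / \<rho> n) \<longlonglongrightarrow> 4 * B P Q"
  proof -
    have "(D (?w n) - D (\<lambda>x. t n * u x)) / \<rho> n = 4 * t n ^ 3 * B P Q +
      (t n)\<^sup>2 * \<rho> n * (2 * B P R + 4 * B Q Q) + 4 * t n * (\<rho> n)\<^sup>2 * B Q R + \<rho> n ^ 3 * D v" for n
      using \<rho>(2)[of n] unfolding D_expand[OF H1V_D(2)[OF u] H1V_D(2)[OF v]] D_scale[OF H1V_D(2)[OF u]] P_def Q_def R_def
      by (simp add: field_simps power2_eq_square power3_eq_cube power4_eq_xxxx)
    moreover have "(\<lambda>n. 4 * t n ^ 3 * B P Q + (t n)\<^sup>2 * \<rho> n * (2 * B P R + 4 * B Q Q) + 4 * t n * (\<rho> n)\<^sup>2 * B Q R + \<rho> n ^ 3 * D v)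
      \<longlonglongrightarrow> 4 * 1 ^ 3 * B P Q + 1\<^sup>2 * 0 * (2 * B P R + 4 * B Q Q) + 4 * 1 * 0\<^sup>2 * B Q R + 0 ^ 3 * D v"
      by (intro tendsto_intros t \<rho>)
    ultimately show ?thesis by simp
  qed
  \<comment> \<open>\<open>M \<ge> 1\<close> lets the dominating function \<open>W\<close> bound the
    bare factor \<open>\<bar>v\<bar>\<close> as well.\<close>
  obtain M where M: "M \<ge> 1" "\<And>n. \<bar>t n\<bar> \<le> M" "\<And>n. \<bar>\<rho> n\<bar> \<le> M"
  proof -
    obtain K1 K2 where "K1 > 0" "\<And>n. norm (t n) \<le> K1" "K2 > 0" "\<And>n. norm (\<rho> n) \<le> K2"
      using convergent_imp_Bseq[OF convergentI[OF t]] convergent_imp_Bseq[OF convergentI[OF \<rho>(1)]] unfolding Bseq_def by blast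
    then show thesis by (intro that[of "max 1 (max K1 K2)"]) (auto simp: le_max_iff_disj)
  qed
  define W where "W x = M * (\<bar>u x\<bar> + \<bar>v x\<bar>)" for x
  have W: "W \<in> L26" unfolding W_def[abs_def] by (intro L26_scale L26_abs_add H1V_L26 u v)
  obtain C where C: "C \<ge> 0" "AE x in lebesgue. \<forall>t w. \<bar>t\<bar> \<le> w \<longrightarrow> \<bar>f x t\<bar> * w \<le> w\<^sup>2 + C * w ^ 6"
    using f_abs_bound by blast
  have WI: "integrable lebesgue (\<lambda>x. (W x)\<^sup>2 + C * W x ^ 6)"
    using L2_integrable[OF L26_D(1)[OF W]] L26_D(2)[OF W] by simp
  define q' where "q' n x = (Fprim f x (?w n x) - Fprim f x (t n * u x)) / \<rho> n" for n x
  have mvt: "AE x in lebesgue. \<forall>n. \<exists>\<theta>\<in>{0..1}. q' n x = f x (t n * u x + \<theta> * (\<rho> n * v x)) * v x"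
    using AE_superquartic
  proof eventually_elim
    case (elim x)
    then interpret superquartic_fun "f x" "Fprim f x" .
    show ?case
    proof
      fix n
      obtain \<theta> where "\<theta> \<in> {0..1}" "Fprim f x (t n * u x + \<rho> n * v x) - Fprim f x (t n * u x) = f x (t n * u x + \<theta> * (\<rho> n * v x)) * (\<rho> n * v x)"
        using G_mvt by blast
      then show "\<exists>\<theta>\<in>{0..1}. q' n x = f x (t n * u x + \<theta> * (\<rho> n * v x)) * v x"
        using \<rho>(2)[of n] by (intro bexI[of _ \<theta>]) (auto simp: q'_def)
    qed
  qed
  have Fl: "(\<lambda>n. \<integral>x. q' n x \<partial>lebesgue) \<longlonglongrightarrow> (\<integral>x. f x (u x) * v x \<partial>lebesgue)"
  proof (rule integral_dominated_convergence[OF _ _ WI])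
    show "(\<lambda>x. f x (u x) * v x) \<in> borel_measurable lebesgue"
      by (rule borel_measurable_integrable[OF f_mult_integrable[OF H1V_L26[OF u] H1V_L26[OF v]]])
    show "q' n \<in> borel_measurable lebesgue" for n
      unfolding q'_def[abs_def]
      by (intro borel_measurable_divide borel_measurable_diff borel_measurable_const F_comp_measurable H1V_D(4)[OF wH(1)] H1V_D(4)[OF wH(2)])
    show "AE x in lebesgue. (\<lambda>n. q' n x) \<longlonglongrightarrow> f x (u x) * v x"
      using mvt
    proof eventually_elim
      case (elim x)
      from choice[OF elim[unfolded Bex_def]] obtain \<theta> where \<theta>: "\<And>n. \<theta> n \<in> {0..1} \<and> q' n x = f x (t n * u x + \<theta> n * (\<rho> n * v x)) * v x"
        by blast
      have "(\<lambda>n. \<theta> n * (\<rho> n * v x)) \<longlonglongrightarrow> 0"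
      proof (rule Lim_null_comparison[OF always_eventually[OF allI]])
        show "norm (\<theta> n * (\<rho> n * v x)) \<le> \<bar>\<rho> n\<bar> * \<bar>v x\<bar>" for n
          using \<theta>[of n] mult_right_mono[of "\<bar>\<theta> n\<bar>" 1 "\<bar>\<rho> n\<bar> * \<bar>v x\<bar>"] by (simp add: abs_mult)
        have "(\<lambda>n. \<bar>\<rho> n\<bar> * \<bar>v x\<bar>) \<longlonglongrightarrow> \<bar>0\<bar> * \<bar>v x\<bar>" by (intro tendsto_intros \<rho>)
        then show "(\<lambda>n. \<bar>\<rho> n\<bar> * \<bar>v x\<bar>) \<longlonglongrightarrow> 0" by simp
      qed
      then have "(\<lambda>n. t n * u x + \<theta> n * (\<rho> n * v x)) \<longlonglongrightarrow> 1 * u x + 0" by (intro tendsto_intros t)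
      then have "(\<lambda>n. t n * u x + \<theta> n * (\<rho> n * v x)) \<longlonglongrightarrow> u x" by simp
      moreover have "isCont (f x) (u x)" using f_cont[of x] by (simp add: continuous_on_eq_continuous_at)
      ultimately have "(\<lambda>n. f x (t n * u x + \<theta> n * (\<rho> n * v x))) \<longlonglongrightarrow> f x (u x)"
        by (rule isCont_tendsto_compose[rotated])
      from tendsto_mult[OF this tendsto_const[of "v x"]] show ?case using \<theta> by simp
    qed
    show "AE x in lebesgue. norm (q' n x) \<le> (W x)\<^sup>2 + C * W x ^ 6" for n
      using mvt C(2)
    proof eventually_elim
      case (elim x)
      then obtain \<theta> where \<theta>: "\<theta> \<in> {0..1}" "q' n x = f x (t n * u x + \<theta> * (\<rho> n * v x)) * v x" by blast
      have "\<bar>t n * u x + \<theta> * (\<rho> n * v x)\<bar> \<le> \<bar>t n\<bar> * \<bar>u x\<bar> + \<bar>\<theta>\<bar> * (\<bar>\<rho> n\<bar> * \<bar>v x\<bar>)"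
        by (metis abs_mult abs_triangle_ineq)
      also have "\<dots> \<le> M * \<bar>u x\<bar> + 1 * (M * \<bar>v x\<bar>)"
        using \<theta>(1) M by (intro add_mono mult_mono) auto
      finally have w: "\<bar>t n * u x + \<theta> * (\<rho> n * v x)\<bar> \<le> W x" by (simp add: W_def distrib_left)
      have "\<bar>v x\<bar> \<le> 1 * (\<bar>u x\<bar> + \<bar>v x\<bar>)" by simp
      also have "\<dots> \<le> W x" unfolding W_def using M(1) by (intro mult_right_mono) auto
      finally have "\<bar>q' n x\<bar> \<le> \<bar>f x (t n * u x + \<theta> * (\<rho> n * v x))\<bar> * W x"
        unfolding \<theta>(2) abs_mult by (intro mult_left_mono) auto
      also have "\<dots> \<le> (W x)\<^sup>2 + C * W x ^ 6" using elim(2) w by blast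
      finally show ?case by simp
    qed
  qed
  have eq: "(J a q V f (?w n) - J a q V f (\<lambda>x. t n * u x)) / \<rho> n =
      (normsq V (?w n) - normsq V (\<lambda>x. t n * u x)) / \<rho> n / 2 + q\<^sup>2 / 4 * ((D (?w n) - D (\<lambda>x. t n * u x)) / \<rho> n) - (\<integral>x. q' n x \<partial>lebesgue)" for n
  proof -
    have "(\<integral>x. q' n x \<partial>lebesgue) = ((\<integral>x. Fprim f x (?w n x) \<partial>lebesgue) - (\<integral>x. Fprim f x (t n * u x) \<partial>lebesgue)) / \<rho> n"
      unfolding q'_def using F_integrable[OF H1V_L26[OF wH(1)], of n] F_integrable[OF H1V_L26[OF wH(2)], of n] by simp
    then show ?thesis by (simp add: J_eq diff_divide_distrib add_divide_distrib algebra_simps)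
  qed
  have "(\<lambda>n. (normsq V (?w n) - normsq V (\<lambda>x. t n * u x)) / \<rho> n / 2 + q\<^sup>2 / 4 * ((D (?w n) - D (\<lambda>x. t n * u x)) / \<rho> n) - (\<integral>x. q' n x \<partial>lebesgue))
     \<longlonglongrightarrow> 2 * ip u v / 2 + q\<^sup>2 / 4 * (4 * B P Q) - (\<integral>x. f x (u x) * v x \<partial>lebesgue)"
    by (intro tendsto_intros N Dl Fl) simp
  then show ?thesis unfolding eq dJ_eq P_def Q_def by simp
qed

text \<open>\<open>J (t (u + s v)) \<ge> J u \<ge> J (t u)\<close>, the first by minimality and the
  second by \<open>J_scale_le\<close>. The quotient by \<open>t s > 0\<close> is therefore
  nonnegative, and it tends to \<open>J'(u) v\<close>.\<close>

lemma minimiser_one_sided: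
  assumes u: "u \<in> Nehari a q V f" and min: "\<And>w. w \<in> Nehari a q V f \<Longrightarrow> J a q V f u \<le> J a q V f w"
    and v: "v \<in> H1V V"
  shows "0 \<le> dJ a q V f u v"
proof -
  have uH: "u \<in> H1V V" "\<Psi> u = 0" using u by (auto simp: Nehari_iff)
  \<comment> \<open>Starting at \<open>1 / 2\<close> keeps every \<open>?\<delta> n\<close> below 1,
    as \<open>nearby_Nehari\<close> demands.\<close>
  let ?\<delta> = "\<lambda>n. inverse (real (Suc (Suc n)))"
  have d: "0 < ?\<delta> n" "?\<delta> n < 1" for n by (auto simp: inverse_less_1_iff)
  have "\<exists>p. 0 < fst p \<and> fst p < ?\<delta> n \<and> \<bar>snd p - 1\<bar> \<le> ?\<delta> n \<and> (\<lambda>x. snd p * (u x + fst p * v x)) \<in> Nehari a q V f" for n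
  proof -
    obtain s t where "0 < s" "s < ?\<delta> n" "\<bar>t - 1\<bar> \<le> ?\<delta> n" "(\<lambda>x. t * (u x + s * v x)) \<in> Nehari a q V f"
      using nearby_Nehari[OF u v d] by blast
    then show ?thesis by (intro exI[of _ "(s, t)"]) simp
  qed
  then have "\<forall>n. \<exists>p. 0 < fst p \<and> fst p < ?\<delta> n \<and> \<bar>snd p - 1\<bar> \<le> ?\<delta> n \<and> (\<lambda>x. snd p * (u x + fst p * v x)) \<in> Nehari a q V f"
    by (rule allI)
  from choice[OF this] obtain p where p: "\<And>n. 0 < fst (p n) \<and> fst (p n) < ?\<delta> n \<and> \<bar>snd (p n) - 1\<bar> \<le> ?\<delta> n \<and> (\<lambda>x. snd (p n) * (u x + fst (p n) * v x)) \<in> Nehari a q V f"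
    by blast
  define s t where "s n = fst (p n)" and "t n = snd (p n)" for n
  have st: "0 < s n" "s n < ?\<delta> n" "\<bar>t n - 1\<bar> \<le> ?\<delta> n" "(\<lambda>x. t n * (u x + s n * v x)) \<in> Nehari a q V f" for n
    using p[of n] by (auto simp: s_def t_def)
  have dlim: "?\<delta> \<longlonglongrightarrow> 0" using LIMSEQ_Suc[OF LIMSEQ_inverse_real_of_nat] by simp
  have "(\<lambda>n. t n - 1) \<longlonglongrightarrow> 0"
    by (rule Lim_null_comparison[OF always_eventually[OF allI] dlim]) (simp only: real_norm_def st(3))
  then have tlim: "t \<longlonglongrightarrow> 1" by (simp add: LIM_zero_iff)
  have slim: "s \<longlonglongrightarrow> 0"
  proof (rule Lim_null_comparison[OF always_eventually[OF allI] dlim])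
    show "norm (s n) \<le> ?\<delta> n" for n using st(1,2)[of n] by (simp only: real_norm_def abs_of_pos less_imp_le)
  qed
  have tpos: "t n > 0" for n using st(3)[of n] d(2)[of n] by linarith
  have "(\<lambda>n. t n * s n) \<longlonglongrightarrow> 1 * 0" by (intro tendsto_intros tlim slim)
  then have rlim: "(\<lambda>n. t n * s n) \<longlonglongrightarrow> 0" by simp
  have "t n * s n \<noteq> 0" for n using tpos[of n] st(1)[of n] by simp
  note lim = J_directional[OF uH(1) v tlim rlim this]
  show ?thesis
  proof (rule LIMSEQ_le_const[OF lim], intro exI allI impI)
    fix n
    have "(\<lambda>x. t n * u x + t n * s n * v x) = (\<lambda>x. t n * (u x + s n * v x))"
      by (simp add: distrib_left mult.assoc)
    then have "J a q V f u \<le> J a q V f (\<lambda>x. t n * u x + t n * s n * v x)" using min[OF st(4)] by simp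
    moreover have "J a q V f (\<lambda>x. t n * u x) \<le> J a q V f u" using tpos[of n] by (intro J_scale_le uH) auto
    ultimately show "0 \<le> (J a q V f (\<lambda>x. t n * u x + t n * s n * v x) - J a q V f (\<lambda>x. t n * u x)) / (t n * s n)"
      using tpos[of n] st(1)[of n] by (intro divide_nonneg_pos) auto
  qed
qed

lemma dJ_minus:
  assumes u: "u \<in> H1V V" and v: "v \<in> H1V V"
  shows "dJ a q V f u (\<lambda>x. - v x) = - dJ a q V f u v"
proof -
  have "ip u (\<lambda>x. - v x) = - ip u v"
    using ip_linear[OF v v u, of "- 1" 0] by (simp add: ip_commute[of u])
  then show ?thesis by (simp add: dJ_eq B_def)
qed

theorem ground_state_exists:
  "\<exists>u \<in> H1V V. u \<in> Nehari a q V f \<and> (\<forall>v \<in> H1V V. dJ a q V f u v = 0)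
     \<and> (\<forall>v \<in> Nehari a q V f. J a q V f u \<le> J a q V f v)"
proof -
  obtain u where u: "u \<in> Nehari a q V f" "\<And>v. v \<in> Nehari a q V f \<Longrightarrow> J a q V f u \<le> J a q V f v"
    using minimiser_exists by blast
  have uH: "u \<in> H1V V" using u(1) by (simp add: Nehari_iff)
  have "dJ a q V f u v = 0" if v: "v \<in> H1V V" for v
  proof -
    \<comment> \<open>The one-sided inequality for \<open>v\<close> and for \<open>- v\<close>
      forces equality.\<close>
    have "(\<lambda>x. - v x) \<in> H1V V" using H1V_scale[OF v, of "- 1"] by simp
    then show ?thesis
      using minimiser_one_sided[OF u v] minimiser_one_sided[OF u, of "\<lambda>x. - v x"] dJ_minus[OF uH v] by simp
  qed
  with u uH show ?thesis by blast
qed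

end

theorem theorem1:
  fixes a q :: real and V :: "R3 \<Rightarrow> real" and f :: "R3 \<Rightarrow> real \<Rightarrow> real"
  assumes a_pos: "a > 0" and q_nz: "q \<noteq> 0"
    and V0_cont: "continuous_on UNIV V" and V0_nonneg: "\<forall>x. V x \<ge> 0"
    and V0_coercive: "filterlim V at_top at_infinity"
    and f_meas: "\<forall>t. (\<lambda>x. f x t) \<in> borel_measurable lebesgue"
    and f_loclip: "\<forall>x t. \<exists>\<delta>>0. \<exists>L. L-lipschitz_on (ball t \<delta>) (f x)"
    and f1: "\<forall>\<epsilon>>0. \<exists>\<delta>>0. \<forall>x t. 0 < \<bar>t\<bar> \<and> \<bar>t\<bar> < \<delta> \<longrightarrow> \<bar>f x t / t\<bar> < \<epsilon>"
    and f2: "\<forall>\<epsilon>>0. \<exists>R. \<forall>x t. \<bar>t\<bar> > R \<longrightarrow> \<bar>f x t / t ^ 5\<bar> < \<epsilon>"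
    and f3: "\<forall>M. \<exists>R. \<forall>x t. \<bar>t\<bar> > R \<longrightarrow> Fprim f x t / t ^ 4 > M"
    and f4: "AE x in lebesgue. \<forall>t. t \<noteq> 0 \<longrightarrow> (\<forall>\<xi> \<in> clarke_subdiff (f x) t.
               0 < 3 * f x t * t \<and> 3 * f x t * t \<le> \<xi> * t\<^sup>2)"
  shows "\<exists>u \<in> H1V V. u \<in> Nehari a q V f \<and> (\<forall>v \<in> H1V V. dJ a q V f u v = 0)
           \<and> (\<forall>v \<in> Nehari a q V f. J a q V f u \<le> J a q V f v)"
proof -
  interpret bp_problem V f a q
  proof unfold_locales
    show "continuous_on UNIV V" by (rule V0_cont)
    show "V x \<ge> 0" for x using V0_nonneg by blast
    show "filterlim V at_top at_infinity" by (rule V0_coercive)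
    show "(\<lambda>x. f x t) \<in> borel_measurable lebesgue" for t using f_meas by blast
    show "\<exists>\<delta>>0. \<exists>L. L-lipschitz_on (ball t \<delta>) (f x)" for x t using f_loclip by blast
    show "\<exists>\<delta>>0. \<forall>x t. 0 < \<bar>t\<bar> \<and> \<bar>t\<bar> < \<delta> \<longrightarrow> \<bar>f x t / t\<bar> < \<epsilon>" if "\<epsilon> > 0" for \<epsilon>
      using f1 that by blast
    show "\<exists>R. \<forall>x t. \<bar>t\<bar> > R \<longrightarrow> \<bar>f x t / t ^ 5\<bar> < \<epsilon>" if "\<epsilon> > 0" for \<epsilon> using f2 that by blast
    show "\<exists>R. \<forall>x t. \<bar>t\<bar> > R \<longrightarrow> Fprim f x t / t ^ 4 > M" for M using f3 by blast
    show "AE x in lebesgue. \<forall>t. t \<noteq> 0 \<longrightarrow> (\<forall>\<xi> \<in> clarke_subdiff (f x) t.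
               0 < 3 * f x t * t \<and> 3 * f x t * t \<le> \<xi> * t\<^sup>2)" by (rule f4)
    show "a > 0" by (rule a_pos)
    show "q \<noteq> 0" by (rule q_nz)
  qed
  show ?thesis by (rule ground_state_exists)
qed

end
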